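(* The global caching algorithm decides the satisfiability problem of the alternation-free $\mu$-calculus in ExpTime, more precisely in time $2^{\mathcal{O}(n)}$, where $n$ is the size of the input formula.
   Context: Setting: $\phi_0$ is a closed, guarded, clean, irredundant formula of the alternation-free modal $\mu$-calculus ($\psi,\phi ::= \bot \mid \top \mid p \mid \neg p \mid X \mid \psi\wedge\phi \mid \psi\vee\phi \mid \langle a \rangle\psi \mid [a]\psi \mid \mu X.\,\psi \mid \nu X.\,\psi$, no subformula containing both a free $\mu$- and a free $\nu$-variable). Tableau rules (premise / conclusions): $(\bot)$: $\Gamma,\bot$ / no conclusion; (clash): $\Gamma,p,\neg p$ / no conclusion; $(\wedge)$: $\Gamma,\psi\wedge\phi$ / $\Gamma,\psi,\phi$; $(\vee)$: $\Gamma,\psi\vee\phi$ / $\Gamma,\psi$ and $\Gamma,\phi$; $(\langle a\rangle)$: $\Gamma,[a]\psi_1,\ldots,[a]\psi_n,\langle a\rangle\phi$ / $\psi_1,\ldots,\psi_n,\phi$; $(\eta)$: $\Gamma,\eta X.\,\psi$ / $\Gamma,\psi[X\mapsto\eta X.\,\psi]$. Nodes are subsets of the Fischer–Ladner closure of $\phi_0$ (at most $2^{n}$ nodes, at most $3^{n}$ focused nodes $(\Gamma,d)$ with $d\subseteq\Gamma$ a set of deferrals); $\mathrm{concl}(\Delta)$ is the set of conclusion sets of the modal rules (if $\Delta$ is a state node) or of the other rules (otherwise) with premise $\Delta$; $d(\Gamma)$ = all deferrals in $\Gamma$; $d_{\Delta\leadsto\Gamma}$ = deferrals obtained by tracking $d$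 to conclusion $\Gamma$, $\emptyset_{\Delta\leadsto\Gamma}=d(\Gamma)$. With $f(Y)=\{(\Delta,d)\mid \forall \Sigma\in\mathrm{concl}(\Delta).\,\exists\Gamma\in\Sigma.\,(\Gamma,d_{\Delta\leadsto\Gamma})\in Y\}$, $g$ the dual, $F$/$\overline{F}$ the focused nodes with empty/nonempty focus, $\hat{f}_X(Y)=(f(Y)\cap\overline{F})\cup(f(X)\cap F)$, $\hat{g}_X(Y)=(g(Y)\cup F)\cap(g(X)\cup\overline{F})$, $E_G=\nu X.\mu Y.\,\hat{f}_X(Y)$, $A_G=\mu X.\nu Y.\,\hat{g}_X(Y)$ over focused nodes with label in $G$. The global caching algorithm: $G:=\emptyset$, $\Gamma_0:=\{\phi_0\}$, $U:=\{\Gamma_0\}$; repeatedly pick $t\in U$, set $G:=G\cup\{t\}$, $U:=(U-\{t\})\cup(\bigcup\mathrm{concl}(t)-G)$, optionally propagating (return `Yes' if $(\Gamma_0,d(\Gamma_0))\in E_G$, `No' if $(\Gamma_0,d(\Gamma_0))\in A_G$); when $U=\emptyset$, return `Yes' iff $(\Gamma_0,d(\Gamma_0))\in E_G$. *)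

theory Defs
  imports Main "HOL-Library.Monad_Syntax"
begin

section \<open>The modal mu-calculus\<close>

datatype fp = Mu | Nu

datatype ('p, 'a, 'v) fm =
    Bot | Top | Prop 'p | NProp 'p | Var 'v
  | And "('p, 'a, 'v) fm" "('p, 'a, 'v) fm"
  | Or "('p, 'a, 'v) fm" "('p, 'a, 'v) fm"
  | Dia 'a "('p, 'a, 'v) fm"
  | Box 'a "('p, 'a, 'v) fm"
  | Fix fp 'v "('p, 'a, 'v) fm"

primrec fm_size :: "('p, 'a, 'v) fm \<Rightarrow> nat" where
  "fm_size Bot = 1"
| "fm_size Top = 1"
| "fm_size (Prop p) = 1"
| "fm_size (NProp p) = 1"
| "fm_size (Var X) = 1"
| "fm_size (And \<psi> \<phi>) = 1 + fm_size \<psi> + fm_size \<phi>"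
| "fm_size (Or \<psi> \<phi>) = 1 + fm_size \<psi> + fm_size \<phi>"
| "fm_size (Dia a \<psi>) = 1 + fm_size \<psi>"
| "fm_size (Box a \<psi>) = 1 + fm_size \<psi>"
| "fm_size (Fix \<eta> X \<psi>) = 1 + fm_size \<psi>"

primrec FV :: "('p, 'a, 'v) fm \<Rightarrow> 'v set" where
  "FV Bot = {}"
| "FV Top = {}"
| "FV (Prop p) = {}"
| "FV (NProp p) = {}"
| "FV (Var X) = {X}"
| "FV (And \<psi> \<phi>) = FV \<psi> \<union> FV \<phi>"
| "FV (Or \<psi> \<phi>) = FV \<psi> \<union> FV \<phi>"
| "FV (Dia a \<psi>) = FV \<psi>"
| "FV (Box a \<psi>) = FV \<psi>"
| "FV (Fix \<eta> X \<psi>) = FV \<psi> - {X}"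

definition closed_fm :: "('p, 'a, 'v) fm \<Rightarrow> bool" where
  "closed_fm \<phi> \<longleftrightarrow> FV \<phi> = {}"

primrec subfms :: "('p, 'a, 'v) fm \<Rightarrow> ('p, 'a, 'v) fm set" where
  "subfms Bot = {Bot}"
| "subfms Top = {Top}"
| "subfms (Prop p) = {Prop p}"
| "subfms (NProp p) = {NProp p}"
| "subfms (Var X) = {Var X}"
| "subfms (And \<psi> \<phi>) = {And \<psi> \<phi>} \<union> subfms \<psi> \<union> subfms \<phi>"
| "subfms (Or \<psi> \<phi>) = {Or \<psi> \<phi>} \<union> subfms \<psi> \<union> subfms \<phi>"
| "subfms (Dia a \<psi>) = {Dia a \<psi>} \<union> subfms \<psi>"
| "subfms (Box a \<psi>) = {Box a \<psi>} \<union> subfms \<psi>"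
| "subfms (Fix \<eta> X \<psi>) = {Fix \<eta> X \<psi>} \<union> subfms \<psi>"

text \<open>Subformulas with an occurrence outside the scope of every fixpoint operator.\<close>

primrec free_subfms :: "('p, 'a, 'v) fm \<Rightarrow> ('p, 'a, 'v) fm set" where
  "free_subfms Bot = {Bot}"
| "free_subfms Top = {Top}"
| "free_subfms (Prop p) = {Prop p}"
| "free_subfms (NProp p) = {NProp p}"
| "free_subfms (Var X) = {Var X}"
| "free_subfms (And \<psi> \<phi>) = {And \<psi> \<phi>} \<union> free_subfms \<psi> \<union> free_subfms \<phi>"
| "free_subfms (Or \<psi> \<phi>) = {Or \<psi> \<phi>} \<union> free_subfms \<psi> \<union> free_subfms \<phi>"
| "free_subfms (Dia a \<psi>) = {Dia a \<psi>} \<union> free_subfms \<psi>"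
| "free_subfms (Box a \<psi>) = {Box a \<psi>} \<union> free_subfms \<psi>"
| "free_subfms (Fix \<eta> X \<psi>) = {Fix \<eta> X \<psi>}"

primrec binders :: "('p, 'a, 'v) fm \<Rightarrow> 'v list" where
  "binders Bot = []"
| "binders Top = []"
| "binders (Prop p) = []"
| "binders (NProp p) = []"
| "binders (Var X) = []"
| "binders (And \<psi> \<phi>) = binders \<psi> @ binders \<phi>"
| "binders (Or \<psi> \<phi>) = binders \<psi> @ binders \<phi>"
| "binders (Dia a \<psi>) = binders \<psi>"
| "binders (Box a \<psi>) = binders \<psi>"
| "binders (Fix \<eta> X \<psi>) = X # binders \<psi>"

definition clean :: "('p, 'a, 'v) fm \<Rightarrow> bool" where
  "clean \<phi> \<longleftrightarrow> distinct (binders \<phi>) \<and> set (binders \<phi>) \<inter> FV \<phi> = {}"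

definition irredundant :: "('p, 'a, 'v) fm \<Rightarrow> bool" where
  "irredundant \<phi> \<longleftrightarrow> (\<forall>\<eta> X \<psi>. Fix \<eta> X \<psi> \<in> subfms \<phi> \<longrightarrow> X \<in> FV \<psi>)"

text \<open>Free variables with an occurrence outside the scope of every modal operator.\<close>

primrec unguarded_vars :: "('p, 'a, 'v) fm \<Rightarrow> 'v set" where
  "unguarded_vars Bot = {}"
| "unguarded_vars Top = {}"
| "unguarded_vars (Prop p) = {}"
| "unguarded_vars (NProp p) = {}"
| "unguarded_vars (Var X) = {X}"
| "unguarded_vars (And \<psi> \<phi>) = unguarded_vars \<psi> \<union> unguarded_vars \<phi>"
| "unguarded_vars (Or \<psi> \<phi>) = unguarded_vars \<psi> \<union> unguarded_vars \<phi>"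
| "unguarded_vars (Dia a \<psi>) = {}"
| "unguarded_vars (Box a \<psi>) = {}"
| "unguarded_vars (Fix \<eta> X \<psi>) = unguarded_vars \<psi> - {X}"

definition guarded :: "('p, 'a, 'v) fm \<Rightarrow> bool" where
  "guarded \<phi> \<longleftrightarrow> (\<forall>\<eta> X \<psi>. Fix \<eta> X \<psi> \<in> subfms \<phi> \<longrightarrow> X \<notin> unguarded_vars \<psi>)"

definition fp_vars :: "fp \<Rightarrow> ('p, 'a, 'v) fm \<Rightarrow> 'v set" where
  "fp_vars \<eta> \<phi> = {X. \<exists>\<psi>. Fix \<eta> X \<psi> \<in> subfms \<phi>}"

text \<open>Whether a free variable of a subformula is a mu- or a nu-variable is determined by its
  binder in the whole formula, which is unique if that formula is closed and clean.\<close>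

definition alternation_free :: "('p, 'a, 'v) fm \<Rightarrow> bool" where
  "alternation_free \<phi> \<longleftrightarrow>
     (\<forall>\<psi> \<in> subfms \<phi>. FV \<psi> \<inter> fp_vars Mu \<phi> = {} \<or> FV \<psi> \<inter> fp_vars Nu \<phi> = {})"

text \<open>Bound variables are not renamed. Capture cannot occur in the uses below: rule
  applications substitute closed formulas only, and the sequences of substitutions that define
  deferrals stem from nested subformulas of a clean formula.\<close>

primrec subst :: "'v \<Rightarrow> ('p, 'a, 'v) fm \<Rightarrow> ('p, 'a, 'v) fm \<Rightarrow> ('p, 'a, 'v) fm" where
  "subst X \<chi> Bot = Bot"
| "subst X \<chi> Top = Top"
| "subst X \<chi> (Prop p) = Prop p"
| "subst X \<chi> (NProp p) = NProp p"
| "subst X \<chi> (Var Y) = (if Y = X then \<chi> else Var Y)"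
| "subst X \<chi> (And \<psi> \<phi>) = And (subst X \<chi> \<psi>) (subst X \<chi> \<phi>)"
| "subst X \<chi> (Or \<psi> \<phi>) = Or (subst X \<chi> \<psi>) (subst X \<chi> \<phi>)"
| "subst X \<chi> (Dia a \<psi>) = Dia a (subst X \<chi> \<psi>)"
| "subst X \<chi> (Box a \<psi>) = Box a (subst X \<chi> \<psi>)"
| "subst X \<chi> (Fix \<eta> Y \<psi>) = (if Y = X then Fix \<eta> Y \<psi> else Fix \<eta> Y (subst X \<chi> \<psi>))"

record ('w, 'p, 'a) kripke =
  states :: "'w set"
  trans_rel :: "'a \<Rightarrow> ('w \<times> 'w) set"
  valuation :: "'p \<Rightarrow> 'w set"

definition kripke_structure :: "('w, 'p, 'a) kripke \<Rightarrow> bool" where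
  "kripke_structure K \<longleftrightarrow>
     (\<forall>a. trans_rel K a \<subseteq> states K \<times> states K) \<and> (\<forall>p. valuation K p \<subseteq> states K)"

text \<open>Intersecting with the set of states makes the fixpoints those of the powerset lattice
  of the set of states rather than of its type.\<close>

primrec sem :: "('w, 'p, 'a) kripke \<Rightarrow> ('p, 'a, 'v) fm \<Rightarrow> ('v \<Rightarrow> 'w set) \<Rightarrow> 'w set" where
  "sem K Bot i = {}"
| "sem K Top i = states K"
| "sem K (Prop p) i = valuation K p"
| "sem K (NProp p) i = states K - valuation K p"
| "sem K (Var X) i = i X"
| "sem K (And \<psi> \<phi>) i = sem K \<psi> i \<inter> sem K \<phi> i"
| "sem K (Or \<psi> \<phi>) i = sem K \<psi> i \<union> sem K \<phi> i"
| "sem K (Dia a \<psi>) i = {v \<in> states K. \<exists>w. (v, w) \<in> trans_rel K a \<and> w \<in> sem K \<psi> i}"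
| "sem K (Box a \<psi>) i = {v \<in> states K. \<forall>w. (v, w) \<in> trans_rel K a \<longrightarrow> w \<in> sem K \<psi> i}"
| "sem K (Fix \<eta> X \<psi>) i =
     (case \<eta> of
        Mu \<Rightarrow> lfp (\<lambda>S. states K \<inter> sem K \<psi> (i(X := S)))
      | Nu \<Rightarrow> gfp (\<lambda>S. states K \<inter> sem K \<psi> (i(X := S))))"

text \<open>The type \<open>'w\<close> is the universe from which the states of Kripke structures are taken. For closed
  formulas, the interpretation of the fixpoint variables is irrelevant.\<close>

definition satisfiable :: "'w itself \<Rightarrow> ('p, 'a, 'v) fm \<Rightarrow> bool" where
  "satisfiable _ \<phi> \<longleftrightarrow>
     (\<exists>K :: ('w, 'p, 'a) kripke. kripke_structure K \<and>
        (\<exists>w \<in> states K. w \<in> sem K \<phi> (\<lambda>_. {})))"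


section \<open>Deferrals\<close>

definition lessf :: "('p, 'a, 'v) fm \<Rightarrow> ('p, 'a, 'v) fm \<Rightarrow> bool" (infix \<open><\<^sub>f\<close> 50) where
  "\<psi> <\<^sub>f \<chi> \<longleftrightarrow> (\<exists>\<eta> X \<phi>. \<chi> = Fix \<eta> X \<phi> \<and> \<psi> \<in> free_subfms \<phi> \<and> \<not> closed_fm \<psi>)"

text \<open>The list of fixpoint literals \<open>[\<chi>\<^sub>1, \<dots>, \<chi>\<^sub>n]\<close>, where \<open>\<chi>\<^sub>i\<close> binds \<open>X\<^sub>i\<close>, represents the
  substitution \<open>[X\<^sub>1 \<mapsto> \<chi>\<^sub>1]; \<dots>; [X\<^sub>n \<mapsto> \<chi>\<^sub>n]\<close>, to be applied from left to right.\<close>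

definition sequentially_unfolds :: "('p, 'a, 'v) fm list \<Rightarrow> bool" where
  "sequentially_unfolds \<chi>s \<longleftrightarrow>
     \<chi>s \<noteq> [] \<and> (\<forall>\<chi> \<in> set \<chi>s. \<exists>\<eta> X \<psi>. \<chi> = Fix \<eta> X \<psi>) \<and> successively (<\<^sub>f) \<chi>s \<and> clean (last \<chi>s)"

primrec apply_unfolding :: "('p, 'a, 'v) fm list \<Rightarrow> ('p, 'a, 'v) fm \<Rightarrow> ('p, 'a, 'v) fm" where
  "apply_unfolding [] \<alpha> = \<alpha>"
| "apply_unfolding (\<chi> # \<chi>s) \<alpha> =
     apply_unfolding \<chi>s (case \<chi> of Fix \<eta> X \<psi> \<Rightarrow> subst X \<chi> \<alpha> | _ \<Rightarrow> \<alpha>)"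

definition irreducible_fm :: "('p, 'a, 'v) fm \<Rightarrow> bool" where
  "irreducible_fm \<chi> \<longleftrightarrow>
     (\<forall>\<chi>s. sequentially_unfolds \<chi>s \<and> \<chi> = apply_unfolding (tl \<chi>s) (hd \<chi>s) \<longrightarrow> length \<chi>s = 1)"

definition eventuality :: "('p, 'a, 'v) fm \<Rightarrow> bool" where
  "eventuality \<theta> \<longleftrightarrow> (\<exists>X \<psi>. \<theta> = Fix Mu X \<psi>) \<and> closed_fm \<theta> \<and> irreducible_fm \<theta>"

definition belongs_to :: "('p, 'a, 'v) fm \<Rightarrow> ('p, 'a, 'v) fm \<Rightarrow> bool" where
  "belongs_to \<psi> \<theta> \<longleftrightarrow>
     (\<exists>\<theta>s \<alpha>. sequentially_unfolds \<theta>s \<and> last \<theta>s = \<theta> \<and> eventuality \<theta> \<and>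
        \<alpha> <\<^sub>f hd \<theta>s \<and> \<psi> = apply_unfolding \<theta>s \<alpha>)"

definition deferrals :: "('p, 'a, 'v) fm set \<Rightarrow> ('p, 'a, 'v) fm set" where
  "deferrals \<Gamma> = {\<delta> \<in> \<Gamma>. \<exists>\<theta>. belongs_to \<delta> \<theta>}"


section \<open>Tableau rules\<close>

text \<open>A conclusion of a rule application to \<open>\<Delta>\<close> consists of its label \<open>\<Gamma>\<close> and of the relation
  that tracks each formula of \<open>\<Delta>\<close> to the formulas of \<open>\<Gamma>\<close> which it evolves to. The label alone
  does not determine the tracking: if both disjuncts of the principal formula of \<open>(\<or>)\<close> already
  belong to the context, then the two conclusions have the same label.\<close>

type_synonym ('p, 'a, 'v) conclusion =
  "('p, 'a, 'v) fm set \<times> (('p, 'a, 'v) fm \<times> ('p, 'a, 'v) fm) set"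

definition replace ::
  "('p, 'a, 'v) fm set \<Rightarrow> ('p, 'a, 'v) fm \<Rightarrow> ('p, 'a, 'v) fm set \<Rightarrow> ('p, 'a, 'v) conclusion" where
  "replace \<Delta> \<chi> \<Theta> = ((\<Delta> - {\<chi>}) \<union> \<Theta>, Id_on (\<Delta> - {\<chi>}) \<union> {\<chi>} \<times> \<Theta>)"

inductive_set nonmodal_rules :: "('p, 'a, 'v) fm set \<Rightarrow> ('p, 'a, 'v) conclusion set set"
  for \<Delta> :: "('p, 'a, 'v) fm set" where
  bot: "Bot \<in> \<Delta> \<Longrightarrow> {} \<in> nonmodal_rules \<Delta>"
| clash: "Prop p \<in> \<Delta> \<Longrightarrow> NProp p \<in> \<Delta> \<Longrightarrow> {} \<in> nonmodal_rules \<Delta>"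
| conj: "And \<psi> \<phi> \<in> \<Delta> \<Longrightarrow> {replace \<Delta> (And \<psi> \<phi>) {\<psi>, \<phi>}} \<in> nonmodal_rules \<Delta>"
| disj: "Or \<psi> \<phi> \<in> \<Delta> \<Longrightarrow>
    {replace \<Delta> (Or \<psi> \<phi>) {\<psi>}, replace \<Delta> (Or \<psi> \<phi>) {\<phi>}} \<in> nonmodal_rules \<Delta>"
| unfold: "Fix \<eta> X \<psi> \<in> \<Delta> \<Longrightarrow>
    {replace \<Delta> (Fix \<eta> X \<psi>) {subst X (Fix \<eta> X \<psi>) \<psi>}} \<in> nonmodal_rules \<Delta>"

inductive_set modal_rules :: "('p, 'a, 'v) fm set \<Rightarrow> ('p, 'a, 'v) conclusion set set"
  for \<Delta> :: "('p, 'a, 'v) fm set" where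
  dia: "Dia a \<phi> \<in> \<Delta> \<Longrightarrow>
    {(insert \<phi> {\<psi>. Box a \<psi> \<in> \<Delta>},
      insert (Dia a \<phi>, \<phi>) {(Box a \<psi>, \<psi>) |\<psi>. Box a \<psi> \<in> \<Delta>})} \<in> modal_rules \<Delta>"

definition state_node :: "('p, 'a, 'v) fm set \<Rightarrow> bool" where
  "state_node \<Delta> \<longleftrightarrow>
     (\<forall>\<phi> \<in> \<Delta>. \<phi> = Top \<or> (\<exists>p. \<phi> = Prop p \<or> \<phi> = NProp p) \<or> (\<exists>a \<psi>. \<phi> = Dia a \<psi> \<or> \<phi> = Box a \<psi>)) \<and>
     (\<forall>p. \<not> (Prop p \<in> \<Delta> \<and> NProp p \<in> \<Delta>))"

definition concl :: "('p, 'a, 'v) fm set \<Rightarrow> ('p, 'a, 'v) conclusion set set" where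
  "concl \<Delta> = (if state_node \<Delta> then modal_rules \<Delta> else nonmodal_rules \<Delta>)"

definition track :: "('p, 'a, 'v) fm set \<Rightarrow> ('p, 'a, 'v) conclusion \<Rightarrow> ('p, 'a, 'v) fm set" where
  "track d = (\<lambda>(\<Gamma>, \<rho>). if d = {} then deferrals \<Gamma> else deferrals (\<rho> `` d))"


section \<open>Propagation\<close>

type_synonym ('p, 'a, 'v) fnode = "('p, 'a, 'v) fm set \<times> ('p, 'a, 'v) fm set"

definition focused_nodes :: "('p, 'a, 'v) fm set set \<Rightarrow> ('p, 'a, 'v) fnode set" where
  "focused_nodes G = {(\<Gamma>, d). \<Gamma> \<in> G \<and> d \<subseteq> deferrals \<Gamma>}"

definition empty_focus :: "('p, 'a, 'v) fm set set \<Rightarrow> ('p, 'a, 'v) fnode set" where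
  "empty_focus G = {(\<Gamma>, d) \<in> focused_nodes G. d = {}}"

definition nonempty_focus :: "('p, 'a, 'v) fm set set \<Rightarrow> ('p, 'a, 'v) fnode set" where
  "nonempty_focus G = {(\<Gamma>, d) \<in> focused_nodes G. d \<noteq> {}}"

definition f_op ::
  "('p, 'a, 'v) fm set set \<Rightarrow> ('p, 'a, 'v) fnode set \<Rightarrow> ('p, 'a, 'v) fnode set" where
  "f_op G Y = {(\<Delta>, d) \<in> focused_nodes G. \<forall>\<Sigma> \<in> concl \<Delta>. \<exists>(\<Gamma>, \<rho>) \<in> \<Sigma>. (\<Gamma>, track d (\<Gamma>, \<rho>)) \<in> Y}"

definition g_op ::
  "('p, 'a, 'v) fm set set \<Rightarrow> ('p, 'a, 'v) fnode set \<Rightarrow> ('p, 'a, 'v) fnode set" where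
  "g_op G Y = {(\<Delta>, d) \<in> focused_nodes G. \<exists>\<Sigma> \<in> concl \<Delta>. \<forall>(\<Gamma>, \<rho>) \<in> \<Sigma>. (\<Gamma>, track d (\<Gamma>, \<rho>)) \<in> Y}"

definition f_hat :: "('p, 'a, 'v) fm set set \<Rightarrow>
    ('p, 'a, 'v) fnode set \<Rightarrow> ('p, 'a, 'v) fnode set \<Rightarrow> ('p, 'a, 'v) fnode set" where
  "f_hat G X Y = (f_op G Y \<inter> nonempty_focus G) \<union> (f_op G X \<inter> empty_focus G)"

definition g_hat :: "('p, 'a, 'v) fm set set \<Rightarrow>
    ('p, 'a, 'v) fnode set \<Rightarrow> ('p, 'a, 'v) fnode set \<Rightarrow> ('p, 'a, 'v) fnode set" where
  "g_hat G X Y = (g_op G Y \<union> empty_focus G) \<inter> (g_op G X \<union> nonempty_focus G)"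

definition E_set :: "('p, 'a, 'v) fm set set \<Rightarrow> ('p, 'a, 'v) fnode set" where
  "E_set G = gfp (\<lambda>X. lfp (\<lambda>Y. f_hat G X Y))"

definition A_set :: "('p, 'a, 'v) fm set set \<Rightarrow> ('p, 'a, 'v) fnode set" where
  "A_set G = lfp (\<lambda>X. gfp (\<lambda>Y. g_hat G X Y))"


section \<open>The global caching algorithm\<close>

datatype 's gc_conf = Running 's 's | Answer bool

definition gc_init :: "('p, 'a, 'v) fm \<Rightarrow> ('p, 'a, 'v) fm set set gc_conf" where
  "gc_init \<phi>\<^sub>0 = Running {} {{\<phi>\<^sub>0}}"

definition expand_unexpanded :: "('p, 'a, 'v) fm set set \<Rightarrow> ('p, 'a, 'v) fm set set \<Rightarrow>
    ('p, 'a, 'v) fm set \<Rightarrow> ('p, 'a, 'v) fm set set" where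
  "expand_unexpanded G U t = (U - {t}) \<union> (fst ` \<Union> (concl t) - insert t G)"

text \<open>One step is one iteration of the main loop: the expansion of a node followed by the
  optional propagation and, if no unexpanded nodes are left, by the final propagation.\<close>

inductive gc_step :: "('p, 'a, 'v) fm \<Rightarrow>
    ('p, 'a, 'v) fm set set gc_conf \<Rightarrow> ('p, 'a, 'v) fm set set gc_conf \<Rightarrow> bool"
  for \<phi>\<^sub>0 :: "('p, 'a, 'v) fm" where
  continue: "t \<in> U \<Longrightarrow> expand_unexpanded G U t \<noteq> {} \<Longrightarrow>
    gc_step \<phi>\<^sub>0 (Running G U) (Running (insert t G) (expand_unexpanded G U t))"
| early_yes: "t \<in> U \<Longrightarrow> ({\<phi>\<^sub>0}, deferrals {\<phi>\<^sub>0}) \<in> E_set (insert t G) \<Longrightarrow>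
    gc_step \<phi>\<^sub>0 (Running G U) (Answer True)"
| early_no: "t \<in> U \<Longrightarrow> ({\<phi>\<^sub>0}, deferrals {\<phi>\<^sub>0}) \<in> A_set (insert t G) \<Longrightarrow>
    gc_step \<phi>\<^sub>0 (Running G U) (Answer False)"
| final: "t \<in> U \<Longrightarrow> expand_unexpanded G U t = {} \<Longrightarrow>
    gc_step \<phi>\<^sub>0 (Running G U) (Answer (({\<phi>\<^sub>0}, deferrals {\<phi>\<^sub>0}) \<in> E_set (insert t G)))"


section \<open>Running time\<close>

text \<open>The running time of the algorithm is the number of computation steps of the following
  program, which is written in a monad that counts one step for every call of a function that
  is not a constructor. Comparing two elements of \<open>'p\<close>, \<open>'a\<close> or \<open>'v\<close> takes one step; formulas,
  nodes and focused nodes are compared by traversing them. Nodes and sets of nodes are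
  represented by lists.\<close>

datatype 'b tm = TM (val: 'b) (time: nat)

definition ret :: "'b \<Rightarrow> 'b tm" where
  "ret x = TM x 0"

definition bind_tm :: "'b tm \<Rightarrow> ('b \<Rightarrow> 'c tm) \<Rightarrow> 'c tm" where
  "bind_tm s k = (case s of TM x m \<Rightarrow> case k x of TM y n \<Rightarrow> TM y (m + n))"

definition tick :: "'b tm \<Rightarrow> 'b tm" where
  "tick s = TM (val s) (Suc (time s))"

adhoc_overloading Monad_Syntax.bind \<rightleftharpoons> bind_tm

subsection \<open>Lists\<close>

primrec map_tm :: "('b \<Rightarrow> 'c tm) \<Rightarrow> 'b list \<Rightarrow> 'c list tm" where
  "map_tm f [] = tick (ret [])"
| "map_tm f (x # xs) = tick (do { y \<leftarrow> f x; ys \<leftarrow> map_tm f xs; ret (y # ys) })"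

primrec filter_tm :: "('b \<Rightarrow> bool tm) \<Rightarrow> 'b list \<Rightarrow> 'b list tm" where
  "filter_tm P [] = tick (ret [])"
| "filter_tm P (x # xs) =
     tick (do { b \<leftarrow> P x; ys \<leftarrow> filter_tm P xs; ret (if b then x # ys else ys) })"

primrec all_tm :: "('b \<Rightarrow> bool tm) \<Rightarrow> 'b list \<Rightarrow> bool tm" where
  "all_tm P [] = tick (ret True)"
| "all_tm P (x # xs) = tick (do { b \<leftarrow> P x; if b then all_tm P xs else ret False })"

primrec ex_tm :: "('b \<Rightarrow> bool tm) \<Rightarrow> 'b list \<Rightarrow> bool tm" where
  "ex_tm P [] = tick (ret False)"
| "ex_tm P (x # xs) = tick (do { b \<leftarrow> P x; if b then ret True else ex_tm P xs })"

primrec append_tm :: "'b list \<Rightarrow> 'b list \<Rightarrow> 'b list tm" where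
  "append_tm [] ys = tick (ret ys)"
| "append_tm (x # xs) ys = tick (do { zs \<leftarrow> append_tm xs ys; ret (x # zs) })"

primrec concat_tm :: "'b list list \<Rightarrow> 'b list tm" where
  "concat_tm [] = tick (ret [])"
| "concat_tm (xs # xss) = tick (do { ys \<leftarrow> concat_tm xss; append_tm xs ys })"

primrec nth_tm :: "'b list \<Rightarrow> nat \<Rightarrow> 'b tm" where
  "nth_tm [] n = tick (ret undefined)"
| "nth_tm (x # xs) n = tick (case n of 0 \<Rightarrow> ret x | Suc m \<Rightarrow> nth_tm xs m)"

primrec sublists_tm :: "'b list \<Rightarrow> 'b list list tm" where
  "sublists_tm [] = tick (ret [[]])"
| "sublists_tm (x # xs) =
     tick (do { yss \<leftarrow> sublists_tm xs; zss \<leftarrow> map_tm (\<lambda>ys. tick (ret (x # ys))) yss; append_tm zss yss })"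

text \<open>Sets represented by lists; the first argument is the comparison of elements.\<close>

definition mem_tm :: "('b \<Rightarrow> 'b \<Rightarrow> bool tm) \<Rightarrow> 'b \<Rightarrow> 'b list \<Rightarrow> bool tm" where
  "mem_tm eq x xs = tick (ex_tm (eq x) xs)"

definition remove_tm :: "('b \<Rightarrow> 'b \<Rightarrow> bool tm) \<Rightarrow> 'b \<Rightarrow> 'b list \<Rightarrow> 'b list tm" where
  "remove_tm eq x xs = tick (filter_tm (\<lambda>y. tick (do { b \<leftarrow> eq x y; ret (\<not> b) })) xs)"

primrec union_tm :: "('b \<Rightarrow> 'b \<Rightarrow> bool tm) \<Rightarrow> 'b list \<Rightarrow> 'b list \<Rightarrow> 'b list tm" where
  "union_tm eq [] ys = tick (ret ys)"
| "union_tm eq (x # xs) ys =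
     tick (do { zs \<leftarrow> union_tm eq xs ys; b \<leftarrow> mem_tm eq x zs; ret (if b then zs else x # zs) })"

definition seteq_tm :: "('b \<Rightarrow> 'b \<Rightarrow> bool tm) \<Rightarrow> 'b list \<Rightarrow> 'b list \<Rightarrow> bool tm" where
  "seteq_tm eq xs ys = tick (do {
     b \<leftarrow> all_tm (\<lambda>x. mem_tm eq x ys) xs;
     if b then all_tm (\<lambda>y. mem_tm eq y xs) ys else ret False })"

text \<open>Iterates \<open>F\<close> as many times as the given list has elements.\<close>

primrec iterate_tm :: "('s \<Rightarrow> 's tm) \<Rightarrow> 'b list \<Rightarrow> 's \<Rightarrow> 's tm" where
  "iterate_tm F [] s = tick (ret s)"
| "iterate_tm F (_ # cs) s = tick (do { s' \<leftarrow> F s; iterate_tm F cs s' })"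

subsection \<open>Formulas\<close>

definition eq_atom_tm :: "'b \<Rightarrow> 'b \<Rightarrow> bool tm" where
  "eq_atom_tm x y = tick (ret (x = y))"

primrec eq_fm_tm :: "('p, 'a, 'v) fm \<Rightarrow> ('p, 'a, 'v) fm \<Rightarrow> bool tm" where
  "eq_fm_tm Bot \<chi> = tick (ret (case \<chi> of Bot \<Rightarrow> True | _ \<Rightarrow> False))"
| "eq_fm_tm Top \<chi> = tick (ret (case \<chi> of Top \<Rightarrow> True | _ \<Rightarrow> False))"
| "eq_fm_tm (Prop p) \<chi> = tick (case \<chi> of Prop q \<Rightarrow> eq_atom_tm p q | _ \<Rightarrow> ret False)"
| "eq_fm_tm (NProp p) \<chi> = tick (case \<chi> of NProp q \<Rightarrow> eq_atom_tm p q | _ \<Rightarrow> ret False)"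
| "eq_fm_tm (Var X) \<chi> = tick (case \<chi> of Var Y \<Rightarrow> eq_atom_tm X Y | _ \<Rightarrow> ret False)"
| "eq_fm_tm (And \<psi> \<phi>) \<chi> = tick (case \<chi> of
     And \<psi>' \<phi>' \<Rightarrow> do { b \<leftarrow> eq_fm_tm \<psi> \<psi>'; if b then eq_fm_tm \<phi> \<phi>' else ret False }
   | _ \<Rightarrow> ret False)"
| "eq_fm_tm (Or \<psi> \<phi>) \<chi> = tick (case \<chi> of
     Or \<psi>' \<phi>' \<Rightarrow> do { b \<leftarrow> eq_fm_tm \<psi> \<psi>'; if b then eq_fm_tm \<phi> \<phi>' else ret False }
   | _ \<Rightarrow> ret False)"
| "eq_fm_tm (Dia a \<psi>) \<chi> = tick (case \<chi> of
     Dia a' \<psi>' \<Rightarrow> do { b \<leftarrow> eq_atom_tm a a'; if b then eq_fm_tm \<psi> \<psi>' else ret False }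
   | _ \<Rightarrow> ret False)"
| "eq_fm_tm (Box a \<psi>) \<chi> = tick (case \<chi> of
     Box a' \<psi>' \<Rightarrow> do { b \<leftarrow> eq_atom_tm a a'; if b then eq_fm_tm \<psi> \<psi>' else ret False }
   | _ \<Rightarrow> ret False)"
| "eq_fm_tm (Fix \<eta> X \<psi>) \<chi> = tick (case \<chi> of
     Fix \<eta>' X' \<psi>' \<Rightarrow> do {
       b \<leftarrow> eq_atom_tm \<eta> \<eta>';
       b' \<leftarrow> eq_atom_tm X X';
       if b \<and> b' then eq_fm_tm \<psi> \<psi>' else ret False }
   | _ \<Rightarrow> ret False)"

abbreviation eq_node_tm :: "('p, 'a, 'v) fm list \<Rightarrow> ('p, 'a, 'v) fm list \<Rightarrow> bool tm" where
  "eq_node_tm \<equiv> seteq_tm eq_fm_tm"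

primrec fv_tm :: "('p, 'a, 'v) fm \<Rightarrow> 'v list tm" where
  "fv_tm Bot = tick (ret [])"
| "fv_tm Top = tick (ret [])"
| "fv_tm (Prop p) = tick (ret [])"
| "fv_tm (NProp p) = tick (ret [])"
| "fv_tm (Var X) = tick (ret [X])"
| "fv_tm (And \<psi> \<phi>) = tick (do { xs \<leftarrow> fv_tm \<psi>; ys \<leftarrow> fv_tm \<phi>; append_tm xs ys })"
| "fv_tm (Or \<psi> \<phi>) = tick (do { xs \<leftarrow> fv_tm \<psi>; ys \<leftarrow> fv_tm \<phi>; append_tm xs ys })"
| "fv_tm (Dia a \<psi>) = tick (fv_tm \<psi>)"
| "fv_tm (Box a \<psi>) = tick (fv_tm \<psi>)"
| "fv_tm (Fix \<eta> X \<psi>) = tick (do { xs \<leftarrow> fv_tm \<psi>; remove_tm eq_atom_tm X xs })"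

primrec subst_tm :: "'v \<Rightarrow> ('p, 'a, 'v) fm \<Rightarrow> ('p, 'a, 'v) fm \<Rightarrow> ('p, 'a, 'v) fm tm" where
  "subst_tm X \<chi> Bot = tick (ret Bot)"
| "subst_tm X \<chi> Top = tick (ret Top)"
| "subst_tm X \<chi> (Prop p) = tick (ret (Prop p))"
| "subst_tm X \<chi> (NProp p) = tick (ret (NProp p))"
| "subst_tm X \<chi> (Var Y) = tick (do { b \<leftarrow> eq_atom_tm Y X; ret (if b then \<chi> else Var Y) })"
| "subst_tm X \<chi> (And \<psi> \<phi>) =
     tick (do { \<psi>' \<leftarrow> subst_tm X \<chi> \<psi>; \<phi>' \<leftarrow> subst_tm X \<chi> \<phi>; ret (And \<psi>' \<phi>') })"
| "subst_tm X \<chi> (Or \<psi> \<phi>) =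
     tick (do { \<psi>' \<leftarrow> subst_tm X \<chi> \<psi>; \<phi>' \<leftarrow> subst_tm X \<chi> \<phi>; ret (Or \<psi>' \<phi>') })"
| "subst_tm X \<chi> (Dia a \<psi>) = tick (do { \<psi>' \<leftarrow> subst_tm X \<chi> \<psi>; ret (Dia a \<psi>') })"
| "subst_tm X \<chi> (Box a \<psi>) = tick (do { \<psi>' \<leftarrow> subst_tm X \<chi> \<psi>; ret (Box a \<psi>') })"
| "subst_tm X \<chi> (Fix \<eta> Y \<psi>) = tick (do {
     b \<leftarrow> eq_atom_tm Y X;
     if b then ret (Fix \<eta> Y \<psi>) else do { \<psi>' \<leftarrow> subst_tm X \<chi> \<psi>; ret (Fix \<eta> Y \<psi>') } })"

subsection \<open>Deferrals\<close>

primrec apply_unfolding_tm ::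
  "('v \<times> ('p, 'a, 'v) fm) list \<Rightarrow> ('p, 'a, 'v) fm \<Rightarrow> ('p, 'a, 'v) fm tm" where
  "apply_unfolding_tm [] \<alpha> = tick (ret \<alpha>)"
| "apply_unfolding_tm (s # \<sigma>) \<alpha> =
     tick (case s of (X, \<chi>) \<Rightarrow> do { \<alpha>' \<leftarrow> subst_tm X \<chi> \<alpha>; apply_unfolding_tm \<sigma> \<alpha>' })"

definition open_instance_tm ::
  "('v \<times> ('p, 'a, 'v) fm) list \<Rightarrow> ('p, 'a, 'v) fm \<Rightarrow> ('p, 'a, 'v) fm list tm" where
  "open_instance_tm \<sigma> \<alpha> = tick (do {
     xs \<leftarrow> fv_tm \<alpha>;
     if xs = [] then ret [] else do { \<delta> \<leftarrow> apply_unfolding_tm \<sigma> \<alpha>; ret [\<delta>] } })"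

text \<open>Collects the deferrals that are instances of subformulas of \<open>\<alpha>\<close>, where \<open>\<sigma>\<close> unfolds the
  fixpoint literals enclosing \<open>\<alpha>\<close> up to an eventuality, innermost first.\<close>

primrec collect_deferrals_tm ::
  "('p, 'a, 'v) fm \<Rightarrow> ('v \<times> ('p, 'a, 'v) fm) list \<Rightarrow> ('p, 'a, 'v) fm list tm" where
  "collect_deferrals_tm Bot \<sigma> = tick (ret [])"
| "collect_deferrals_tm Top \<sigma> = tick (ret [])"
| "collect_deferrals_tm (Prop p) \<sigma> = tick (ret [])"
| "collect_deferrals_tm (NProp p) \<sigma> = tick (ret [])"
| "collect_deferrals_tm (Var X) \<sigma> = tick (open_instance_tm \<sigma> (Var X))"
| "collect_deferrals_tm (And \<psi> \<phi>) \<sigma> = tick (do {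
     xs \<leftarrow> open_instance_tm \<sigma> (And \<psi> \<phi>);
     ys \<leftarrow> collect_deferrals_tm \<psi> \<sigma>;
     zs \<leftarrow> collect_deferrals_tm \<phi> \<sigma>;
     concat_tm [xs, ys, zs] })"
| "collect_deferrals_tm (Or \<psi> \<phi>) \<sigma> = tick (do {
     xs \<leftarrow> open_instance_tm \<sigma> (Or \<psi> \<phi>);
     ys \<leftarrow> collect_deferrals_tm \<psi> \<sigma>;
     zs \<leftarrow> collect_deferrals_tm \<phi> \<sigma>;
     concat_tm [xs, ys, zs] })"
| "collect_deferrals_tm (Dia a \<psi>) \<sigma> = tick (do {
     xs \<leftarrow> open_instance_tm \<sigma> (Dia a \<psi>);
     ys \<leftarrow> collect_deferrals_tm \<psi> \<sigma>;
     append_tm xs ys })"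
| "collect_deferrals_tm (Box a \<psi>) \<sigma> = tick (do {
     xs \<leftarrow> open_instance_tm \<sigma> (Box a \<psi>);
     ys \<leftarrow> collect_deferrals_tm \<psi> \<sigma>;
     append_tm xs ys })"
| "collect_deferrals_tm (Fix \<eta> X \<psi>) \<sigma> = tick (do {
     xs \<leftarrow> open_instance_tm \<sigma> (Fix \<eta> X \<psi>);
     if xs = [] then ret []
     else do { ys \<leftarrow> collect_deferrals_tm \<psi> ((X, Fix \<eta> X \<psi>) # \<sigma>); append_tm xs ys } })"

text \<open>The eventualities in the Fischer--Ladner closure of a closed clean formula are the closed
  least fixpoint literals among its subformulas.\<close>

primrec all_deferrals_tm :: "('p, 'a, 'v) fm \<Rightarrow> ('p, 'a, 'v) fm list tm" where
  "all_deferrals_tm Bot = tick (ret [])"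
| "all_deferrals_tm Top = tick (ret [])"
| "all_deferrals_tm (Prop p) = tick (ret [])"
| "all_deferrals_tm (NProp p) = tick (ret [])"
| "all_deferrals_tm (Var X) = tick (ret [])"
| "all_deferrals_tm (And \<psi> \<phi>) =
     tick (do { xs \<leftarrow> all_deferrals_tm \<psi>; ys \<leftarrow> all_deferrals_tm \<phi>; append_tm xs ys })"
| "all_deferrals_tm (Or \<psi> \<phi>) =
     tick (do { xs \<leftarrow> all_deferrals_tm \<psi>; ys \<leftarrow> all_deferrals_tm \<phi>; append_tm xs ys })"
| "all_deferrals_tm (Dia a \<psi>) = tick (all_deferrals_tm \<psi>)"
| "all_deferrals_tm (Box a \<psi>) = tick (all_deferrals_tm \<psi>)"
| "all_deferrals_tm (Fix \<eta> X \<psi>) = tick (do {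
     xs \<leftarrow> all_deferrals_tm \<psi>;
     vs \<leftarrow> fv_tm (Fix \<eta> X \<psi>);
     if \<eta> = Mu \<and> vs = []
     then do { ys \<leftarrow> collect_deferrals_tm \<psi> [(X, Fix \<eta> X \<psi>)]; append_tm ys xs }
     else ret xs })"

text \<open>From here on, \<open>D\<close> is the list of all deferrals.\<close>

definition deferrals_tm ::
  "('p, 'a, 'v) fm list \<Rightarrow> ('p, 'a, 'v) fm list \<Rightarrow> ('p, 'a, 'v) fm list tm" where
  "deferrals_tm D \<Gamma> = tick (filter_tm (\<lambda>\<delta>. mem_tm eq_fm_tm \<delta> D) \<Gamma>)"

subsection \<open>Tableau rules\<close>

type_synonym ('p, 'a, 'v) conclusion_rep =
  "('p, 'a, 'v) fm list \<times> (('p, 'a, 'v) fm \<times> ('p, 'a, 'v) fm) list"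

definition replace_tm :: "('p, 'a, 'v) fm list \<Rightarrow> ('p, 'a, 'v) fm \<Rightarrow> ('p, 'a, 'v) fm list \<Rightarrow>
    ('p, 'a, 'v) conclusion_rep tm" where
  "replace_tm \<Delta> \<chi> \<Theta> = tick (do {
     \<Delta>' \<leftarrow> remove_tm eq_fm_tm \<chi> \<Delta>;
     \<Gamma> \<leftarrow> union_tm eq_fm_tm \<Theta> \<Delta>';
     \<rho>\<^sub>1 \<leftarrow> map_tm (\<lambda>\<psi>. tick (ret (\<psi>, \<psi>))) \<Delta>';
     \<rho>\<^sub>2 \<leftarrow> map_tm (\<lambda>\<theta>. tick (ret (\<chi>, \<theta>))) \<Theta>;
     \<rho> \<leftarrow> append_tm \<rho>\<^sub>1 \<rho>\<^sub>2;
     ret (\<Gamma>, \<rho>) })"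

definition nonmodal_rules_tm ::
  "('p, 'a, 'v) fm list \<Rightarrow> ('p, 'a, 'v) fm \<Rightarrow> ('p, 'a, 'v) conclusion_rep list list tm" where
  "nonmodal_rules_tm \<Delta> \<chi> = tick (case \<chi> of
     Bot \<Rightarrow> ret [[]]
   | Prop p \<Rightarrow> do { b \<leftarrow> mem_tm eq_fm_tm (NProp p) \<Delta>; ret (if b then [[]] else []) }
   | And \<psi> \<phi> \<Rightarrow> do { c \<leftarrow> replace_tm \<Delta> \<chi> [\<psi>, \<phi>]; ret [[c]] }
   | Or \<psi> \<phi> \<Rightarrow> do { c \<leftarrow> replace_tm \<Delta> \<chi> [\<psi>]; c' \<leftarrow> replace_tm \<Delta> \<chi> [\<phi>]; ret [[c, c']] }
   | Fix \<eta> X \<psi> \<Rightarrow> do { \<psi>' \<leftarrow> subst_tm X \<chi> \<psi>; c \<leftarrow> replace_tm \<Delta> \<chi> [\<psi>']; ret [[c]] }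
   | _ \<Rightarrow> ret [])"

primrec boxes_tm ::
  "'a \<Rightarrow> ('p, 'a, 'v) fm list \<Rightarrow> (('p, 'a, 'v) fm \<times> ('p, 'a, 'v) fm) list tm" where
  "boxes_tm a [] = tick (ret [])"
| "boxes_tm a (\<chi> # \<Delta>) = tick (do {
     \<rho> \<leftarrow> boxes_tm a \<Delta>;
     case \<chi> of
       Box b \<psi> \<Rightarrow> do { c \<leftarrow> eq_atom_tm a b; ret (if c then (\<chi>, \<psi>) # \<rho> else \<rho>) }
     | _ \<Rightarrow> ret \<rho> })"

definition modal_rules_tm ::
  "('p, 'a, 'v) fm list \<Rightarrow> ('p, 'a, 'v) fm \<Rightarrow> ('p, 'a, 'v) conclusion_rep list list tm" where
  "modal_rules_tm \<Delta> \<chi> = tick (case \<chi> of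
     Dia a \<phi> \<Rightarrow> do {
       \<rho> \<leftarrow> boxes_tm a \<Delta>;
       \<psi>s \<leftarrow> map_tm (\<lambda>(_, \<psi>). tick (ret \<psi>)) ((\<chi>, \<phi>) # \<rho>);
       \<Gamma> \<leftarrow> union_tm eq_fm_tm \<psi>s [];
       ret [[(\<Gamma>, (\<chi>, \<phi>) # \<rho>)]] }
   | _ \<Rightarrow> ret [])"

definition state_node_tm :: "('p, 'a, 'v) fm list \<Rightarrow> bool tm" where
  "state_node_tm \<Delta> = tick (all_tm (\<lambda>\<chi>. tick (case \<chi> of
     Top \<Rightarrow> ret True
   | Prop p \<Rightarrow> do { b \<leftarrow> mem_tm eq_fm_tm (NProp p) \<Delta>; ret (\<not> b) }
   | NProp p \<Rightarrow> ret True
   | Dia a \<psi> \<Rightarrow> ret True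
   | Box a \<psi> \<Rightarrow> ret True
   | _ \<Rightarrow> ret False)) \<Delta>)"

definition concl_tm ::
  "('p, 'a, 'v) fm list \<Rightarrow> ('p, 'a, 'v) conclusion_rep list list tm" where
  "concl_tm \<Delta> = tick (do {
     b \<leftarrow> state_node_tm \<Delta>;
     \<Sigma>ss \<leftarrow> map_tm (if b then modal_rules_tm \<Delta> else nonmodal_rules_tm \<Delta>) \<Delta>;
     concat_tm \<Sigma>ss })"

definition track_tm :: "('p, 'a, 'v) fm list \<Rightarrow> ('p, 'a, 'v) fm list \<Rightarrow>
    ('p, 'a, 'v) conclusion_rep \<Rightarrow> ('p, 'a, 'v) fm list tm" where
  "track_tm D d c = tick (case c of (\<Gamma>, \<rho>) \<Rightarrow>
     if d = [] then deferrals_tm D \<Gamma>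
     else do {
       \<rho>' \<leftarrow> filter_tm (\<lambda>(\<delta>, _). tick (mem_tm eq_fm_tm \<delta> d)) \<rho>;
       \<delta>s \<leftarrow> map_tm (\<lambda>(_, \<delta>'). tick (ret \<delta>')) \<rho>';
       ds \<leftarrow> union_tm eq_fm_tm \<delta>s [];
       deferrals_tm D ds })"

subsection \<open>Propagation\<close>

type_synonym ('p, 'a, 'v) fnode_rep = "('p, 'a, 'v) fm list \<times> ('p, 'a, 'v) fm list"

definition eq_fnode_tm ::
  "('p, 'a, 'v) fnode_rep \<Rightarrow> ('p, 'a, 'v) fnode_rep \<Rightarrow> bool tm" where
  "eq_fnode_tm v w = tick (case (v, w) of ((\<Gamma>, d), (\<Gamma>', d')) \<Rightarrow>
     do { b \<leftarrow> eq_node_tm \<Gamma> \<Gamma>'; if b then eq_node_tm d d' else ret False })"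

definition focused_nodes_tm :: "('p, 'a, 'v) fm list \<Rightarrow> ('p, 'a, 'v) fm list list \<Rightarrow>
    ('p, 'a, 'v) fnode_rep list tm" where
  "focused_nodes_tm D G = tick (do {
     vss \<leftarrow> map_tm (\<lambda>\<Gamma>. tick (do {
       \<delta>s \<leftarrow> deferrals_tm D \<Gamma>;
       ds \<leftarrow> sublists_tm \<delta>s;
       map_tm (\<lambda>d. tick (ret (\<Gamma>, d))) ds })) G;
     concat_tm vss })"

definition successor_in_tm :: "('p, 'a, 'v) fm list \<Rightarrow> ('p, 'a, 'v) fnode_rep list \<Rightarrow>
    ('p, 'a, 'v) fm list \<Rightarrow> ('p, 'a, 'v) conclusion_rep \<Rightarrow> bool tm" where
  "successor_in_tm D Z d c = tick (do {
     d' \<leftarrow> track_tm D d c;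
     case c of (\<Gamma>, \<rho>) \<Rightarrow> mem_tm eq_fnode_tm (\<Gamma>, d') Z })"

definition f_tm :: "('p, 'a, 'v) fm list \<Rightarrow> ('p, 'a, 'v) fnode_rep list \<Rightarrow>
    ('p, 'a, 'v) fnode_rep \<Rightarrow> bool tm" where
  "f_tm D Z v = tick (case v of (\<Delta>, d) \<Rightarrow> do {
     \<Sigma>s \<leftarrow> concl_tm \<Delta>;
     all_tm (\<lambda>\<Sigma>. tick (ex_tm (successor_in_tm D Z d) \<Sigma>)) \<Sigma>s })"

definition g_tm :: "('p, 'a, 'v) fm list \<Rightarrow> ('p, 'a, 'v) fnode_rep list \<Rightarrow>
    ('p, 'a, 'v) fnode_rep \<Rightarrow> bool tm" where
  "g_tm D Z v = tick (case v of (\<Delta>, d) \<Rightarrow> do {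
     \<Sigma>s \<leftarrow> concl_tm \<Delta>;
     ex_tm (\<lambda>\<Sigma>. tick (all_tm (successor_in_tm D Z d) \<Sigma>)) \<Sigma>s })"

text \<open>For \<open>h = f_tm D\<close> and \<open>h = g_tm D\<close>, this computes \<open>f_hat\<close> and \<open>g_hat\<close>, respectively.\<close>

definition hat_tm :: "(('p, 'a, 'v) fnode_rep list \<Rightarrow> ('p, 'a, 'v) fnode_rep \<Rightarrow> bool tm) \<Rightarrow>
    ('p, 'a, 'v) fnode_rep list \<Rightarrow> ('p, 'a, 'v) fnode_rep list \<Rightarrow> ('p, 'a, 'v) fnode_rep list \<Rightarrow>
    ('p, 'a, 'v) fnode_rep list tm" where
  "hat_tm h C X Y =
     tick (filter_tm (\<lambda>v. tick (case v of (\<Delta>, d) \<Rightarrow> h (if d = [] then X else Y) v)) C)"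

text \<open>Fixpoints over \<open>C\<close> are reached after at most \<open>length C\<close> iterations.\<close>

definition E_tm :: "('p, 'a, 'v) fm list \<Rightarrow> ('p, 'a, 'v) fm list list \<Rightarrow>
    ('p, 'a, 'v) fnode_rep list tm" where
  "E_tm D G = tick (do {
     C \<leftarrow> focused_nodes_tm D G;
     iterate_tm (\<lambda>X. tick (iterate_tm (\<lambda>Y. hat_tm (f_tm D) C X Y) C [])) C C })"

definition A_tm :: "('p, 'a, 'v) fm list \<Rightarrow> ('p, 'a, 'v) fm list list \<Rightarrow>
    ('p, 'a, 'v) fnode_rep list tm" where
  "A_tm D G = tick (do {
     C \<leftarrow> focused_nodes_tm D G;
     iterate_tm (\<lambda>X. tick (iterate_tm (\<lambda>Y. hat_tm (g_tm D) C X Y) C C)) C [] })"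

subsection \<open>The main loop\<close>

definition root_in_tm :: "('p, 'a, 'v) fm list \<Rightarrow> ('p, 'a, 'v) fm \<Rightarrow>
    ('p, 'a, 'v) fnode_rep list tm \<Rightarrow> bool tm" where
  "root_in_tm D \<phi>\<^sub>0 Z = tick (do {
     vs \<leftarrow> Z;
     d \<leftarrow> deferrals_tm D [\<phi>\<^sub>0];
     mem_tm eq_fnode_tm ([\<phi>\<^sub>0], d) vs })"

text \<open>Here \<open>i\<close> is the position of the node that is picked for expansion, and \<open>e\<close> and \<open>a\<close> say
  whether the intermediate propagation computes \<open>E_set\<close> and \<open>A_set\<close>, respectively.\<close>

definition gc_iteration_tm :: "('p, 'a, 'v) fm list \<Rightarrow> ('p, 'a, 'v) fm \<Rightarrow> nat \<Rightarrow> bool \<Rightarrow> bool \<Rightarrow>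
    ('p, 'a, 'v) fm list list \<Rightarrow> ('p, 'a, 'v) fm list list \<Rightarrow>
    ('p, 'a, 'v) fm list list gc_conf tm" where
  "gc_iteration_tm D \<phi>\<^sub>0 i e a G U = tick (do {
     t \<leftarrow> nth_tm U i;
     U\<^sub>1 \<leftarrow> remove_tm eq_node_tm t U;
     \<Sigma>s \<leftarrow> concl_tm t;
     cs \<leftarrow> concat_tm \<Sigma>s;
     \<Gamma>s \<leftarrow> map_tm (\<lambda>(\<Gamma>, _). tick (ret \<Gamma>)) cs;
     new \<leftarrow> filter_tm (\<lambda>\<Gamma>. tick (do { b \<leftarrow> mem_tm eq_node_tm \<Gamma> (t # G); ret (\<not> b) })) \<Gamma>s;
     U' \<leftarrow> union_tm eq_node_tm new U\<^sub>1;
     yes \<leftarrow> (if e then root_in_tm D \<phi>\<^sub>0 (E_tm D (t # G)) else ret False);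
     if yes then ret (Answer True)
     else do {
       no \<leftarrow> (if a then root_in_tm D \<phi>\<^sub>0 (A_tm D (t # G)) else ret False);
       if no then ret (Answer False)
       else if U' = [] then do { b \<leftarrow> root_in_tm D \<phi>\<^sub>0 (E_tm D (t # G)); ret (Answer b) }
       else ret (Running (t # G) U') } })"

text \<open>\<open>gc_exec \<phi>\<^sub>0 c n\<close>: some execution on input \<open>\<phi>\<^sub>0\<close> reaches the configuration \<open>c\<close> after \<open>n\<close>
  computation steps.\<close>

inductive gc_exec :: "('p, 'a, 'v) fm \<Rightarrow> ('p, 'a, 'v) fm list list gc_conf \<Rightarrow> nat \<Rightarrow> bool"
  for \<phi>\<^sub>0 :: "('p, 'a, 'v) fm" where
  init: "gc_exec \<phi>\<^sub>0 (Running [] [[\<phi>\<^sub>0]]) (time (all_deferrals_tm \<phi>\<^sub>0))"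
| iteration: "gc_exec \<phi>\<^sub>0 (Running G U) n \<Longrightarrow> i < length U \<Longrightarrow>
    r = gc_iteration_tm (val (all_deferrals_tm \<phi>\<^sub>0)) \<phi>\<^sub>0 i e a G U \<Longrightarrow>
    gc_exec \<phi>\<^sub>0 (val r) (n + time r)"

definition abs_conf ::
  "('p, 'a, 'v) fm list list gc_conf \<Rightarrow> ('p, 'a, 'v) fm set set gc_conf" where
  "abs_conf = map_gc_conf (\<lambda>G. set ` set G)"

end

theory Submission
  imports Defs "HOL-Library.Multiset"
begin

text \<open>The Fischer--Ladner closure of \<open>\<phi>\<^sub>0\<close> consists of the closed instances of its subformulas. By
  cleanness and irreducibility, the deferrals in the closure are the instances of open subformulas
  whose outermost relevant fixpoint literal is a least one; by alternation freeness, such subformulas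
  only contain least fixpoint variables.

  If \<open>\<phi>\<^sub>0\<close> holds in a model, then so does every node that is reached by resolving the tableau rules
  along the model. The truth of a deferral is witnessed by a well-founded tree of unfoldings, and the
  multiset of these trees for the focused deferrals decreases until the focus is empty. Conversely,
  the focused state nodes in \<open>E_set G\<close> form a model in which successors respect the rank in the inner
  least fixpoint: greatest fixpoints hold by coinduction, and least fixpoints since the focus gets
  exhausted again and again. Since \<open>A_set G\<close> is the complement of \<open>E_set G\<close> on sets of nodes that are
  closed under the rules, all answers are correct.

  The closure has at most \<open>n\<close> elements, each of size at most \<open>4 ^ n\<close>, and there are at most \<open>4 ^ n\<close>
  focused nodes. All loops of the program are polynomial in these numbers.\<close>

text \<open>Early answers concern a set \<open>G\<close> that need not be closed under the rules,
  and there \<open>A_set G\<close> and \<open>E_set G\<close> are not known to be complementary. The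
  answer Yes is sound on any \<open>G\<close>, since the nodes of \<open>E_set G\<close> support
  each other and yield a model. The answer No is moved to the set of all nodes by monotonicity of
  \<open>A_set\<close>, and complemented only there.

  The worlds of the model are state nodes, so runs of non-modal steps must be condensed. During such
  a run the focus may become empty and be refilled, which raises the rank. The condensed step
  therefore records an alternative: either the rank has not increased, or the old focus has been
  discharged and the new one accounts for the whole label. This alternative, in
  \<open>good_state\<close> and \<open>good_edge\<close>, carries the soundness proof.

  Deferrals are defined by arbitrary unfolding sequences, which are not tied to the input formula.
  The irreducibility of eventualities leads them back to occurrences inside it.\<close>

section \<open>Substitution\<close>

text \<open>Simultaneous substitution. Rules and deferrals iterate single substitutions without
  renaming; as long as nothing is captured, each such sequence becomes one \<open>psubst\<close>,
  which depends only on the values at free variables.\<close>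

primrec psubst :: "('v \<Rightarrow> ('p, 'a, 'v) fm) \<Rightarrow> ('p, 'a, 'v) fm \<Rightarrow> ('p, 'a, 'v) fm" where
  "psubst \<rho> Bot = Bot"
| "psubst \<rho> Top = Top"
| "psubst \<rho> (Prop p) = Prop p"
| "psubst \<rho> (NProp p) = NProp p"
| "psubst \<rho> (Var X) = \<rho> X"
| "psubst \<rho> (And \<psi> \<phi>) = And (psubst \<rho> \<psi>) (psubst \<rho> \<phi>)"
| "psubst \<rho> (Or \<psi> \<phi>) = Or (psubst \<rho> \<psi>) (psubst \<rho> \<phi>)"
| "psubst \<rho> (Dia a \<psi>) = Dia a (psubst \<rho> \<psi>)"
| "psubst \<rho> (Box a \<psi>) = Box a (psubst \<rho> \<psi>)"
| "psubst \<rho> (Fix \<eta> X \<psi>) = Fix \<eta> X (psubst (\<rho>(X := Var X)) \<psi>)"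

lemma psubst_cong: "(\<And>X. X \<in> FV \<alpha> \<Longrightarrow> \<rho> X = \<rho>' X) \<Longrightarrow> psubst \<rho> \<alpha> = psubst \<rho>' \<alpha>"
proof (induction \<alpha> arbitrary: \<rho> \<rho>')
  case (Fix \<eta> X \<psi>)
  have "psubst (\<rho>(X := Var X)) \<psi> = psubst (\<rho>'(X := Var X)) \<psi>"
    by (rule Fix.IH) (use Fix.prems in auto)
  then show ?case by simp
next
  case (And \<alpha>1 \<alpha>2)
  show ?case using And.IH[of \<rho> \<rho>'] And.prems by simp
next
  case (Or \<alpha>1 \<alpha>2)
  show ?case using Or.IH[of \<rho> \<rho>'] Or.prems by simp
next
  case (Dia a \<alpha>)
  show ?case using Dia.IH[of \<rho> \<rho>'] Dia.prems by simp
next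
  case (Box a \<alpha>)
  show ?case using Box.IH[of \<rho> \<rho>'] Box.prems by simp
qed simp_all

lemma psubst_Var [simp]: "psubst Var \<alpha> = \<alpha>"
proof (induction \<alpha>)
  case (Fix \<eta> X \<psi>)
  have "Var(X := Var X) = Var" by (rule fun_upd_triv)
  then show ?case using Fix by (simp del: fun_upd_apply)
qed simp_all

lemma psubst_closed: "closed_fm \<alpha> \<Longrightarrow> psubst \<rho> \<alpha> = \<alpha>"
  using psubst_cong[of \<alpha> \<rho> Var] by (simp add: closed_fm_def)

lemma subst_eq_psubst: "subst X \<chi> \<alpha> = psubst (Var(X := \<chi>)) \<alpha>"
proof (induction \<alpha>)
  case (Fix \<eta> Y \<psi>)
  show ?case
  proof (cases "Y = X")
    case True
    have "Var(X := \<chi>, X := Var X) = Var" by auto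
    then have "psubst (Var(X := \<chi>, X := Var X)) \<psi> = \<psi>" by simp
    then show ?thesis using True by (simp del: fun_upd_apply fun_upd_upd)
  next
    case False
    then have "Var(X := \<chi>, Y := Var Y) = Var(X := \<chi>)" by auto
    then show ?thesis using False Fix by (simp del: fun_upd_apply)
  qed
qed simp_all

text \<open>The premise rules out capture. Its exception \<open>Z \<noteq> X\<close> makes it stable
  under the induction: below a binder \<open>Z\<close> the updated substitution maps
  \<open>Z\<close> to \<open>Var Z\<close>, even if \<open>Z\<close> is bound once more further
  inside.\<close>

lemma psubst_psubst:
  assumes "\<And>X Z. X \<in> FV \<alpha> \<Longrightarrow> Z \<in> FV (\<rho> X) \<Longrightarrow> Z \<noteq> X \<Longrightarrow> Z \<notin> set (binders \<alpha>)"
  shows "psubst \<tau> (psubst \<rho> \<alpha>) = psubst (\<lambda>X. psubst \<tau> (\<rho> X)) \<alpha>"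
  using assms
proof (induction \<alpha> arbitrary: \<rho> \<tau>)
  case (Fix \<eta> Z \<psi>)
  have "psubst (\<tau>(Z := Var Z)) (psubst (\<rho>(Z := Var Z)) \<psi>) =
      psubst (\<lambda>X. psubst (\<tau>(Z := Var Z)) ((\<rho>(Z := Var Z)) X)) \<psi>"
  proof (rule Fix.IH)
    fix X Y assume "X \<in> FV \<psi>" "Y \<in> FV ((\<rho>(Z := Var Z)) X)" "Y \<noteq> X"
    then show "Y \<notin> set (binders \<psi>)" using Fix.prems[of X Y] by (auto split: if_splits)
  qed
  also have "\<dots> = psubst ((\<lambda>X. psubst \<tau> (\<rho> X))(Z := Var Z)) \<psi>"
  proof (rule psubst_cong)
    fix X assume X: "X \<in> FV \<psi>"
    show "psubst (\<tau>(Z := Var Z)) ((\<rho>(Z := Var Z)) X) = ((\<lambda>X. psubst \<tau> (\<rho> X))(Z := Var Z)) X"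
    proof (cases "X = Z")
      case False
      then have "Z \<notin> FV (\<rho> X)" using Fix.prems[of X Z] X by auto
      then have "psubst (\<tau>(Z := Var Z)) (\<rho> X) = psubst \<tau> (\<rho> X)"
        by (intro psubst_cong) auto
      then show ?thesis using False by simp
    qed simp
  qed
  finally show ?case by simp
next
  case (And \<alpha>1 \<alpha>2)
  have "psubst \<tau> (psubst \<rho> \<alpha>1) = psubst (\<lambda>X. psubst \<tau> (\<rho> X)) \<alpha>1"
    by (rule And.IH(1)) (use And.prems in auto)
  moreover have "psubst \<tau> (psubst \<rho> \<alpha>2) = psubst (\<lambda>X. psubst \<tau> (\<rho> X)) \<alpha>2"
    by (rule And.IH(2)) (use And.prems in auto)
  ultimately show ?case by simp
next
  case (Or \<alpha>1 \<alpha>2)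
  have "psubst \<tau> (psubst \<rho> \<alpha>1) = psubst (\<lambda>X. psubst \<tau> (\<rho> X)) \<alpha>1"
    by (rule Or.IH(1)) (use Or.prems in auto)
  moreover have "psubst \<tau> (psubst \<rho> \<alpha>2) = psubst (\<lambda>X. psubst \<tau> (\<rho> X)) \<alpha>2"
    by (rule Or.IH(2)) (use Or.prems in auto)
  ultimately show ?case by simp
next
  case (Dia a \<alpha>)
  have "psubst \<tau> (psubst \<rho> \<alpha>) = psubst (\<lambda>X. psubst \<tau> (\<rho> X)) \<alpha>"
    by (rule Dia.IH) (use Dia.prems in auto)
  then show ?case by simp
next
  case (Box a \<alpha>)
  have "psubst \<tau> (psubst \<rho> \<alpha>) = psubst (\<lambda>X. psubst \<tau> (\<rho> X)) \<alpha>"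
    by (rule Box.IH) (use Box.prems in auto)
  then show ?case by simp
qed simp_all

text \<open>With \<open>\<chi>\<close> the instance of \<open>Fix \<eta> X \<psi>\<close> under
  \<open>\<rho>\<close>, the left side is what the unfolding rule produces, and the right side is
  again an instance of the body. Closed values exclude capture.\<close>

lemma subst_psubst:
  assumes "\<And>Y. Y \<in> FV \<psi> \<Longrightarrow> Y \<noteq> X \<Longrightarrow> closed_fm (\<rho> Y)"
  shows "subst X \<chi> (psubst (\<rho>(X := Var X)) \<psi>) = psubst (\<rho>(X := \<chi>)) \<psi>"
proof -
  have "subst X \<chi> (psubst (\<rho>(X := Var X)) \<psi>)
      = psubst (\<lambda>Y. psubst (Var(X := \<chi>)) ((\<rho>(X := Var X)) Y)) \<psi>"
    unfolding subst_eq_psubst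
    by (rule psubst_psubst) (use assms in \<open>auto simp: closed_fm_def split: if_splits\<close>)
  also have "\<dots> = psubst (\<rho>(X := \<chi>)) \<psi>"
    by (rule psubst_cong) (use assms psubst_closed in auto)
  finally show ?thesis .
qed

lemma FV_psubst: "Y \<in> FV (psubst \<rho> \<alpha>) \<Longrightarrow> \<exists>X \<in> FV \<alpha>. Y \<in> FV (\<rho> X)"
proof (induction \<alpha> arbitrary: \<rho>)
  case (Fix \<eta> X \<psi>)
  then have "Y \<in> FV (psubst (\<rho>(X := Var X)) \<psi>)" "Y \<noteq> X" by auto
  then obtain Z where "Z \<in> FV \<psi>" "Y \<in> FV ((\<rho>(X := Var X)) Z)" using Fix.IH by blast
  then show ?case using \<open>Y \<noteq> X\<close> by (auto split: if_splits)
qed (auto; blast)+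

lemma closed_psubst: "(\<And>X. X \<in> FV \<alpha> \<Longrightarrow> closed_fm (\<rho> X)) \<Longrightarrow> closed_fm (psubst \<rho> \<alpha>)"
  using FV_psubst[of _ \<rho> \<alpha>] by (fastforce simp: closed_fm_def)

lemma unguarded_vars_subset_FV: "unguarded_vars \<alpha> \<subseteq> FV \<alpha>"
  by (induction \<alpha>) auto

text \<open>Taking all free variables of \<open>\<rho> X\<close> is crude but enough, because the
  environments of the closure have closed values.\<close>

lemma unguarded_vars_psubst:
  "Y \<in> unguarded_vars (psubst \<rho> \<alpha>) \<Longrightarrow> \<exists>X \<in> unguarded_vars \<alpha>. Y \<in> FV (\<rho> X)"
proof (induction \<alpha> arbitrary: \<rho>)
  case (Fix \<eta> X \<psi>)
  then have "Y \<in> unguarded_vars (psubst (\<rho>(X := Var X)) \<psi>)" "Y \<noteq> X" by auto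
  then obtain Z where "Z \<in> unguarded_vars \<psi>" "Y \<in> FV ((\<rho>(X := Var X)) Z)" using Fix.IH by blast
  then show ?case using \<open>Y \<noteq> X\<close> by (auto split: if_splits)
next
  case (Var X)
  then show ?case using unguarded_vars_subset_FV[of "\<rho> X"] by auto
qed (auto; blast)+

section \<open>Subformulas, binders, and sets closed under decomposition and unfolding\<close>

lemma subfms_refl [simp]: "\<alpha> \<in> subfms \<alpha>"
  by (cases \<alpha>) auto

lemma subfms_trans: "\<beta> \<in> subfms \<alpha> \<Longrightarrow> \<gamma> \<in> subfms \<beta> \<Longrightarrow> \<gamma> \<in> subfms \<alpha>"
  by (induction \<alpha>) auto

lemma fm_size_pos: "0 < fm_size \<alpha>"
  by (cases \<alpha>) auto

lemma fm_size_subfms: "\<beta> \<in> subfms \<alpha> \<Longrightarrow> \<beta> = \<alpha> \<or> fm_size \<beta> < fm_size \<alpha>"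
  by (induction \<alpha>) auto

lemma fm_size_subfms_le: "\<beta> \<in> subfms \<alpha> \<Longrightarrow> fm_size \<beta> \<le> fm_size \<alpha>"
  using fm_size_subfms by fastforce

lemma clean_subfms: "clean \<alpha> \<Longrightarrow> \<beta> \<in> subfms \<alpha> \<Longrightarrow> clean \<beta>"
  by (induction \<alpha>) (auto simp: clean_def)

lemma binders_subfms: "\<beta> \<in> subfms \<alpha> \<Longrightarrow> set (binders \<beta>) \<subseteq> set (binders \<alpha>)"
  by (induction \<alpha>) auto

lemma free_subfms_subset: "free_subfms \<alpha> \<subseteq> subfms \<alpha>"
  by (induction \<alpha>) auto

lemma free_subfms_refl [simp]: "\<alpha> \<in> free_subfms \<alpha>"
  by (cases \<alpha>) auto

lemma free_subfms_trans: "\<beta> \<in> free_subfms \<alpha> \<Longrightarrow> \<gamma> \<in> free_subfms \<beta> \<Longrightarrow> \<gamma> \<in> free_subfms \<alpha>"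
  by (induction \<alpha>) auto

lemma FV_free_subfms: "\<beta> \<in> free_subfms \<alpha> \<Longrightarrow> FV \<beta> \<subseteq> FV \<alpha>"
  by (induction \<alpha>) auto

lemma subfms_psubst: "X \<in> FV \<alpha> \<Longrightarrow> subfms (\<rho> X) \<subseteq> subfms (psubst \<rho> \<alpha>)"
proof (induction \<alpha> arbitrary: \<rho>)
  case (Fix \<eta> Y \<psi>)
  then have "subfms ((\<rho>(Y := Var Y)) X) \<subseteq> subfms (psubst (\<rho>(Y := Var Y)) \<psi>)"
    by (intro Fix.IH) simp
  then show ?case using Fix.prems by auto
qed fastforce+

text \<open>What lies below a fixpoint operator is reached only after unfolding, which instantiates
  the bound variable. Hence the induction speaks about an instance of \<open>\<alpha>\<close>, in
  which a closed \<open>\<beta>\<close> survives unchanged.\<close>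

lemma in_closed_under_subfms:
  assumes "\<And>\<psi> \<phi>. And \<psi> \<phi> \<in> S \<Longrightarrow> \<psi> \<in> S \<and> \<phi> \<in> S"
    and "\<And>\<psi> \<phi>. Or \<psi> \<phi> \<in> S \<Longrightarrow> \<psi> \<in> S \<and> \<phi> \<in> S"
    and "\<And>a \<psi>. Dia a \<psi> \<in> S \<Longrightarrow> \<psi> \<in> S"
    and "\<And>a \<psi>. Box a \<psi> \<in> S \<Longrightarrow> \<psi> \<in> S"
    and unf: "\<And>\<eta> X \<psi>. Fix \<eta> X \<psi> \<in> S \<Longrightarrow> subst X (Fix \<eta> X \<psi>) \<psi> \<in> S"
  shows "psubst \<rho> \<alpha> \<in> S \<Longrightarrow> (\<And>X. X \<in> FV \<alpha> \<Longrightarrow> closed_fm (\<rho> X)) \<Longrightarrow>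
    \<beta> \<in> subfms \<alpha> \<Longrightarrow> closed_fm \<beta> \<Longrightarrow> \<beta> \<in> S"
proof (induction \<alpha> arbitrary: \<rho>)
  case (Fix \<eta> X \<psi>)
  show ?case
  proof (cases "\<beta> = Fix \<eta> X \<psi>")
    case True
    then show ?thesis using Fix.prems(1,4) psubst_closed by metis
  next
    case False
    let ?\<chi> = "psubst \<rho> (Fix \<eta> X \<psi>)"
    have cl: "closed_fm ?\<chi>" using closed_psubst[of "Fix \<eta> X \<psi>" \<rho>] Fix.prems(2) by blast
    have "subst X ?\<chi> (psubst (\<rho>(X := Var X)) \<psi>) \<in> S"
      using unf[of \<eta> X "psubst (\<rho>(X := Var X)) \<psi>"] Fix.prems(1) by simp
    then have *: "psubst (\<rho>(X := ?\<chi>)) \<psi> \<in> S"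
      using subst_psubst[of \<psi> X \<rho> ?\<chi>] Fix.prems(2) by simp
    show ?thesis
    proof (rule Fix.IH[OF *])
      show "closed_fm ((\<rho>(X := ?\<chi>)) Y)" if "Y \<in> FV \<psi>" for Y
        using that cl Fix.prems(2) by simp
      show "\<beta> \<in> subfms \<psi>" using False Fix.prems(3) by simp
    qed (rule Fix.prems(4))
  qed
next
  case (And \<alpha>1 \<alpha>2)
  have *: "psubst \<rho> \<alpha>1 \<in> S" "psubst \<rho> \<alpha>2 \<in> S" using And.prems(1) assms(1)[of "psubst \<rho> \<alpha>1" "psubst \<rho> \<alpha>2"] by simp_all
  show ?case
    using And.IH(1)[OF *(1)] And.IH(2)[OF *(2)] And.prems psubst_closed
    by (metis FV.simps(6) UnCI UnE subfms.simps(6) singletonD)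
next
  case (Or \<alpha>1 \<alpha>2)
  have *: "psubst \<rho> \<alpha>1 \<in> S" "psubst \<rho> \<alpha>2 \<in> S" using Or.prems(1) assms(2)[of "psubst \<rho> \<alpha>1" "psubst \<rho> \<alpha>2"] by simp_all
  show ?case
    using Or.IH(1)[OF *(1)] Or.IH(2)[OF *(2)] Or.prems psubst_closed
    by (metis FV.simps(7) UnCI UnE subfms.simps(7) singletonD)
next
  case (Dia a \<alpha>)
  have *: "psubst \<rho> \<alpha> \<in> S" using Dia.prems(1) assms(3)[of a "psubst \<rho> \<alpha>"] by simp
  show ?case
    using Dia.IH[OF *] Dia.prems psubst_closed
    by (metis FV.simps(8) UnE subfms.simps(8) singletonD)
next
  case (Box a \<alpha>)
  have *: "psubst \<rho> \<alpha> \<in> S" using Box.prems(1) assms(4)[of a "psubst \<rho> \<alpha>"] by simp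
  show ?case
    using Box.IH[OF *] Box.prems psubst_closed
    by (metis FV.simps(9) UnE subfms.simps(9) singletonD)
qed (auto simp: closed_fm_def)

text \<open>The simultaneous substitution that amounts to applying the unfoldings of the list from
  left to right: the literal at the head, the innermost one, is itself instantiated by the
  rest.\<close>

primrec env :: "('p, 'a, 'v) fm list \<Rightarrow> 'v \<Rightarrow> ('p, 'a, 'v) fm" where
  "env [] = Var"
| "env (\<chi> # \<sigma>) = (case \<chi> of Fix \<eta> X \<psi> \<Rightarrow> (env \<sigma>)(X := psubst (env \<sigma>) \<chi>) | _ \<Rightarrow> env \<sigma>)"

lemma env_Fix [simp]:
  "env (Fix \<eta> X \<psi> # \<sigma>) = (env \<sigma>)(X := psubst (env \<sigma>) (Fix \<eta> X \<psi>))"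
  by (rule ext) simp

declare env.simps(2) [simp del]

text \<open>Binders shrink from the outside inwards, and no literal binds one of its own free
  variables. So a free variable of a substituted literal is never bound in the formula that receives
  it.\<close>

primrec capture_free :: "('p, 'a, 'v) fm list \<Rightarrow> ('p, 'a, 'v) fm \<Rightarrow> bool" where
  "capture_free [] \<alpha> \<longleftrightarrow> True"
| "capture_free (\<chi> # \<sigma>) \<alpha> \<longleftrightarrow> set (binders \<alpha>) \<subseteq> set (binders \<chi>) \<and>
     FV \<chi> \<inter> set (binders \<chi>) = {} \<and> capture_free \<sigma> \<chi>"

lemma capture_free_mono:
  "capture_free \<sigma> \<alpha> \<Longrightarrow> set (binders \<beta>) \<subseteq> set (binders \<alpha>) \<Longrightarrow> capture_free \<sigma> \<beta>"
  by (cases \<sigma>) auto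

lemma binders_subst: "set (binders (subst X \<chi> \<alpha>)) \<subseteq> set (binders \<alpha>) \<union> set (binders \<chi>)"
  by (induction \<alpha>) auto

text \<open>Substituting the innermost literal keeps all binders within those of that literal. The
  condition therefore persists for the rest of the list, and \<open>psubst_psubst\<close> fuses the
  two substitutions.\<close>

lemma apply_unfolding_eq_psubst:
  "capture_free \<sigma> \<alpha> \<Longrightarrow> \<forall>\<chi> \<in> set \<sigma>. \<exists>\<eta> X \<psi>. \<chi> = Fix \<eta> X \<psi> \<Longrightarrow>
   apply_unfolding \<sigma> \<alpha> = psubst (env \<sigma>) \<alpha>"
proof (induction \<sigma> arbitrary: \<alpha>)
  case (Cons \<chi> \<sigma>)
  obtain \<eta> X \<psi> where \<chi>: "\<chi> = Fix \<eta> X \<psi>" using Cons.prems by auto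
  have "set (binders (subst X \<chi> \<alpha>)) \<subseteq> set (binders \<chi>)"
    using binders_subst[of X \<chi> \<alpha>] Cons.prems by auto
  then have "capture_free \<sigma> (subst X \<chi> \<alpha>)"
    using Cons.prems(1) capture_free_mono by fastforce
  then have "apply_unfolding \<sigma> (subst X \<chi> \<alpha>) = psubst (env \<sigma>) (subst X \<chi> \<alpha>)"
    using Cons by auto
  also have "\<dots> = psubst (\<lambda>Y. psubst (env \<sigma>) ((Var(X := \<chi>)) Y)) \<alpha>"
    unfolding subst_eq_psubst
    by (rule psubst_psubst) (use Cons.prems in \<open>auto split: if_splits\<close>)
  also have "\<dots> = psubst (env (\<chi> # \<sigma>)) \<alpha>"
    by (rule psubst_cong) (auto simp: \<chi>)
  finally show ?case using \<chi> by (simp del: fun_upd_apply env_Fix)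
qed simp

section \<open>Fischer--Ladner closure\<close>

definition is_fix :: "('p, 'a, 'v) fm \<Rightarrow> bool" where
  "is_fix \<chi> \<longleftrightarrow> (\<exists>\<eta> X \<psi>. \<chi> = Fix \<eta> X \<psi>)"

definition bvars :: "('p, 'a, 'v) fm list \<Rightarrow> 'v set" where
  "bvars \<sigma> = {X. \<exists>\<eta> \<psi>. Fix \<eta> X \<psi> \<in> set \<sigma>}"

lemma bvars_simps [simp]: "bvars [] = {}" "bvars (Fix \<eta> X \<psi> # \<sigma>) = insert X (bvars \<sigma>)"
  by (auto simp: bvars_def)

text \<open>\<open>\<alpha>\<close> occurs in \<open>\<phi>\<close> below the fixpoint literals \<open>\<sigma>\<close> (innermost first). Only the literals up
  to the innermost closed one are recorded, since \<open>\<alpha>\<close> cannot refer to the outer ones.\<close>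

inductive occ :: "('p, 'a, 'v) fm \<Rightarrow> ('p, 'a, 'v) fm list \<Rightarrow> ('p, 'a, 'v) fm \<Rightarrow> bool"
  for \<phi> :: "('p, 'a, 'v) fm" where
  root: "occ \<phi> [] \<phi>"
| and1: "occ \<phi> \<sigma> (And \<alpha> \<beta>) \<Longrightarrow> occ \<phi> \<sigma> \<alpha>"
| and2: "occ \<phi> \<sigma> (And \<alpha> \<beta>) \<Longrightarrow> occ \<phi> \<sigma> \<beta>"
| or1: "occ \<phi> \<sigma> (Or \<alpha> \<beta>) \<Longrightarrow> occ \<phi> \<sigma> \<alpha>"
| or2: "occ \<phi> \<sigma> (Or \<alpha> \<beta>) \<Longrightarrow> occ \<phi> \<sigma> \<beta>"
| dia: "occ \<phi> \<sigma> (Dia a \<alpha>) \<Longrightarrow> occ \<phi> \<sigma> \<alpha>"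
| box: "occ \<phi> \<sigma> (Box a \<alpha>) \<Longrightarrow> occ \<phi> \<sigma> \<alpha>"
| fix_closed: "occ \<phi> \<sigma> (Fix \<eta> X \<alpha>) \<Longrightarrow> closed_fm (Fix \<eta> X \<alpha>) \<Longrightarrow> occ \<phi> [Fix \<eta> X \<alpha>] \<alpha>"
| fix_open: "occ \<phi> \<sigma> (Fix \<eta> X \<alpha>) \<Longrightarrow> \<not> closed_fm (Fix \<eta> X \<alpha>) \<Longrightarrow> occ \<phi> (Fix \<eta> X \<alpha> # \<sigma>) \<alpha>"

lemma occ_subfms: "occ \<phi> \<sigma> \<alpha> \<Longrightarrow> \<alpha> \<in> subfms \<phi> \<and> (\<forall>\<chi> \<in> set \<sigma>. \<chi> \<in> subfms \<phi> \<and> is_fix \<chi>)"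
proof (induction rule: occ.induct)
  case (fix_closed \<sigma> \<eta> X \<alpha>)
  then show ?case using subfms_trans[of "Fix \<eta> X \<alpha>" \<phi> \<alpha>] by (auto simp: is_fix_def)
next
  case (fix_open \<sigma> \<eta> X \<alpha>)
  then show ?case using subfms_trans[of "Fix \<eta> X \<alpha>" \<phi> \<alpha>] by (auto simp: is_fix_def)
qed (use subfms_trans in fastforce)+

lemma occ_FV: "closed_fm \<phi> \<Longrightarrow> occ \<phi> \<sigma> \<alpha> \<Longrightarrow> FV \<alpha> \<subseteq> bvars \<sigma>"
proof -
  assume "closed_fm \<phi>"
  show "occ \<phi> \<sigma> \<alpha> \<Longrightarrow> FV \<alpha> \<subseteq> bvars \<sigma>"
    by (induction rule: occ.induct) (use \<open>closed_fm \<phi>\<close> in \<open>auto simp: closed_fm_def\<close>)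
qed

text \<open>Since \<open>\<phi>\<close> is closed, an open literal always has recorded literals
  around it, so the record ends with a closed one.\<close>

lemma occ_last:
  "occ \<phi> \<sigma> \<alpha> \<Longrightarrow> closed_fm \<phi> \<Longrightarrow> \<sigma> \<noteq> [] \<Longrightarrow> closed_fm (last \<sigma>) \<and> is_fix (last \<sigma>) \<and> (\<exists>\<sigma>'. occ \<phi> \<sigma>' (last \<sigma>))"
proof (induction rule: occ.induct)
  case (fix_open \<sigma> \<eta> X \<alpha>)
  then have "\<sigma> \<noteq> []" using occ_FV[of \<phi> \<sigma> "Fix \<eta> X \<alpha>"] by (auto simp: closed_fm_def)
  then show ?case using fix_open by simp
qed (auto simp: is_fix_def)

definition fix_body :: "('p, 'a, 'v) fm \<Rightarrow> ('p, 'a, 'v) fm" where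
  "fix_body \<chi> = (case \<chi> of Fix \<eta> X \<psi> \<Rightarrow> \<psi> | _ \<Rightarrow> \<chi>)"

lemma fix_body_Fix [simp]: "fix_body (Fix \<eta> X \<psi>) = \<psi>"
  by (simp add: fix_body_def)

lemma occ_successively:
  "occ \<phi> \<sigma> \<alpha> \<Longrightarrow> closed_fm \<phi> \<Longrightarrow>
   successively (<\<^sub>f) \<sigma> \<and> (\<sigma> \<noteq> [] \<longrightarrow> is_fix (hd \<sigma>) \<and> \<alpha> \<in> free_subfms (fix_body (hd \<sigma>)))"
proof (induction rule: occ.induct)
  case (fix_open \<sigma> \<eta> X \<alpha>)
  then show ?case
    by (cases \<sigma>) (auto simp: is_fix_def lessf_def)
qed (use free_subfms_trans in \<open>fastforce simp: is_fix_def\<close>)+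

lemma occ_capture_free:
  "occ \<phi> \<sigma> \<alpha> \<Longrightarrow> clean \<phi> \<Longrightarrow> capture_free \<sigma> \<alpha>"
proof (induction rule: occ.induct)
  case (fix_closed \<sigma> \<eta> X \<alpha>)
  then show ?case by (auto simp: closed_fm_def)
next
  case (fix_open \<sigma> \<eta> X \<alpha>)
  have "clean (Fix \<eta> X \<alpha>)" using clean_subfms fix_open occ_subfms by blast
  then show ?case using fix_open by (auto simp: clean_def)
qed (auto intro: capture_free_mono)

lemma occ_free_subfms: "occ \<phi> \<sigma> \<alpha> \<Longrightarrow> \<beta> \<in> free_subfms \<alpha> \<Longrightarrow> occ \<phi> \<sigma> \<beta>"
  by (induction \<alpha>) (auto intro: occ.intros)

lemma occ_exists: "occ \<phi> \<sigma> \<alpha> \<Longrightarrow> \<beta> \<in> subfms \<alpha> \<Longrightarrow> \<exists>\<sigma>'. occ \<phi> \<sigma>' \<beta>"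
proof (induction \<alpha> arbitrary: \<sigma>)
  case (Fix \<eta> X \<psi>)
  then show ?case
    by (cases "closed_fm (Fix \<eta> X \<psi>)") (auto dest: occ.fix_closed occ.fix_open)
qed (auto; blast dest: occ.and1 occ.and2 occ.or1 occ.or2 occ.dia occ.box)+

lemma occ_apply_unfolding:
  "occ \<phi> \<sigma> \<alpha> \<Longrightarrow> clean \<phi> \<Longrightarrow> apply_unfolding \<sigma> \<alpha> = psubst (env \<sigma>) \<alpha>"
  using apply_unfolding_eq_psubst occ_capture_free occ_subfms unfolding is_fix_def by blast

text \<open>The value of a variable is the instance of the literal that binds it, taken at the
  literal's own occurrence. The conditional says where the chain of that occurrence ends: a closed
  literal is itself the end of \<open>\<sigma>\<close>, whereas an open one lies in a nonempty chain
  with the same end.\<close>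

lemma occ_env:
  "occ \<phi> \<sigma> \<alpha> \<Longrightarrow> closed_fm \<phi> \<Longrightarrow> X \<in> bvars \<sigma> \<Longrightarrow>
   \<exists>\<sigma>' \<eta> \<psi>. occ \<phi> \<sigma>' (Fix \<eta> X \<psi>) \<and> env \<sigma> X = psubst (env \<sigma>') (Fix \<eta> X \<psi>) \<and>
     (if closed_fm (Fix \<eta> X \<psi>) then last \<sigma> = Fix \<eta> X \<psi> else \<sigma>' \<noteq> [] \<and> last \<sigma>' = last \<sigma>) \<and>
     Fix \<eta> X \<psi> \<in> set \<sigma>"
proof (induction rule: occ.induct)
  case (fix_closed \<sigma> \<eta> Y \<alpha>)
  have "psubst (env \<sigma>) (Fix \<eta> Y \<alpha>) = Fix \<eta> Y \<alpha>" by (rule psubst_closed) fact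
  then show ?case
    using fix_closed
    by (intro exI[of _ \<sigma>] exI[of _ \<eta>] exI[of _ \<alpha>]) (auto simp del: psubst.simps)
next
  case (fix_open \<sigma> \<eta> Y \<alpha>)
  have ne: "\<sigma> \<noteq> []" using occ_FV[of \<phi> \<sigma> "Fix \<eta> Y \<alpha>"] fix_open by (auto simp: closed_fm_def)
  show ?case
  proof (cases "X = Y")
    case True
    then show ?thesis
      using fix_open ne
      by (intro exI[of _ \<sigma>] exI[of _ \<eta>] exI[of _ \<alpha>]) (auto simp del: psubst.simps)
  next
    case False
    then obtain \<sigma>' \<eta>' \<psi> where *: "occ \<phi> \<sigma>' (Fix \<eta>' X \<psi>)"
      "env \<sigma> X = psubst (env \<sigma>') (Fix \<eta>' X \<psi>)"
      "if closed_fm (Fix \<eta>' X \<psi>) then last \<sigma> = Fix \<eta>' X \<psi> else \<sigma>' \<noteq> [] \<and> last \<sigma>' = last \<sigma>"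
      "Fix \<eta>' X \<psi> \<in> set \<sigma>"
      using fix_open by auto
    show ?thesis
      using * False ne
      by (intro exI[of _ \<sigma>'] exI[of _ \<eta>'] exI[of _ \<psi>]) (auto simp del: psubst.simps)
  qed
qed auto

lemma occ_env_closed:
  assumes "closed_fm \<phi>"
  shows "occ \<phi> \<sigma> \<alpha> \<Longrightarrow> X \<in> bvars \<sigma> \<Longrightarrow> closed_fm (env \<sigma> X)"
proof (induction arbitrary: X rule: occ.induct)
  case (fix_closed \<sigma> \<eta> Y \<alpha>)
  have "X = Y" using fix_closed.prems by auto
  then show ?case using fix_closed.hyps by (simp del: psubst.simps)
next
  case (fix_open \<sigma> \<eta> Y \<alpha>)
  have "closed_fm (psubst (env \<sigma>) (Fix \<eta> Y \<alpha>))"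
    by (rule closed_psubst) (use fix_open occ_FV[OF assms] in blast)
  then show ?case using fix_open by (auto simp del: psubst.simps)
qed auto

section \<open>The closure as a set of instances, and its closure properties\<close>

definition FL :: "('p, 'a, 'v) fm \<Rightarrow> ('p, 'a, 'v) fm set" where
  "FL \<phi> = {psubst (env \<sigma>) \<alpha> |\<sigma> \<alpha>. occ \<phi> \<sigma> \<alpha>}"

lemma FL_root: "\<phi> \<in> FL \<phi>"
proof -
  have "psubst (env []) \<phi> = \<phi>" by simp
  then show ?thesis unfolding FL_def using occ.root[of \<phi>] by (metis (mono_tags, lifting) mem_Collect_eq)
qed

lemma occ_psubst_closed: "closed_fm \<phi> \<Longrightarrow> occ \<phi> \<sigma> \<alpha> \<Longrightarrow> closed_fm (psubst (env \<sigma>) \<alpha>)"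
  by (intro closed_psubst occ_env_closed) (auto dest: occ_FV)

lemma FL_closed: "closed_fm \<phi> \<Longrightarrow> x \<in> FL \<phi> \<Longrightarrow> closed_fm x"
  by (auto simp: FL_def intro: occ_psubst_closed)

text \<open>A variable occurrence hides the outermost connective of its instance. It is replaced by
  the occurrence of the literal that binds it, so that case analysis on \<open>\<alpha>\<close>
  mirrors case analysis on \<open>x\<close>.\<close>

lemma FL_non_Var:
  assumes "closed_fm \<phi>" "x \<in> FL \<phi>"
  obtains \<sigma> \<alpha> where "occ \<phi> \<sigma> \<alpha>" "x = psubst (env \<sigma>) \<alpha>" "\<And>X. \<alpha> \<noteq> Var X"
proof -
  obtain \<sigma> \<alpha> where *: "occ \<phi> \<sigma> \<alpha>" "x = psubst (env \<sigma>) \<alpha>" using assms FL_def by blast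
  show thesis
  proof (cases "\<exists>X. \<alpha> = Var X")
    case True
    then obtain X where "\<alpha> = Var X" by blast
    then show thesis
      using occ_env[OF *(1) assms(1), of X] occ_FV[OF assms(1) *(1)] *(2) that by auto
  qed (use * that in blast)
qed

text \<open>At a closed literal the enclosing literals are dropped from the chain. This leaves the
  instance of the body unchanged, as \<open>X\<close> is its only possible free variable.\<close>

lemma occ_unfold:
  assumes "closed_fm \<phi>" "occ \<phi> \<sigma> (Fix \<eta> X \<psi>)"
  obtains \<sigma>' where "occ \<phi> \<sigma>' \<psi>" "\<sigma>' = (if closed_fm (Fix \<eta> X \<psi>) then [Fix \<eta> X \<psi>] else Fix \<eta> X \<psi> # \<sigma>)"
    "subst X (psubst (env \<sigma>) (Fix \<eta> X \<psi>)) (psubst ((env \<sigma>)(X := Var X)) \<psi>) = psubst (env \<sigma>') \<psi>"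
proof -
  let ?\<chi> = "psubst (env \<sigma>) (Fix \<eta> X \<psi>)"
  have "closed_fm (env \<sigma> Y)" if "Y \<in> FV \<psi>" "Y \<noteq> X" for Y
    using that occ_FV[OF assms] occ_env_closed[OF assms] by auto
  then have *: "subst X ?\<chi> (psubst ((env \<sigma>)(X := Var X)) \<psi>) = psubst ((env \<sigma>)(X := ?\<chi>)) \<psi>"
    using subst_psubst[of \<psi> X "env \<sigma>" ?\<chi>] by blast
  show thesis
  proof (cases "closed_fm (Fix \<eta> X \<psi>)")
    case True
    have "FV \<psi> \<subseteq> {X}" using True by (auto simp: closed_fm_def)
    then have "psubst ((env \<sigma>)(X := ?\<chi>)) \<psi> = psubst (env [Fix \<eta> X \<psi>]) \<psi>"
      using psubst_closed[OF True] by (intro psubst_cong) (auto simp del: psubst.simps)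
    then show thesis using True * assms(2) occ.fix_closed by (intro that) auto
  next
    case False
    then show thesis using * assms(2) occ.fix_open by (intro that) auto
  qed
qed

lemma FL_And: "closed_fm \<phi> \<Longrightarrow> And x y \<in> FL \<phi> \<Longrightarrow> x \<in> FL \<phi> \<and> y \<in> FL \<phi>"
proof (erule FL_non_Var)
  fix \<sigma> \<alpha> assume "occ \<phi> \<sigma> \<alpha>" "And x y = psubst (env \<sigma>) \<alpha>" "\<And>X. \<alpha> \<noteq> Var X"
  then show ?thesis unfolding FL_def by (cases \<alpha>) (auto dest: occ.and1 occ.and2)
qed

lemma FL_Or: "closed_fm \<phi> \<Longrightarrow> Or x y \<in> FL \<phi> \<Longrightarrow> x \<in> FL \<phi> \<and> y \<in> FL \<phi>"
proof (erule FL_non_Var)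
  fix \<sigma> \<alpha> assume "occ \<phi> \<sigma> \<alpha>" "Or x y = psubst (env \<sigma>) \<alpha>" "\<And>X. \<alpha> \<noteq> Var X"
  then show ?thesis unfolding FL_def by (cases \<alpha>) (auto dest: occ.or1 occ.or2)
qed

lemma FL_Dia: "closed_fm \<phi> \<Longrightarrow> Dia a x \<in> FL \<phi> \<Longrightarrow> x \<in> FL \<phi>"
proof (erule FL_non_Var)
  fix \<sigma> \<alpha> assume "occ \<phi> \<sigma> \<alpha>" "Dia a x = psubst (env \<sigma>) \<alpha>" "\<And>X. \<alpha> \<noteq> Var X"
  then show ?thesis unfolding FL_def by (cases \<alpha>) (auto dest: occ.dia)
qed

lemma FL_Box: "closed_fm \<phi> \<Longrightarrow> Box a x \<in> FL \<phi> \<Longrightarrow> x \<in> FL \<phi>"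
proof (erule FL_non_Var)
  fix \<sigma> \<alpha> assume "occ \<phi> \<sigma> \<alpha>" "Box a x = psubst (env \<sigma>) \<alpha>" "\<And>X. \<alpha> \<noteq> Var X"
  then show ?thesis unfolding FL_def by (cases \<alpha>) (auto dest: occ.box)
qed

lemma FL_Fix:
  assumes "closed_fm \<phi>" "Fix \<eta> X x \<in> FL \<phi>"
  shows "subst X (Fix \<eta> X x) x \<in> FL \<phi>"
  using assms
proof (rule FL_non_Var)
  fix \<sigma> \<alpha> assume *: "occ \<phi> \<sigma> \<alpha>" "Fix \<eta> X x = psubst (env \<sigma>) \<alpha>" "\<And>X. \<alpha> \<noteq> Var X"
  then obtain \<psi> where \<alpha>: "\<alpha> = Fix \<eta> X \<psi>" "x = psubst ((env \<sigma>)(X := Var X)) \<psi>" by (cases \<alpha>) auto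
  then obtain \<sigma>' where "occ \<phi> \<sigma>' \<psi>"
    "subst X (psubst (env \<sigma>) (Fix \<eta> X \<psi>)) (psubst ((env \<sigma>)(X := Var X)) \<psi>) = psubst (env \<sigma>') \<psi>"
    using *(1) assms(1) occ_unfold by metis
  then show ?thesis unfolding FL_def using \<alpha> *(2) by auto
qed

text \<open>Guardedness passes to instances: the other variables are replaced by closed formulas,
  which bring no new free occurrence of \<open>X\<close>.\<close>

lemma FL_guarded:
  assumes "closed_fm \<phi>" "guarded \<phi>" "Fix \<eta> X x \<in> FL \<phi>"
  shows "X \<notin> unguarded_vars x"
  using assms(1,3)
proof (rule FL_non_Var)
  fix \<sigma> \<alpha> assume *: "occ \<phi> \<sigma> \<alpha>" "Fix \<eta> X x = psubst (env \<sigma>) \<alpha>" "\<And>X. \<alpha> \<noteq> Var X"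
  then obtain \<psi> where \<alpha>: "\<alpha> = Fix \<eta> X \<psi>" "x = psubst ((env \<sigma>)(X := Var X)) \<psi>" by (cases \<alpha>) auto
  have "Fix \<eta> X \<psi> \<in> subfms \<phi>" using occ_subfms *(1) \<alpha> by blast
  then have "X \<notin> unguarded_vars \<psi>" using assms(2) unfolding guarded_def by blast
  moreover have "closed_fm (env \<sigma> Y)" if "Y \<in> unguarded_vars \<psi>" "Y \<noteq> X" for Y
    using that unguarded_vars_subset_FV[of \<psi>] occ_FV[OF assms(1) *(1)]
      occ_env_closed[OF assms(1) *(1)] \<alpha>(1) by auto
  ultimately show ?thesis
    using unguarded_vars_psubst[of X "(env \<sigma>)(X := Var X)" \<psi>] \<alpha>(2)
    unfolding closed_fm_def by (metis emptyE fun_upd_other)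
qed

lemma FL_subfms:
  assumes "closed_fm \<phi>" "x \<in> FL \<phi>" "\<beta> \<in> subfms x" "closed_fm \<beta>"
  shows "\<beta> \<in> FL \<phi>"
proof (rule in_closed_under_subfms[where S = "FL \<phi>" and \<rho> = Var and \<alpha> = x])
  show "closed_fm (Var X)" if "X \<in> FV x" for X
    using that FL_closed[OF assms(1,2)] by (simp add: closed_fm_def)
  show "\<psi> \<in> FL \<phi>" if "Dia a \<psi> \<in> FL \<phi>" for a \<psi> by (rule FL_Dia[OF assms(1) that])
  show "\<psi> \<in> FL \<phi>" if "Box a \<psi> \<in> FL \<phi>" for a \<psi> by (rule FL_Box[OF assms(1) that])
  show "\<psi> \<in> FL \<phi> \<and> \<psi>' \<in> FL \<phi>" if "And \<psi> \<psi>' \<in> FL \<phi>" for \<psi> \<psi>' by (rule FL_And[OF assms(1) that])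
  show "\<psi> \<in> FL \<phi> \<and> \<psi>' \<in> FL \<phi>" if "Or \<psi> \<psi>' \<in> FL \<phi>" for \<psi> \<psi>' by (rule FL_Or[OF assms(1) that])
  show "subst X (Fix \<eta> X \<psi>) \<psi> \<in> FL \<phi>" if "Fix \<eta> X \<psi> \<in> FL \<phi>" for \<eta> X \<psi>
    by (rule FL_Fix[OF assms(1) that])
qed (simp_all add: assms)

section \<open>Irreducibility of closed clean formulas, by counting binders with
  multiplicity\<close>

lemma count_binders_subst:
  "count_list (binders \<alpha>) Z + (if X \<in> FV \<alpha> then count_list (binders \<chi>) Z else 0)
    \<le> count_list (binders (subst X \<chi> \<alpha>)) Z"
  by (induction \<alpha>) auto

lemma count_binders_apply_unfolding:
  "\<forall>\<chi> \<in> set \<tau>. is_fix \<chi> \<Longrightarrow>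
   count_list (binders \<alpha>) Z \<le> count_list (binders (apply_unfolding \<tau> \<alpha>)) Z"
proof (induction \<tau> arbitrary: \<alpha>)
  case (Cons \<chi> \<tau>)
  then obtain \<eta> X \<psi> where "\<chi> = Fix \<eta> X \<psi>" by (auto simp: is_fix_def)
  then show ?case
    using Cons.IH[of "subst X \<chi> \<alpha>"] Cons.prems count_binders_subst[of \<alpha> Z X \<chi>] by auto
qed simp

lemma subst_not_free: "X \<notin> FV \<alpha> \<Longrightarrow> subst X \<chi> \<alpha> = \<alpha>"
  by (induction \<alpha>) auto

text \<open>To close an open formula, some literal of the sequence must replace one of its free
  variables. At the first such literal both collections of binders are present, and later
  substitutions only add to them.\<close>

lemma binders_apply_unfolding_open:
  "\<forall>\<chi> \<in> set \<tau>. is_fix \<chi> \<Longrightarrow> \<not> closed_fm \<alpha> \<Longrightarrow> closed_fm (apply_unfolding \<tau> \<alpha>) \<Longrightarrow>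
   \<exists>\<chi> \<in> set \<tau>. \<forall>Z. count_list (binders \<alpha>) Z + count_list (binders \<chi>) Z
      \<le> count_list (binders (apply_unfolding \<tau> \<alpha>)) Z"
proof (induction \<tau> arbitrary: \<alpha>)
  case (Cons \<chi> \<tau>)
  then obtain \<eta> X \<psi> where \<chi>: "\<chi> = Fix \<eta> X \<psi>" by (auto simp: is_fix_def)
  show ?case
  proof (cases "X \<in> FV \<alpha>")
    case True
    have "count_list (binders \<alpha>) Z + count_list (binders \<chi>) Z
        \<le> count_list (binders (apply_unfolding (\<chi> # \<tau>) \<alpha>)) Z" for Z
      using count_binders_subst[of \<alpha> Z X \<chi>] True
        count_binders_apply_unfolding[of \<tau> "subst X \<chi> \<alpha>" Z] Cons.prems \<chi> by auto
    then show ?thesis by (intro bexI[of _ \<chi>]) auto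
  next
    case False
    then show ?thesis using Cons \<chi> subst_not_free by fastforce
  qed
qed simp

lemma successively_lessf_subfms:
  "successively (<\<^sub>f) (\<chi> # \<tau>) \<Longrightarrow> \<chi>' \<in> set (\<chi> # \<tau>) \<Longrightarrow> \<chi> \<in> subfms \<chi>'"
proof (induction \<tau> arbitrary: \<chi>)
  case (Cons \<chi>2 \<tau>)
  show ?case
  proof (cases "\<chi>' = \<chi>")
    case False
    then have "\<chi>2 \<in> subfms \<chi>'" using Cons by auto
    moreover have "\<chi> \<in> subfms \<chi>2"
      using Cons.prems free_subfms_subset by (fastforce simp: lessf_def)
    ultimately show ?thesis using subfms_trans by blast
  qed simp
qed simp

lemma count_list_distinct: "distinct xs \<Longrightarrow> count_list xs x \<le> 1"
  by (induction xs) (auto simp: count_list_0_iff)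

text \<open>An instance \<open>t\<close> of an open literal \<open>Fix \<eta> X \<psi>\<close> contains an outer literal in which \<open>Fix \<eta> X \<psi>\<close> is
  nested, so \<open>X\<close> would be bound twice in \<open>t\<close>.\<close>

lemma irreducible_closed_clean:
  assumes "closed_fm t" "clean t"
  shows "irreducible_fm t"
  unfolding irreducible_fm_def
proof (intro allI impI, elim conjE)
  fix \<chi>s :: "('a, 'b, 'c) fm list"
  assume u: "sequentially_unfolds \<chi>s" and t: "t = apply_unfolding (tl \<chi>s) (hd \<chi>s)"
  show "length \<chi>s = 1"
  proof (rule ccontr)
    assume "length \<chi>s \<noteq> 1"
    moreover have "\<chi>s \<noteq> []" using u by (simp add: sequentially_unfolds_def)
    ultimately obtain \<chi>1 \<chi>2 \<tau> where \<chi>s: "\<chi>s = \<chi>1 # \<chi>2 # \<tau>"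
      by (metis One_nat_def length_0_conv length_Cons neq_Nil_conv)
    have fx: "\<forall>\<chi> \<in> set \<chi>s. is_fix \<chi>" and s: "successively (<\<^sub>f) \<chi>s"
      using u by (auto simp: sequentially_unfolds_def is_fix_def)
    obtain \<eta> X \<psi> where \<chi>1: "\<chi>1 = Fix \<eta> X \<psi>" using fx \<chi>s by (auto simp: is_fix_def)
    have "\<not> closed_fm \<chi>1" using s \<chi>s by (auto simp: lessf_def)
    then obtain \<chi> where \<chi>: "\<chi> \<in> set (\<chi>2 # \<tau>)"
      "count_list (binders \<chi>1) X + count_list (binders \<chi>) X \<le> count_list (binders t) X"
      using binders_apply_unfolding_open[of "\<chi>2 # \<tau>" \<chi>1] fx \<chi>s t assms(1) by auto
    have "\<chi>1 \<in> subfms \<chi>" using successively_lessf_subfms[of \<chi>1 "\<chi>2 # \<tau>" \<chi>] s \<chi>s \<chi>(1) by simp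
    then have "X \<in> set (binders \<chi>)" using binders_subfms \<chi>1 by fastforce
    then have "count_list (binders \<chi>) X \<noteq> 0" using count_list_0_iff[of "binders \<chi>" X] by blast
    moreover have "count_list (binders \<chi>1) X \<ge> 1" by (simp add: \<chi>1)
    moreover have "count_list (binders t) X \<le> 1"
      using assms(2) count_list_distinct unfolding clean_def by metis
    ultimately show False using \<chi>(2) by linarith
  qed
qed

section \<open>Deferrals in the closure\<close>

definition Df :: "('p, 'a, 'v) fm \<Rightarrow> ('p, 'a, 'v) fm set" where
  "Df \<phi> = {psubst (env \<sigma>) \<alpha> |\<sigma> \<alpha>. occ \<phi> \<sigma> \<alpha> \<and> \<sigma> \<noteq> [] \<and>
     (\<exists>X \<psi>. last \<sigma> = Fix Mu X \<psi>) \<and> \<not> closed_fm \<alpha>}"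

lemma Df_subset_FL: "Df \<phi> \<subseteq> FL \<phi>"
  unfolding Df_def FL_def by blast

text \<open>The chain recorded by \<open>occ\<close> is itself the required unfolding sequence: its
  end is closed and, as a subformula of \<open>\<phi>\<close>, clean, hence irreducible.\<close>

lemma occ_belongs_to:
  assumes "closed_fm \<phi>" "clean \<phi>" "occ \<phi> \<sigma> \<alpha>" "\<sigma> \<noteq> []" "last \<sigma> = Fix Mu X \<psi>" "\<not> closed_fm \<alpha>"
  shows "belongs_to (psubst (env \<sigma>) \<alpha>) (last \<sigma>)"
  unfolding belongs_to_def
proof (intro exI conjI)
  have fx: "\<forall>\<chi> \<in> set \<sigma>. \<chi> \<in> subfms \<phi> \<and> is_fix \<chi>" using occ_subfms assms by blast
  have lc: "closed_fm (last \<sigma>)" using occ_last assms by blast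
  have cl: "clean (last \<sigma>)" using clean_subfms fx assms by (metis last_in_set)
  have s: "successively (<\<^sub>f) \<sigma>" "\<alpha> \<in> free_subfms (fix_body (hd \<sigma>))" "is_fix (hd \<sigma>)"
    using occ_successively assms by blast+
  show "sequentially_unfolds \<sigma>"
    unfolding sequentially_unfolds_def using assms fx cl s by (auto simp: is_fix_def)
  show "eventuality (last \<sigma>)"
    unfolding eventuality_def using lc cl assms irreducible_closed_clean by blast
  show "\<alpha> <\<^sub>f hd \<sigma>"
    using s assms by (auto simp: lessf_def is_fix_def)
  show "psubst (env \<sigma>) \<alpha> = apply_unfolding \<sigma> \<alpha>"
    using occ_apply_unfolding assms by metis
qed simp

section \<open>Chains of nested literals that are not known to occur in the input formula\<close>

lemma lessf_FV: "\<alpha> <\<^sub>f Fix \<eta> X \<psi> \<Longrightarrow> FV \<alpha> \<subseteq> insert X (FV (Fix \<eta> X \<psi>))"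
proof -
  assume "\<alpha> <\<^sub>f Fix \<eta> X \<psi>"
  then have "\<alpha> \<in> free_subfms \<psi>" by (auto simp: lessf_def)
  then have "FV \<alpha> \<subseteq> FV \<psi>" by (rule FV_free_subfms)
  then show ?thesis by auto
qed

lemma chain_FV:
  "\<sigma> \<noteq> [] \<Longrightarrow> \<forall>\<chi> \<in> set \<sigma>. is_fix \<chi> \<Longrightarrow> successively (<\<^sub>f) \<sigma> \<Longrightarrow> closed_fm (last \<sigma>) \<Longrightarrow>
   \<alpha> <\<^sub>f hd \<sigma> \<Longrightarrow> FV \<alpha> \<subseteq> bvars \<sigma>"
proof (induction \<sigma> arbitrary: \<alpha>)
  case (Cons \<chi> \<sigma>)
  then obtain \<eta> X \<psi> where \<chi>: "\<chi> = Fix \<eta> X \<psi>" by (auto simp: is_fix_def)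
  have "FV \<alpha> \<subseteq> insert X (FV \<chi>)" using lessf_FV Cons.prems \<chi> by fastforce
  moreover have "FV \<chi> \<subseteq> bvars \<sigma>"
  proof (cases \<sigma>)
    case Nil
    then show ?thesis using Cons.prems by (simp add: closed_fm_def)
  next
    case (Cons \<chi>' \<sigma>')
    then show ?thesis using Cons.IH[of \<chi>] Cons.prems by simp
  qed
  ultimately show ?case using \<chi> by auto
qed simp

text \<open>Every literal but the last is open and refers to an outer one. So its instance contains
  the instance of an outer literal and in the end the closed last literal.\<close>

lemma chain_env_subfms:
  "\<sigma> \<noteq> [] \<Longrightarrow> \<forall>\<chi> \<in> set \<sigma>. is_fix \<chi> \<Longrightarrow> successively (<\<^sub>f) \<sigma> \<Longrightarrow> closed_fm (last \<sigma>) \<Longrightarrow>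
   X \<in> bvars \<sigma> \<Longrightarrow> last \<sigma> \<in> subfms (env \<sigma> X)"
proof (induction \<sigma> arbitrary: X)
  case (Cons \<chi> \<sigma>)
  then obtain \<eta> Y \<psi> where \<chi>: "\<chi> = Fix \<eta> Y \<psi>" by (auto simp: is_fix_def)
  show ?case
  proof (cases \<sigma>)
    case Nil
    then show ?thesis using Cons.prems \<chi> by (simp del: psubst.simps)
  next
    case (Cons \<chi>' \<sigma>')
    have \<chi>o: "\<not> closed_fm \<chi>" "\<chi> <\<^sub>f hd \<sigma>"
      using Cons Cons.prems by (auto simp: lessf_def)
    have "FV \<chi> \<subseteq> bvars \<sigma>"
      using chain_FV[of \<sigma> \<chi>] Cons.prems \<chi>o Cons by auto
    then obtain Z where Z: "Z \<in> FV \<chi>" "Z \<in> bvars \<sigma>" using \<chi>o by (auto simp: closed_fm_def)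
    have IH: "last \<sigma> \<in> subfms (env \<sigma> W)" if "W \<in> bvars \<sigma>" for W
      using Cons.IH[of W] Cons.prems Cons that by auto
    have "last \<sigma> \<in> subfms (psubst (env \<sigma>) \<chi>)"
      using subfms_psubst[OF Z(1), of "env \<sigma>"] IH[OF Z(2)] by blast
    then show ?thesis
      using IH Cons.prems \<chi> Cons by (auto simp del: psubst.simps)
  qed
qed simp

lemma chain_capture_free:
  "\<sigma> \<noteq> [] \<Longrightarrow> \<forall>\<chi> \<in> set \<sigma>. is_fix \<chi> \<Longrightarrow> successively (<\<^sub>f) \<sigma> \<Longrightarrow> clean (last \<sigma>) \<Longrightarrow>
   \<alpha> <\<^sub>f hd \<sigma> \<Longrightarrow> capture_free \<sigma> \<alpha> \<and> clean (hd \<sigma>)"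
proof (induction \<sigma> arbitrary: \<alpha>)
  case (Cons \<chi> \<sigma>)
  have "clean \<chi> \<and> capture_free \<sigma> \<chi>"
  proof (cases \<sigma>)
    case Nil
    then show ?thesis using Cons.prems by simp
  next
    case (Cons \<chi>' \<sigma>')
    have "\<chi> <\<^sub>f hd \<sigma>" using Cons Cons.prems by simp
    moreover from this have "\<chi> \<in> subfms (hd \<sigma>)"
      using free_subfms_subset by (fastforce simp: lessf_def)
    ultimately show ?thesis using Cons.IH[of \<chi>] Cons.prems Cons clean_subfms by auto
  qed
  moreover have "set (binders \<alpha>) \<subseteq> set (binders \<chi>)"
  proof -
    have "\<alpha> \<in> subfms \<chi>" using Cons.prems free_subfms_subset by (fastforce simp: lessf_def)
    then show ?thesis by (rule binders_subfms)
  qed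
  ultimately show ?case by (auto simp: clean_def)
qed simp

text \<open>Converse of \<open>occ_successively\<close>: once the outermost literal is found in
  \<open>\<phi>\<close>, the nesting relation places the whole chain there.\<close>

lemma chain_occ:
  "\<sigma> \<noteq> [] \<Longrightarrow> \<forall>\<chi> \<in> set \<sigma>. is_fix \<chi> \<Longrightarrow> successively (<\<^sub>f) \<sigma> \<Longrightarrow> closed_fm (last \<sigma>) \<Longrightarrow>
   occ \<phi> \<tau> (last \<sigma>) \<Longrightarrow> \<alpha> \<in> free_subfms (fix_body (hd \<sigma>)) \<Longrightarrow> occ \<phi> \<sigma> \<alpha>"
proof (induction \<sigma> arbitrary: \<alpha>)
  case (Cons \<chi> \<sigma>)
  then obtain \<eta> Y \<psi> where \<chi>: "\<chi> = Fix \<eta> Y \<psi>" by (auto simp: is_fix_def)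
  have "occ \<phi> (\<chi> # \<sigma>) \<psi>"
  proof (cases \<sigma>)
    case Nil
    then show ?thesis using Cons.prems \<chi> occ.fix_closed by fastforce
  next
    case (Cons \<chi>' \<sigma>')
    have l: "\<chi> <\<^sub>f hd \<sigma>" using Cons Cons.prems by simp
    then have "\<chi> \<in> free_subfms (fix_body (hd \<sigma>))" "\<not> closed_fm \<chi>" by (auto simp: lessf_def)
    moreover from this have "occ \<phi> \<sigma> \<chi>" using Cons.IH[of \<chi>] Cons.prems Cons by auto
    ultimately show ?thesis using \<chi> occ.fix_open by fastforce
  qed
  then show ?case using occ_free_subfms Cons.prems(6) \<chi> by fastforce
qed simp

text \<open>The sequence behind \<open>belongs_to\<close> need not come from \<open>\<phi>\<close>.
  Its eventuality \<open>\<theta>\<close> is a closed subformula of \<open>x\<close>, hence in the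
  closure, that is, an instance of some \<open>\<beta>\<close> occurring in \<open>\<phi>\<close>.
  If \<open>\<beta>\<close> were open, \<open>\<theta>\<close> would arise by a proper unfolding and
  be reducible. So \<open>\<theta>\<close> itself occurs in \<open>\<phi>\<close>, and with it the
  whole sequence.\<close>

lemma belongs_to_Df:
  assumes \<phi>: "closed_fm \<phi>" "clean \<phi>" and x: "x \<in> FL \<phi>" and b: "belongs_to x \<theta>"
  shows "x \<in> Df \<phi>"
proof -
  obtain \<theta>s \<alpha> where u: "sequentially_unfolds \<theta>s" "last \<theta>s = \<theta>" "eventuality \<theta>"
    "\<alpha> <\<^sub>f hd \<theta>s" "x = apply_unfolding \<theta>s \<alpha>" using b unfolding belongs_to_def by blast
  have c: "\<theta>s \<noteq> []" "\<forall>\<chi> \<in> set \<theta>s. is_fix \<chi>" "successively (<\<^sub>f) \<theta>s" "closed_fm (last \<theta>s)" "clean (last \<theta>s)"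
    using u by (auto simp: sequentially_unfolds_def eventuality_def is_fix_def)
  have xe: "x = psubst (env \<theta>s) \<alpha>"
    using apply_unfolding_eq_psubst[of \<theta>s \<alpha>] chain_capture_free[OF c(1-3,5) u(4)] c u
    by (auto simp: is_fix_def)
  have \<alpha>o: "\<not> closed_fm \<alpha>" using u(4) by (auto simp: lessf_def)
  moreover have "FV \<alpha> \<subseteq> bvars \<theta>s" by (rule chain_FV) (use c u in auto)
  ultimately obtain Z where "Z \<in> FV \<alpha>" "Z \<in> bvars \<theta>s" by (auto simp: closed_fm_def)
  then have "\<theta> \<in> subfms x"
    using chain_env_subfms[of \<theta>s Z] c u(2) subfms_psubst[of Z \<alpha> "env \<theta>s"] xe by auto
  then have "\<theta> \<in> FL \<phi>" using FL_subfms \<phi> x c u by blast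
  from \<phi>(1) this obtain \<sigma> \<beta> where \<beta>: "occ \<phi> \<sigma> \<beta>" "\<theta> = psubst (env \<sigma>) \<beta>" "\<And>X. \<beta> \<noteq> Var X"
    by (rule FL_non_Var) blast
  obtain X t where t: "\<theta> = Fix Mu X t" using u(3) by (auto simp: eventuality_def)
  obtain \<psi> where \<psi>: "\<beta> = Fix Mu X \<psi>" using \<beta> t by (cases \<beta>) auto
  have "closed_fm \<beta>"
  proof (rule ccontr)
    assume o: "\<not> closed_fm \<beta>"
    then have ne: "\<sigma> \<noteq> []" using occ_FV[OF \<phi>(1) \<beta>(1)] by (auto simp: closed_fm_def)
    have o': "occ \<phi> (\<beta> # \<sigma>) \<psi>" using \<beta>(1) o \<psi> by (simp add: occ.fix_open)
    have "clean (last \<sigma>)" using ne \<beta>(1) occ_subfms clean_subfms \<phi>(2) by (metis last_in_set)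
    then have "sequentially_unfolds (\<beta> # \<sigma>)"
      using occ_successively[OF o' \<phi>(1)] occ_subfms[OF o'] ne
      by (auto simp: sequentially_unfolds_def is_fix_def)
    moreover have "\<theta> = apply_unfolding \<sigma> \<beta>" using occ_apply_unfolding \<beta> \<phi> by metis
    ultimately have "length (\<beta> # \<sigma>) = 1"
      using u(3) unfolding eventuality_def irreducible_fm_def by (metis list.sel(1) list.sel(3))
    then show False using ne by simp
  qed
  then have "occ \<phi> \<sigma> \<theta>" using \<beta> psubst_closed by metis
  then have "occ \<phi> \<theta>s \<alpha>"
    using chain_occ[of \<theta>s \<phi> \<sigma> \<alpha>] c u(2,4) by (auto simp: lessf_def)
  then show ?thesis unfolding Df_def using xe c(1) u(2) t \<alpha>o by blast
qed

lemma deferral_iff: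
  assumes "closed_fm \<phi>" "clean \<phi>" "x \<in> FL \<phi>"
  shows "(\<exists>\<theta>. belongs_to x \<theta>) \<longleftrightarrow> x \<in> Df \<phi>"
proof
  assume "x \<in> Df \<phi>"
  then obtain \<sigma> \<alpha> X \<psi> where "x = psubst (env \<sigma>) \<alpha>" "occ \<phi> \<sigma> \<alpha>" "\<sigma> \<noteq> []" "last \<sigma> = Fix Mu X \<psi>" "\<not> closed_fm \<alpha>"
    unfolding Df_def by blast
  then show "\<exists>\<theta>. belongs_to x \<theta>" using occ_belongs_to[OF assms(1,2)] by blast
qed (use belongs_to_Df[OF assms] in blast)

lemma deferrals_eq:
  assumes "closed_fm \<phi>" "clean \<phi>" "\<Gamma> \<subseteq> FL \<phi>"
  shows "deferrals \<Gamma> = \<Gamma> \<inter> Df \<phi>"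
proof -
  have "(\<exists>\<theta>. belongs_to x \<theta>) \<longleftrightarrow> x \<in> Df \<phi>" if "x \<in> \<Gamma>" for x
    using deferral_iff[OF assms(1,2)] assms(3) that by blast
  then show ?thesis unfolding deferrals_def by blast
qed

text \<open>Supplies the measure of the induction in \<open>Df_holds_Fin\<close>: a deferral is at
  least as large as the eventuality that it belongs to.\<close>

lemma Df_last_subfms:
  assumes "closed_fm \<phi>" "occ \<phi> \<sigma> \<alpha>" "\<sigma> \<noteq> []" "\<not> closed_fm \<alpha>"
  shows "last \<sigma> \<in> subfms (psubst (env \<sigma>) \<alpha>)"
proof -
  obtain Z where Z: "Z \<in> FV \<alpha>" "Z \<in> bvars \<sigma>" using occ_FV assms by (fastforce simp: closed_fm_def)
  then have "last \<sigma> \<in> subfms (env \<sigma> Z)"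
    using chain_env_subfms[of \<sigma> Z] assms occ_subfms occ_successively occ_last by blast
  then show ?thesis using subfms_psubst[OF Z(1)] by blast
qed

text \<open>There is one entry for each occurrence of a subformula; this bounds the size of the closure.\<close>

primrec FL_list :: "('p, 'a, 'v) fm \<Rightarrow> ('p, 'a, 'v) fm list \<Rightarrow> ('p, 'a, 'v) fm list" where
  "FL_list Bot \<sigma> = [Bot]"
| "FL_list Top \<sigma> = [Top]"
| "FL_list (Prop p) \<sigma> = [Prop p]"
| "FL_list (NProp p) \<sigma> = [NProp p]"
| "FL_list (Var X) \<sigma> = [env \<sigma> X]"
| "FL_list (And \<psi> \<phi>) \<sigma> = psubst (env \<sigma>) (And \<psi> \<phi>) # FL_list \<psi> \<sigma> @ FL_list \<phi> \<sigma>"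
| "FL_list (Or \<psi> \<phi>) \<sigma> = psubst (env \<sigma>) (Or \<psi> \<phi>) # FL_list \<psi> \<sigma> @ FL_list \<phi> \<sigma>"
| "FL_list (Dia a \<psi>) \<sigma> = psubst (env \<sigma>) (Dia a \<psi>) # FL_list \<psi> \<sigma>"
| "FL_list (Box a \<psi>) \<sigma> = psubst (env \<sigma>) (Box a \<psi>) # FL_list \<psi> \<sigma>"
| "FL_list (Fix \<eta> X \<psi>) \<sigma> = psubst (env \<sigma>) (Fix \<eta> X \<psi>) #
     FL_list \<psi> (if closed_fm (Fix \<eta> X \<psi>) then [Fix \<eta> X \<psi>] else Fix \<eta> X \<psi> # \<sigma>)"

lemma length_FL_list: "length (FL_list \<alpha> \<sigma>) = fm_size \<alpha>"
  by (induction \<alpha> arbitrary: \<sigma>) auto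

lemma psubst_in_FL_list: "psubst (env \<sigma>) \<alpha> \<in> set (FL_list \<alpha> \<sigma>)"
  by (cases \<alpha>) auto

lemma occ_FL_list: "occ \<phi> \<sigma> \<alpha> \<Longrightarrow> set (FL_list \<alpha> \<sigma>) \<subseteq> set (FL_list \<phi> [])"
  by (induction rule: occ.induct) auto

lemma FL_subset_FL_list: "FL \<phi> \<subseteq> set (FL_list \<phi> [])"
  using occ_FL_list psubst_in_FL_list by (fastforce simp: FL_def)

lemma finite_FL: "finite (FL \<phi>)"
  using FL_subset_FL_list finite_subset by blast

lemma card_FL: "card (FL \<phi>) \<le> fm_size \<phi>"
proof -
  have "card (FL \<phi>) \<le> card (set (FL_list \<phi> []))"
    using FL_subset_FL_list by (intro card_mono) auto
  also have "\<dots> \<le> fm_size \<phi>" using card_length length_FL_list by metis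
  finally show ?thesis .
qed

section \<open>Semantics\<close>

lemma sem_cong: "(\<And>X. X \<in> FV \<alpha> \<Longrightarrow> i X = j X) \<Longrightarrow> sem K \<alpha> i = sem K \<alpha> j"
proof (induction \<alpha> arbitrary: i j)
  case (And \<alpha>1 \<alpha>2)
  have "sem K \<alpha>1 i = sem K \<alpha>1 j" by (rule And.IH(1)) (use And.prems in simp)
  moreover have "sem K \<alpha>2 i = sem K \<alpha>2 j" by (rule And.IH(2)) (use And.prems in simp)
  ultimately show ?case by simp
next
  case (Or \<alpha>1 \<alpha>2)
  have "sem K \<alpha>1 i = sem K \<alpha>1 j" by (rule Or.IH(1)) (use Or.prems in simp)
  moreover have "sem K \<alpha>2 i = sem K \<alpha>2 j" by (rule Or.IH(2)) (use Or.prems in simp)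
  ultimately show ?case by simp
next
  case (Dia a \<alpha>)
  have "sem K \<alpha> i = sem K \<alpha> j" by (rule Dia.IH) (use Dia.prems in simp)
  then show ?case by simp
next
  case (Box a \<alpha>)
  have "sem K \<alpha> i = sem K \<alpha> j" by (rule Box.IH) (use Box.prems in simp)
  then show ?case by simp
next
  case (Fix \<eta> X \<psi>)
  have "sem K \<psi> (i(X := S)) = sem K \<psi> (j(X := S))" for S
    by (rule Fix.IH) (use Fix.prems in simp)
  then show ?case by (simp only: sem.simps)
qed simp_all

lemma sem_closed: "closed_fm \<alpha> \<Longrightarrow> sem K \<alpha> i = sem K \<alpha> j"
  by (rule sem_cong) (simp add: closed_fm_def)

lemma sem_mono: "(\<And>X. i X \<subseteq> j X) \<Longrightarrow> sem K \<alpha> i \<subseteq> sem K \<alpha> j"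
proof (induction \<alpha> arbitrary: i j)
  case (And \<alpha>1 \<alpha>2)
  have "sem K \<alpha>1 i \<subseteq> sem K \<alpha>1 j" "sem K \<alpha>2 i \<subseteq> sem K \<alpha>2 j"
    using And.IH And.prems by blast+
  then show ?case by auto
next
  case (Or \<alpha>1 \<alpha>2)
  have "sem K \<alpha>1 i \<subseteq> sem K \<alpha>1 j" "sem K \<alpha>2 i \<subseteq> sem K \<alpha>2 j"
    using Or.IH Or.prems by blast+
  then show ?case by auto
next
  case (Dia a \<alpha>)
  have "sem K \<alpha> i \<subseteq> sem K \<alpha> j" using Dia.IH Dia.prems by blast
  then show ?case by auto
next
  case (Box a \<alpha>)
  have "sem K \<alpha> i \<subseteq> sem K \<alpha> j" using Box.IH Box.prems by blast
  then show ?case by auto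
next
  case (Fix \<eta> X \<psi>)
  have "(i(X := S)) Y \<subseteq> (j(X := S)) Y" for S Y using Fix.prems by simp
  then have *: "states K \<inter> sem K \<psi> (i(X := S)) \<subseteq> states K \<inter> sem K \<psi> (j(X := S))" for S
    using Fix.IH[of "i(X := S)" "j(X := S)"] by blast
  show ?case
    using lfp_mono[of "\<lambda>S. states K \<inter> sem K \<psi> (i(X := S))"] gfp_mono[of "\<lambda>S. states K \<inter> sem K \<psi> (i(X := S))"] *
    by (cases \<eta>) auto
qed simp_all

lemma sem_mono_FV: "(\<And>X. X \<in> FV \<alpha> \<Longrightarrow> i X \<subseteq> j X) \<Longrightarrow> sem K \<alpha> i \<subseteq> sem K \<alpha> j"
proof -
  assume *: "\<And>X. X \<in> FV \<alpha> \<Longrightarrow> i X \<subseteq> j X"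
  have "sem K \<alpha> i = sem K \<alpha> (\<lambda>X. if X \<in> FV \<alpha> then i X else {})" by (rule sem_cong) simp
  also have "\<dots> \<subseteq> sem K \<alpha> j" by (rule sem_mono) (use * in auto)
  finally show ?thesis .
qed

lemma mono_sem_body: "mono (\<lambda>S. states K \<inter> sem K \<psi> (i(X := S)))"
proof (rule monoI)
  fix S T :: "'a set" assume "S \<subseteq> T"
  then have "sem K \<psi> (i(X := S)) \<subseteq> sem K \<psi> (i(X := T))" by (intro sem_mono) simp
  then show "states K \<inter> sem K \<psi> (i(X := S)) \<subseteq> states K \<inter> sem K \<psi> (i(X := T))" by blast
qed

lemma sem_Fix_unfold:
  "sem K (Fix \<eta> X \<psi>) i = states K \<inter> sem K \<psi> (i(X := sem K (Fix \<eta> X \<psi>) i))"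
  using lfp_unfold[OF mono_sem_body[of K \<psi> i X]] gfp_unfold[OF mono_sem_body[of K \<psi> i X]]
  by (cases \<eta>) (simp_all only: sem.simps fp.case)

text \<open>The alternative \<open>\<rho> Y = Var Y\<close> is for the induction: below a binder the
  bound variable is mapped to itself.\<close>

lemma sem_psubst:
  "(\<And>Y. Y \<in> FV \<alpha> \<Longrightarrow> \<rho> Y = Var Y \<or> closed_fm (\<rho> Y)) \<Longrightarrow>
   sem K (psubst \<rho> \<alpha>) i = sem K \<alpha> (\<lambda>X. sem K (\<rho> X) i)"
proof (induction \<alpha> arbitrary: \<rho> i)
  case (And \<alpha>1 \<alpha>2)
  have "sem K (psubst \<rho> \<alpha>1) i = sem K \<alpha>1 (\<lambda>X. sem K (\<rho> X) i)"
    by (rule And.IH(1)) (use And.prems in simp)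
  moreover have "sem K (psubst \<rho> \<alpha>2) i = sem K \<alpha>2 (\<lambda>X. sem K (\<rho> X) i)"
    by (rule And.IH(2)) (use And.prems in simp)
  ultimately show ?case by simp
next
  case (Or \<alpha>1 \<alpha>2)
  have "sem K (psubst \<rho> \<alpha>1) i = sem K \<alpha>1 (\<lambda>X. sem K (\<rho> X) i)"
    by (rule Or.IH(1)) (use Or.prems in simp)
  moreover have "sem K (psubst \<rho> \<alpha>2) i = sem K \<alpha>2 (\<lambda>X. sem K (\<rho> X) i)"
    by (rule Or.IH(2)) (use Or.prems in simp)
  ultimately show ?case by simp
next
  case (Dia a \<alpha>)
  have "sem K (psubst \<rho> \<alpha>) i = sem K \<alpha> (\<lambda>X. sem K (\<rho> X) i)"
    by (rule Dia.IH) (use Dia.prems in simp)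
  then show ?case by simp
next
  case (Box a \<alpha>)
  have "sem K (psubst \<rho> \<alpha>) i = sem K \<alpha> (\<lambda>X. sem K (\<rho> X) i)"
    by (rule Box.IH) (use Box.prems in simp)
  then show ?case by simp
next
  case (Fix \<eta> X \<psi>)
  have "sem K (psubst (\<rho>(X := Var X)) \<psi>) (i(X := S)) =
      sem K \<psi> ((\<lambda>X. sem K (\<rho> X) i)(X := S))" for S
  proof -
    have "sem K (psubst (\<rho>(X := Var X)) \<psi>) (i(X := S)) =
        sem K \<psi> (\<lambda>Y. sem K ((\<rho>(X := Var X)) Y) (i(X := S)))"
      by (rule Fix.IH) (use Fix.prems in simp)
    also have "\<dots> = sem K \<psi> ((\<lambda>X. sem K (\<rho> X) i)(X := S))"
    proof (rule sem_cong)
      fix Y assume "Y \<in> FV \<psi>"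
      then show "sem K ((\<rho>(X := Var X)) Y) (i(X := S)) = ((\<lambda>X. sem K (\<rho> X) i)(X := S)) Y"
        using Fix.prems[of Y] sem_closed[of "\<rho> Y" K "i(X := S)" i] by (cases "Y = X") auto
    qed
    finally show ?thesis .
  qed
  then show ?case by (simp only: sem.simps psubst.simps)
qed simp_all

lemma sem_psubst_closed:
  "(\<And>Y. Y \<in> FV \<alpha> \<Longrightarrow> closed_fm (\<rho> Y)) \<Longrightarrow> sem K (psubst \<rho> \<alpha>) i = sem K \<alpha> (\<lambda>X. sem K (\<rho> X) i)"
  by (rule sem_psubst) simp

lemma sem_unfold:
  assumes "closed_fm (Fix \<eta> X \<psi>)"
  shows "sem K (Fix \<eta> X \<psi>) i = states K \<inter> sem K (subst X (Fix \<eta> X \<psi>) \<psi>) i"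
proof -
  have "sem K (subst X (Fix \<eta> X \<psi>) \<psi>) i = sem K \<psi> (\<lambda>Y. sem K ((Var(X := Fix \<eta> X \<psi>)) Y) i)"
    unfolding subst_eq_psubst by (rule sem_psubst) (use assms in simp)
  also have "(\<lambda>Y. sem K ((Var(X := Fix \<eta> X \<psi>)) Y) i) = i(X := sem K (Fix \<eta> X \<psi>) i)"
    by (rule ext) (simp del: sem.simps(10))
  finally show ?thesis using sem_Fix_unfold by metis
qed

section \<open>Consequences of alternation freeness and irredundance\<close>

locale admissible =
  fixes \<phi> :: "('p, 'a, 'v) fm"
  assumes closed: "closed_fm \<phi>" and guarded: "guarded \<phi>" and clean: "clean \<phi>"
    and irredundant: "irredundant \<phi>" and alternation_free: "alternation_free \<phi>"
begin

lemma not_both_fp_vars: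
  "\<psi> \<in> subfms \<phi> \<Longrightarrow> X \<in> FV \<psi> \<Longrightarrow> Y \<in> FV \<psi> \<Longrightarrow> X \<in> fp_vars Mu \<phi> \<Longrightarrow> Y \<in> fp_vars Nu \<phi> \<Longrightarrow> False"
  using alternation_free unfolding alternation_free_def by blast

lemma Fix_subfms:
  "Fix \<eta> X \<psi> \<in> subfms \<phi> \<Longrightarrow> X \<in> FV \<psi> \<and> X \<in> fp_vars \<eta> \<phi> \<and> \<psi> \<in> subfms \<phi>"
  using irredundant subfms_trans[of "Fix \<eta> X \<psi>" \<phi> \<psi>]
  unfolding irredundant_def fp_vars_def by auto

text \<open>By irredundance \<open>X\<close> is free in \<open>\<psi>\<close> together with
  \<open>Y\<close>, and no subformula has free variables of both kinds.\<close>

lemma open_Fix_same: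
  assumes "Fix \<eta> X \<psi> \<in> subfms \<phi>" "Y \<in> FV (Fix \<eta> X \<psi>)" "Y \<in> fp_vars \<eta>' \<phi>"
  shows "\<eta> = \<eta>'"
  using not_both_fp_vars[of \<psi> X Y] not_both_fp_vars[of \<psi> Y X] Fix_subfms[OF assms(1)] assms(2,3)
  by (cases \<eta>; cases \<eta>') auto

text \<open>An open literal refers to an outer recorded one and so has its kind; thus the kind of
  the outermost literal spreads inwards.\<close>

lemma occ_bvars:
  "occ \<phi> \<sigma> \<alpha> \<Longrightarrow> \<sigma> \<noteq> [] \<Longrightarrow> last \<sigma> = Fix \<eta> X \<psi> \<Longrightarrow> bvars \<sigma> \<subseteq> fp_vars \<eta> \<phi>"
proof (induction rule: occ.induct)
  case (fix_closed \<sigma> \<eta>' Y \<alpha>)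
  then show ?case using occ_subfms Fix_subfms by fastforce
next
  case (fix_open \<sigma> \<eta>' Y \<alpha>)
  have s: "Fix \<eta>' Y \<alpha> \<in> subfms \<phi>" using fix_open occ_subfms by blast
  obtain Z where Z: "Z \<in> FV (Fix \<eta>' Y \<alpha>)" using fix_open by (auto simp: closed_fm_def)
  have b: "FV (Fix \<eta>' Y \<alpha>) \<subseteq> bvars \<sigma>" using occ_FV closed fix_open by blast
  then have "\<sigma> \<noteq> []" using Z by auto
  then have i: "bvars \<sigma> \<subseteq> fp_vars \<eta> \<phi>" using fix_open by simp
  then have "\<eta>' = \<eta>" using open_Fix_same[OF s Z] b Z by blast
  then show ?case using i Fix_subfms[OF s] by simp
qed auto

end

section \<open>Completeness\<close>

definition holds :: "('w, 'p, 'a) kripke \<Rightarrow> 'w \<Rightarrow> ('p, 'a, 'v) fm \<Rightarrow> bool" where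
  "holds K w \<psi> \<longleftrightarrow> w \<in> states K \<and> w \<in> sem K \<psi> (\<lambda>_. {})"

text \<open>Well-founded trees serve as ordinals: \<open>fin\<close> equips the truth of a formula with a derivation in
  which every least fixpoint is unfolded only finitely often along each branch, and which stops at
  formulas that are not deferrals.\<close>

datatype 'w rank = Leaf | Join "'w rank" "'w rank" | Branch "'w \<Rightarrow> 'w rank"

definition subrank :: "('w rank \<times> 'w rank) set" where
  "subrank = {(s, t). (\<exists>r. t = Join s r \<or> t = Join r s) \<or> (\<exists>f w. t = Branch f \<and> s = f w)}"

lemma wf_subrank: "wf (subrank :: ('w rank \<times> 'w rank) set)"
proof (rule wfUNIVI)
  fix P :: "'w rank \<Rightarrow> bool" and x :: "'w rank"
  assume *: "\<forall>t. (\<forall>s. (s, t) \<in> subrank \<longrightarrow> P s) \<longrightarrow> P t"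
  show "P x"
  proof (induction x)
    case Leaf
    have "\<forall>s. (s, Leaf) \<notin> subrank" by (simp add: subrank_def)
    then show ?case using * by blast
  next
    case (Join r s)
    have "\<forall>t. (t, Join r s) \<in> subrank \<longrightarrow> t = r \<or> t = s" by (auto simp: subrank_def)
    then show ?case using * Join by blast
  next
    case (Branch f)
    have "\<forall>t. (t, Branch f) \<in> subrank \<longrightarrow> t \<in> range f" by (auto simp: subrank_def)
    then show ?case using * Branch by blast
  qed
qed

inductive fin :: "('w, 'p, 'a) kripke \<Rightarrow> ('p, 'a, 'v) fm set \<Rightarrow> 'w \<Rightarrow> ('p, 'a, 'v) fm \<Rightarrow> 'w rank \<Rightarrow> bool"
  for K :: "('w, 'p, 'a) kripke" and D :: "('p, 'a, 'v) fm set" where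
  leaf: "\<delta> \<notin> D \<Longrightarrow> fin K D w \<delta> Leaf"
| conj: "fin K D w \<alpha> r \<Longrightarrow> fin K D w \<beta> s \<Longrightarrow> fin K D w (And \<alpha> \<beta>) (Join r s)"
| disj1: "fin K D w \<alpha> r \<Longrightarrow> holds K w \<alpha> \<Longrightarrow> fin K D w (Or \<alpha> \<beta>) (Join r r)"
| disj2: "fin K D w \<beta> r \<Longrightarrow> holds K w \<beta> \<Longrightarrow> fin K D w (Or \<alpha> \<beta>) (Join r r)"
| dia: "(w, v) \<in> trans_rel K a \<Longrightarrow> fin K D v \<alpha> r \<Longrightarrow> holds K v \<alpha> \<Longrightarrow> fin K D w (Dia a \<alpha>) (Join r r)"
| box: "(\<And>v. (w, v) \<in> trans_rel K a \<Longrightarrow> fin K D v \<alpha> (f v)) \<Longrightarrow> fin K D w (Box a \<alpha>) (Branch f)"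
| unf: "fin K D w (subst X (Fix \<eta> X \<alpha>) \<alpha>) r \<Longrightarrow> fin K D w (Fix \<eta> X \<alpha>) (Join r r)"

definition Fin :: "('w, 'p, 'a) kripke \<Rightarrow> ('p, 'a, 'v) fm set \<Rightarrow> ('p, 'a, 'v) fm \<Rightarrow> 'w set" where
  "Fin K D \<delta> = {w. holds K w \<delta> \<and> (\<exists>r. fin K D w \<delta> r)}"

lemma successively_lessf_last: "successively (<\<^sub>f) (\<chi> # \<tau>) \<Longrightarrow> \<tau> \<noteq> [] \<Longrightarrow> \<chi> \<in> subfms (last \<tau>)"
  by (rule successively_lessf_subfms) auto

context admissible
begin

text \<open>The states with a ranked derivation form a pre-fixpoint of the body of a least fixpoint,
  by \<open>fin.unf\<close>, and so include the least fixpoint. The free variables are least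
  fixpoint variables interpreted within \<open>Fin\<close>. Closed proper subformulas may contain
  greatest fixpoints and are left to a hypothesis.\<close>

lemma sem_subset_Fin_open:
  fixes K :: "('w, 'p, 'a) kripke"
  assumes K: "kripke_structure K"
  shows "\<alpha> \<in> subfms \<phi> \<Longrightarrow> \<not> closed_fm \<alpha> \<or> (\<exists>X \<psi>. \<alpha> = Fix Mu X \<psi>) \<Longrightarrow> FV \<alpha> \<subseteq> fp_vars Mu \<phi> \<Longrightarrow>
    (\<And>X. X \<in> FV \<alpha> \<Longrightarrow> closed_fm (\<rho> X) \<and> i X \<subseteq> Fin K (Df \<phi>) (\<rho> X)) \<Longrightarrow>
    (\<And>\<beta> w. \<beta> \<in> subfms \<alpha> \<Longrightarrow> \<beta> \<noteq> \<alpha> \<Longrightarrow> closed_fm \<beta> \<Longrightarrow> holds K w \<beta> \<Longrightarrow> w \<in> Fin K (Df \<phi>) \<beta>) \<Longrightarrow>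
    w \<in> states K \<Longrightarrow> w \<in> sem K \<alpha> i \<Longrightarrow> w \<in> Fin K (Df \<phi>) (psubst \<rho> \<alpha>)"
proof (induction "fm_size \<alpha>" arbitrary: \<alpha> \<rho> i w rule: less_induct)
  case less
  note prems = less.prems
  let ?D = "Df \<phi>"
  have hold: "holds K w (psubst \<rho> \<alpha>)"
  proof -
    have "sem K \<alpha> i \<subseteq> sem K \<alpha> (\<lambda>X. sem K (\<rho> X) (\<lambda>_. {}))"
      by (rule sem_mono_FV) (use prems(4) in \<open>fastforce simp: Fin_def holds_def\<close>)
    also have "\<dots> = sem K (psubst \<rho> \<alpha>) (\<lambda>_. {})"
      by (rule sem_psubst_closed[symmetric]) (use prems(4) in blast)
    finally show ?thesis using prems(6,7) by (auto simp: holds_def)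
  qed
  have sub: "v \<in> Fin K ?D (psubst \<rho> \<beta>)"
    if \<beta>: "\<beta> \<in> subfms \<alpha>" "fm_size \<beta> < fm_size \<alpha>" "FV \<beta> \<subseteq> FV \<alpha>" "v \<in> states K" "v \<in> sem K \<beta> i" for \<beta> v
  proof (cases "closed_fm \<beta>")
    case True
    have "holds K v \<beta>" using \<beta>(4,5) sem_closed[OF True, of K i "\<lambda>_. {}"] by (simp add: holds_def)
    moreover have "\<beta> \<noteq> \<alpha>" using \<beta>(2) by auto
    ultimately show ?thesis using prems(5)[OF \<beta>(1)] True psubst_closed[OF True] by metis
  next
    case False
    show ?thesis
    proof (rule less.hyps)
      show "\<beta> \<in> subfms \<phi>" using subfms_trans[OF prems(1) \<beta>(1)] .
      show "u \<in> Fin K ?D \<gamma>" if "\<gamma> \<in> subfms \<beta>" "\<gamma> \<noteq> \<beta>" "closed_fm \<gamma>" "holds K u \<gamma>" for \<gamma> u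
      proof (rule prems(5))
        show "\<gamma> \<in> subfms \<alpha>" using subfms_trans[OF \<beta>(1) that(1)] .
        show "\<gamma> \<noteq> \<alpha>" using fm_size_subfms_le[OF that(1)] \<beta>(2) by auto
      qed (use that in auto)
    qed (use False \<beta> prems in auto)
  qed
  have "\<exists>r. fin K ?D w (psubst \<rho> \<alpha>) r"
  proof (cases \<alpha>)
    case (Var X)
    then show ?thesis using prems(4,7) by (auto simp: Fin_def)
  next
    case (And \<alpha>1 \<alpha>2)
    then have "w \<in> Fin K ?D (psubst \<rho> \<alpha>1)" "w \<in> Fin K ?D (psubst \<rho> \<alpha>2)"
      using prems(6,7) by (auto intro!: sub)
    then show ?thesis using And fin.conj by (fastforce simp: Fin_def)
  next
    case (Or \<alpha>1 \<alpha>2)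
    then have "w \<in> Fin K ?D (psubst \<rho> \<alpha>1) \<or> w \<in> Fin K ?D (psubst \<rho> \<alpha>2)"
      using prems(6,7) sub[of \<alpha>1 w] sub[of \<alpha>2 w] by auto
    then show ?thesis using Or fin.disj1 fin.disj2 by (fastforce simp: Fin_def)
  next
    case (Dia a \<alpha>1)
    then obtain v where v: "(w, v) \<in> trans_rel K a" "v \<in> sem K \<alpha>1 i" using prems(7) by auto
    moreover have "v \<in> states K" using v(1) K by (auto simp: kripke_structure_def)
    ultimately have "v \<in> Fin K ?D (psubst \<rho> \<alpha>1)" using Dia by (intro sub) auto
    then show ?thesis using Dia v(1) fin.dia by (fastforce simp: Fin_def)
  next
    case (Box a \<alpha>1)
    have "v \<in> Fin K ?D (psubst \<rho> \<alpha>1)" if "(w, v) \<in> trans_rel K a" for v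
    proof (rule sub)
      show "v \<in> states K" using that K by (auto simp: kripke_structure_def)
      show "v \<in> sem K \<alpha>1 i" using prems(7) Box that by simp
    qed (use Box in auto)
    then have "\<forall>v. \<exists>r. (w, v) \<in> trans_rel K a \<longrightarrow> fin K ?D v (psubst \<rho> \<alpha>1) r" by (auto simp: Fin_def)
    then obtain f where "\<forall>v. (w, v) \<in> trans_rel K a \<longrightarrow> fin K ?D v (psubst \<rho> \<alpha>1) (f v)" by metis
    then show ?thesis using Box fin.box by fastforce
  next
    case (Fix \<eta> X \<psi>)
    note s = Fix_subfms[OF prems(1)[unfolded Fix]]
    have \<eta>: "\<eta> = Mu"
    proof (cases "closed_fm \<alpha>")
      case True
      then show ?thesis using prems(2) Fix by auto
    next
      case False
      then show ?thesis
        using open_Fix_same[OF prems(1)[unfolded Fix], of _ Mu] prems(3) Fix by (auto simp: closed_fm_def)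
    qed
    let ?\<chi> = "psubst \<rho> \<alpha>"
    have \<chi>: "?\<chi> = Fix Mu X (psubst (\<rho>(X := Var X)) \<psi>)" using Fix \<eta> by simp
    have c\<chi>: "closed_fm ?\<chi>" by (rule closed_psubst) (use prems(4) in blast)
    have unf: "subst X ?\<chi> (psubst (\<rho>(X := Var X)) \<psi>) = psubst (\<rho>(X := ?\<chi>)) \<psi>"
      by (rule subst_psubst) (use prems(4) Fix in auto)
    have "lfp (\<lambda>S. states K \<inter> sem K \<psi> (i(X := S))) \<subseteq> Fin K ?D ?\<chi>"
    proof (rule lfp_lowerbound, rule subsetI)
      fix v assume v: "v \<in> states K \<inter> sem K \<psi> (i(X := Fin K ?D ?\<chi>))"
      have "v \<in> Fin K ?D (psubst (\<rho>(X := ?\<chi>)) \<psi>)"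
      proof (rule less.hyps[where i = "i(X := Fin K ?D ?\<chi>)"])
        show "v \<in> sem K \<psi> (i(X := Fin K ?D ?\<chi>))" using v by (rule IntD2)
        show "\<not> closed_fm \<psi> \<or> (\<exists>X' \<psi>'. \<psi> = Fix Mu X' \<psi>')" using s by (auto simp: closed_fm_def)
        show "FV \<psi> \<subseteq> fp_vars Mu \<phi>" using prems(3) s \<eta> Fix by auto
        show "closed_fm ((\<rho>(X := ?\<chi>)) Y) \<and> (i(X := Fin K ?D ?\<chi>)) Y \<subseteq> Fin K ?D ((\<rho>(X := ?\<chi>)) Y)"
          if "Y \<in> FV \<psi>" for Y using that prems(4) Fix c\<chi> by auto
        show "u \<in> Fin K ?D \<gamma>" if "\<gamma> \<in> subfms \<psi>" "\<gamma> \<noteq> \<psi>" "closed_fm \<gamma>" "holds K u \<gamma>" for \<gamma> u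
        proof (rule prems(5))
          show "\<gamma> \<in> subfms \<alpha>" using Fix that(1) by simp
          show "\<gamma> \<noteq> \<alpha>" using fm_size_subfms_le[OF that(1)] Fix by auto
        qed (use that in auto)
      qed (use Fix s v in auto)
      then have "holds K v (subst X ?\<chi> (psubst (\<rho>(X := Var X)) \<psi>))"
        "\<exists>r. fin K ?D v (subst X ?\<chi> (psubst (\<rho>(X := Var X)) \<psi>)) r"
        unfolding unf by (auto simp: Fin_def)
      note unfolded = this[unfolded \<chi>]
      have "holds K v ?\<chi>"
        using unfolded(1) sem_unfold[OF c\<chi>[unfolded \<chi>], of K "\<lambda>_. {}"] unfolding \<chi> holds_def by blast
      moreover have "\<exists>r. fin K ?D v ?\<chi> r"
        using unfolded(2) unfolding \<chi> by (blast intro: fin.unf)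
      ultimately show "v \<in> Fin K ?D ?\<chi>" by (simp add: Fin_def)
    qed
    then show ?thesis using prems(7) Fix \<eta> by (auto simp: Fin_def)
  qed (use prems(2) in \<open>auto simp: closed_fm_def\<close>)
  then show ?case using hold by (simp add: Fin_def)
qed

text \<open>Induction on the size of the eventuality. A closed proper subformula either is no
  deferral, hence a leaf of the derivation, or belongs to a smaller eventuality. This discharges the
  hypothesis on closed subformulas in \<open>sem_subset_Fin_open\<close>.\<close>

lemma Df_holds_Fin:
  assumes K: "kripke_structure K"
  shows "occ \<phi> \<sigma> \<alpha> \<Longrightarrow> \<sigma> \<noteq> [] \<Longrightarrow> last \<sigma> = Fix Mu X \<psi> \<Longrightarrow> \<not> closed_fm \<alpha> \<Longrightarrow>
    holds K w (psubst (env \<sigma>) \<alpha>) \<Longrightarrow> w \<in> Fin K (Df \<phi>) (psubst (env \<sigma>) \<alpha>)"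
proof (induction "fm_size (last \<sigma>)" arbitrary: \<sigma> \<alpha> X \<psi> w rule: less_induct)
  case less
  let ?D = "Df \<phi>" and ?s = "\<lambda>\<sigma> X. sem K (env \<sigma> X) (\<lambda>_. {})"
  let ?\<theta> = "Fix Mu X \<psi>"
  obtain \<tau> where \<theta>: "occ \<phi> \<tau> ?\<theta>" "closed_fm ?\<theta>" using occ_last[OF less.prems(1) closed less.prems(2)] less.prems(3) by auto
  have small: "v \<in> Fin K ?D \<beta>" if b: "closed_fm \<beta>" "occ \<phi> \<tau>' \<beta>" "fm_size \<beta> < fm_size ?\<theta>" "holds K v \<beta>" for \<beta> \<tau>' v
  proof (cases "\<beta> \<in> ?D")
    case True
    then obtain \<sigma>' \<alpha>' X' \<psi>' where d: "\<beta> = psubst (env \<sigma>') \<alpha>'" "occ \<phi> \<sigma>' \<alpha>'" "\<sigma>' \<noteq> []"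
      "last \<sigma>' = Fix Mu X' \<psi>'" "\<not> closed_fm \<alpha>'" unfolding Df_def by blast
    have "fm_size (last \<sigma>') \<le> fm_size \<beta>"
      using Df_last_subfms[OF closed d(2,3,5)] d(1) fm_size_subfms_le by metis
    then have "fm_size (last \<sigma>') < fm_size (last \<sigma>)" using b(3) less.prems(3) by simp
    then show ?thesis using less.hyps[OF _ d(2-5)] b(4) d(1) by blast
  next
    case False
    then show ?thesis using b(4) fin.leaf by (fastforce simp: Fin_def)
  qed
  have smallsub: "v \<in> Fin K ?D \<beta>"
    if "occ \<phi> \<tau>' \<gamma>" "fm_size \<gamma> \<le> fm_size ?\<theta>" "\<beta> \<in> subfms \<gamma>" "\<beta> \<noteq> \<gamma>" "closed_fm \<beta>" "holds K v \<beta>" for \<gamma> \<beta> \<tau>' v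
  proof -
    have "fm_size \<beta> < fm_size ?\<theta>" using fm_size_subfms that(2-4) by fastforce
    then show ?thesis using small occ_exists[OF that(1,3)] that(5,6) by blast
  qed
  have inst: "v \<in> Fin K ?D (psubst (env \<sigma>') \<gamma>)"
    if g: "occ \<phi> \<sigma>' \<gamma>" "\<gamma> = ?\<theta> \<or> \<sigma>' \<noteq> [] \<and> last \<sigma>' = ?\<theta> \<and> \<not> closed_fm \<gamma>"
      "\<forall>Y \<in> FV \<gamma>. ?s \<sigma>' Y \<inter> states K \<subseteq> Fin K ?D (env \<sigma>' Y)" "holds K v (psubst (env \<sigma>') \<gamma>)"
      "fm_size \<gamma> \<le> fm_size ?\<theta>" for \<sigma>' \<gamma> v
  proof (rule sem_subset_Fin_open[OF K, where i = "\<lambda>X. ?s \<sigma>' X \<inter> states K"])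
    show "\<gamma> \<in> subfms \<phi>" using occ_subfms[OF g(1)] by blast
    show "FV \<gamma> \<subseteq> fp_vars Mu \<phi>"
      using g(2) \<theta>(2) occ_FV[OF closed g(1)] occ_bvars[OF g(1)] unfolding closed_fm_def by blast
    show "closed_fm (env \<sigma>' Y) \<and> ?s \<sigma>' Y \<inter> states K \<subseteq> Fin K ?D (env \<sigma>' Y)" if "Y \<in> FV \<gamma>" for Y
      using occ_env_closed[OF closed g(1)] occ_FV[OF closed g(1)] g(3) that by blast
    show "u \<in> Fin K ?D \<beta>" if "\<beta> \<in> subfms \<gamma>" "\<beta> \<noteq> \<gamma>" "closed_fm \<beta>" "holds K u \<beta>" for \<beta> u
      using smallsub[OF g(1,5) that] .
    show "v \<in> states K" using g(4) by (simp add: holds_def)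
    have "sem K (psubst (env \<sigma>') \<gamma>) (\<lambda>_. {}) = sem K \<gamma> (?s \<sigma>')"
      by (rule sem_psubst_closed) (use occ_env_closed[OF closed g(1)] occ_FV[OF closed g(1)] in blast)
    \<comment> \<open>Values of the environment are semantics of fixpoint literals and so sets of
      states; cutting them down to \<open>states K\<close> loses nothing.\<close>
    also have "sem K \<gamma> (?s \<sigma>') \<subseteq> sem K \<gamma> (\<lambda>X. ?s \<sigma>' X \<inter> states K)"
    proof (rule sem_mono_FV)
      fix Y assume "Y \<in> FV \<gamma>"
      then obtain \<sigma>2 \<eta> \<chi> where "env \<sigma>' Y = psubst (env \<sigma>2) (Fix \<eta> Y \<chi>)"
        using occ_env[OF g(1) closed, of Y] occ_FV[OF closed g(1)] by blast
      then have "env \<sigma>' Y = Fix \<eta> Y (psubst ((env \<sigma>2)(Y := Var Y)) \<chi>)" by simp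
      then have "?s \<sigma>' Y \<subseteq> states K"
        using sem_Fix_unfold by (metis Int_lower1)
      then show "?s \<sigma>' Y \<subseteq> ?s \<sigma>' Y \<inter> states K" by blast
    qed
    finally show "v \<in> sem K \<gamma> (\<lambda>X. ?s \<sigma>' X \<inter> states K)" using g(4) by (auto simp: holds_def)
    show "\<not> closed_fm \<gamma> \<or> (\<exists>X \<psi>. \<gamma> = Fix Mu X \<psi>)" using g(2) by blast
  qed
  \<comment> \<open>From the outermost literal inwards: once the outer variables are interpreted
    within \<open>Fin\<close>, so is the next one, whose value is the instance of a literal over
    them.\<close>
  have env: "occ \<phi> \<sigma>' \<gamma> \<Longrightarrow> \<sigma>' \<noteq> [] \<Longrightarrow> last \<sigma>' = ?\<theta> \<Longrightarrow> Y \<in> bvars \<sigma>' \<Longrightarrow>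
      holds K v (env \<sigma>' Y) \<Longrightarrow> v \<in> Fin K ?D (env \<sigma>' Y)" for \<sigma>' \<gamma> Y v
  proof (induction arbitrary: Y v rule: occ.induct)
    case (fix_closed \<sigma>' \<eta> Z \<gamma>)
    have e: "\<eta> = Mu" "Z = X" "\<gamma> = \<psi>" "Y = X" using fix_closed by auto
    have c: "psubst (env \<sigma>') ?\<theta> = ?\<theta>" by (rule psubst_closed) (rule \<theta>(2))
    have "env [Fix \<eta> Z \<gamma>] Y = ?\<theta>" by (simp add: e del: psubst.simps)
    moreover have "v \<in> Fin K ?D (psubst (env \<sigma>') ?\<theta>)"
      by (rule inst) (use fix_closed e \<theta>(2) c calculation in \<open>auto simp: closed_fm_def simp del: psubst.simps\<close>)
    ultimately show ?case using c e by simp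
  next
    case (fix_open \<sigma>' \<eta> Z \<gamma>)
    have b: "FV (Fix \<eta> Z \<gamma>) \<subseteq> bvars \<sigma>'" by (rule occ_FV[OF closed fix_open.hyps(1)])
    then have ne: "\<sigma>' \<noteq> []" using fix_open.hyps(2) by (auto simp: closed_fm_def)
    then have "last \<sigma>' = ?\<theta>" using fix_open.prems(2) by simp
    note ne = ne this
    obtain W where W: "W \<in> bvars \<sigma>'" using b fix_open.hyps(2) by (auto simp: closed_fm_def)
    have cW: "closed_fm (env \<sigma>' Y)" if "Y \<in> bvars \<sigma>'" for Y
      using occ_env_closed[OF closed fix_open.hyps(1) that] .
    have sz: "fm_size (Fix \<eta> Z \<gamma>) \<le> fm_size ?\<theta>"
    proof -
      have "Fix \<eta> Z \<gamma> \<in> subfms (last \<sigma>')"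
        using successively_lessf_last occ_successively[OF occ.fix_open[OF fix_open.hyps] closed] ne(1)
        by blast
      then show ?thesis using fm_size_subfms_le ne by metis
    qed
    have IH: "?s \<sigma>' Y \<inter> states K \<subseteq> Fin K ?D (env \<sigma>' Y)" if "Y \<in> bvars \<sigma>'" for Y
      using fix_open.IH[OF ne that] by (auto simp: holds_def)
    show ?case
    proof (cases "Y = Z")
      case True
      have "v \<in> Fin K ?D (psubst (env \<sigma>') (Fix \<eta> Z \<gamma>))"
      proof (rule inst)
        show "\<forall>Y \<in> FV (Fix \<eta> Z \<gamma>). ?s \<sigma>' Y \<inter> states K \<subseteq> Fin K ?D (env \<sigma>' Y)" using IH b by blast
        show "holds K v (psubst (env \<sigma>') (Fix \<eta> Z \<gamma>))"
          using fix_open.prems(4) True by (simp del: psubst.simps)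
      qed (use fix_open.hyps ne sz in blast)+
      then show ?thesis using True by simp
    next
      case False
      then show ?thesis using fix_open.prems fix_open.IH[OF ne, of Y v] by auto
    qed
  qed auto
  have sz\<alpha>: "fm_size \<alpha> \<le> fm_size ?\<theta>"
  proof -
    have *: "successively (<\<^sub>f) \<sigma>" "\<alpha> \<in> free_subfms (fix_body (hd \<sigma>))" "is_fix (hd \<sigma>)"
      using occ_successively[OF less.prems(1) closed] less.prems(2) by blast+
    then have "\<alpha> <\<^sub>f hd \<sigma>" using less.prems(4) by (auto simp: lessf_def is_fix_def)
    then have "successively (<\<^sub>f) (\<alpha> # \<sigma>)" using *(1) less.prems(2) by (cases \<sigma>) auto
    then have "\<alpha> \<in> subfms (last \<sigma>)"
      using successively_lessf_last less.prems(2) by blast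
    then show ?thesis using fm_size_subfms_le less.prems(3) by metis
  qed
  show ?case
  proof (rule inst[OF less.prems(1) _ _ less.prems(5) sz\<alpha>])
    show "\<forall>Y \<in> FV \<alpha>. ?s \<sigma> Y \<inter> states K \<subseteq> Fin K ?D (env \<sigma> Y)"
      using env[OF less.prems(1-3)] occ_FV[OF closed less.prems(1)] by (auto simp: holds_def)
  qed (use less.prems in blast)
qed

lemma holds_Fin:
  assumes "kripke_structure K" "holds K w \<delta>"
  shows "w \<in> Fin K (Df \<phi>) \<delta>"
proof (cases "\<delta> \<in> Df \<phi>")
  case True
  then obtain \<sigma>' \<alpha>' X' \<psi>' where d: "\<delta> = psubst (env \<sigma>') \<alpha>'" "occ \<phi> \<sigma>' \<alpha>'" "\<sigma>' \<noteq> []"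
    "last \<sigma>' = Fix Mu X' \<psi>'" "\<not> closed_fm \<alpha>'" unfolding Df_def by blast
  show ?thesis using Df_holds_Fin[OF assms(1) d(2-5)] assms(2) d(1) by blast
next
  case False
  then show ?thesis using assms(2) fin.leaf by (fastforce simp: Fin_def)
qed

end

text \<open>Measures the part above the modal operators. By guardedness the bound variable sits
  below modalities, so an unfolding removes one fixpoint operator from this part and adds nothing to
  it.\<close>

primrec lsize :: "('p, 'a, 'v) fm \<Rightarrow> nat" where
  "lsize Bot = 0"
| "lsize Top = 0"
| "lsize (Prop p) = 0"
| "lsize (NProp p) = 0"
| "lsize (Var X) = 0"
| "lsize (And \<psi> \<phi>) = 1 + lsize \<psi> + lsize \<phi>"
| "lsize (Or \<psi> \<phi>) = 1 + lsize \<psi> + lsize \<phi>"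
| "lsize (Dia a \<psi>) = 0"
| "lsize (Box a \<psi>) = 0"
| "lsize (Fix \<eta> X \<psi>) = 1 + lsize \<psi>"

lemma lsize_subst: "X \<notin> unguarded_vars \<psi> \<Longrightarrow> lsize (subst X \<chi> \<psi>) = lsize \<psi>"
  by (induction \<psi>) auto

lemma track_replace:
  "d \<noteq> {} \<Longrightarrow> d \<subseteq> \<Delta> \<Longrightarrow> track d (replace \<Delta> \<chi> \<Theta>) = deferrals ((d - {\<chi>}) \<union> (if \<chi> \<in> d then \<Theta> else {}))"
  unfolding track_def replace_def by (auto intro!: arg_cong[where f = deferrals])

section \<open>The propagation operators: membership, monotonicity, closure under the rules\<close>

lemma f_hat_iff:
  "(\<Delta>, d) \<in> f_hat G X Y \<longleftrightarrow> (\<Delta>, d) \<in> focused_nodes G \<and>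
    (\<forall>\<Sigma> \<in> concl \<Delta>. \<exists>c \<in> \<Sigma>. (fst c, track d c) \<in> (if d = {} then X else Y))"
  unfolding f_hat_def f_op_def nonempty_focus_def empty_focus_def
  by (cases "d = {}") (auto simp: case_prod_unfold)

lemma g_hat_iff:
  "(\<Delta>, d) \<in> g_hat G X Y \<longleftrightarrow> (\<Delta>, d) \<in> focused_nodes G \<and>
    (\<exists>\<Sigma> \<in> concl \<Delta>. \<forall>c \<in> \<Sigma>. (fst c, track d c) \<in> (if d = {} then X else Y))"
  unfolding g_hat_def g_op_def nonempty_focus_def empty_focus_def
  by (cases "d = {}") (auto simp: case_prod_unfold)

lemma f_hat_mono: "G \<subseteq> G' \<Longrightarrow> X \<subseteq> X' \<Longrightarrow> Y \<subseteq> Y' \<Longrightarrow> f_hat G X Y \<subseteq> f_hat G' X' Y'"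
proof (rule subsetI)
  fix v assume *: "G \<subseteq> G'" "X \<subseteq> X'" "Y \<subseteq> Y'" "v \<in> f_hat G X Y"
  obtain \<Delta> d where v: "v = (\<Delta>, d)" by (cases v)
  have "(if d = {} then X else Y) \<subseteq> (if d = {} then X' else Y')" using * by simp
  moreover have "focused_nodes G \<subseteq> focused_nodes G'" using * by (auto simp: focused_nodes_def)
  ultimately show "v \<in> f_hat G' X' Y'" using *(4) unfolding v f_hat_iff by blast
qed

lemma g_hat_mono: "G \<subseteq> G' \<Longrightarrow> X \<subseteq> X' \<Longrightarrow> Y \<subseteq> Y' \<Longrightarrow> g_hat G X Y \<subseteq> g_hat G' X' Y'"
proof (rule subsetI)
  fix v assume *: "G \<subseteq> G'" "X \<subseteq> X'" "Y \<subseteq> Y'" "v \<in> g_hat G X Y"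
  obtain \<Delta> d where v: "v = (\<Delta>, d)" by (cases v)
  have "(if d = {} then X else Y) \<subseteq> (if d = {} then X' else Y')" using * by simp
  moreover have "focused_nodes G \<subseteq> focused_nodes G'" using * by (auto simp: focused_nodes_def)
  ultimately show "v \<in> g_hat G' X' Y'" using *(4) unfolding v g_hat_iff by blast
qed

lemma mono_f_hat: "mono (f_hat G X)" "mono (\<lambda>X. lfp (f_hat G X))"
  by (intro monoI f_hat_mono lfp_mono; simp)+

lemma mono_g_hat: "mono (g_hat G X)" "mono (\<lambda>X. gfp (g_hat G X))"
  by (intro monoI g_hat_mono gfp_mono; simp)+

definition concl_closed :: "('p, 'a, 'v) fm set set \<Rightarrow> bool" where
  "concl_closed G \<longleftrightarrow> (\<forall>\<Delta> \<in> G. \<forall>\<Sigma> \<in> concl \<Delta>. \<forall>c \<in> \<Sigma>. fst c \<in> G)"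

lemma track_subset_deferrals:
  assumes "\<Sigma> \<in> concl \<Delta>" "c \<in> \<Sigma>" shows "track d c \<subseteq> deferrals (fst c)"
proof -
  have "snd c `` d \<subseteq> fst c"
    using assms by (auto simp: concl_def split: if_splits elim!: modal_rules.cases nonmodal_rules.cases)
      (auto simp: replace_def)
  then show ?thesis by (auto simp: track_def deferrals_def case_prod_unfold split: if_splits)
qed

lemma concl_closed_focused:
  assumes "concl_closed G" "\<Delta> \<in> G" "\<Sigma> \<in> concl \<Delta>" "c \<in> \<Sigma>"
  shows "(fst c, track d c) \<in> focused_nodes G"
  using assms track_subset_deferrals[OF assms(3,4), of d] by (auto simp: focused_nodes_def concl_closed_def)

section \<open>Resolving the tableau rules along a model\<close>

context admissible
begin

lemma concl_FL:
  assumes "\<Delta> \<subseteq> FL \<phi>" "\<Sigma> \<in> concl \<Delta>" "c \<in> \<Sigma>"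
  shows "fst c \<subseteq> FL \<phi>"
proof (cases "state_node \<Delta>")
  case True
  then have "\<Sigma> \<in> modal_rules \<Delta>" using assms by (simp add: concl_def)
  then show ?thesis
  proof cases
    case (dia a \<phi>')
    have "\<phi>' \<in> FL \<phi>" using FL_Dia[OF closed] dia assms(1) by blast
    moreover have "{\<psi>. Box a \<psi> \<in> \<Delta>} \<subseteq> FL \<phi>" using FL_Box[OF closed] assms(1) by blast
    ultimately show ?thesis using dia assms(3) by auto
  qed
next
  case False
  then have "\<Sigma> \<in> nonmodal_rules \<Delta>" using assms by (simp add: concl_def)
  then show ?thesis
  proof cases
    case (conj \<psi> \<chi>)
    have "\<psi> \<in> FL \<phi>" "\<chi> \<in> FL \<phi>" using FL_And[OF closed] conj assms(1) by blast+
    then show ?thesis using conj assms by (auto simp: replace_def)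
  next
    case (disj \<psi> \<chi>)
    have "\<psi> \<in> FL \<phi>" "\<chi> \<in> FL \<phi>" using FL_Or[OF closed] disj assms(1) by blast+
    then show ?thesis using disj assms by (auto simp: replace_def)
  next
    case (unfold \<eta> X \<psi>)
    have "subst X (Fix \<eta> X \<psi>) \<psi> \<in> FL \<phi>" using FL_Fix[OF closed] unfold assms(1) by blast
    then show ?thesis using unfold assms by (auto simp: replace_def)
  qed (use assms in auto)
qed

lemma concl_closed_Pow_FL: "concl_closed (Pow (FL \<phi>))"
  unfolding concl_closed_def using concl_FL by blast

lemma deferrals_FL: "\<Gamma> \<subseteq> FL \<phi> \<Longrightarrow> deferrals \<Gamma> = \<Gamma> \<inter> Df \<phi>"
  by (rule deferrals_eq[OF closed clean])

lemma lsize_unfold: "Fix \<eta> X \<psi> \<in> FL \<phi> \<Longrightarrow> lsize (subst X (Fix \<eta> X \<psi>) \<psi>) = lsize \<psi>"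
  using FL_guarded[OF closed guarded] by (simp add: lsize_subst)

lemma sum_lsize_replace:
  assumes "finite \<Delta>" "\<chi> \<in> \<Delta>" "finite \<Theta>" "sum lsize \<Theta> < lsize \<chi>"
  shows "sum lsize (fst (replace \<Delta> \<chi> \<Theta>)) < sum lsize \<Delta>"
proof -
  have "sum lsize (fst (replace \<Delta> \<chi> \<Theta>)) \<le> sum lsize (\<Delta> - {\<chi>}) + sum lsize \<Theta>"
    using assms sum_Un_nat[of "\<Delta> - {\<chi>}" \<Theta> lsize] by (simp add: replace_def)
  also have "\<dots> < sum lsize \<Delta>" using assms sum.remove[of \<Delta> \<chi> lsize] by simp
  finally show ?thesis .
qed

lemma finite_node: "\<Gamma> \<subseteq> FL \<phi> \<Longrightarrow> finite \<Gamma>"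
  using finite_FL finite_subset by blast

text \<open>The model decides which conclusion to take. For a focused principal formula the
  derivation decides instead: the branch recorded there is the one along which the rank drops,
  whereas another true disjunct need not lower it.\<close>

lemma nonmodal_step:
  assumes \<Delta>: "\<Delta> \<subseteq> FL \<phi>" "\<And>\<psi>. \<psi> \<in> \<Delta> \<Longrightarrow> holds K w \<psi>" and \<Sigma>: "\<Sigma> \<in> nonmodal_rules \<Delta>"
    and d: "d \<subseteq> Df \<phi>" "\<And>\<delta>. \<delta> \<in> d \<Longrightarrow> fin K (Df \<phi>) w \<delta> (rk \<delta>)"
  shows "\<exists>\<chi> \<Theta>. \<chi> \<in> \<Delta> \<and> replace \<Delta> \<chi> \<Theta> \<in> \<Sigma> \<and> finite \<Theta> \<and> (\<forall>\<theta> \<in> \<Theta>. holds K w \<theta>) \<and>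
    sum lsize \<Theta> < lsize \<chi> \<and> (\<chi> \<in> d \<longrightarrow> (\<forall>\<theta> \<in> \<Theta>. \<exists>r. fin K (Df \<phi>) w \<theta> r \<and> (r, rk \<chi>) \<in> subrank))"
  using \<Sigma>
proof cases
  case bot
  then show ?thesis using \<Delta>(2) by (fastforce simp: holds_def)
next
  case (clash p)
  then show ?thesis using \<Delta>(2)[of "Prop p"] \<Delta>(2)[of "NProp p"] by (simp add: holds_def)
next
  case (conj \<psi> \<chi>)
  have "\<forall>\<theta> \<in> {\<psi>, \<chi>}. \<exists>r. fin K (Df \<phi>) w \<theta> r \<and> (r, rk (And \<psi> \<chi>)) \<in> subrank" if "And \<psi> \<chi> \<in> d"
    using d(2)[OF that] d(1) that by (cases rule: fin.cases) (auto simp: subrank_def)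
  moreover have "holds K w \<psi>" "holds K w \<chi>" using \<Delta>(2)[of "And \<psi> \<chi>"] conj by (auto simp: holds_def)
  moreover have "sum lsize {\<psi>, \<chi>} < lsize (And \<psi> \<chi>)" by (cases "\<psi> = \<chi>") auto
  ultimately show ?thesis using conj by (intro exI[of _ "And \<psi> \<chi>"] exI[of _ "{\<psi>, \<chi>}"]) auto
next
  case (disj \<psi> \<chi>)
  have "\<exists>\<theta> \<in> {\<psi>, \<chi>}. holds K w \<theta> \<and>
      (Or \<psi> \<chi> \<in> d \<longrightarrow> (\<exists>r. fin K (Df \<phi>) w \<theta> r \<and> (r, rk (Or \<psi> \<chi>)) \<in> subrank))"
  proof (cases "Or \<psi> \<chi> \<in> d")
    case True
    show ?thesis using d(2)[OF True] d(1) True by (cases rule: fin.cases) (auto simp: subrank_def)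
  next
    case False
    then show ?thesis using \<Delta>(2)[of "Or \<psi> \<chi>"] disj by (auto simp: holds_def)
  qed
  then obtain \<theta> where "\<theta> \<in> {\<psi>, \<chi>}" "holds K w \<theta>"
    "Or \<psi> \<chi> \<in> d \<longrightarrow> (\<exists>r. fin K (Df \<phi>) w \<theta> r \<and> (r, rk (Or \<psi> \<chi>)) \<in> subrank)" by blast
  then show ?thesis using disj by (intro exI[of _ "Or \<psi> \<chi>"] exI[of _ "{\<theta>}"]) auto
next
  case (unfold \<eta> X \<psi>)
  let ?u = "subst X (Fix \<eta> X \<psi>) \<psi>"
  have F: "Fix \<eta> X \<psi> \<in> FL \<phi>" using unfold \<Delta>(1) by blast
  have "\<exists>r. fin K (Df \<phi>) w ?u r \<and> (r, rk (Fix \<eta> X \<psi>)) \<in> subrank" if "Fix \<eta> X \<psi> \<in> d"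
    using d(2)[OF that] d(1) that by (cases rule: fin.cases) (auto simp: subrank_def)
  moreover have "holds K w ?u"
    using \<Delta>(2)[OF unfold(2)] sem_unfold[OF FL_closed[OF closed F], of K "\<lambda>_. {}"] unfolding holds_def by blast
  moreover have "sum lsize {?u} < lsize (Fix \<eta> X \<psi>)" using lsize_unfold[OF F] by simp
  ultimately show ?thesis using unfold by (intro exI[of _ "Fix \<eta> X \<psi>"] exI[of _ "{?u}"]) simp
qed

text \<open>A focused diamond moves to the successor chosen by its derivation. A focused box follows
  to any successor, with the subtree that \<open>Branch\<close> stores for it.\<close>

lemma modal_step:
  assumes K: "kripke_structure K" and \<Delta>: "\<And>\<psi>. \<psi> \<in> \<Delta> \<Longrightarrow> holds K w \<psi>" and \<Sigma>: "\<Sigma> \<in> modal_rules \<Delta>"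
    and d: "d \<subseteq> Df \<phi>" "\<And>\<delta>. \<delta> \<in> d \<Longrightarrow> fin K (Df \<phi>) w \<delta> (rk \<delta>)"
  shows "\<exists>c \<in> \<Sigma>. \<exists>v. (\<forall>\<psi> \<in> fst c. holds K v \<psi>) \<and>
    (\<forall>\<delta>' \<in> snd c `` d. \<exists>r. fin K (Df \<phi>) v \<delta>' r \<and> (\<exists>\<delta> \<in> d. (r, rk \<delta>) \<in> subrank))"
  using \<Sigma>
proof cases
  case (dia a \<phi>')
  let ?D = "Df \<phi>"
  have "\<exists>v. (w, v) \<in> trans_rel K a \<and> holds K v \<phi>' \<and>
      (Dia a \<phi>' \<in> d \<longrightarrow> (\<exists>r. fin K ?D v \<phi>' r \<and> (r, rk (Dia a \<phi>')) \<in> subrank))"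
  proof (cases "Dia a \<phi>' \<in> d")
    case True
    show ?thesis using d(2)[OF True] d(1) True by (cases rule: fin.cases) (auto simp: subrank_def)
  next
    case False
    obtain v where "(w, v) \<in> trans_rel K a" "v \<in> sem K \<phi>' (\<lambda>_. {})"
      using \<Delta>[of "Dia a \<phi>'"] dia by (auto simp: holds_def)
    moreover from this have "v \<in> states K" using K by (auto simp: kripke_structure_def)
    ultimately show ?thesis using False by (auto simp: holds_def)
  qed
  then obtain v where v: "(w, v) \<in> trans_rel K a" "holds K v \<phi>'"
    "Dia a \<phi>' \<in> d \<longrightarrow> (\<exists>r. fin K ?D v \<phi>' r \<and> (r, rk (Dia a \<phi>')) \<in> subrank)" by blast
  have vs: "v \<in> states K" using v(2) by (simp add: holds_def)
  have box: "holds K v \<psi>" if "Box a \<psi> \<in> \<Delta>" for \<psi>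
    using \<Delta>[OF that] v(1) vs by (auto simp: holds_def)
  have boxd: "\<exists>r. fin K ?D v \<psi> r \<and> (r, rk (Box a \<psi>)) \<in> subrank" if "Box a \<psi> \<in> d" for \<psi>
    using d(2)[OF that] d(1) that v(1) by (cases rule: fin.cases) (auto simp: subrank_def)
  have "\<exists>r. fin K ?D v \<delta>' r \<and> (\<exists>\<delta> \<in> d. (r, rk \<delta>) \<in> subrank)"
    if "\<delta>' \<in> insert (Dia a \<phi>', \<phi>') {(Box a \<psi>, \<psi>) |\<psi>. Box a \<psi> \<in> \<Delta>} `` d" for \<delta>'
    using that v(3) boxd by blast
  moreover have "\<forall>\<psi> \<in> insert \<phi>' {\<psi>. Box a \<psi> \<in> \<Delta>}. holds K v \<psi>" using v(2) box by blast
  ultimately show ?thesis unfolding dia(1) by (intro bexI exI[of _ v]) auto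
qed

text \<open>Rule applications to the focus replace a deferral by formulas of smaller rank, so the multiset of
  the ranks of the focus decreases; other rule applications shrink the label by guardedness.\<close>

lemma satisfied_in_lfp:
  fixes K :: "('w, 'p, 'a) kripke"
  assumes K: "kripke_structure K" and G: "G \<subseteq> Pow (FL \<phi>)" "concl_closed G"
    and S: "S = {(\<Gamma>, d) \<in> focused_nodes G. \<exists>w. \<forall>\<psi> \<in> \<Gamma>. holds (K :: ('w, 'p, 'a) kripke) w \<psi>}"
  shows "\<Gamma> \<in> G \<Longrightarrow> d \<subseteq> deferrals \<Gamma> \<Longrightarrow> (\<And>\<psi>. \<psi> \<in> \<Gamma> \<Longrightarrow> holds K w \<psi>) \<Longrightarrow>
    (\<And>\<delta>. \<delta> \<in> d \<Longrightarrow> fin K (Df \<phi>) w \<delta> (rk \<delta>)) \<Longrightarrow>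
    p = (image_mset rk (mset_set d), sum lsize \<Gamma>) \<Longrightarrow> (\<Gamma>, d) \<in> lfp (f_hat G S)"
proof (induction p arbitrary: \<Gamma> d w rk rule: wf_induct[OF wf_lex_prod[OF wf_mult[OF wf_subrank] wf_less_than]])
  case (1 p)
  let ?D = "Df \<phi>"
  let ?R = "mult (subrank :: ('w rank \<times> 'w rank) set) <*lex*> less_than"
  have IH: "(\<Gamma>', d') \<in> lfp (f_hat G S)"
    if "\<Gamma>' \<in> G" "d' \<subseteq> deferrals \<Gamma>'" "\<And>\<psi>. \<psi> \<in> \<Gamma>' \<Longrightarrow> holds K v \<psi>" "\<And>\<delta>. \<delta> \<in> d' \<Longrightarrow> fin K ?D v \<delta> (rk' \<delta>)"
      "((image_mset rk' (mset_set d'), sum lsize \<Gamma>'), p) \<in> ?R" for \<Gamma>' d' v rk'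
    using 1(1) that by blast
  have \<Gamma>: "\<Gamma> \<subseteq> FL \<phi>" using 1(2) G by blast
  have d: "d \<subseteq> \<Gamma>" "d \<subseteq> ?D" using deferrals_FL[OF \<Gamma>] 1(3) by auto
  have fd: "finite d" using d(1) finite_node[OF \<Gamma>] finite_subset by blast
  have foc: "(\<Gamma>, d) \<in> focused_nodes G" using 1(2,3) by (simp add: focused_nodes_def)
  have "\<exists>c \<in> \<Sigma>. (fst c, track d c) \<in> (if d = {} then S else lfp (f_hat G S))" if \<Sigma>: "\<Sigma> \<in> concl \<Gamma>" for \<Sigma>
  proof (cases "state_node \<Gamma>")
    case True
    then have "\<Sigma> \<in> modal_rules \<Gamma>" using \<Sigma> by (simp add: concl_def)
    from modal_step[OF K 1(4) this d(2) 1(5)] obtain c v where c: "c \<in> \<Sigma>" "\<forall>\<psi> \<in> fst c. holds K v \<psi>"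
      "\<forall>\<delta>' \<in> snd c `` d. \<exists>r. fin K ?D v \<delta>' r \<and> (\<exists>\<delta> \<in> d. (r, rk \<delta>) \<in> subrank)" by blast
    have foc': "(fst c, track d c) \<in> focused_nodes G" using concl_closed_focused[OF G(2) 1(2) \<Sigma> c(1)] .
    show ?thesis
    proof (cases "d = {}")
      case True
      \<comment> \<open>With an empty focus the conclusion is looked up in the outer set
        \<open>S\<close>, for which satisfaction of its label is enough.\<close>
      then show ?thesis using c(1,2) foc' S by auto
    next
      case False
      obtain rk' where rk': "\<forall>\<delta>' \<in> snd c `` d. fin K ?D v \<delta>' (rk' \<delta>') \<and> (\<exists>\<delta> \<in> d. (rk' \<delta>', rk \<delta>) \<in> subrank)"
        using c(3) by metis
      have t: "track d c \<subseteq> snd c `` d"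
        using False by (auto simp: track_def deferrals_def case_prod_unfold)
      have fc: "fst c \<subseteq> FL \<phi>" using concl_FL[OF \<Gamma> \<Sigma> c(1)] .
      have ft: "finite (track d c)" using foc' finite_node[OF fc] finite_subset
        by (fastforce simp: focused_nodes_def deferrals_def)
      \<comment> \<open>Multiset extension with an empty common part: the whole old focus, which is
        nonempty, is replaced, and each new rank lies below some old one.\<close>
      have "({#} + image_mset rk' (mset_set (track d c)), {#} + image_mset rk (mset_set d)) \<in> mult subrank"
        by (rule one_step_implies_mult) (use rk' t fd ft False in \<open>auto simp: mset_set_empty_iff\<close>)
      then have "(fst c, track d c) \<in> lfp (f_hat G S)"
        using foc' c(2) rk' t 1(6) by (intro IH[of _ _ v rk']) (auto simp: focused_nodes_def)
      then show ?thesis using c(1) False by auto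
    qed
  next
    case False
    then have "\<Sigma> \<in> nonmodal_rules \<Gamma>" using \<Sigma> by (simp add: concl_def)
    from nonmodal_step[OF \<Gamma> 1(4) this d(2) 1(5)] obtain \<chi> \<Theta> where c: "\<chi> \<in> \<Gamma>" "replace \<Gamma> \<chi> \<Theta> \<in> \<Sigma>" "finite \<Theta>"
      "\<forall>\<theta> \<in> \<Theta>. holds K w \<theta>" "sum lsize \<Theta> < lsize \<chi>"
      "\<chi> \<in> d \<longrightarrow> (\<forall>\<theta> \<in> \<Theta>. \<exists>r. fin K ?D w \<theta> r \<and> (r, rk \<chi>) \<in> subrank)" by blast
    let ?c = "replace \<Gamma> \<chi> \<Theta>"
    have foc': "(fst ?c, track d ?c) \<in> focused_nodes G" using concl_closed_focused[OF G(2) 1(2) \<Sigma> c(2)] .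
    have hold: "holds K w \<psi>" if "\<psi> \<in> fst ?c" for \<psi> using that 1(4) c(4) by (auto simp: replace_def)
    have ls: "sum lsize (fst ?c) < sum lsize \<Gamma>" using sum_lsize_replace[OF finite_node[OF \<Gamma>] c(1,3,5)] .
    show ?thesis
    proof (cases "d = {}")
      case True
      then show ?thesis using c(2) hold foc' S by (intro bexI[of _ ?c]) auto
    next
      case ne: False
      have fc: "fst ?c \<subseteq> FL \<phi>" using concl_FL[OF \<Gamma> \<Sigma> c(2)] .
      have tr: "track d ?c = ((d - {\<chi>}) \<union> (if \<chi> \<in> d then \<Theta> else {})) \<inter> ?D"
      proof -
        have "(d - {\<chi>}) \<union> (if \<chi> \<in> d then \<Theta> else {}) \<subseteq> FL \<phi>"
          using \<Gamma> fc d(1) by (auto simp: replace_def)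
        then show ?thesis using track_replace[OF ne d(1)] deferrals_FL by metis
      qed
      have "(fst ?c, track d ?c) \<in> lfp (f_hat G S)"
      proof (cases "\<chi> \<in> d")
        case True
        then obtain rk1 where rk1: "\<forall>\<theta> \<in> \<Theta>. fin K ?D w \<theta> (rk1 \<theta>) \<and> (rk1 \<theta>, rk \<chi>) \<in> subrank"
          using c(6) by metis
        \<comment> \<open>Formulas that were already in focus keep their rank. Only
          \<open>?N\<close>, the part of \<open>\<Theta>\<close> that is new to the focus, receives
          ranks below that of \<open>\<chi>\<close>, because \<open>mset_set\<close> counts each
          deferral once.\<close>
        define rk' where "rk' = (\<lambda>\<delta>. if \<delta> \<in> d - {\<chi>} then rk \<delta> else rk1 \<delta>)"
        let ?N = "(\<Theta> \<inter> ?D) - (d - {\<chi>})"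
        have t: "track d ?c = (d - {\<chi>}) \<union> ?N" using tr True d(2) by auto
        have "image_mset rk' (mset_set (track d ?c)) =
            image_mset rk' (mset_set (d - {\<chi>})) + image_mset rk' (mset_set ?N)"
          unfolding t using fd c(3) by (subst mset_set_Union) auto
        also have "image_mset rk' (mset_set (d - {\<chi>})) = image_mset rk (mset_set (d - {\<chi>}))"
          by (rule image_mset_cong) (use fd in \<open>auto simp: rk'_def\<close>)
        finally have m': "image_mset rk' (mset_set (track d ?c)) =
            image_mset rk (mset_set (d - {\<chi>})) + image_mset rk' (mset_set ?N)" .
        have "mset_set d = mset_set (d - {\<chi>}) + {#\<chi>#}"
          using mset_set.remove[OF fd True] by simp
        then have m: "image_mset rk (mset_set d) = image_mset rk (mset_set (d - {\<chi>})) + {#rk \<chi>#}"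
          by simp
        have "(image_mset rk' (mset_set (track d ?c)), image_mset rk (mset_set d)) \<in> mult subrank"
          unfolding m m' by (rule one_step_implies_mult) (use rk1 c(3) in \<open>auto simp: rk'_def\<close>)
        moreover have "fin K ?D w \<delta> (rk' \<delta>)" if "\<delta> \<in> track d ?c" for \<delta>
          using that t 1(5) rk1 by (auto simp: rk'_def)
        ultimately show ?thesis
          using foc' hold 1(6) by (intro IH[of _ _ w rk']) (auto simp: focused_nodes_def)
      next
        case False
        \<comment> \<open>The focus is unchanged, so it is the second component, the size of the
          label, that decreases.\<close>
        then have "track d ?c = d" using tr d by auto
        then show ?thesis
          using foc' hold 1(5,6) ls by (intro IH[of _ _ w rk]) (auto simp: focused_nodes_def)
      qed
      then show ?thesis using c(2) ne by auto
    qed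
  qed
  then have "(\<Gamma>, d) \<in> f_hat G S (lfp (f_hat G S))" unfolding f_hat_iff using foc by blast
  then show ?case using lfp_unfold[OF mono_f_hat(1)] by blast
qed

text \<open>The focused nodes with satisfied label form a post-fixpoint of the outer operator: each
  of them lies in the inner least fixpoint over their set, by
  \<open>satisfied_in_lfp\<close>.\<close>

lemma satisfiable_imp_E:
  assumes sat: "satisfiable TYPE('w) \<phi>" and G: "G \<subseteq> Pow (FL \<phi>)" "concl_closed G" "{\<phi>} \<in> G"
  shows "({\<phi>}, deferrals {\<phi>}) \<in> E_set G"
proof -
  obtain K :: "('w, 'p, 'a) kripke" and w where K: "kripke_structure K" "holds K w \<phi>"
    using sat unfolding satisfiable_def holds_def by blast
  define S where "S = {(\<Gamma>, d) \<in> focused_nodes G. \<exists>w. \<forall>\<psi> \<in> \<Gamma>. holds K w \<psi>}"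
  have "S \<subseteq> lfp (f_hat G S)"
  proof (rule subsetI)
    fix v assume "v \<in> S"
    then obtain \<Gamma> d w where v: "v = (\<Gamma>, d)" "\<Gamma> \<in> G" "d \<subseteq> deferrals \<Gamma>" "\<forall>\<psi> \<in> \<Gamma>. holds K w \<psi>"
      unfolding S_def focused_nodes_def by blast
    have "\<forall>\<delta> \<in> d. \<exists>r. fin K (Df \<phi>) w \<delta> r"
      using holds_Fin[OF K(1)] v(3,4) by (fastforce simp: Fin_def deferrals_def)
    then obtain rk where "\<forall>\<delta> \<in> d. fin K (Df \<phi>) w \<delta> (rk \<delta>)" by metis
    then show "v \<in> lfp (f_hat G S)"
      using satisfied_in_lfp[OF K(1) G(1,2) S_def v(2,3), of w rk] v(1,4) by blast
  qed
  then have "S \<subseteq> E_set G" unfolding E_set_def by (rule gfp_upperbound)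
  moreover have "({\<phi>}, deferrals {\<phi>}) \<in> S" using K(2) G(3) by (auto simp: S_def focused_nodes_def)
  ultimately show ?thesis by blast
qed

end

section \<open>Fixpoint iteration over finite sets\<close>

text \<open>Otherwise each of the first \<open>Suc (card C)\<close> steps would add an element, and
  the chain would outgrow \<open>C\<close>.\<close>

lemma chain_stabilizes:
  fixes A :: "nat \<Rightarrow> 'b set"
  assumes "\<And>k. A k \<subseteq> A (Suc k)" "\<And>k. A k \<subseteq> C" "finite C"
  shows "\<exists>k \<le> card C. A (Suc k) = A k"
proof (rule ccontr)
  assume *: "\<not> ?thesis"
  have "k \<le> Suc (card C) \<Longrightarrow> k \<le> card (A k)" for k
  proof (induction k)
    case (Suc k)
    then have "A k \<subset> A (Suc k)" using assms(1)[of k] * by auto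
    then have "card (A k) < card (A (Suc k))"
      using psubset_card_mono assms(2,3) finite_subset by metis
    then show ?case using Suc by simp
  qed simp
  from this[of "Suc (card C)"] have "Suc (card C) \<le> card (A (Suc (card C)))" by simp
  moreover have "card (A (Suc (card C))) \<le> card C" using assms(2,3) by (intro card_mono) auto
  ultimately show False by simp
qed

lemma funpow_fixpoint: "F ((F ^^ k) x) = (F ^^ k) x \<Longrightarrow> k \<le> n \<Longrightarrow> (F ^^ n) x = (F ^^ k) x"
proof (induction n)
  case (Suc n)
  then show ?case by (cases "k = Suc n") auto
qed simp

lemma lfp_iterate:
  fixes F :: "'b set \<Rightarrow> 'b set"
  assumes F: "mono F" "\<And>X. F X \<subseteq> C" and C: "finite C" "card C \<le> n"
  shows "(F ^^ n) {} = lfp F"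
proof -
  have inc: "(F ^^ k) {} \<subseteq> (F ^^ Suc k) {}" for k
    by (induction k) (use F(1) in \<open>auto dest: monoD\<close>)
  have "(F ^^ k) {} \<subseteq> C" for k by (cases k) (use F(2) in auto)
  then obtain k where k: "k \<le> card C" "(F ^^ Suc k) {} = (F ^^ k) {}"
    using chain_stabilizes[of "\<lambda>k. (F ^^ k) {}" C, OF inc] C(1) by blast
  then have n: "(F ^^ n) {} = (F ^^ k) {}" using C(2) by (intro funpow_fixpoint) auto
  have "lfp F \<subseteq> (F ^^ k) {}" using k(2) by (intro lfp_lowerbound) simp
  moreover have "(F ^^ m) {} \<subseteq> lfp F" for m
  proof (induction m)
    case (Suc m)
    then have "F ((F ^^ m) {}) \<subseteq> F (lfp F)" using F(1) by (auto dest: monoD)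
    then show ?case using lfp_unfold[OF F(1)] by simp
  qed simp
  ultimately show ?thesis using n by blast
qed

lemma gfp_iterate:
  fixes F :: "'b set \<Rightarrow> 'b set"
  assumes F: "mono F" "\<And>X. F X \<subseteq> C" and C: "finite C" "card C \<le> n"
  shows "(F ^^ n) C = gfp F"
proof -
  have sub: "(F ^^ k) C \<subseteq> C" for k by (cases k) (use F(2) in auto)
  have dec: "(F ^^ Suc k) C \<subseteq> (F ^^ k) C" for k
    by (induction k) (use F in \<open>auto dest: monoD\<close>)
  \<comment> \<open>Complements turn the decreasing chain into an increasing one.\<close>
  have "C - (F ^^ k) C \<subseteq> C - (F ^^ Suc k) C" for k using dec[of k] by blast
  then obtain k where k: "k \<le> card C" "C - (F ^^ Suc k) C = C - (F ^^ k) C"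
    using chain_stabilizes[of "\<lambda>k. C - (F ^^ k) C" C] C(1) by blast
  then have k': "(F ^^ Suc k) C = (F ^^ k) C" using sub[of k] sub[of "Suc k"] by blast
  then have n: "(F ^^ n) C = (F ^^ k) C" using C(2) k(1) by (intro funpow_fixpoint) auto
  have "(F ^^ k) C \<subseteq> gfp F" using k' by (intro gfp_upperbound) simp
  moreover have "gfp F \<subseteq> (F ^^ m) C" for m
  proof (induction m)
    case 0
    show ?case using gfp_unfold[OF F(1)] F(2) by auto
  next
    case (Suc m)
    then have "F (gfp F) \<subseteq> F ((F ^^ m) C)" using F(1) by (auto dest: monoD)
    then show ?case using gfp_unfold[OF F(1)] by simp
  qed
  ultimately show ?thesis using n by blast
qed

section \<open>Soundness\<close>

text \<open>The non-modal rules read backwards: a state node entails the formulas whose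
  decomposition ends in its label. This relates a label to the state node at the end of a run of
  non-modal steps.\<close>

inductive entails :: "('p, 'a, 'v) fm set \<Rightarrow> ('p, 'a, 'v) fm \<Rightarrow> bool" for A :: "('p, 'a, 'v) fm set" where
  base: "\<psi> \<in> A \<Longrightarrow> entails A \<psi>"
| conj: "entails A \<psi> \<Longrightarrow> entails A \<chi> \<Longrightarrow> entails A (And \<psi> \<chi>)"
| disj1: "entails A \<psi> \<Longrightarrow> entails A (Or \<psi> \<chi>)"
| disj2: "entails A \<chi> \<Longrightarrow> entails A (Or \<psi> \<chi>)"
| unf: "entails A (subst X (Fix \<eta> X \<psi>) \<psi>) \<Longrightarrow> entails A (Fix \<eta> X \<psi>)"

lemma entails_trans: "entails A \<psi> \<Longrightarrow> (\<And>\<chi>. \<chi> \<in> A \<Longrightarrow> entails B \<chi>) \<Longrightarrow> entails B \<psi>"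
  by (induction rule: entails.induct) (auto intro: entails.intros)

inductive_cases entails_BotE: "entails A Bot"
inductive_cases entails_PropE: "entails A (Prop p)"
inductive_cases entails_NPropE: "entails A (NProp p)"
inductive_cases entails_AndE: "entails A (And \<psi> \<chi>)"
inductive_cases entails_OrE: "entails A (Or \<psi> \<chi>)"
inductive_cases entails_DiaE: "entails A (Dia a \<psi>)"
inductive_cases entails_BoxE: "entails A (Box a \<psi>)"
inductive_cases entails_FixE: "entails A (Fix \<eta> X \<psi>)"

context admissible
begin

text \<open>The formulas entailed by a node that need not be kept in focus.\<close>

definition settled :: "('p, 'a, 'v) fm set \<Rightarrow> ('p, 'a, 'v) fm set" where
  "settled \<Gamma> = {\<beta>. \<beta> \<notin> Df \<phi> \<and> entails \<Gamma> \<beta>}"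

lemma settled_mono: "(\<And>\<psi>. \<psi> \<in> \<Gamma> \<Longrightarrow> entails \<Delta> \<psi>) \<Longrightarrow> settled \<Gamma> \<subseteq> settled \<Delta>"
  unfolding settled_def using entails_trans by blast

lemma nonmodal_replace:
  assumes "\<Gamma> \<subseteq> FL \<phi>" "\<Sigma> \<in> nonmodal_rules \<Gamma>" "c \<in> \<Sigma>"
  shows "\<exists>\<chi> \<Theta>. c = replace \<Gamma> \<chi> \<Theta> \<and> \<chi> \<in> \<Gamma> \<and> finite \<Theta> \<and> sum lsize \<Theta> < lsize \<chi> \<and>
    (\<forall>A. (\<forall>\<theta> \<in> \<Theta>. entails A \<theta>) \<longrightarrow> entails A \<chi>)"
  using assms(2)
proof cases
  case (conj \<psi> \<chi>)
  have "sum lsize {\<psi>, \<chi>} < lsize (And \<psi> \<chi>)" by (cases "\<psi> = \<chi>") auto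
  then show ?thesis using conj assms(3)
    by (intro exI[of _ "And \<psi> \<chi>"] exI[of _ "{\<psi>, \<chi>}"]) (auto intro: entails.intros)
next
  case (disj \<psi> \<chi>)
  then obtain \<theta> where "\<theta> \<in> {\<psi>, \<chi>}" "c = replace \<Gamma> (Or \<psi> \<chi>) {\<theta>}" using assms(3) by auto
  then show ?thesis using disj
    by (intro exI[of _ "Or \<psi> \<chi>"] exI[of _ "{\<theta>}"]) (auto intro: entails.intros)
next
  case (unfold \<eta> X \<psi>)
  have "lsize (subst X (Fix \<eta> X \<psi>) \<psi>) = lsize \<psi>" using lsize_unfold unfold assms(1) by blast
  then show ?thesis using unfold assms(3)
    by (intro exI[of _ "Fix \<eta> X \<psi>"] exI[of _ "{subst X (Fix \<eta> X \<psi>) \<psi>}"]) (auto intro: entails.intros)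
qed (use assms in auto)

text \<open>Besides the shapes that \<open>state_node\<close> admits, only a variable could resist
  all rules, and formulas of the closure are closed.\<close>

lemma non_state_rule:
  assumes "\<Gamma> \<subseteq> FL \<phi>" "\<not> state_node \<Gamma>"
  shows "\<exists>\<Sigma>. \<Sigma> \<in> nonmodal_rules \<Gamma>"
proof (cases "\<exists>p. Prop p \<in> \<Gamma> \<and> NProp p \<in> \<Gamma>")
  case True
  then obtain p where "Prop p \<in> \<Gamma>" "NProp p \<in> \<Gamma>" by blast
  from nonmodal_rules.clash[OF this] show ?thesis ..
next
  case False
  then obtain \<chi> where \<chi>: "\<chi> \<in> \<Gamma>" "\<not> (\<chi> = Top \<or> (\<exists>p. \<chi> = Prop p \<or> \<chi> = NProp p) \<or> (\<exists>a \<psi>. \<chi> = Dia a \<psi> \<or> \<chi> = Box a \<psi>))"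
    using assms(2) unfolding state_node_def by blast
  have "closed_fm \<chi>" using \<chi>(1) assms(1) FL_closed[OF closed] by blast
  then show ?thesis
    using \<chi> nonmodal_rules.bot[of \<Gamma>] nonmodal_rules.conj[of _ _ \<Gamma>] nonmodal_rules.disj[of _ _ \<Gamma>]
      nonmodal_rules.unfold[of _ _ _ \<Gamma>]
    by (cases \<chi>) (simp_all add: closed_fm_def, blast+)
qed

lemma focused_FL: "G \<subseteq> Pow (FL \<phi>) \<Longrightarrow> (\<Gamma>, d) \<in> focused_nodes G \<Longrightarrow> \<Gamma> \<subseteq> FL \<phi> \<and> d \<subseteq> \<Gamma> \<and> d \<subseteq> Df \<phi>"
  using deferrals_FL[of \<Gamma>] by (auto simp: focused_nodes_def)

lemma finite_focused:
  assumes "G \<subseteq> Pow (FL \<phi>)" shows "finite (focused_nodes G)"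
proof (rule finite_subset)
  show "focused_nodes G \<subseteq> Pow (FL \<phi>) \<times> Pow (FL \<phi>)"
  proof clarify
    fix \<Gamma> d assume "(\<Gamma>, d) \<in> focused_nodes G"
    from focused_FL[OF assms this] show "\<Gamma> \<in> Pow (FL \<phi>) \<and> d \<in> Pow (FL \<phi>)" by blast
  qed
qed (simp add: finite_FL)

lemma f_hat_focused: "f_hat G X Y \<subseteq> focused_nodes G"
  unfolding f_hat_def f_op_def by blast

lemma g_hat_focused: "g_hat G X Y \<subseteq> focused_nodes G"
  unfolding g_hat_def g_op_def empty_focus_def nonempty_focus_def by blast

end

text \<open>The stage at which a focused node enters the inner least fixpoint. An empty focus gets
  0: reaching it counts as progress in \<open>rank_step\<close>, and since no successor has a
  smaller rank, \<open>good_edge\<close> must then offer its alternative, the refilled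
  focus.\<close>

definition next_rank :: "('p, 'a, 'v) fm set set \<Rightarrow> ('p, 'a, 'v) fnode \<Rightarrow> nat" where
  "next_rank G u = (if snd u = {} then 0 else LEAST k. u \<in> (f_hat G (E_set G) ^^ k) {})"

lemma E_set_unfold: "E_set G = lfp (f_hat G (E_set G))"
  unfolding E_set_def by (rule gfp_unfold[OF mono_f_hat(2)])

section \<open>Ranks, and condensed steps between state nodes in \<open>E_set G\<close>\<close>

locale tableau = admissible \<phi> for \<phi> :: "('p, 'a, 'v) fm" +
  fixes G :: "('p, 'a, 'v) fm set set"
  assumes nodes: "G \<subseteq> Pow (FL \<phi>)"
begin

lemma E_focused: "E_set G \<subseteq> focused_nodes G"
  using E_set_unfold[of G] lfp_unfold[OF mono_f_hat(1)] f_hat_focused by blast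

lemma E_iterate: "\<exists>n. E_set G = (f_hat G (E_set G) ^^ n) {}"
  using lfp_iterate[OF mono_f_hat(1) f_hat_focused finite_focused[OF nodes] order_refl] E_set_unfold
  by metis

lemma iterate_subset_E: "(f_hat G (E_set G) ^^ k) {} \<subseteq> E_set G"
proof (induction k)
  case (Suc k)
  have "f_hat G (E_set G) ((f_hat G (E_set G) ^^ k) {}) \<subseteq> f_hat G (E_set G) (E_set G)"
    using Suc by (intro f_hat_mono) auto
  also have "\<dots> = E_set G" using E_set_unfold[of G] lfp_unfold[OF mono_f_hat(1)] by metis
  finally show ?case by simp
qed simp

text \<open>A node with nonempty focus first appears at a successor stage of the inner iteration,
  which places a conclusion one stage earlier. With an empty focus the outer fixpoint governs
  membership, and no bound on the rank results.\<close>

lemma rank_step: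
  assumes u: "(\<Gamma>, d) \<in> E_set G" and \<Sigma>: "\<Sigma> \<in> concl \<Gamma>"
  shows "\<exists>c \<in> \<Sigma>. (fst c, track d c) \<in> E_set G \<and> (d \<noteq> {} \<longrightarrow> next_rank G (fst c, track d c) < next_rank G (\<Gamma>, d))"
proof (cases "d = {}")
  case True
  have "(\<Gamma>, d) \<in> f_hat G (E_set G) (E_set G)"
    using u E_set_unfold[of G] lfp_unfold[OF mono_f_hat(1)] by metis
  then show ?thesis using \<Sigma> True unfolding f_hat_iff by auto
next
  case False
  let ?Y = "\<lambda>k. (f_hat G (E_set G) ^^ k) {}"
  define k where "k = next_rank G (\<Gamma>, d)"
  have k: "k = (LEAST k. (\<Gamma>, d) \<in> ?Y k)" using False by (simp add: k_def next_rank_def)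
  have "(\<Gamma>, d) \<in> ?Y k" unfolding k by (rule LeastI_ex) (use u E_iterate in blast)
  then obtain m where m: "k = Suc m" "(\<Gamma>, d) \<in> f_hat G (E_set G) (?Y m)" by (cases k) auto
  then have "\<exists>c \<in> \<Sigma>. (fst c, track d c) \<in> ?Y m"
    using \<Sigma> False unfolding f_hat_iff by simp
  then obtain c where c: "c \<in> \<Sigma>" "(fst c, track d c) \<in> ?Y m" by blast
  have "next_rank G (fst c, track d c) \<le> m"
    using c(2) by (auto simp: next_rank_def intro: Least_le)
  then show ?thesis using c m(1) iterate_subset_E k_def by (intro bexI[OF _ c(1)]) auto
qed

text \<open>Condenses a run of non-modal steps from \<open>u\<close> to a state node
  \<open>v\<close>. If the focus survives the run, the rank does not increase. If it becomes empty
  and is refilled on the way, the rank may jump, but then the focused deferrals of \<open>u\<close>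
  have been reduced to settled formulas, and up to settled formulas the new focus accounts for the
  whole label of \<open>u\<close>.\<close>

definition good_state :: "('p, 'a, 'v) fnode \<Rightarrow> ('p, 'a, 'v) fnode \<Rightarrow> bool" where
  "good_state u v \<longleftrightarrow> v \<in> E_set G \<and> state_node (fst v) \<and>
     (\<forall>\<psi> \<in> fst u. entails (fst v) \<psi>) \<and>
     (\<forall>\<delta> \<in> snd u. entails (snd v \<union> settled (fst v)) \<delta>) \<and>
     (next_rank G v \<le> next_rank G u \<or> (\<forall>\<delta> \<in> snd u. entails (settled (fst v)) \<delta>)) \<and>
     (next_rank G v \<le> next_rank G u \<or> (\<forall>\<psi> \<in> fst u. entails (snd v \<union> settled (fst v)) \<psi>))"

lemma good_state_exists: "(\<Gamma>, d) \<in> E_set G \<Longrightarrow> \<exists>v. good_state (\<Gamma>, d) v"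
proof (induction "sum lsize \<Gamma>" arbitrary: \<Gamma> d rule: less_induct)
  case less
  have FL: "\<Gamma> \<subseteq> FL \<phi>" "d \<subseteq> \<Gamma>" "d \<subseteq> Df \<phi>"
    using focused_FL[OF nodes] E_focused less.prems by blast+
  show ?case
  proof (cases "state_node \<Gamma>")
    case True
    then have "good_state (\<Gamma>, d) (\<Gamma>, d)"
      using less.prems by (auto simp: good_state_def intro: entails.base)
    then show ?thesis by blast
  next
    case False
    then obtain \<Sigma> where \<Sigma>: "\<Sigma> \<in> nonmodal_rules \<Gamma>" using non_state_rule FL(1) by blast
    then have \<Sigma>': "\<Sigma> \<in> concl \<Gamma>" using False by (simp add: concl_def)
    from rank_step[OF less.prems this] obtain c where c: "c \<in> \<Sigma>" "(fst c, track d c) \<in> E_set G"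
      "d \<noteq> {} \<longrightarrow> next_rank G (fst c, track d c) < next_rank G (\<Gamma>, d)" by blast
    obtain \<chi> \<Theta> where r: "c = replace \<Gamma> \<chi> \<Theta>" "\<chi> \<in> \<Gamma>" "finite \<Theta>" "sum lsize \<Theta> < lsize \<chi>"
      "\<And>A. (\<forall>\<theta> \<in> \<Theta>. entails A \<theta>) \<Longrightarrow> entails A \<chi>"
      using nonmodal_replace[OF FL(1) \<Sigma> c(1)] by blast
    define \<Gamma>' d' where "\<Gamma>' = fst c" and "d' = track d c"
    have FL': "\<Gamma>' \<subseteq> FL \<phi>" "d' \<subseteq> \<Gamma>'" "d' \<subseteq> Df \<phi>"
      using focused_FL[OF nodes] E_focused c(2) unfolding \<Gamma>'_def d'_def by blast+
    have \<Gamma>': "\<Gamma>' = (\<Gamma> - {\<chi>}) \<union> \<Theta>" by (simp add: \<Gamma>'_def r(1) replace_def)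
    have "sum lsize \<Gamma>' < sum lsize \<Gamma>"
      unfolding \<Gamma>'_def r(1) using sum_lsize_replace[OF finite_node[OF FL(1)] r(2-4)] .
    then obtain v where v: "good_state (\<Gamma>', d') v" using less.hyps c(2) unfolding \<Gamma>'_def d'_def by blast
    obtain \<Delta> e where ve: "v = (\<Delta>, e)" by (cases v)
    have v1: "v \<in> E_set G" "state_node \<Delta>" "\<And>\<psi>. \<psi> \<in> \<Gamma>' \<Longrightarrow> entails \<Delta> \<psi>"
      and v2: "\<And>\<delta>. \<delta> \<in> d' \<Longrightarrow> entails (e \<union> settled \<Delta>) \<delta>"
      and v3: "next_rank G v \<le> next_rank G (\<Gamma>', d') \<or> (\<forall>\<delta> \<in> d'. entails (settled \<Delta>) \<delta>)"
      and v4: "next_rank G v \<le> next_rank G (\<Gamma>', d') \<or> (\<forall>\<psi> \<in> \<Gamma>'. entails (e \<union> settled \<Delta>) \<psi>)"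
      using v unfolding good_state_def ve by auto
    have st: "settled \<Gamma>' \<subseteq> settled \<Delta>" by (rule settled_mono) (rule v1(3))
    have all: "entails \<Gamma>' \<psi>" if "\<psi> \<in> \<Gamma>" for \<psi>
    proof (cases "\<psi> = \<chi>")
      case True
      then show ?thesis using r(5)[of \<Gamma>'] \<Gamma>' by (auto intro: entails.base)
    next
      case False
      then show ?thesis using that \<Gamma>' by (auto intro: entails.base)
    qed
    \<comment> \<open>Parts of a focused formula that leave the focus are no deferrals, hence
      settled.\<close>
    have foc: "entails (d' \<union> settled \<Gamma>') \<delta>" if "\<delta> \<in> d" for \<delta>
    proof -
      have ne: "d \<noteq> {}" using that by blast
      have d': "d' = ((d - {\<chi>}) \<union> (if \<chi> \<in> d then \<Theta> else {})) \<inter> Df \<phi>"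
      proof -
        have "(d - {\<chi>}) \<union> (if \<chi> \<in> d then \<Theta> else {}) \<subseteq> FL \<phi>"
          using FL FL'(1) \<Gamma>' by auto
        then show ?thesis unfolding d'_def r(1) using track_replace[OF ne FL(2)] deferrals_FL by metis
      qed
      show ?thesis
      proof (cases "\<delta> = \<chi>")
        case True
        have "entails (d' \<union> settled \<Gamma>') \<theta>" if "\<theta> \<in> \<Theta>" for \<theta>
          using that True \<open>\<delta> \<in> d\<close> d' \<Gamma>' by (cases "\<theta> \<in> Df \<phi>") (auto simp: settled_def intro: entails.base)
        then show ?thesis using r(5) True by blast
      next
        case False
        then show ?thesis using that d' FL(3) by (auto intro: entails.base)
      qed
    qed
    have "good_state (\<Gamma>, d) v"
    proof (cases "d = {}")
      case True
      \<comment> \<open>Refocusing: the new focus consists of all deferrals of the new label, so it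
        misses only settled formulas.\<close>
      have d': "d' = \<Gamma>' \<inter> Df \<phi>"
        using deferrals_FL[OF FL'(1)] True by (simp add: d'_def \<Gamma>'_def track_def case_prod_unfold)
      have "entails (e \<union> settled \<Delta>) \<gamma>" if "\<gamma> \<in> \<Gamma>'" for \<gamma>
        using that v2 d' st by (cases "\<gamma> \<in> Df \<phi>") (auto simp: settled_def intro: entails.base)
      then have "entails (e \<union> settled \<Delta>) \<psi>" if "\<psi> \<in> \<Gamma>" for \<psi>
        using entails_trans[OF all[OF that]] by blast
      moreover have "entails \<Delta> \<psi>" if "\<psi> \<in> \<Gamma>" for \<psi> using entails_trans[OF all[OF that] v1(3)] .
      ultimately show ?thesis using v1(1,2) True by (auto simp: good_state_def ve)
    next
      case False
      then have rk: "next_rank G (\<Gamma>', d') < next_rank G (\<Gamma>, d)" using c(3) unfolding \<Gamma>'_def d'_def by blast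
      have "entails \<Delta> \<psi>" if "\<psi> \<in> \<Gamma>" for \<psi> using entails_trans[OF all[OF that] v1(3)] .
      moreover have "entails (e \<union> settled \<Delta>) \<delta>" if "\<delta> \<in> d" for \<delta>
        by (rule entails_trans[OF foc[OF that]]) (use v2 st in \<open>auto intro: entails.base\<close>)
      \<comment> \<open>Either the rest of the run settles \<open>d'\<close> and with it
        \<open>d\<close>, or its bound on the rank combines with the strict decrease in this
        step.\<close>
      moreover have "next_rank G v \<le> next_rank G (\<Gamma>, d) \<or> (\<forall>\<delta> \<in> d. entails (settled \<Delta>) \<delta>)"
      proof (cases "\<forall>\<delta> \<in> d'. entails (settled \<Delta>) \<delta>")
        case True
        have "entails (settled \<Delta>) \<delta>" if "\<delta> \<in> d" for \<delta>
          by (rule entails_trans[OF foc[OF that]]) (use True st in \<open>auto intro: entails.base\<close>)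
        then show ?thesis by blast
      next
        case False
        then show ?thesis using v3 rk by auto
      qed
      moreover have "next_rank G v \<le> next_rank G (\<Gamma>, d) \<or> (\<forall>\<psi> \<in> \<Gamma>. entails (e \<union> settled \<Delta>) \<psi>)"
      proof (cases "\<forall>\<psi> \<in> \<Gamma>'. entails (e \<union> settled \<Delta>) \<psi>")
        case True
        have "entails (e \<union> settled \<Delta>) \<psi>" if "\<psi> \<in> \<Gamma>" for \<psi>
          by (rule entails_trans[OF all[OF that]]) (use True in blast)
        then show ?thesis by blast
      next
        case False
        then show ?thesis using v4 rk by auto
      qed
      ultimately show ?thesis using v1(1,2) unfolding good_state_def ve by simp
    qed
    then show ?thesis by blast
  qed
qed

text \<open>\<open>\<chi>\<close> is the modal formula at \<open>v\<close> that hands \<open>\<psi>\<close> to the successor \<open>v'\<close>.\<close>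

definition good_edge :: "('p, 'a, 'v) fnode \<Rightarrow> ('p, 'a, 'v) fm \<Rightarrow> ('p, 'a, 'v) fm \<Rightarrow> ('p, 'a, 'v) fnode \<Rightarrow> bool" where
  "good_edge v \<chi> \<psi> v' \<longleftrightarrow> entails (fst v') \<psi> \<and>
     (\<chi> \<in> snd v \<longrightarrow> entails (snd v' \<union> settled (fst v')) \<psi> \<and>
        (next_rank G v' < next_rank G v \<or> entails (settled (fst v')) \<psi>)) \<and>
     (next_rank G v' < next_rank G v \<or> entails (snd v' \<union> settled (fst v')) \<psi>)"

text \<open>The modal rule collects the arguments of the diamond and of all matching boxes in one
  label, so a single successor serves all of them: the rule is applied once, and the non-modal steps
  after it are condensed.\<close>

lemma good_successor:
  assumes v: "(\<Delta>, e) \<in> E_set G" "state_node \<Delta>" and dia: "Dia a \<phi>' \<in> \<Delta>"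
  shows "\<exists>v'. v' \<in> E_set G \<and> state_node (fst v') \<and> good_edge (\<Delta>, e) (Dia a \<phi>') \<phi>' v' \<and>
    (\<forall>\<psi>. Box a \<psi> \<in> \<Delta> \<longrightarrow> good_edge (\<Delta>, e) (Box a \<psi>) \<psi> v')"
proof -
  define \<Gamma> where "\<Gamma> = insert \<phi>' {\<psi>. Box a \<psi> \<in> \<Delta>}"
  define \<rho> where "\<rho> = insert (Dia a \<phi>', \<phi>') {(Box a \<psi>, \<psi>) |\<psi>. Box a \<psi> \<in> \<Delta>}"
  define d where "d = track e (\<Gamma>, \<rho>)"
  have \<Sigma>: "{(\<Gamma>, \<rho>)} \<in> concl \<Delta>"
    using v(2) modal_rules.dia[OF dia] by (simp add: concl_def \<Gamma>_def \<rho>_def)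
  have u: "(\<Gamma>, d) \<in> E_set G" "e \<noteq> {} \<longrightarrow> next_rank G (\<Gamma>, d) < next_rank G (\<Delta>, e)"
    using rank_step[OF v(1) \<Sigma>] by (auto simp: d_def)
  have FL: "\<Gamma> \<subseteq> FL \<phi>" "d \<subseteq> \<Gamma>" "d \<subseteq> Df \<phi>"
    using focused_FL[OF nodes] E_focused u(1) by blast+
  have \<rho>\<Gamma>: "\<rho> `` e \<subseteq> FL \<phi>" using FL(1) by (auto simp: \<rho>_def \<Gamma>_def)
  obtain v' where v': "good_state (\<Gamma>, d) v'" using good_state_exists[OF u(1)] by blast
  obtain \<Delta>' e' where ve: "v' = (\<Delta>', e')" by (cases v')
  have v1: "v' \<in> E_set G" "state_node \<Delta>'" "\<And>\<psi>. \<psi> \<in> \<Gamma> \<Longrightarrow> entails \<Delta>' \<psi>"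
    and v2: "\<And>\<delta>. \<delta> \<in> d \<Longrightarrow> entails (e' \<union> settled \<Delta>') \<delta>"
    and v3: "next_rank G v' \<le> next_rank G (\<Gamma>, d) \<or> (\<forall>\<delta> \<in> d. entails (settled \<Delta>') \<delta>)"
    and v4: "next_rank G v' \<le> next_rank G (\<Gamma>, d) \<or> (\<forall>\<psi> \<in> \<Gamma>. entails (e' \<union> settled \<Delta>') \<psi>)"
    using v' unfolding good_state_def ve by auto
  have "good_edge (\<Delta>, e) \<chi> \<psi> v'" if \<chi>: "(\<chi>, \<psi>) \<in> \<rho>" for \<chi> \<psi>
  proof -
    have \<psi>: "\<psi> \<in> \<Gamma>" using \<chi> by (auto simp: \<rho>_def \<Gamma>_def)
    have nd: "entails (settled \<Delta>') \<psi>" if "\<psi> \<notin> Df \<phi>"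
      using that v1(3)[OF \<psi>] by (auto simp: settled_def intro: entails.base)
    have up: "entails (e' \<union> settled \<Delta>') \<psi>" if "entails (settled \<Delta>') \<psi>"
      by (rule entails_trans[OF that]) (auto intro: entails.base)
    have d1: "\<psi> \<in> d" if "\<chi> \<in> e" "\<psi> \<in> Df \<phi>"
    proof -
      have "d = \<rho> `` e \<inter> Df \<phi>" using that deferrals_FL[OF \<rho>\<Gamma>] by (auto simp: d_def track_def)
      then show ?thesis using that \<chi> by blast
    qed
    have d2: "\<psi> \<in> d" if "e = {}" "\<psi> \<in> Df \<phi>"
      using that deferrals_FL[OF FL(1)] \<psi> by (simp add: d_def track_def)
    show ?thesis
      unfolding good_edge_def ve
    proof (intro conjI impI)
      show "entails (fst (\<Delta>', e')) \<psi>" using v1(3)[OF \<psi>] by simp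
      show "entails (snd (\<Delta>', e') \<union> settled (fst (\<Delta>', e'))) \<psi>" if "\<chi> \<in> snd (\<Delta>, e)"
        using that nd up d1 v2 by (cases "\<psi> \<in> Df \<phi>") auto
      \<comment> \<open>A focused \<open>\<chi>\<close> makes \<open>e\<close> nonempty, so the rank
        drops in the modal step. It can rise again only by refocusing, and then
        \<open>\<psi>\<close> is settled.\<close>
      show "next_rank G (\<Delta>', e') < next_rank G (\<Delta>, e) \<or> entails (settled (fst (\<Delta>', e'))) \<psi>" if "\<chi> \<in> snd (\<Delta>, e)"
      proof (cases "\<psi> \<in> Df \<phi>")
        case True
        then have "\<psi> \<in> d" "e \<noteq> {}" using that d1 by auto
        then show ?thesis using v3 u(2) ve by auto
      qed (use nd in simp)
      show "next_rank G (\<Delta>', e') < next_rank G (\<Delta>, e) \<or> entails (snd (\<Delta>', e') \<union> settled (fst (\<Delta>', e'))) \<psi>"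
      proof (cases "e = {}")
        case True
        then show ?thesis using d2 v2 nd up by (cases "\<psi> \<in> Df \<phi>") auto
      next
        case False
        then show ?thesis using v4 u(2) \<psi> ve by auto
      qed
    qed
  qed
  then show ?thesis using v1(1,2) ve by (intro exI[of _ v']) (auto simp: \<rho>_def)
qed

end

section \<open>Nests of least fixpoints below one eventuality\<close>

context admissible
begin

text \<open>Alternation freeness lets all least fixpoints nested below a closed
  \<open>\<theta>\<close> be treated together. Decomposition and unfolding stay within the block,
  except for exits to smaller closed subformulas, which form \<open>below \<theta>\<close>.\<close>

definition block :: "('p, 'a, 'v) fm \<Rightarrow> ('p, 'a, 'v) fm set" where
  "block \<theta> = insert \<theta> {psubst (env \<sigma>) \<alpha> |\<sigma> \<alpha>. occ \<phi> \<sigma> \<alpha> \<and> \<sigma> \<noteq> [] \<and> last \<sigma> = \<theta> \<and> \<not> closed_fm \<alpha>}"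

definition below :: "('p, 'a, 'v) fm \<Rightarrow> ('p, 'a, 'v) fm set" where
  "below \<theta> = {\<beta>. closed_fm \<beta> \<and> (\<exists>\<sigma>. occ \<phi> \<sigma> \<beta>) \<and> fm_size \<beta> < fm_size \<theta>}"

text \<open>Follows a free occurrence of \<open>X\<close> down to the variable. The literals passed
  on the way are open; they extend the chain without rebinding \<open>X\<close>.\<close>

lemma occ_Var:
  "occ \<phi> \<sigma> \<alpha> \<Longrightarrow> \<sigma> \<noteq> [] \<Longrightarrow> X \<in> FV \<alpha> \<Longrightarrow>
   \<exists>\<sigma>'. occ \<phi> \<sigma>' (Var X) \<and> \<sigma>' \<noteq> [] \<and> last \<sigma>' = last \<sigma> \<and> env \<sigma>' X = env \<sigma> X"
proof (induction \<alpha> arbitrary: \<sigma>)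
  case (Var Y)
  then show ?case by auto
next
  case (And \<alpha>1 \<alpha>2)
  then show ?case using occ.and1[OF And.prems(1)] occ.and2[OF And.prems(1)] by auto
next
  case (Or \<alpha>1 \<alpha>2)
  then show ?case using occ.or1[OF Or.prems(1)] occ.or2[OF Or.prems(1)] by auto
next
  case (Dia a \<alpha>)
  then show ?case using occ.dia[OF Dia.prems(1)] by auto
next
  case (Box a \<alpha>)
  then show ?case using occ.box[OF Box.prems(1)] by auto
next
  case (Fix \<eta> Y \<psi>)
  have "\<not> closed_fm (Fix \<eta> Y \<psi>)" using Fix.prems(3) by (auto simp: closed_fm_def)
  with Fix.prems(1) have "occ \<phi> (Fix \<eta> Y \<psi> # \<sigma>) \<psi>" by (rule occ.fix_open)
  then obtain \<sigma>' where "occ \<phi> \<sigma>' (Var X)" "\<sigma>' \<noteq> []" "last \<sigma>' = last (Fix \<eta> Y \<psi> # \<sigma>)"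
    "env \<sigma>' X = env (Fix \<eta> Y \<psi> # \<sigma>) X" using Fix.IH[of "Fix \<eta> Y \<psi> # \<sigma>"] Fix.prems(3) by auto
  then show ?case using Fix.prems by auto
qed auto

text \<open>By irredundance the bound variable occurs in the body. The instance of that occurrence
  is the eventuality itself, which is therefore a deferral like the rest of its block.\<close>

lemma block_subset_Df:
  assumes "occ \<phi> \<tau> (Fix Mu X \<psi>)" "closed_fm (Fix Mu X \<psi>)"
  shows "block (Fix Mu X \<psi>) \<subseteq> Df \<phi>"
proof -
  have "X \<in> FV \<psi>" using Fix_subfms occ_subfms[OF assms(1)] by blast
  then obtain \<sigma> where s: "occ \<phi> \<sigma> (Var X)" "\<sigma> \<noteq> []" "last \<sigma> = Fix Mu X \<psi>" "env \<sigma> X = env [Fix Mu X \<psi>] X"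
    using occ_Var[OF occ.fix_closed[OF assms], of X] by auto
  have "env \<sigma> X = Fix Mu X \<psi>" using s(4) by (simp del: psubst.simps)
  then have "Fix Mu X \<psi> = psubst (env \<sigma>) (Var X)" by simp
  moreover have "\<not> closed_fm (Var X :: ('p, 'a, 'v) fm)" by (simp add: closed_fm_def)
  ultimately have "Fix Mu X \<psi> \<in> Df \<phi>" unfolding Df_def using s(1-3) by blast
  then show ?thesis unfolding block_def Df_def by auto
qed

lemma block_non_Var:
  assumes "x \<in> block \<theta>"
  obtains "x = \<theta>"
  | \<sigma> \<alpha> where "occ \<phi> \<sigma> \<alpha>" "\<sigma> \<noteq> []" "last \<sigma> = \<theta>" "\<not> closed_fm \<alpha>" "x = psubst (env \<sigma>) \<alpha>" "\<And>X. \<alpha> \<noteq> Var X"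
proof (cases "x = \<theta>")
  case False
  then obtain \<sigma> \<alpha> where s: "occ \<phi> \<sigma> \<alpha>" "\<sigma> \<noteq> []" "last \<sigma> = \<theta>" "\<not> closed_fm \<alpha>" "x = psubst (env \<sigma>) \<alpha>"
    using assms unfolding block_def by blast
  show thesis
  proof (cases "\<exists>X. \<alpha> = Var X")
    case True
    then obtain X where X: "\<alpha> = Var X" by blast
    then have "X \<in> bvars \<sigma>" using occ_FV[OF closed s(1)] by simp
    from occ_env[OF s(1) closed this] obtain \<sigma>' \<eta> \<psi> where e: "occ \<phi> \<sigma>' (Fix \<eta> X \<psi>)"
      "env \<sigma> X = psubst (env \<sigma>') (Fix \<eta> X \<psi>)"
      "if closed_fm (Fix \<eta> X \<psi>) then last \<sigma> = Fix \<eta> X \<psi> else \<sigma>' \<noteq> [] \<and> last \<sigma>' = last \<sigma>" by blast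
    have x: "x = psubst (env \<sigma>') (Fix \<eta> X \<psi>)" using s(5) X e(2) by simp
    show thesis
    proof (cases "closed_fm (Fix \<eta> X \<psi>)")
      case True
      then show thesis using x psubst_closed[OF True] e(3) s(3) that(1) by metis
    next
      case False
      then show thesis using that(2)[OF e(1)] x e(3) s(3) by auto
    qed
  qed (use s that(2) in blast)
qed (use that in blast)

lemma occ_size_last:
  assumes "occ \<phi> \<sigma> \<alpha>" "\<sigma> \<noteq> []" "\<not> closed_fm \<alpha>"
  shows "fm_size \<alpha> \<le> fm_size (last \<sigma>)"
proof -
  have *: "successively (<\<^sub>f) \<sigma>" "\<alpha> \<in> free_subfms (fix_body (hd \<sigma>))" "is_fix (hd \<sigma>)"
    using occ_successively[OF assms(1) closed] assms(2) by blast+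
  then have "\<alpha> <\<^sub>f hd \<sigma>" using assms(3) by (auto simp: lessf_def is_fix_def)
  then have "successively (<\<^sub>f) (\<alpha> # \<sigma>)" using *(1) assms(2) by (cases \<sigma>) auto
  then have "\<alpha> \<in> subfms (last \<sigma>)" using successively_lessf_last assms(2) by blast
  then show ?thesis by (rule fm_size_subfms_le)
qed

text \<open>Open parts stay in the same chain, and closed parts are strictly smaller than the
  eventuality. Atoms are excluded: a member of the block other than the eventuality can be taken as
  an instance of an open formula that is not a variable.\<close>

lemma block_step:
  assumes \<theta>: "occ \<phi> \<tau> (Fix Mu Z \<zeta>)" "closed_fm (Fix Mu Z \<zeta>)" and x: "x \<in> block (Fix Mu Z \<zeta>)"
  shows "case x of
      And y z \<Rightarrow> {y, z} \<subseteq> block (Fix Mu Z \<zeta>) \<union> below (Fix Mu Z \<zeta>)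
    | Or y z \<Rightarrow> {y, z} \<subseteq> block (Fix Mu Z \<zeta>) \<union> below (Fix Mu Z \<zeta>)
    | Dia a y \<Rightarrow> y \<in> block (Fix Mu Z \<zeta>) \<union> below (Fix Mu Z \<zeta>)
    | Box a y \<Rightarrow> y \<in> block (Fix Mu Z \<zeta>) \<union> below (Fix Mu Z \<zeta>)
    | Fix \<eta> X y \<Rightarrow> subst X x y \<in> block (Fix Mu Z \<zeta>) \<union> below (Fix Mu Z \<zeta>)
    | _ \<Rightarrow> False"
  using x
proof (rule block_non_Var)
  let ?\<theta> = "Fix Mu Z \<zeta>"
  assume "x = ?\<theta>"
  moreover have "occ \<phi> [?\<theta>] \<zeta>" by (rule occ.fix_closed) (fact \<theta>)+
  moreover have "Z \<in> FV \<zeta>" using Fix_subfms occ_subfms[OF \<theta>(1)] by blast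
  moreover have "subst Z ?\<theta> \<zeta> = psubst (env [?\<theta>]) \<zeta>" by (simp add: subst_eq_psubst del: psubst.simps)
  ultimately show ?thesis
    by (auto simp: block_def closed_fm_def intro!: exI[of _ "[?\<theta>]"] exI[of _ \<zeta>] simp del: env_Fix psubst.simps)
next
  let ?\<theta> = "Fix Mu Z \<zeta>"
  fix \<sigma> \<alpha> assume a: "occ \<phi> \<sigma> \<alpha>" "\<sigma> \<noteq> []" "last \<sigma> = ?\<theta>" "\<not> closed_fm \<alpha>" "x = psubst (env \<sigma>) \<alpha>" "\<And>X. \<alpha> \<noteq> Var X"
  have sz: "fm_size \<alpha> \<le> fm_size ?\<theta>" using occ_size_last[OF a(1,2,4)] a(3) by simp
  have sub: "psubst (env \<sigma>) \<beta> \<in> block ?\<theta> \<union> below ?\<theta>" if "occ \<phi> \<sigma> \<beta>" "fm_size \<beta> < fm_size \<alpha>" for \<beta>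
  proof (cases "closed_fm \<beta>")
    case True
    then have "\<beta> \<in> below ?\<theta>" using that sz unfolding below_def by auto
    then show ?thesis using psubst_closed[OF True] by simp
  next
    case False
    then show ?thesis using that a(2,3) unfolding block_def by blast
  qed
  show ?thesis
  proof (cases \<alpha>)
    case (And \<beta> \<gamma>)
    then show ?thesis using a(1,5) sub[OF occ.and1, of \<beta> \<gamma>] sub[OF occ.and2, of \<beta> \<gamma>] by simp
  next
    case (Or \<beta> \<gamma>)
    then show ?thesis using a(1,5) sub[OF occ.or1, of \<beta> \<gamma>] sub[OF occ.or2, of \<beta> \<gamma>] by simp
  next
    case (Dia b \<beta>)
    then show ?thesis using a(1,5) sub[OF occ.dia, of b \<beta>] by simp
  next
    case (Box b \<beta>)
    then show ?thesis using a(1,5) sub[OF occ.box, of b \<beta>] by simp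
  next
    case (Fix \<eta> X \<psi>)
    \<comment> \<open>Irredundance keeps the body open, so this unfolding does not leave the
      block.\<close>
    have X: "X \<in> FV \<psi>" using Fix_subfms occ_subfms[OF a(1)] Fix by blast
    obtain \<sigma>' where s: "occ \<phi> \<sigma>' \<psi>" "\<sigma>' = \<alpha> # \<sigma>"
      "subst X (psubst (env \<sigma>) (Fix \<eta> X \<psi>)) (psubst ((env \<sigma>)(X := Var X)) \<psi>) = psubst (env \<sigma>') \<psi>"
      using occ_unfold[OF closed a(1)[unfolded Fix]] a(4) Fix by metis
    have "psubst (env \<sigma>') \<psi> \<in> block ?\<theta>"
    proof -
      have "\<not> closed_fm \<psi>" using X by (auto simp: closed_fm_def)
      moreover have "last \<sigma>' = ?\<theta>" "\<sigma>' \<noteq> []" using s(2) a(2,3) by auto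
      ultimately show ?thesis unfolding block_def using s(1) by blast
    qed
    then show ?thesis using s(3) a(5) Fix by simp
  qed (use a(4,6) in \<open>auto simp: closed_fm_def\<close>)
qed

lemma fp_vars_cases: "occ \<phi> \<sigma> \<alpha> \<Longrightarrow> X \<in> FV \<alpha> \<Longrightarrow> X \<in> fp_vars Mu \<phi> \<or> X \<in> fp_vars Nu \<phi>"
proof -
  assume o: "occ \<phi> \<sigma> \<alpha>" "X \<in> FV \<alpha>"
  then obtain \<eta> \<psi> where "Fix \<eta> X \<psi> \<in> set \<sigma>" using occ_FV[OF closed, of \<sigma> \<alpha>] by (auto simp: bvars_def)
  then have "X \<in> fp_vars \<eta> \<phi>" using occ_subfms[OF o(1)] by (auto simp: fp_vars_def)
  then show ?thesis by (cases \<eta>) auto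
qed

end

section \<open>Truth in a model whose worlds are labelled by focused state nodes\<close>

locale tableau_model = tableau \<phi> G for \<phi> :: "('p, 'a, 'v) fm" and G +
  fixes K :: "('w, 'p, 'a) kripke" and lab :: "'w \<Rightarrow> ('p, 'a, 'v) fnode"
  assumes kripke: "kripke_structure K"
    and lab: "w \<in> states K \<Longrightarrow> lab w \<in> E_set G \<and> state_node (fst (lab w))"
    and val: "valuation K p = {w \<in> states K. Prop p \<in> fst (lab w)}"
    and dia: "w \<in> states K \<Longrightarrow> Dia a \<psi> \<in> fst (lab w) \<Longrightarrow>
      \<exists>w'. (w, w') \<in> trans_rel K a \<and> good_edge (lab w) (Dia a \<psi>) \<psi> (lab w')"
    and box: "(w, w') \<in> trans_rel K a \<Longrightarrow> Box a \<psi> \<in> fst (lab w) \<Longrightarrow> good_edge (lab w) (Box a \<psi>) \<psi> (lab w')"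
begin

lemma trans_states: "(w, w') \<in> trans_rel K a \<Longrightarrow> w \<in> states K \<and> w' \<in> states K"
  using kripke unfolding kripke_structure_def by blast

text \<open>Peels off the non-modal structure: truth of an entailed block formula is reduced to
  truth of those members of \<open>A\<close> that lie in the block, and whatever falls below the
  eventuality is true by \<open>H\<close>.\<close>

lemma block_holds:
  assumes \<theta>: "occ \<phi> \<tau> \<theta>" "closed_fm \<theta>" "\<theta> = Fix Mu Z \<zeta>"
    and H: "\<And>\<beta> w. \<beta> \<in> below \<theta> \<Longrightarrow> w \<in> states K \<Longrightarrow> entails (fst (lab w)) \<beta> \<Longrightarrow> holds K w \<beta>"
    and w: "w \<in> states K"
    and A: "\<And>\<chi>. \<chi> \<in> A \<Longrightarrow> entails (fst (lab w)) \<chi>" "\<And>\<chi>. \<chi> \<in> A \<Longrightarrow> \<chi> \<in> block \<theta> \<Longrightarrow> holds K w \<chi>"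
  shows "entails A \<delta> \<Longrightarrow> \<delta> \<in> block \<theta> \<union> below \<theta> \<Longrightarrow> holds K w \<delta>"
proof (induction rule: entails.induct)
  case (base \<psi>)
  then show ?case using A H w by blast
next
  case (conj \<psi> \<chi>)
  show ?case
  proof (cases "And \<psi> \<chi> \<in> below \<theta>")
    case True
    have "entails (fst (lab w)) (And \<psi> \<chi>)"
      by (rule entails_trans[OF entails.conj[OF conj.hyps]]) (rule A(1))
    then show ?thesis using H True w by blast
  next
    case False
    then have "holds K w \<psi>" "holds K w \<chi>"
      using conj block_step[OF \<theta>(1,2)[unfolded \<theta>(3)], of "And \<psi> \<chi>"] \<theta>(3) by auto
    then show ?thesis by (simp add: holds_def)
  qed
next
  case (disj1 \<psi> \<chi>)
  show ?case
  proof (cases "Or \<psi> \<chi> \<in> below \<theta>")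
    case True
    have "entails (fst (lab w)) (Or \<psi> \<chi>)"
      by (rule entails_trans[OF entails.disj1[OF disj1.hyps]]) (rule A(1))
    then show ?thesis using H True w by blast
  next
    case False
    then have "holds K w \<psi>"
      using disj1 block_step[OF \<theta>(1,2)[unfolded \<theta>(3)], of "Or \<psi> \<chi>"] \<theta>(3) by auto
    then show ?thesis by (simp add: holds_def)
  qed
next
  case (disj2 \<chi> \<psi>)
  show ?case
  proof (cases "Or \<psi> \<chi> \<in> below \<theta>")
    case True
    have "entails (fst (lab w)) (Or \<psi> \<chi>)"
      by (rule entails_trans[OF entails.disj2[OF disj2.hyps]]) (rule A(1))
    then show ?thesis using H True w by blast
  next
    case False
    then have "holds K w \<chi>"
      using disj2 block_step[OF \<theta>(1,2)[unfolded \<theta>(3)], of "Or \<psi> \<chi>"] \<theta>(3) by auto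
    then show ?thesis by (simp add: holds_def)
  qed
next
  case (unf X \<eta> \<psi>)
  show ?case
  proof (cases "Fix \<eta> X \<psi> \<in> below \<theta>")
    case True
    have "entails (fst (lab w)) (Fix \<eta> X \<psi>)"
      by (rule entails_trans[OF entails.unf[OF unf.hyps]]) (rule A(1))
    then show ?thesis using H True w by blast
  next
    case False
    then have b: "Fix \<eta> X \<psi> \<in> block \<theta>" using unf.prems by blast
    then have "subst X (Fix \<eta> X \<psi>) \<psi> \<in> block \<theta> \<union> below \<theta>"
      using block_step[OF \<theta>(1,2)[unfolded \<theta>(3)], of "Fix \<eta> X \<psi>"] \<theta>(3) by auto
    then have "holds K w (subst X (Fix \<eta> X \<psi>) \<psi>)" using unf.IH by blast
    moreover have "closed_fm (Fix \<eta> X \<psi>)"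
      using b block_subset_Df[OF \<theta>(1,2)[unfolded \<theta>(3)]] \<theta>(3) Df_subset_FL FL_closed[OF closed] by blast
    ultimately show ?thesis using sem_unfold[of \<eta> X \<psi> K "\<lambda>_. {}"] unfolding holds_def by blast
  qed
qed

lemma lab_focused:
  assumes "w \<in> states K"
  shows "fst (lab w) \<subseteq> FL \<phi> \<and> snd (lab w) \<subseteq> fst (lab w) \<and> snd (lab w) \<subseteq> Df \<phi>"
  using focused_FL[OF nodes, of "fst (lab w)" "snd (lab w)"] lab[OF assms] E_focused by auto

text \<open>The label of a world is a state node, and by \<open>block_step\<close> the block
  contains no atoms, so only diamonds and boxes remain.\<close>

lemma modal_holds:
  assumes "w \<in> states K" "\<chi> \<in> fst (lab w)" "\<chi> \<in> block \<theta>"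
    and \<theta>: "occ \<phi> \<tau> \<theta>" "closed_fm \<theta>" "\<theta> = Fix Mu Z \<zeta>"
    and suc: "\<And>w' \<psi>. w' \<in> states K \<Longrightarrow> \<psi> \<in> block \<theta> \<union> below \<theta> \<Longrightarrow> good_edge (lab w) \<chi> \<psi> (lab w') \<Longrightarrow> holds K w' \<psi>"
  shows "holds K w \<chi>"
proof -
  note st = block_step[OF \<theta>(1,2)[unfolded \<theta>(3)], of \<chi>, folded \<theta>(3), OF assms(3)]
  have "state_node (fst (lab w))" using lab assms(1) by blast
  then consider a \<psi> where "\<chi> = Dia a \<psi>" | a \<psi> where "\<chi> = Box a \<psi>"
    using assms(2) st unfolding state_node_def by fastforce
  then show ?thesis
  proof cases
    case 1
    then obtain w' where "(w, w') \<in> trans_rel K a" "good_edge (lab w) \<chi> \<psi> (lab w')"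
      using dia assms(1,2) by blast
    moreover from this have "holds K w' \<psi>" using suc[of w' \<psi>] st 1 trans_states by auto
    ultimately show ?thesis using 1 assms(1) by (auto simp: holds_def)
  next
    case 2
    have "holds K w' \<psi>" if "(w, w') \<in> trans_rel K a" for w'
      using suc[of w' \<psi>] st 2 trans_states[OF that] box[OF that] assms(2) by auto
    then show ?thesis using 2 assms(1) by (auto simp: holds_def)
  qed
qed

text \<open>A deferral that is in focus is fulfilled when the focus is exhausted. A deferral that is not in
  focus enters it at the next refocusing, which is reached since the focus gets exhausted.\<close>

lemma eventuality_holds:
  assumes \<theta>: "occ \<phi> \<tau> \<theta>" "closed_fm \<theta>" "\<theta> = Fix Mu Z \<zeta>"
    and H: "\<And>\<beta> w. \<beta> \<in> below \<theta> \<Longrightarrow> w \<in> states K \<Longrightarrow> entails (fst (lab w)) \<beta> \<Longrightarrow> holds K w \<beta>"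
    and w: "w \<in> states K" "entails (fst (lab w)) \<theta>"
  shows "holds K w \<theta>"
proof -
  have D: "block \<theta> \<subseteq> Df \<phi>" using block_subset_Df \<theta> by blast
  \<comment> \<open>Settled formulas are no deferrals, whereas the block consists of deferrals; so
    \<open>block_holds\<close> leaves no premise to be checked inside the block.\<close>
  have settled: "holds K w \<delta>" if "w \<in> states K" "entails (settled (fst (lab w))) \<delta>" "\<delta> \<in> block \<theta> \<union> below \<theta>" for w \<delta>
    by (rule block_holds[OF \<theta> H that(1) _ _ that(2,3)]) (use D in \<open>auto simp: settled_def\<close>)
  have focused: "w \<in> states K \<Longrightarrow> entails (snd (lab w) \<union> settled (fst (lab w))) \<delta> \<Longrightarrow> \<delta> \<in> block \<theta> \<union> below \<theta> \<Longrightarrow>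
      holds K w \<delta>" for w \<delta>
  proof (induction "next_rank G (lab w)" arbitrary: w \<delta> rule: less_induct)
    case less
    show ?case
    proof (rule block_holds[OF \<theta> H less.prems(1) _ _ less.prems(2,3)])
      show "entails (fst (lab w)) \<chi>" if "\<chi> \<in> snd (lab w) \<union> settled (fst (lab w))" for \<chi>
        using that lab_focused[OF less.prems(1)] by (auto simp: settled_def intro: entails.base)
    next
      fix \<chi> assume \<chi>: "\<chi> \<in> snd (lab w) \<union> settled (fst (lab w))" "\<chi> \<in> block \<theta>"
      then have e: "\<chi> \<in> snd (lab w)" using D by (auto simp: settled_def)
      show "holds K w \<chi>"
      proof (rule modal_holds[OF less.prems(1) _ \<chi>(2) \<theta>])
        show "\<chi> \<in> fst (lab w)" using e lab_focused[OF less.prems(1)] by blast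
      next
        \<comment> \<open>The edge either settles \<open>\<psi>\<close> or keeps it accounted for by
          the focus at a smaller rank.\<close>
        fix w' \<psi> assume a: "w' \<in> states K" "\<psi> \<in> block \<theta> \<union> below \<theta>" "good_edge (lab w) \<chi> \<psi> (lab w')"
        then show "holds K w' \<psi>"
          using e less.hyps[of w' \<psi>] settled[of w' \<psi>] unfolding good_edge_def by blast
      qed
    qed
  qed
  have "w \<in> states K \<Longrightarrow> entails (fst (lab w)) \<delta> \<Longrightarrow> \<delta> \<in> block \<theta> \<union> below \<theta> \<Longrightarrow> holds K w \<delta>" for w \<delta>
  proof (induction "next_rank G (lab w)" arbitrary: w \<delta> rule: less_induct)
    case less
    show ?case
    proof (rule block_holds[OF \<theta> _ less.prems(1) _ _ less.prems(2,3)])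
      fix \<chi> assume \<chi>: "\<chi> \<in> fst (lab w)" "\<chi> \<in> block \<theta>"
      show "holds K w \<chi>"
      proof (rule modal_holds[OF less.prems(1) \<chi> \<theta>])
        \<comment> \<open>Either the rank drops and the induction hypothesis applies, or
          \<open>\<psi>\<close> is covered by the focus of the successor.\<close>
        fix w' \<psi> assume a: "w' \<in> states K" "\<psi> \<in> block \<theta> \<union> below \<theta>" "good_edge (lab w) \<chi> \<psi> (lab w')"
        then show "holds K w' \<psi>"
          using less.hyps[of w' \<psi>] focused[of w' \<psi>] unfolding good_edge_def by blast
      qed
    qed (use H in \<open>auto intro: entails.base\<close>)
  qed
  then show ?thesis using w by (simp add: block_def)
qed

text \<open>Induction over formulas without free least fixpoint variables. Every least fixpoint met
  in this way is closed and goes to \<open>eventuality_holds\<close>; greatest fixpoints are treated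
  by coinduction. The interpretation \<open>i\<close> is only bounded from below, by the states that
  entail the instance of a variable, which admits the coinductive candidate.\<close>

lemma truth:
  "occ \<phi> \<tau> \<alpha> \<Longrightarrow> FV \<alpha> \<inter> fp_vars Mu \<phi> = {} \<Longrightarrow> (\<And>X. X \<in> FV \<alpha> \<Longrightarrow> closed_fm (\<rho> X)) \<Longrightarrow>
   (\<And>X w. X \<in> FV \<alpha> \<Longrightarrow> w \<in> states K \<Longrightarrow> entails (fst (lab w)) (\<rho> X) \<Longrightarrow> w \<in> i X) \<Longrightarrow>
   w \<in> states K \<Longrightarrow> entails (fst (lab w)) (psubst \<rho> \<alpha>) \<Longrightarrow> w \<in> sem K \<alpha> i"
proof (induction "fm_size \<alpha>" arbitrary: \<alpha> \<rho> i w \<tau> rule: less_induct)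
  case less
  note prems = less.prems
  have st: "state_node (fst (lab w))" using lab prems(5) by blast
  have sub: "v \<in> sem K \<beta> i" if "occ \<phi> \<tau> \<beta>" "fm_size \<beta> < fm_size \<alpha>" "FV \<beta> \<subseteq> FV \<alpha>" "v \<in> states K"
    "entails (fst (lab v)) (psubst \<rho> \<beta>)" for \<beta> v
    by (rule less.hyps[OF that(2,1) _ _ _ that(4,5)]) (use prems(2-4) that(3) in blast)+
  show ?case
  proof (cases \<alpha>)
    case Bot
    then have "Bot \<in> fst (lab w)" using prems(6) by (auto elim: entails_BotE)
    then show ?thesis using st by (auto simp: state_node_def)
  next
    case Top
    then show ?thesis using prems(5) by simp
  next
    case (Prop p)
    then have "Prop p \<in> fst (lab w)" using prems(6) by (auto elim: entails_PropE)
    then show ?thesis using Prop val prems(5) by simp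
  next
    case (NProp p)
    then have "NProp p \<in> fst (lab w)" using prems(6) by (auto elim: entails_NPropE)
    then show ?thesis using NProp val prems(5) st by (auto simp: state_node_def)
  next
    case (Var X)
    then show ?thesis using prems(4-6) by simp
  next
    case (And \<beta> \<gamma>)
    have "entails (fst (lab w)) (And (psubst \<rho> \<beta>) (psubst \<rho> \<gamma>))" using prems(6) And by simp
    then have "entails (fst (lab w)) (psubst \<rho> \<beta>) \<and> entails (fst (lab w)) (psubst \<rho> \<gamma>)"
      by (rule entails_AndE) (use st in \<open>auto simp: state_node_def\<close>)
    then show ?thesis
      using And sub[OF occ.and1[of \<phi> \<tau> \<beta> \<gamma>], of w] sub[OF occ.and2[of \<phi> \<tau> \<beta> \<gamma>], of w] prems(1,5)
      by simp
  next
    case (Or \<beta> \<gamma>)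
    have "entails (fst (lab w)) (Or (psubst \<rho> \<beta>) (psubst \<rho> \<gamma>))" using prems(6) Or by simp
    then have "entails (fst (lab w)) (psubst \<rho> \<beta>) \<or> entails (fst (lab w)) (psubst \<rho> \<gamma>)"
      by (rule entails_OrE) (use st in \<open>auto simp: state_node_def\<close>)
    then show ?thesis
      using Or sub[OF occ.or1[of \<phi> \<tau> \<beta> \<gamma>], of w] sub[OF occ.or2[of \<phi> \<tau> \<beta> \<gamma>], of w] prems(1,5)
      by auto
  next
    case (Dia a \<beta>)
    have "entails (fst (lab w)) (Dia a (psubst \<rho> \<beta>))" using prems(6) Dia by simp
    then have "Dia a (psubst \<rho> \<beta>) \<in> fst (lab w)" by (rule entails_DiaE)
    from dia[OF prems(5) this] obtain w' where w': "(w, w') \<in> trans_rel K a" "entails (fst (lab w')) (psubst \<rho> \<beta>)"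
      unfolding good_edge_def by blast
    have "w' \<in> sem K \<beta> i"
      using sub[OF occ.dia[of \<phi> \<tau> a \<beta>], of w'] Dia prems(1) trans_states[OF w'(1)] w'(2) by simp
    then show ?thesis using Dia w'(1) prems(5) by auto
  next
    case (Box a \<beta>)
    have "entails (fst (lab w)) (Box a (psubst \<rho> \<beta>))" using prems(6) Box by simp
    then have b: "Box a (psubst \<rho> \<beta>) \<in> fst (lab w)" by (rule entails_BoxE)
    have "w' \<in> sem K \<beta> i" if t: "(w, w') \<in> trans_rel K a" for w'
    proof -
      have "entails (fst (lab w')) (psubst \<rho> \<beta>)" using box[OF t b] unfolding good_edge_def by blast
      then show ?thesis using sub[OF occ.box[of \<phi> \<tau> a \<beta>], of w'] Box prems(1) trans_states[OF t] by simp
    qed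
    then show ?thesis using Box prems(5) by auto
  next
    case (Fix \<eta> X \<psi>)
    have s: "Fix \<eta> X \<psi> \<in> subfms \<phi>" using occ_subfms prems(1) Fix by blast
    show ?thesis
    proof (cases \<eta>)
      case Mu
      \<comment> \<open>A free variable would be a greatest fixpoint variable, against
        \<open>open_Fix_same\<close>.\<close>
      have cl: "closed_fm \<alpha>"
      proof (rule ccontr)
        assume "\<not> closed_fm \<alpha>"
        then obtain Y where Y: "Y \<in> FV \<alpha>" by (auto simp: closed_fm_def)
        then have "Y \<in> fp_vars Nu \<phi>" using fp_vars_cases[OF prems(1)] prems(2) by blast
        then show False using open_Fix_same[OF s, of Y Nu] Y Fix Mu by auto
      qed
      have "holds K w \<alpha>"
      proof (rule eventuality_holds[OF prems(1) cl])
        show "\<alpha> = Fix Mu X \<psi>" using Fix Mu by simp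
      next
        fix \<beta> v assume b: "\<beta> \<in> below \<alpha>" "v \<in> states K" "entails (fst (lab v)) \<beta>"
        then obtain \<tau>' where \<tau>': "closed_fm \<beta>" "occ \<phi> \<tau>' \<beta>" "fm_size \<beta> < fm_size \<alpha>" unfolding below_def by blast
        \<comment> \<open>Members of \<open>below \<alpha>\<close> are closed and smaller than
          \<open>\<alpha>\<close>, so the induction hypothesis applies with the identity
          substitution.\<close>
        have "v \<in> sem K \<beta> (\<lambda>_. {})"
          by (rule less.hyps[OF \<tau>'(3,2), of Var]) (use \<tau>'(1) b in \<open>auto simp: closed_fm_def\<close>)
        then show "holds K v \<beta>" using b(2) by (simp add: holds_def)
      qed (use prems(5,6) psubst_closed[OF cl] in auto)
      then show ?thesis using sem_closed[OF cl, of K "\<lambda>_. {}" i] by (simp add: holds_def)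
    next
      case Nu
      let ?\<chi> = "psubst \<rho> \<alpha>"
      have c\<chi>: "closed_fm ?\<chi>" by (rule closed_psubst) (rule prems(3))
      let ?S = "{w \<in> states K. entails (fst (lab w)) ?\<chi>}"
      note X = Fix_subfms[OF s]
      obtain \<tau>' where \<tau>': "occ \<phi> \<tau>' \<psi>" using occ_unfold[OF closed prems(1)[unfolded Fix]] by blast
      have unf: "subst X ?\<chi> (psubst (\<rho>(X := Var X)) \<psi>) = psubst (\<rho>(X := ?\<chi>)) \<psi>"
        by (rule subst_psubst) (use prems(3) Fix in auto)
      \<comment> \<open>The states that entail the instance form a post-fixpoint: a state node
        contains no fixpoint literal and can entail one only through its unfolding.\<close>
      have "?S \<subseteq> gfp (\<lambda>S. states K \<inter> sem K \<psi> (i(X := S)))"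
      proof (rule gfp_upperbound, rule subsetI)
        fix v assume v: "v \<in> ?S"
        then have "entails (fst (lab v)) (Fix \<eta> X (psubst (\<rho>(X := Var X)) \<psi>))" using Fix by simp
        then have e: "entails (fst (lab v)) (subst X ?\<chi> (psubst (\<rho>(X := Var X)) \<psi>))"
          by (rule entails_FixE) (use v lab[of v] Fix in \<open>auto simp: state_node_def\<close>)
        have "v \<in> sem K \<psi> (i(X := ?S))"
        proof (rule less.hyps[OF _ \<tau>', of "\<rho>(X := ?\<chi>)"])
          show "FV \<psi> \<inter> fp_vars Mu \<phi> = {}"
          proof -
            have "X \<notin> fp_vars Mu \<phi>" using not_both_fp_vars[of \<psi> X X] X Nu by blast
            then show ?thesis using prems(2) Fix by auto
          qed
          show "closed_fm ((\<rho>(X := ?\<chi>)) Y)" if "Y \<in> FV \<psi>" for Y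
            using that prems(3) c\<chi> Fix by auto
          show "u \<in> (i(X := ?S)) Y" if "Y \<in> FV \<psi>" "u \<in> states K" "entails (fst (lab u)) ((\<rho>(X := ?\<chi>)) Y)" for Y u
            using that prems(4) Fix by (cases "Y = X") auto
          show "entails (fst (lab v)) (psubst (\<rho>(X := ?\<chi>)) \<psi>)" using e unf by simp
        qed (use v Fix in auto)
        then show "v \<in> states K \<inter> sem K \<psi> (i(X := ?S))" using v by blast
      qed
      then show ?thesis using prems(5,6) Fix Nu by auto
    qed
  qed
qed

lemma root_satisfied: "w \<in> states K \<Longrightarrow> entails (fst (lab w)) \<phi> \<Longrightarrow> holds K w \<phi>"
  using truth[OF occ.root, of Var "\<lambda>_. {}" w] closed by (auto simp: closed_fm_def holds_def)

end

context tableau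
begin

lemma E_imp_satisfiable:
  assumes inf: "infinite (UNIV :: 'w set)" and root: "({\<phi>}, d) \<in> E_set G"
  shows "satisfiable TYPE('w) \<phi>"
proof -
  define V where "V = {v \<in> E_set G. state_node (fst v)}"
  have "finite V" using finite_focused[OF nodes] E_focused finite_subset unfolding V_def
    by (metis (no_types, lifting) mem_Collect_eq subsetI)
  \<comment> \<open>Only finitely many nodes become worlds, so every infinite type has room for
    them.\<close>
  then obtain W :: "'w set" where W: "finite W" "card W = card V"
    using infinite_arbitrarily_large[OF inf] by blast
  then obtain lab where lab: "bij_betw lab W V" using \<open>finite V\<close> finite_same_card_bij by metis
  have labV: "lab w \<in> V" if "w \<in> W" for w using lab that by (auto simp: bij_betw_def)
  have surj: "\<exists>w \<in> W. lab w = v" if "v \<in> V" for v using lab that by (auto simp: bij_betw_def)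
  \<comment> \<open>All pairs that respect the boxes of the source are related. The condition on
    boxes is then immediate, and \<open>good_successor\<close> provides an edge for each
    diamond.\<close>
  define edge where "edge a w w' \<longleftrightarrow> w \<in> W \<and> w' \<in> W \<and>
    (\<forall>\<psi>. Box a \<psi> \<in> fst (lab w) \<longrightarrow> good_edge (lab w) (Box a \<psi>) \<psi> (lab w'))" for a w w'
  define K :: "('w, 'p, 'a) kripke" where
    "K = \<lparr>states = W, trans_rel = (\<lambda>a. {(w, w'). edge a w w'}), valuation = (\<lambda>p. {w \<in> W. Prop p \<in> fst (lab w)})\<rparr>"
  interpret tableau_model \<phi> G K lab
  proof
    show "kripke_structure K" by (auto simp: kripke_structure_def K_def edge_def)
    show "lab w \<in> E_set G \<and> state_node (fst (lab w))" if "w \<in> states K" for w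
      using labV that by (auto simp: K_def V_def)
    show "valuation K p = {w \<in> states K. Prop p \<in> fst (lab w)}" for p by (simp add: K_def)
    show "good_edge (lab w) (Box a \<psi>) \<psi> (lab w')" if "(w, w') \<in> trans_rel K a" "Box a \<psi> \<in> fst (lab w)" for w w' a \<psi>
      using that by (simp add: K_def edge_def)
    fix w a \<psi> assume w: "w \<in> states K" "Dia a \<psi> \<in> fst (lab w)"
    then have "lab w \<in> V" using labV by (simp add: K_def)
    then obtain v' where v': "v' \<in> V" "good_edge (lab w) (Dia a \<psi>) \<psi> v'"
      "\<And>\<psi>. Box a \<psi> \<in> fst (lab w) \<Longrightarrow> good_edge (lab w) (Box a \<psi>) \<psi> v'"
      using good_successor[of "fst (lab w)" "snd (lab w)" a \<psi>] w(2) unfolding V_def by auto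
    then obtain w' where "w' \<in> W" "lab w' = v'" using surj by blast
    then show "\<exists>w'. (w, w') \<in> trans_rel K a \<and> good_edge (lab w) (Dia a \<psi>) \<psi> (lab w')"
      using v' w(1) by (auto simp: K_def edge_def)
  qed
  obtain v where "good_state ({\<phi>}, d) v" using good_state_exists[OF root] by blast
  then have "v \<in> V" "entails (fst v) \<phi>" unfolding good_state_def V_def by auto
  then obtain w where "w \<in> states K" "entails (fst (lab w)) \<phi>" using surj[of v] by (auto simp: K_def)
  then have "holds K w \<phi>" by (rule root_satisfied)
  then show ?thesis using kripke unfolding satisfiable_def holds_def by blast
qed

end

section \<open>Global caching\<close>

text \<open>De Morgan duality relative to a carrier \<open>C\<close>, because the focused nodes over
  \<open>G\<close> do not exhaust their type.\<close>

lemma gfp_complement_lfp: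
  fixes f g :: "'b set \<Rightarrow> 'b set"
  assumes "mono f" "mono g" "\<And>Y. f Y \<subseteq> C" "\<And>Y. g Y \<subseteq> C" "\<And>Y. Y \<subseteq> C \<Longrightarrow> g (C - Y) = C - f Y"
  shows "gfp g = C - lfp f"
proof (rule antisym)
  have gC: "gfp g \<subseteq> C" using gfp_unfold[OF assms(2)] assms(4) by metis
  have "C - (C - gfp g) = gfp g" using gC by blast
  then have "gfp g = C - f (C - gfp g)"
    using gfp_unfold[OF assms(2)] assms(5)[of "C - gfp g"] by auto
  then have "f (C - gfp g) \<subseteq> C - gfp g" using assms(3) by blast
  then have "lfp f \<subseteq> C - gfp g" by (rule lfp_lowerbound)
  then show "gfp g \<subseteq> C - lfp f" using gC by blast
  have "lfp f \<subseteq> C" using lfp_unfold[OF assms(1)] assms(3) by metis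
  then have "g (C - lfp f) = C - lfp f" using assms(5) lfp_unfold[OF assms(1)] by metis
  then show "C - lfp f \<subseteq> gfp g" by (intro gfp_upperbound) simp
qed

lemma A_set_mono: "G \<subseteq> G' \<Longrightarrow> A_set G \<subseteq> A_set G'"
  unfolding A_set_def by (intro lfp_mono gfp_mono g_hat_mono) auto

text \<open>Closure under the rules makes the two operators dual: a conclusion whose label lies
  outside \<open>G\<close> would belong neither to \<open>Y\<close> nor to its complement in the
  carrier.\<close>

lemma g_hat_complement:
  assumes "concl_closed G" "X \<subseteq> focused_nodes G" "Y \<subseteq> focused_nodes G"
  shows "g_hat G (focused_nodes G - X) (focused_nodes G - Y) = focused_nodes G - f_hat G X Y"
proof (rule set_eqI)
  fix v :: "('a, 'b, 'c) fnode"
  obtain \<Delta> d where v: "v = (\<Delta>, d)" by (cases v)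
  show "v \<in> g_hat G (focused_nodes G - X) (focused_nodes G - Y) \<longleftrightarrow> v \<in> focused_nodes G - f_hat G X Y"
  proof (cases "v \<in> focused_nodes G")
    case True
    then have "\<Delta> \<in> G" by (auto simp: v focused_nodes_def)
    then have "(fst c, track d c) \<in> focused_nodes G" if "\<Sigma> \<in> concl \<Delta>" "c \<in> \<Sigma>" for \<Sigma> c
      using concl_closed_focused[OF assms(1)] that by blast
    then show ?thesis using True unfolding v Diff_iff f_hat_iff g_hat_iff by (cases "d = {}") auto
  next
    case False
    then show ?thesis unfolding v Diff_iff g_hat_iff by blast
  qed
qed

context admissible
begin

lemma A_set_eq:
  assumes "concl_closed G"
  shows "A_set G = focused_nodes G - E_set G"
proof -
  let ?C = "focused_nodes G"
  have inner: "gfp (g_hat G (?C - X)) = ?C - lfp (f_hat G X)" if "X \<subseteq> ?C" for X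
  proof (rule gfp_complement_lfp)
    show "g_hat G (?C - X) (?C - Y) = ?C - f_hat G X Y" if "Y \<subseteq> ?C" for Y
      by (rule g_hat_complement) (use assms that \<open>X \<subseteq> ?C\<close> in auto)
  qed (rule mono_f_hat mono_g_hat f_hat_focused g_hat_focused)+
  have fC: "lfp (f_hat G X) \<subseteq> ?C" for X using lfp_unfold[OF mono_f_hat(1)] f_hat_focused by metis
  have gC: "gfp (g_hat G X) \<subseteq> ?C" for X using gfp_unfold[OF mono_g_hat(1)] g_hat_focused by metis
  \<comment> \<open>For the outer fixpoints the roles are exchanged: here the least fixpoint is on
    the side of \<open>g_hat\<close>.\<close>
  have "gfp (\<lambda>X. lfp (f_hat G X)) = ?C - lfp (\<lambda>X. gfp (g_hat G X))"
  proof (rule gfp_complement_lfp)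
    show "lfp (f_hat G (?C - Y)) = ?C - gfp (g_hat G Y)" if "Y \<subseteq> ?C" for Y
    proof -
      have "?C - (?C - Y) = Y" using that by blast
      then show ?thesis using inner[of "?C - Y"] fC[of "?C - Y"] by auto
    qed
  qed (rule mono_f_hat mono_g_hat fC gC)+
  moreover have "lfp (\<lambda>X. gfp (g_hat G X)) \<subseteq> ?C" using lfp_unfold[OF mono_g_hat(2)] gC by metis
  ultimately show ?thesis unfolding A_set_def E_set_def by blast
qed

section \<open>Invariant, answers and termination of the loop\<close>

definition gc_inv :: "('p, 'a, 'v) fm set set \<Rightarrow> ('p, 'a, 'v) fm set set \<Rightarrow> bool" where
  "gc_inv G U \<longleftrightarrow> G \<union> U \<subseteq> Pow (FL \<phi>) \<and> G \<inter> U = {} \<and> U \<noteq> {} \<and> {\<phi>} \<in> G \<union> U \<and>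
     (\<forall>\<Delta> \<in> G. \<forall>\<Sigma> \<in> concl \<Delta>. \<forall>c \<in> \<Sigma>. fst c \<in> G \<union> U)"

lemma gc_inv_init: "gc_inv {} {{\<phi>}}"
  by (simp add: gc_inv_def FL_root)

text \<open>The invariant except for the nonemptiness of the set of unexpanded nodes, so that the
  last iteration is covered as well.\<close>

lemma gc_inv_expand:
  assumes "gc_inv G U" "t \<in> U" "U' = expand_unexpanded G U t"
  shows "insert t G \<union> U' \<subseteq> Pow (FL \<phi>) \<and> insert t G \<inter> U' = {} \<and> {\<phi>} \<in> insert t G \<union> U' \<and>
    (\<forall>\<Delta> \<in> insert t G. \<forall>\<Sigma> \<in> concl \<Delta>. \<forall>c \<in> \<Sigma>. fst c \<in> insert t G \<union> U')"
proof (intro conjI)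
  have t: "t \<subseteq> FL \<phi>" "t \<notin> G" using assms(1,2) unfolding gc_inv_def by blast+
  have "fst ` \<Union> (concl t) \<subseteq> Pow (FL \<phi>)" using concl_FL[OF t(1)] by blast
  then show "insert t G \<union> U' \<subseteq> Pow (FL \<phi>)"
    using assms t unfolding gc_inv_def expand_unexpanded_def by blast
  show "insert t G \<inter> U' = {}" using assms unfolding gc_inv_def expand_unexpanded_def by blast
  show "{\<phi>} \<in> insert t G \<union> U'" using assms unfolding gc_inv_def expand_unexpanded_def by blast
  show "\<forall>\<Delta> \<in> insert t G. \<forall>\<Sigma> \<in> concl \<Delta>. \<forall>c \<in> \<Sigma>. fst c \<in> insert t G \<union> U'"
  proof (intro ballI)
    fix \<Delta> \<Sigma> c assume *: "\<Delta> \<in> insert t G" "\<Sigma> \<in> concl \<Delta>" "c \<in> \<Sigma>"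
    show "fst c \<in> insert t G \<union> U'"
    proof (cases "\<Delta> = t")
      case True
      then have "fst c \<in> fst ` \<Union> (concl t)" using * by blast
      then show ?thesis using assms(3) unfolding expand_unexpanded_def by blast
    next
      case False
      then have "fst c \<in> G \<union> U" using * assms(1) unfolding gc_inv_def by blast
      then show ?thesis using assms(3) unfolding expand_unexpanded_def by blast
    qed
  qed
qed

lemma E_sound:
  assumes "infinite (UNIV :: 'w set)" "G \<subseteq> Pow (FL \<phi>)" "({\<phi>}, d) \<in> E_set G"
  shows "satisfiable TYPE('w) \<phi>"
proof -
  interpret tableau \<phi> G by unfold_locales (rule assms(2))
  show ?thesis using E_imp_satisfiable[OF assms(1,3)] .
qed

lemma gc_step_correct:
  assumes inf: "infinite (UNIV :: 'w set)" and inv: "gc_inv G U" and st: "gc_step \<phi> (Running G U) r"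
  shows "case r of Running G' U' \<Rightarrow> gc_inv G' U' \<and> (\<exists>t \<in> U. t \<notin> G \<and> G' = insert t G)
    | Answer b \<Rightarrow> b \<longleftrightarrow> satisfiable TYPE('w) \<phi>"
  using st
proof cases
  case (continue t)
  then show ?thesis using gc_inv_expand[OF inv continue(2) refl] inv unfolding gc_inv_def by auto
next
  case (early_yes t)
  then show ?thesis
    using E_sound[OF inf, of "insert t G"] gc_inv_expand[OF inv early_yes(2) refl] by auto
next
  case (early_no t)
  have "insert t G \<subseteq> Pow (FL \<phi>)" using gc_inv_expand[OF inv early_no(2) refl] by blast
  then have "({\<phi>}, deferrals {\<phi>}) \<in> A_set (Pow (FL \<phi>))" using early_no(3) A_set_mono[of "insert t G"] by blast
  then have "({\<phi>}, deferrals {\<phi>}) \<notin> E_set (Pow (FL \<phi>))"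
    unfolding A_set_eq[OF concl_closed_Pow_FL] by blast
  then have "\<not> satisfiable TYPE('w) \<phi>"
    using satisfiable_imp_E[OF _ order_refl concl_closed_Pow_FL] FL_root by blast
  then show ?thesis using early_no by simp
next
  case (final t)
  have c: "insert t G \<subseteq> Pow (FL \<phi>)" "{\<phi>} \<in> insert t G" "concl_closed (insert t G)"
    using gc_inv_expand[OF inv final(2) refl] unfolding final(3) concl_closed_def by auto
  have "({\<phi>}, deferrals {\<phi>}) \<in> E_set (insert t G) \<longleftrightarrow> satisfiable TYPE('w) \<phi>"
    using E_sound[OF inf c(1)] satisfiable_imp_E[OF _ c(1,3,2)] by blast
  then show ?thesis using final by simp
qed

lemma gc_reachable:
  assumes inf: "infinite (UNIV :: 'w set)" and "(gc_step \<phi>)\<^sup>*\<^sup>* (gc_init \<phi>) r"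
  shows "case r of Running G U \<Rightarrow> gc_inv G U | Answer b \<Rightarrow> b \<longleftrightarrow> satisfiable TYPE('w) \<phi>"
  using assms(2)
proof (induction rule: rtranclp_induct)
  case base
  then show ?case by (simp add: gc_init_def gc_inv_init)
next
  case (step r r')
  then obtain G U where r: "r = Running G U" by (auto elim: gc_step.cases)
  then show ?case using gc_step_correct[OF inf, of G U r'] step by (auto split: gc_conf.splits)
qed

lemma gc_progress: "gc_inv G U \<Longrightarrow> \<exists>r. gc_step \<phi> (Running G U) r"
proof -
  assume "gc_inv G U"
  then obtain t where t: "t \<in> U" unfolding gc_inv_def by blast
  show ?thesis
  proof (cases "expand_unexpanded G U t = {}")
    case True
    from gc_step.final[OF t this] show ?thesis by blast
  next
    case False
    from gc_step.continue[OF t this] show ?thesis by blast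
  qed
qed

lemma gc_terminates: "\<nexists>s. s 0 = gc_init \<phi> \<and> (\<forall>i::nat. gc_step \<phi> (s i) (s (Suc i)))"
proof
  assume "\<exists>s. s 0 = gc_init \<phi> \<and> (\<forall>i::nat. gc_step \<phi> (s i) (s (Suc i)))"
  then obtain s where s: "s 0 = gc_init \<phi>" "\<And>i. gc_step \<phi> (s i) (s (Suc i))" by blast
  have run: "\<exists>G U. s i = Running G U" for i using s(2)[of i] by (auto elim: gc_step.cases)
  have "\<exists>G U. s i = Running G U \<and> gc_inv G U \<and> i \<le> card G" for i
  proof (induction i)
    case 0
    then show ?case using s(1) gc_inv_init by (simp add: gc_init_def)
  next
    case (Suc i)
    then obtain G U where G: "s i = Running G U" "gc_inv G U" "i \<le> card G" by blast
    obtain G' U' where G': "s (Suc i) = Running G' U'" using run by blast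
    \<comment> \<open>Correctness is stated for an infinite type of worlds, and \<open>nat\<close>
      is one. Each step adds a fresh node, which maintains \<open>i \<le> card G\<close>.\<close>
    have "gc_inv G' U' \<and> (\<exists>t \<in> U. t \<notin> G \<and> G' = insert t G)"
      using gc_step_correct[OF infinite_UNIV_nat G(2), of "s (Suc i)"] s(2)[of i] G(1) G' by simp
    moreover have "finite G"
      by (rule finite_subset[of _ "Pow (FL \<phi>)"]) (use G(2) finite_FL in \<open>auto simp: gc_inv_def\<close>)
    ultimately show ?case using G(3) G' by auto
  qed
  then obtain G U where "gc_inv G U" "Suc (card (Pow (FL \<phi>))) \<le> card G" by blast
  moreover have "card G \<le> card (Pow (FL \<phi>))"
    using calculation(1) finite_FL by (intro card_mono) (auto simp: gc_inv_def)
  ultimately show False by simp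
qed

end

section \<open>Values computed by the program\<close>

lemma val_time_simps [simp]:
  "val (ret x) = x" "time (ret x) = 0"
  "val (tick s) = val s" "time (tick s) = Suc (time s)"
  "val (bind_tm s k) = val (k (val s))" "time (bind_tm s k) = time s + time (k (val s))"
  by (simp_all add: ret_def tick_def bind_tm_def split: tm.splits)

lemma val_map_tm [simp]: "val (map_tm f xs) = map (\<lambda>x. val (f x)) xs"
  by (induction xs) simp_all

lemma val_filter_tm [simp]: "val (filter_tm P xs) = filter (\<lambda>x. val (P x)) xs"
  by (induction xs) simp_all

lemma val_all_tm [simp]: "val (all_tm P xs) \<longleftrightarrow> (\<forall>x \<in> set xs. val (P x))"
  by (induction xs) simp_all

lemma val_ex_tm [simp]: "val (ex_tm P xs) \<longleftrightarrow> (\<exists>x \<in> set xs. val (P x))"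
  by (induction xs) simp_all

lemma val_append_tm [simp]: "val (append_tm xs ys) = xs @ ys"
  by (induction xs) simp_all

lemma val_concat_tm [simp]: "val (concat_tm xss) = concat xss"
  by (induction xss) simp_all

lemma val_nth_tm [simp]: "i < length xs \<Longrightarrow> val (nth_tm xs i) = xs ! i"
  by (induction xs arbitrary: i) (auto split: nat.splits)

lemma val_mem_tm [simp]: "val (mem_tm eq x xs) \<longleftrightarrow> (\<exists>y \<in> set xs. val (eq x y))"
  by (simp add: mem_tm_def)

lemma val_remove_tm [simp]: "val (remove_tm eq x xs) = filter (\<lambda>y. \<not> val (eq x y)) xs"
  by (simp add: remove_tm_def)

lemma val_seteq_tm [simp]:
  "val (seteq_tm eq xs ys) \<longleftrightarrow>
    (\<forall>x \<in> set xs. \<exists>y \<in> set ys. val (eq x y)) \<and> (\<forall>y \<in> set ys. \<exists>x \<in> set xs. val (eq y x))"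
  by (simp add: seteq_tm_def)

lemma val_iterate_tm [simp]: "val (iterate_tm F cs s) = ((\<lambda>s. val (F s)) ^^ length cs) s"
  by (induction cs arbitrary: s) (simp_all add: funpow_Suc_right del: funpow.simps)

lemma union_tm_subset: "set (val (union_tm eq xs ys)) \<subseteq> set xs \<union> set ys"
  by (induction xs) auto

lemma length_union_tm: "length (val (union_tm eq xs ys)) \<le> length xs + length ys"
  by (induction xs) auto

text \<open>\<open>f\<close> sends a representation to what it denotes, \<open>id\<close> for
  formulas and \<open>set\<close> for nodes, so lists are compared up to denotation only.\<close>

lemma image_union_tm:
  assumes "\<And>x y. val (eq x y) \<longleftrightarrow> f x = f y"
  shows "f ` set (val (union_tm eq xs ys)) = f ` set xs \<union> f ` set ys"
  by (induction xs) (use assms in \<open>auto; metis imageI\<close>)+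

lemma distinct_union_tm:
  assumes "\<And>x y. val (eq x y) \<longleftrightarrow> f x = f y" "distinct (map f ys)"
  shows "distinct (map f (val (union_tm eq xs ys)))"
  by (induction xs) (use assms in auto)

lemma val_eq_atom_tm [simp]: "val (eq_atom_tm x y) \<longleftrightarrow> x = y"
  by (simp add: eq_atom_tm_def)

lemma val_eq_fm_tm [simp]: "val (eq_fm_tm \<psi> \<chi>) \<longleftrightarrow> \<psi> = \<chi>"
proof (induction \<psi> arbitrary: \<chi>)
  case Bot
  then show ?case by (cases \<chi>) simp_all
next
  case Top
  then show ?case by (cases \<chi>) simp_all
next
  case (Prop p)
  then show ?case by (cases \<chi>) simp_all
next
  case (NProp p)
  then show ?case by (cases \<chi>) simp_all
next
  case (Var X)
  then show ?case by (cases \<chi>) simp_all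
next
  case (And \<psi> \<psi>')
  then show ?case by (cases \<chi>) simp_all
next
  case (Or \<psi> \<psi>')
  then show ?case by (cases \<chi>) simp_all
next
  case (Dia a \<psi>)
  then show ?case by (cases \<chi>) simp_all
next
  case (Box a \<psi>)
  then show ?case by (cases \<chi>) simp_all
next
  case (Fix \<eta> X \<psi>)
  then show ?case by (cases \<chi>) auto
qed

lemma val_eq_node_tm: "val (eq_node_tm \<Gamma> \<Gamma>') \<longleftrightarrow> set \<Gamma> = set \<Gamma>'"
  by auto

lemma set_union_fm [simp]: "set (val (union_tm eq_fm_tm xs ys)) = set xs \<union> set ys"
  using image_union_tm[of eq_fm_tm id] by simp

lemma distinct_union_fm: "distinct ys \<Longrightarrow> distinct (val (union_tm eq_fm_tm xs ys))"
  using distinct_union_tm[of eq_fm_tm id] by simp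

lemma set_fv_tm [simp]: "set (val (fv_tm \<alpha>)) = FV \<alpha>"
  by (induction \<alpha>) auto

lemma fv_tm_Nil [simp]: "val (fv_tm \<alpha>) = [] \<longleftrightarrow> closed_fm \<alpha>"
  unfolding closed_fm_def by (metis set_fv_tm set_empty)

lemma val_subst_tm [simp]: "val (subst_tm X \<chi> \<psi>) = subst X \<chi> \<psi>"
  by (induction \<psi>) simp_all

lemma sublists_tm_props:
  "set ` set (val (sublists_tm xs)) = Pow (set xs)"
  "ys \<in> set (val (sublists_tm xs)) \<Longrightarrow> set ys \<subseteq> set xs \<and> length ys \<le> length xs \<and> (distinct xs \<longrightarrow> distinct ys)"
  "length (val (sublists_tm xs)) = 2 ^ length xs"
proof (induction xs arbitrary: ys)
  case (Cons x xs)
  {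
    case 1
    have "set ` set (val (sublists_tm (x # xs))) =
        insert x ` (set ` set (val (sublists_tm xs))) \<union> set ` set (val (sublists_tm xs))"
      by (simp add: image_Un image_image)
    then show ?case using Cons.IH(1) by (simp add: Pow_insert Un_commute)
  next
    case 2
    then consider "ys \<in> set (val (sublists_tm xs))" | zs where "zs \<in> set (val (sublists_tm xs))" "ys = x # zs"
      by auto
    then show ?case using Cons.IH(2) by cases fastforce+
  next
    case 3
    then show ?case using Cons.IH(3) by simp
  }
qed auto

section \<open>Correctness of the computed list of deferrals\<close>

definition lit :: "('p, 'a, 'v) fm \<Rightarrow> 'v \<times> ('p, 'a, 'v) fm" where
  "lit \<chi> = (case \<chi> of Fix \<eta> X \<psi> \<Rightarrow> (X, \<chi>) | _ \<Rightarrow> (undefined, \<chi>))"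

lemma lit_Fix [simp]: "lit (Fix \<eta> X \<psi>) = (X, Fix \<eta> X \<psi>)"
  by (simp add: lit_def)

lemma val_apply_unfolding_tm:
  "\<forall>\<chi> \<in> set \<sigma>. is_fix \<chi> \<Longrightarrow> val (apply_unfolding_tm (map lit \<sigma>) \<alpha>) = apply_unfolding \<sigma> \<alpha>"
  by (induction \<sigma> arbitrary: \<alpha>) (auto simp: is_fix_def)

lemma val_open_instance_tm:
  "\<forall>\<chi> \<in> set \<sigma>. is_fix \<chi> \<Longrightarrow>
   val (open_instance_tm (map lit \<sigma>) \<alpha>) = (if closed_fm \<alpha> then [] else [apply_unfolding \<sigma> \<alpha>])"
  using val_apply_unfolding_tm[of \<sigma> \<alpha>] by (simp add: open_instance_tm_def)

definition open_instances :: "('p, 'a, 'v) fm list \<Rightarrow> ('p, 'a, 'v) fm \<Rightarrow> ('p, 'a, 'v) fm set" where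
  "open_instances \<sigma> \<alpha> = (if closed_fm \<alpha> then {} else {apply_unfolding \<sigma> \<alpha>})"

lemma set_collect_deferrals:
  assumes "\<forall>\<chi> \<in> set \<sigma>. is_fix \<chi>"
  shows "set (val (collect_deferrals_tm (Var X) (map lit \<sigma>))) = open_instances \<sigma> (Var X)"
    "set (val (collect_deferrals_tm (And \<alpha> \<beta>) (map lit \<sigma>))) = open_instances \<sigma> (And \<alpha> \<beta>) \<union>
      set (val (collect_deferrals_tm \<alpha> (map lit \<sigma>))) \<union> set (val (collect_deferrals_tm \<beta> (map lit \<sigma>)))"
    "set (val (collect_deferrals_tm (Or \<alpha> \<beta>) (map lit \<sigma>))) = open_instances \<sigma> (Or \<alpha> \<beta>) \<union>
      set (val (collect_deferrals_tm \<alpha> (map lit \<sigma>))) \<union> set (val (collect_deferrals_tm \<beta> (map lit \<sigma>)))"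
    "set (val (collect_deferrals_tm (Dia a \<alpha>) (map lit \<sigma>))) = open_instances \<sigma> (Dia a \<alpha>) \<union>
      set (val (collect_deferrals_tm \<alpha> (map lit \<sigma>)))"
    "set (val (collect_deferrals_tm (Box a \<alpha>) (map lit \<sigma>))) = open_instances \<sigma> (Box a \<alpha>) \<union>
      set (val (collect_deferrals_tm \<alpha> (map lit \<sigma>)))"
    "set (val (collect_deferrals_tm (Fix \<eta> X \<psi>) (map lit \<sigma>))) = (if closed_fm (Fix \<eta> X \<psi>) then {}
      else open_instances \<sigma> (Fix \<eta> X \<psi>) \<union> set (val (collect_deferrals_tm \<psi> (map lit (Fix \<eta> X \<psi> # \<sigma>)))))"
  using val_open_instance_tm[OF assms] by (auto simp: open_instances_def)

lemma open_instances_collect_deferrals: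
  assumes "\<forall>\<chi> \<in> set \<sigma>. is_fix \<chi>"
  shows "open_instances \<sigma> \<alpha> \<subseteq> set (val (collect_deferrals_tm \<alpha> (map lit \<sigma>)))"
proof (cases \<alpha>)
  case (Fix \<eta> X \<psi>)
  show ?thesis unfolding Fix set_collect_deferrals[OF assms] by (simp add: open_instances_def)
qed (auto simp: set_collect_deferrals[OF assms] open_instances_def closed_fm_def
    simp del: collect_deferrals_tm.simps(5-9))

context admissible
begin

lemma open_instances_Df:
  "occ \<phi> \<sigma> \<alpha> \<Longrightarrow> \<sigma> \<noteq> [] \<Longrightarrow> last \<sigma> = Fix Mu Z \<zeta> \<Longrightarrow> open_instances \<sigma> \<alpha> \<subseteq> Df \<phi>"
  using occ_apply_unfolding[OF _ clean, of \<sigma> \<alpha>] unfolding open_instances_def Df_def by auto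

lemma collect_deferrals_subset_Df:
  "occ \<phi> \<sigma> \<alpha> \<Longrightarrow> \<sigma> \<noteq> [] \<Longrightarrow> last \<sigma> = Fix Mu Z \<zeta> \<Longrightarrow> set (val (collect_deferrals_tm \<alpha> (map lit \<sigma>))) \<subseteq> Df \<phi>"
proof (induction \<alpha> arbitrary: \<sigma>)
  case (Var X)
  have fx: "\<forall>\<chi> \<in> set \<sigma>. is_fix \<chi>" using occ_subfms[OF Var.prems(1)] by blast
  show ?case unfolding set_collect_deferrals[OF fx] using open_instances_Df[OF Var.prems] .
next
  case (And \<alpha> \<beta>)
  have fx: "\<forall>\<chi> \<in> set \<sigma>. is_fix \<chi>" using occ_subfms[OF And.prems(1)] by blast
  show ?case
    unfolding set_collect_deferrals[OF fx] using open_instances_Df[OF And.prems]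
      And.IH(1)[OF occ.and1[OF And.prems(1)] And.prems(2,3)]
      And.IH(2)[OF occ.and2[OF And.prems(1)] And.prems(2,3)] by simp
next
  case (Or \<alpha> \<beta>)
  have fx: "\<forall>\<chi> \<in> set \<sigma>. is_fix \<chi>" using occ_subfms[OF Or.prems(1)] by blast
  show ?case
    unfolding set_collect_deferrals[OF fx] using open_instances_Df[OF Or.prems]
      Or.IH(1)[OF occ.or1[OF Or.prems(1)] Or.prems(2,3)]
      Or.IH(2)[OF occ.or2[OF Or.prems(1)] Or.prems(2,3)] by simp
next
  case (Dia a \<alpha>)
  have fx: "\<forall>\<chi> \<in> set \<sigma>. is_fix \<chi>" using occ_subfms[OF Dia.prems(1)] by blast
  show ?case
    unfolding set_collect_deferrals[OF fx] using open_instances_Df[OF Dia.prems]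
      Dia.IH[OF occ.dia[OF Dia.prems(1)] Dia.prems(2,3)] by simp
next
  case (Box a \<alpha>)
  have fx: "\<forall>\<chi> \<in> set \<sigma>. is_fix \<chi>" using occ_subfms[OF Box.prems(1)] by blast
  show ?case
    unfolding set_collect_deferrals[OF fx] using open_instances_Df[OF Box.prems]
      Box.IH[OF occ.box[OF Box.prems(1)] Box.prems(2,3)] by simp
next
  case (Fix \<eta> X \<psi>)
  have fx: "\<forall>\<chi> \<in> set \<sigma>. is_fix \<chi>" using occ_subfms[OF Fix.prems(1)] by blast
  have "set (val (collect_deferrals_tm \<psi> (map lit (Fix \<eta> X \<psi> # \<sigma>)))) \<subseteq> Df \<phi>" if "\<not> closed_fm (Fix \<eta> X \<psi>)"
    by (rule Fix.IH[OF occ.fix_open[OF Fix.prems(1) that]]) (use Fix.prems in auto)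
  then show ?case unfolding set_collect_deferrals[OF fx] using open_instances_Df[OF Fix.prems] by simp
qed auto

lemma all_deferrals_subset_Df: "occ \<phi> \<sigma> \<alpha> \<Longrightarrow> set (val (all_deferrals_tm \<alpha>)) \<subseteq> Df \<phi>"
proof (induction \<alpha> arbitrary: \<sigma>)
  case (And \<alpha> \<beta>)
  then show ?case using And.IH(1)[OF occ.and1[OF And.prems]] And.IH(2)[OF occ.and2[OF And.prems]] by simp
next
  case (Or \<alpha> \<beta>)
  then show ?case using Or.IH(1)[OF occ.or1[OF Or.prems]] Or.IH(2)[OF occ.or2[OF Or.prems]] by simp
next
  case (Dia a \<alpha>)
  then show ?case using Dia.IH[OF occ.dia[OF Dia.prems]] by simp
next
  case (Box a \<alpha>)
  then show ?case using Box.IH[OF occ.box[OF Box.prems]] by simp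
next
  case (Fix \<eta> X \<psi>)
  have 1: "set (val (all_deferrals_tm \<psi>)) \<subseteq> Df \<phi>"
    using Fix.IH occ_unfold[OF closed Fix.prems] by metis
  have 2: "set (val (collect_deferrals_tm \<psi> [(X, Fix Mu X \<psi>)])) \<subseteq> Df \<phi>" if "\<eta> = Mu" "closed_fm (Fix \<eta> X \<psi>)"
    using collect_deferrals_subset_Df[OF occ.fix_closed[OF Fix.prems that(2)]] that(1) by simp
  have v: "val (fv_tm (Fix \<eta> X \<psi>)) = [] \<longleftrightarrow> closed_fm (Fix \<eta> X \<psi>)" by (rule fv_tm_Nil)
  show ?case using 1 2 by (auto simp: v simp del: fv_tm.simps)
qed auto

text \<open>What is collected at an occurrence is also collected at the end of its chain. The
  induction starts at a closed literal, where the chain is the eventuality alone; afterwards the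
  collection for a part is included in that for the whole.\<close>

lemma collect_deferrals_complete:
  "occ \<phi> \<sigma> \<alpha> \<Longrightarrow> \<sigma> \<noteq> [] \<Longrightarrow> last \<sigma> = Fix \<eta> X \<psi> \<Longrightarrow>
   set (val (collect_deferrals_tm \<alpha> (map lit \<sigma>))) \<subseteq> set (val (collect_deferrals_tm \<psi> [(X, Fix \<eta> X \<psi>)]))"
proof (induction rule: occ.induct)
  case (fix_open \<sigma> \<eta>' Y \<alpha>)
  have ne: "\<sigma> \<noteq> []"
    using occ_FV[OF closed fix_open.hyps(1)] fix_open.hyps(2) by (auto simp: closed_fm_def)
  have fx: "\<forall>\<chi> \<in> set \<sigma>. is_fix \<chi>" using occ_subfms[OF fix_open.hyps(1)] by blast
  have "set (val (collect_deferrals_tm (Fix \<eta>' Y \<alpha>) (map lit \<sigma>))) \<subseteq>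
      set (val (collect_deferrals_tm \<psi> [(X, Fix \<eta> X \<psi>)]))"
    using fix_open.IH fix_open.prems ne by simp
  then show ?case unfolding set_collect_deferrals[OF fx] using fix_open.hyps(2) by simp
qed (simp_all add: set_collect_deferrals occ_subfms[THEN conjunct2])

lemma all_deferrals_complete:
  "Fix Mu X \<psi> \<in> subfms \<alpha> \<Longrightarrow> closed_fm (Fix Mu X \<psi>) \<Longrightarrow>
   set (val (collect_deferrals_tm \<psi> [(X, Fix Mu X \<psi>)])) \<subseteq> set (val (all_deferrals_tm \<alpha>))"
proof (induction \<alpha>)
  case (Fix \<eta> Y \<zeta>)
  have v: "val (fv_tm (Fix \<eta> Y \<zeta>)) = [] \<longleftrightarrow> closed_fm (Fix \<eta> Y \<zeta>)" by (rule fv_tm_Nil)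
  show ?case
  proof (cases "Fix Mu X \<psi> = Fix \<eta> Y \<zeta>")
    case True
    then show ?thesis using Fix.prems(2) by (auto simp: v simp del: fv_tm.simps)
  next
    case False
    then have "set (val (collect_deferrals_tm \<psi> [(X, Fix Mu X \<psi>)])) \<subseteq> set (val (all_deferrals_tm \<zeta>))"
      using Fix by auto
    then show ?thesis by (auto simp del: fv_tm.simps)
  qed
qed auto

lemma set_all_deferrals: "set (val (all_deferrals_tm \<phi>)) = Df \<phi>"
proof
  show "set (val (all_deferrals_tm \<phi>)) \<subseteq> Df \<phi>" using all_deferrals_subset_Df[OF occ.root] .
  show "Df \<phi> \<subseteq> set (val (all_deferrals_tm \<phi>))"
  proof
    fix x assume "x \<in> Df \<phi>"
    then obtain \<sigma> \<alpha> X \<psi> where x: "x = psubst (env \<sigma>) \<alpha>" "occ \<phi> \<sigma> \<alpha>" "\<sigma> \<noteq> []" "last \<sigma> = Fix Mu X \<psi>" "\<not> closed_fm \<alpha>"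
      unfolding Df_def by blast
    have fx: "\<forall>\<chi> \<in> set \<sigma>. is_fix \<chi>" using occ_subfms[OF x(2)] by blast
    have "x \<in> set (val (collect_deferrals_tm \<alpha> (map lit \<sigma>)))"
      using open_instances_collect_deferrals[OF fx, of \<alpha>] occ_apply_unfolding[OF x(2) clean] x(1,5)
      by (simp add: open_instances_def)
    then have c: "x \<in> set (val (collect_deferrals_tm \<psi> [(X, Fix Mu X \<psi>)]))"
      using collect_deferrals_complete[OF x(2-4)] by blast
    have "closed_fm (Fix Mu X \<psi>)" "Fix Mu X \<psi> \<in> subfms \<phi>"
      using occ_last[OF x(2) closed x(3)] x(4) occ_subfms[OF x(2)] x(3) last_in_set by metis+
    then show "x \<in> set (val (all_deferrals_tm \<phi>))" using all_deferrals_complete[of X \<psi> \<phi>] c by auto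
  qed
qed

end

declare eq_fm_tm.simps [simp del]

section \<open>Correctness of the computed rules\<close>

lemma val_proj_tm [simp]:
  "(\<lambda>x. val (case x of (_, \<psi>) \<Rightarrow> tick (ret \<psi>))) = snd" "(\<lambda>x. val (case x of (\<Gamma>, _) \<Rightarrow> tick (ret \<Gamma>))) = fst"
  by auto

definition concl_of :: "('p, 'a, 'v) conclusion_rep \<Rightarrow> ('p, 'a, 'v) conclusion" where
  "concl_of c = (set (fst c), set (snd c))"

definition node_of :: "('p, 'a, 'v) fnode_rep \<Rightarrow> ('p, 'a, 'v) fnode" where
  "node_of v = (set (fst v), set (snd v))"

lemma concl_of_replace_tm: "concl_of (val (replace_tm \<Delta> \<chi> \<Theta>)) = replace (set \<Delta>) \<chi> (set \<Theta>)"
  by (auto simp: concl_of_def replace_tm_def replace_def)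

lemma rules_of_nonmodal:
  "(\<Union>\<chi> \<in> set \<Delta>. (\<lambda>\<Sigma>. concl_of ` set \<Sigma>) ` set (val (nonmodal_rules_tm \<Delta> \<chi>))) = nonmodal_rules (set \<Delta>)"
proof (rule set_eqI, rule iffI)
  fix R assume "R \<in> (\<Union>\<chi> \<in> set \<Delta>. (\<lambda>\<Sigma>. concl_of ` set \<Sigma>) ` set (val (nonmodal_rules_tm \<Delta> \<chi>)))"
  then obtain \<chi> \<Sigma> where *: "\<chi> \<in> set \<Delta>" "\<Sigma> \<in> set (val (nonmodal_rules_tm \<Delta> \<chi>))" "R = concl_of ` set \<Sigma>" by blast
  show "R \<in> nonmodal_rules (set \<Delta>)"
  proof (cases \<chi>)
    case Bot
    then show ?thesis using * nonmodal_rules.bot by (simp add: nonmodal_rules_tm_def)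
  next
    case (Prop p)
    then show ?thesis using * nonmodal_rules.clash[of p "set \<Delta>"] by (simp add: nonmodal_rules_tm_def split: if_splits)
  next
    case (And \<psi> \<psi>')
    then show ?thesis using * nonmodal_rules.conj[of \<psi> \<psi>' "set \<Delta>"]
      by (simp add: nonmodal_rules_tm_def concl_of_replace_tm)
  next
    case (Or \<psi> \<psi>')
    then show ?thesis using * nonmodal_rules.disj[of \<psi> \<psi>' "set \<Delta>"]
      by (simp add: nonmodal_rules_tm_def concl_of_replace_tm)
  next
    case (Fix \<eta> X \<psi>)
    then show ?thesis using * nonmodal_rules.unfold[of \<eta> X \<psi> "set \<Delta>"]
      by (simp add: nonmodal_rules_tm_def concl_of_replace_tm)
  qed (use * in \<open>simp_all add: nonmodal_rules_tm_def\<close>)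
next
  fix R assume "R \<in> nonmodal_rules (set \<Delta>)"
  then show "R \<in> (\<Union>\<chi> \<in> set \<Delta>. (\<lambda>\<Sigma>. concl_of ` set \<Sigma>) ` set (val (nonmodal_rules_tm \<Delta> \<chi>)))"
  proof cases
    case bot
    then show ?thesis by (intro UN_I[of Bot]) (simp_all add: nonmodal_rules_tm_def)
  next
    case (clash p)
    then show ?thesis by (intro UN_I[of "Prop p"]) (simp_all add: nonmodal_rules_tm_def)
  next
    case (conj \<psi> \<psi>')
    then show ?thesis
      by (intro UN_I[of "And \<psi> \<psi>'"]) (simp_all add: nonmodal_rules_tm_def concl_of_replace_tm)
  next
    case (disj \<psi> \<psi>')
    then show ?thesis
      by (intro UN_I[of "Or \<psi> \<psi>'"]) (simp_all add: nonmodal_rules_tm_def concl_of_replace_tm)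
  next
    case (unfold \<eta> X \<psi>)
    then show ?thesis
      by (intro UN_I[of "Fix \<eta> X \<psi>"]) (simp_all add: nonmodal_rules_tm_def concl_of_replace_tm)
  qed
qed

lemma set_boxes_tm: "set (val (boxes_tm a \<Delta>)) = {(Box a \<psi>, \<psi>) |\<psi>. Box a \<psi> \<in> set \<Delta>}"
proof (induction \<Delta>)
  case (Cons \<chi> \<Delta>)
  then show ?case by (cases \<chi>) auto
qed simp

lemma concl_of_modal:
  "concl_of (val (union_tm eq_fm_tm (\<psi> # map snd (val (boxes_tm a \<Delta>))) []), (Dia a \<psi>, \<psi>) # val (boxes_tm a \<Delta>)) =
   (insert \<psi> {\<psi>. Box a \<psi> \<in> set \<Delta>}, insert (Dia a \<psi>, \<psi>) {(Box a \<psi>, \<psi>) |\<psi>. Box a \<psi> \<in> set \<Delta>})"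
  by (force simp: concl_of_def set_boxes_tm simp del: union_tm.simps)

lemma rules_of_modal:
  "(\<Union>\<chi> \<in> set \<Delta>. (\<lambda>\<Sigma>. concl_of ` set \<Sigma>) ` set (val (modal_rules_tm \<Delta> \<chi>))) = modal_rules (set \<Delta>)"
proof (rule set_eqI, rule iffI)
  fix R assume "R \<in> (\<Union>\<chi> \<in> set \<Delta>. (\<lambda>\<Sigma>. concl_of ` set \<Sigma>) ` set (val (modal_rules_tm \<Delta> \<chi>)))"
  then obtain \<chi> \<Sigma> where *: "\<chi> \<in> set \<Delta>" "\<Sigma> \<in> set (val (modal_rules_tm \<Delta> \<chi>))" "R = concl_of ` set \<Sigma>" by blast
  show "R \<in> modal_rules (set \<Delta>)"
  proof (cases \<chi>)
    case (Dia a \<psi>)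
    then show ?thesis using * modal_rules.dia[of a \<psi> "set \<Delta>"] concl_of_modal[of \<psi> a \<Delta>]
      by (simp add: modal_rules_tm_def del: union_tm.simps)
  qed (use * in \<open>simp_all add: modal_rules_tm_def\<close>)
next
  fix R assume "R \<in> modal_rules (set \<Delta>)"
  then show "R \<in> (\<Union>\<chi> \<in> set \<Delta>. (\<lambda>\<Sigma>. concl_of ` set \<Sigma>) ` set (val (modal_rules_tm \<Delta> \<chi>)))"
  proof cases
    case (dia a \<psi>)
    then show ?thesis using concl_of_modal[of \<psi> a \<Delta>]
      by (intro UN_I[of "Dia a \<psi>"]) (simp_all add: modal_rules_tm_def del: union_tm.simps)
  qed
qed

lemma val_state_node_tm: "val (state_node_tm \<Delta>) \<longleftrightarrow> state_node (set \<Delta>)"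
proof -
  have "val (state_node_tm \<Delta>) \<longleftrightarrow> (\<forall>\<chi> \<in> set \<Delta>. case \<chi> of Top \<Rightarrow> True | Prop p \<Rightarrow> NProp p \<notin> set \<Delta> | NProp p \<Rightarrow> True
     | Dia a \<psi> \<Rightarrow> True | Box a \<psi> \<Rightarrow> True | _ \<Rightarrow> False)"
    unfolding state_node_tm_def by (simp, intro ball_cong refl) (auto split: fm.splits)
  also have "\<dots> \<longleftrightarrow> state_node (set \<Delta>)"
    unfolding state_node_def by (fastforce split: fm.splits)
  finally show ?thesis .
qed

definition rules_tm :: "('p, 'a, 'v) fm list \<Rightarrow> ('p, 'a, 'v) fm \<Rightarrow> ('p, 'a, 'v) conclusion_rep list list tm" where
  "rules_tm \<Delta> = (if state_node (set \<Delta>) then modal_rules_tm \<Delta> else nonmodal_rules_tm \<Delta>)"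

lemma val_concl_tm: "val (concl_tm \<Delta>) = concat (map (\<lambda>\<chi>. val (rules_tm \<Delta> \<chi>)) \<Delta>)"
  by (simp add: concl_tm_def val_state_node_tm rules_tm_def)

lemma rules_of_concl: "(\<lambda>\<Sigma>. concl_of ` set \<Sigma>) ` set (val (concl_tm \<Delta>)) = concl (set \<Delta>)"
  unfolding val_concl_tm concl_def rules_tm_def rules_of_modal[symmetric] rules_of_nonmodal[symmetric]
  by (cases "state_node (set \<Delta>)") (simp_all add: image_UN)

text \<open>Each formula triggers at most one rule with at most two conclusions. Labels stay free of
  duplicates, which later bounds their length by the size of the closure. The \<open>+ 2\<close> for
  the tracking relation stems from the two conjuncts.\<close>

lemma rules_tm_shape:
  assumes "distinct \<Delta>"
  shows "length (val (rules_tm \<Delta> \<chi>)) \<le> 1 \<and> (\<forall>\<Sigma> \<in> set (val (rules_tm \<Delta> \<chi>)). length \<Sigma> \<le> 2 \<and>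
    (\<forall>c \<in> set \<Sigma>. distinct (fst c) \<and> length (snd c) \<le> length \<Delta> + 2))"
proof -
  have rep1: "distinct (fst (val (replace_tm \<Delta> \<chi> \<Theta>)))" for \<Theta>
    using assms by (simp add: replace_tm_def distinct_union_fm)
  have rep2: "length (snd (val (replace_tm \<Delta> \<chi> \<Theta>))) \<le> length \<Delta> + 2" if "length \<Theta> \<le> 2" for \<Theta>
  proof -
    have "length (snd (val (replace_tm \<Delta> \<chi> \<Theta>))) = length (filter ((\<noteq>) \<chi>) \<Delta>) + length \<Theta>"
      by (simp add: replace_tm_def)
    then show ?thesis using add_mono[OF length_filter_le that] by metis
  qed
  note rep = rep1 rep2
  have bx: "length (val (boxes_tm a \<Delta>)) \<le> length \<Delta>" for a
  proof (induction \<Delta>)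
    case (Cons \<psi> \<Delta>)
    then show ?case by (cases \<psi>) auto
  qed simp
  have dist: "distinct (val (union_tm eq_fm_tm xs []))" for xs :: "('a, 'b, 'c) fm list"
    by (rule distinct_union_fm) simp
  have nm: "length (val (nonmodal_rules_tm \<Delta> \<chi>)) \<le> 1 \<and> (\<forall>\<Sigma> \<in> set (val (nonmodal_rules_tm \<Delta> \<chi>)). length \<Sigma> \<le> 2 \<and>
    (\<forall>c \<in> set \<Sigma>. distinct (fst c) \<and> length (snd c) \<le> length \<Delta> + 2))"
    using rep[of "[_]"] rep[of "[_, _]"] by (cases \<chi>) (auto simp: nonmodal_rules_tm_def)
  have m: "length (val (modal_rules_tm \<Delta> \<chi>)) \<le> 1 \<and> (\<forall>\<Sigma> \<in> set (val (modal_rules_tm \<Delta> \<chi>)). length \<Sigma> \<le> 2 \<and>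
    (\<forall>c \<in> set \<Sigma>. distinct (fst c) \<and> length (snd c) \<le> length \<Delta> + 2))"
  proof (cases \<chi>)
    case (Dia a \<psi>)
    then show ?thesis using bx[of a] dist by (simp add: modal_rules_tm_def del: union_tm.simps)
  qed (simp_all add: modal_rules_tm_def)
  show ?thesis using nm m by (simp add: rules_tm_def)
qed

lemma val_deferrals_tm: "val (deferrals_tm D \<Gamma>) = filter (\<lambda>\<delta>. \<delta> \<in> set D) \<Gamma>"
  by (simp add: deferrals_tm_def)

lemma val_eq_fnode_tm [simp]: "val (eq_fnode_tm v w) \<longleftrightarrow> node_of v = node_of w"
  by (auto simp: eq_fnode_tm_def node_of_def split: prod.splits)

lemma val_mem_fnode: "val (mem_tm eq_fnode_tm v Z) \<longleftrightarrow> node_of v \<in> node_of ` set Z"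
  by auto

lemma val_hat_tm: "val (hat_tm h C X Y) = filter (\<lambda>v. val (h (if snd v = [] then X else Y) v)) C"
  by (simp add: hat_tm_def case_prod_unfold)

lemma concl_Range:
  assumes "\<Sigma> \<in> concl \<Delta>" "c \<in> \<Sigma>" shows "snd c `` d \<subseteq> fst c"
  using assms by (auto simp: concl_def split: if_splits elim!: modal_rules.cases nonmodal_rules.cases)
    (auto simp: replace_def)

context admissible
begin

abbreviation D :: "('p, 'a, 'v) fm list" where "D \<equiv> val (all_deferrals_tm \<phi>)"

definition node_list :: "('p, 'a, 'v) fm list \<Rightarrow> bool" where
  "node_list \<Gamma> \<longleftrightarrow> distinct \<Gamma> \<and> set \<Gamma> \<subseteq> FL \<phi>"

lemma length_node_list: "node_list \<Gamma> \<Longrightarrow> length \<Gamma> \<le> fm_size \<phi>"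
  using card_mono[OF finite_FL, of "set \<Gamma>" \<phi>] card_FL[of \<phi>] distinct_card[of \<Gamma>]
  unfolding node_list_def by linarith

lemma set_deferrals_tm: "set \<Gamma> \<subseteq> FL \<phi> \<Longrightarrow> set (val (deferrals_tm D \<Gamma>)) = deferrals (set \<Gamma>)"
  using deferrals_FL[of "set \<Gamma>"] set_all_deferrals by (auto simp: val_deferrals_tm)

lemma concl_tm_node_list:
  assumes "node_list \<Delta>" "\<Sigma> \<in> set (val (concl_tm \<Delta>))" "c \<in> set \<Sigma>"
  shows "node_list (fst c)" "set (snd c) `` d \<subseteq> set (fst c)" "length (snd c) \<le> length \<Delta> + 2" "length \<Sigma> \<le> 2"
    "concl_of ` set \<Sigma> \<in> concl (set \<Delta>)"
proof -
  show S: "concl_of ` set \<Sigma> \<in> concl (set \<Delta>)" using assms(2) rules_of_concl[of \<Delta>] by blast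
  then have "fst (concl_of c) \<subseteq> FL \<phi>" "snd (concl_of c) `` d \<subseteq> fst (concl_of c)"
    using concl_FL[OF _ S] concl_Range[OF S] assms by (auto simp: node_list_def)
  moreover obtain \<chi> where "\<Sigma> \<in> set (val (rules_tm \<Delta> \<chi>))" using assms(2) by (auto simp: val_concl_tm)
  ultimately show "node_list (fst c)" "set (snd c) `` d \<subseteq> set (fst c)" "length (snd c) \<le> length \<Delta> + 2" "length \<Sigma> \<le> 2"
    using rules_tm_shape[of \<Delta> \<chi>] assms(1,3) by (auto simp: node_list_def concl_of_def)
qed

lemma track_tm_props:
  assumes "set (fst c) \<subseteq> FL \<phi>" "set (snd c) `` set d \<subseteq> set (fst c)"
  shows "set (val (track_tm D d c)) = track (set d) (concl_of c)"
    and "distinct (fst c) \<Longrightarrow> distinct (val (track_tm D d c))"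
proof -
  obtain \<Gamma> \<rho> where c: "c = (\<Gamma>, \<rho>)" by (cases c)
  have v: "val (track_tm D d c) = (if d = [] then val (deferrals_tm D \<Gamma>)
      else val (deferrals_tm D (val (union_tm eq_fm_tm (map snd (filter (\<lambda>x. fst x \<in> set d) \<rho>)) []))))"
    by (simp add: track_tm_def c) (simp add: case_prod_unfold)
  have im: "snd ` {x \<in> set \<rho>. fst x \<in> set d} = set \<rho> `` set d" by force
  then have fl: "snd ` {x \<in> set \<rho>. fst x \<in> set d} \<subseteq> FL \<phi>" using assms by (auto simp: c)
  show "set (val (track_tm D d c)) = track (set d) (concl_of c)"
  proof (cases "d = []")
    case True
    then show ?thesis using set_deferrals_tm[of \<Gamma>] assms(1) unfolding v by (simp add: track_def concl_of_def c)
  next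
    case False
    have "set (val (deferrals_tm D (val (union_tm eq_fm_tm (map snd (filter (\<lambda>x. fst x \<in> set d) \<rho>)) [])))) =
        deferrals (set \<rho> `` set d)"
      using fl im by (subst set_deferrals_tm) auto
    then show ?thesis using False unfolding v by (simp add: track_def concl_of_def c)
  qed
  show "distinct (val (track_tm D d c))" if "distinct (fst c)"
    using that unfolding v by (auto simp: val_deferrals_tm c intro!: distinct_filter distinct_union_fm)
qed

lemma val_successor_in_tm:
  assumes "node_list \<Delta>" "\<Sigma> \<in> set (val (concl_tm \<Delta>))" "c \<in> set \<Sigma>"
  shows "val (successor_in_tm D Z d c) \<longleftrightarrow> (fst (concl_of c), track (set d) (concl_of c)) \<in> node_of ` set Z"
proof -
  have "val (successor_in_tm D Z d c) \<longleftrightarrow> node_of (fst c, val (track_tm D d c)) \<in> node_of ` set Z"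
    unfolding successor_in_tm_def by (simp add: val_mem_fnode case_prod_unfold del: val_mem_tm)
  also have "node_of (fst c, val (track_tm D d c)) = (fst (concl_of c), track (set d) (concl_of c))"
    using track_tm_props(1)[of c d] concl_tm_node_list[OF assms] by (simp add: node_of_def concl_of_def node_list_def)
  finally show ?thesis .
qed

lemma val_f_tm:
  assumes "node_list \<Delta>"
  shows "val (f_tm D Z (\<Delta>, d)) \<longleftrightarrow> (\<forall>\<Sigma> \<in> concl (set \<Delta>). \<exists>c \<in> \<Sigma>. (fst c, track (set d) c) \<in> node_of ` set Z)"
proof -
  have "val (f_tm D Z (\<Delta>, d)) \<longleftrightarrow> (\<forall>\<Sigma> \<in> set (val (concl_tm \<Delta>)). \<exists>c \<in> set \<Sigma>. val (successor_in_tm D Z d c))"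
    by (simp add: f_tm_def)
  also have "\<dots> \<longleftrightarrow> (\<forall>\<Sigma> \<in> set (val (concl_tm \<Delta>)). \<exists>c \<in> set \<Sigma>.
      (fst (concl_of c), track (set d) (concl_of c)) \<in> node_of ` set Z)"
    using val_successor_in_tm[OF assms] by (intro ball_cong bex_cong refl) blast
  finally show ?thesis unfolding rules_of_concl[symmetric] by simp
qed

lemma val_g_tm:
  assumes "node_list \<Delta>"
  shows "val (g_tm D Z (\<Delta>, d)) \<longleftrightarrow> (\<exists>\<Sigma> \<in> concl (set \<Delta>). \<forall>c \<in> \<Sigma>. (fst c, track (set d) c) \<in> node_of ` set Z)"
proof -
  have "val (g_tm D Z (\<Delta>, d)) \<longleftrightarrow> (\<exists>\<Sigma> \<in> set (val (concl_tm \<Delta>)). \<forall>c \<in> set \<Sigma>. val (successor_in_tm D Z d c))"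
    by (simp add: g_tm_def)
  also have "\<dots> \<longleftrightarrow> (\<exists>\<Sigma> \<in> set (val (concl_tm \<Delta>)). \<forall>c \<in> set \<Sigma>.
      (fst (concl_of c), track (set d) (concl_of c)) \<in> node_of ` set Z)"
    using val_successor_in_tm[OF assms] by (intro ball_cong bex_cong refl) blast
  finally show ?thesis unfolding rules_of_concl[symmetric] by simp
qed

section \<open>Correctness of the computed fixpoints\<close>

definition fnode_list :: "('p, 'a, 'v) fnode_rep \<Rightarrow> bool" where
  "fnode_list v \<longleftrightarrow> node_list (fst v) \<and> node_list (snd v)"

lemma val_focused_nodes_tm:
  "val (focused_nodes_tm D G) = concat (map (\<lambda>\<Gamma>. map (Pair \<Gamma>) (val (sublists_tm (val (deferrals_tm D \<Gamma>))))) G)"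
  by (simp add: focused_nodes_tm_def)

lemma focused_nodes_tm_props:
  assumes "\<forall>\<Gamma> \<in> set G. node_list \<Gamma>"
  shows "node_of ` set (val (focused_nodes_tm D G)) = focused_nodes (set ` set G)"
    and "\<forall>v \<in> set (val (focused_nodes_tm D G)). fnode_list v"
proof -
  have *: "set (val (focused_nodes_tm D G)) = (\<Union>\<Gamma> \<in> set G. Pair \<Gamma> ` set (val (sublists_tm (val (deferrals_tm D \<Gamma>)))))"
    by (simp add: val_focused_nodes_tm)
  have "node_of ` set (val (focused_nodes_tm D G)) =
      (\<Union>\<Gamma> \<in> set G. Pair (set \<Gamma>) ` (set ` set (val (sublists_tm (val (deferrals_tm D \<Gamma>))))))"
    unfolding * by (simp add: image_UN image_image node_of_def)
  also have "\<dots> = (\<Union>\<Gamma> \<in> set G. Pair (set \<Gamma>) ` Pow (deferrals (set \<Gamma>)))"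
  proof (rule SUP_cong[OF refl])
    fix \<Gamma> assume "\<Gamma> \<in> set G"
    then have "set \<Gamma> \<subseteq> FL \<phi>" using assms by (simp add: node_list_def)
    then show "Pair (set \<Gamma>) ` (set ` set (val (sublists_tm (val (deferrals_tm D \<Gamma>))))) =
        Pair (set \<Gamma>) ` Pow (deferrals (set \<Gamma>))"
      by (simp only: sublists_tm_props(1) set_deferrals_tm)
  qed
  also have "\<dots> = focused_nodes (set ` set G)" by (auto simp: focused_nodes_def)
  finally show "node_of ` set (val (focused_nodes_tm D G)) = focused_nodes (set ` set G)" .
  show "\<forall>v \<in> set (val (focused_nodes_tm D G)). fnode_list v"
  proof
    fix v assume "v \<in> set (val (focused_nodes_tm D G))"
    then obtain \<Gamma> d where v: "v = (\<Gamma>, d)" "\<Gamma> \<in> set G" "d \<in> set (val (sublists_tm (val (deferrals_tm D \<Gamma>))))"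
      unfolding * by blast
    then show "fnode_list v"
      using assms sublists_tm_props(2)[OF v(3)] by (auto simp: fnode_list_def node_list_def val_deferrals_tm)
  qed
qed

lemma hat_f:
  assumes "\<forall>v \<in> set C. fnode_list v" "node_of ` set C = focused_nodes Gs"
  shows "node_of ` set (val (hat_tm (f_tm D) C X Y)) = f_hat Gs (node_of ` set X) (node_of ` set Y)"
proof (rule set_eqI)
  fix u :: "('p, 'a, 'v) fnode"
  obtain \<Delta> d where u: "u = (\<Delta>, d)" by (cases u)
  have key: "val (f_tm D (if snd v = [] then X else Y) v) \<longleftrightarrow> (\<forall>\<Sigma> \<in> concl (fst (node_of v)). \<exists>c \<in> \<Sigma>.
      (fst c, track (snd (node_of v)) c) \<in> (if snd (node_of v) = {} then node_of ` set X else node_of ` set Y))"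
    if "v \<in> set C" for v
    using val_f_tm[of "fst v" _ "snd v"] assms(1) that by (simp add: fnode_list_def node_of_def)
  have "u \<in> node_of ` set (val (hat_tm (f_tm D) C X Y)) \<longleftrightarrow>
      (\<exists>v \<in> set C. node_of v = u \<and> val (f_tm D (if snd v = [] then X else Y) v))"
    by (auto simp: val_hat_tm)
  also have "\<dots> \<longleftrightarrow> (\<exists>v \<in> set C. node_of v = u \<and> (\<forall>\<Sigma> \<in> concl \<Delta>. \<exists>c \<in> \<Sigma>.
      (fst c, track d c) \<in> (if d = {} then node_of ` set X else node_of ` set Y)))"
    using key u by (intro bex_cong refl conj_cong) simp
  also have "\<dots> \<longleftrightarrow> u \<in> f_hat Gs (node_of ` set X) (node_of ` set Y)"
    unfolding u f_hat_iff assms(2)[symmetric] image_iff by (metis (no_types, lifting))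
  finally show "u \<in> node_of ` set (val (hat_tm (f_tm D) C X Y)) \<longleftrightarrow> u \<in> f_hat Gs (node_of ` set X) (node_of ` set Y)" .
qed

lemma hat_g:
  assumes "\<forall>v \<in> set C. fnode_list v" "node_of ` set C = focused_nodes Gs"
  shows "node_of ` set (val (hat_tm (g_tm D) C X Y)) = g_hat Gs (node_of ` set X) (node_of ` set Y)"
proof (rule set_eqI)
  fix u :: "('p, 'a, 'v) fnode"
  obtain \<Delta> d where u: "u = (\<Delta>, d)" by (cases u)
  have key: "val (g_tm D (if snd v = [] then X else Y) v) \<longleftrightarrow> (\<exists>\<Sigma> \<in> concl (fst (node_of v)). \<forall>c \<in> \<Sigma>.
      (fst c, track (snd (node_of v)) c) \<in> (if snd (node_of v) = {} then node_of ` set X else node_of ` set Y))"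
    if "v \<in> set C" for v
    using val_g_tm[of "fst v" _ "snd v"] assms(1) that by (simp add: fnode_list_def node_of_def)
  have "u \<in> node_of ` set (val (hat_tm (g_tm D) C X Y)) \<longleftrightarrow>
      (\<exists>v \<in> set C. node_of v = u \<and> val (g_tm D (if snd v = [] then X else Y) v))"
    by (auto simp: val_hat_tm)
  also have "\<dots> \<longleftrightarrow> (\<exists>v \<in> set C. node_of v = u \<and> (\<exists>\<Sigma> \<in> concl \<Delta>. \<forall>c \<in> \<Sigma>.
      (fst c, track d c) \<in> (if d = {} then node_of ` set X else node_of ` set Y)))"
    using key u by (intro bex_cong refl conj_cong) simp
  also have "\<dots> \<longleftrightarrow> u \<in> g_hat Gs (node_of ` set X) (node_of ` set Y)"
    unfolding u g_hat_iff assms(2)[symmetric] image_iff by (metis (no_types, lifting))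
  finally show "u \<in> node_of ` set (val (hat_tm (g_tm D) C X Y)) \<longleftrightarrow> u \<in> g_hat Gs (node_of ` set X) (node_of ` set Y)" .
qed

lemma node_of_funpow:
  fixes F :: "('p, 'a, 'v) fnode_rep list \<Rightarrow> ('p, 'a, 'v) fnode_rep list"
  assumes "\<And>Y. node_of ` set (F Y) = H (node_of ` set Y)"
  shows "node_of ` set ((F ^^ n) Y) = (H ^^ n) (node_of ` set Y)"
  by (induction n) (simp_all add: assms)

lemma
  assumes "\<forall>\<Gamma> \<in> set G. node_list \<Gamma>"
  shows val_E_tm: "node_of ` set (val (E_tm D G)) = E_set (set ` set G)"
    and val_A_tm: "node_of ` set (val (A_tm D G)) = A_set (set ` set G)"
proof -
  define C where "C = val (focused_nodes_tm D G)"
  let ?G = "set ` set G"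
  have C: "\<forall>v \<in> set C. fnode_list v" "node_of ` set C = focused_nodes ?G"
    using focused_nodes_tm_props[OF assms] by (simp_all add: C_def)
  have fin: "finite (focused_nodes ?G)" unfolding C(2)[symmetric] by simp
  \<comment> \<open>\<open>C\<close> may list a focused node more than once; its length still bounds
    the number of iterations until stabilization.\<close>
  have card: "card (focused_nodes ?G) \<le> length C"
    unfolding C(2)[symmetric] using card_image_le[of "set C" node_of] card_length[of C] by simp
  have lfpC: "lfp (f_hat ?G X) \<subseteq> focused_nodes ?G" for X
    using lfp_unfold[OF mono_f_hat(1)] f_hat_focused by metis
  have gfpC: "gfp (g_hat ?G X) \<subseteq> focused_nodes ?G" for X
    using gfp_unfold[OF mono_g_hat(1)] g_hat_focused by metis
  have f1: "node_of ` set (((val \<circ> hat_tm (f_tm D) C X) ^^ length C) []) = lfp (f_hat ?G (node_of ` set X))" for X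
    using node_of_funpow[of "val \<circ> hat_tm (f_tm D) C X" "f_hat ?G (node_of ` set X)" "length C" "[]"] hat_f[OF C]
      lfp_iterate[OF mono_f_hat(1) f_hat_focused fin card] by simp
  have g1: "node_of ` set (((val \<circ> hat_tm (g_tm D) C X) ^^ length C) C) = gfp (g_hat ?G (node_of ` set X))" for X
    using node_of_funpow[of "val \<circ> hat_tm (g_tm D) C X" "g_hat ?G (node_of ` set X)" "length C" C] hat_g[OF C]
      gfp_iterate[OF mono_g_hat(1) g_hat_focused fin card] C(2) by simp
  have E: "val (E_tm D G) = ((\<lambda>X. ((val \<circ> hat_tm (f_tm D) C X) ^^ length C) []) ^^ length C) C"
    by (simp add: E_tm_def C_def comp_def)
  have A: "val (A_tm D G) = ((\<lambda>X. ((val \<circ> hat_tm (g_tm D) C X) ^^ length C) C) ^^ length C) []"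
    by (simp add: A_tm_def C_def comp_def)
  show "node_of ` set (val (E_tm D G)) = E_set ?G"
    unfolding E E_set_def
    using node_of_funpow[of "\<lambda>X. ((val \<circ> hat_tm (f_tm D) C X) ^^ length C) []" "\<lambda>X. lfp (f_hat ?G X)" "length C" C] f1
      gfp_iterate[OF mono_f_hat(2) lfpC fin card] C(2) by simp
  show "node_of ` set (val (A_tm D G)) = A_set ?G"
    unfolding A A_set_def
    using node_of_funpow[of "\<lambda>X. ((val \<circ> hat_tm (g_tm D) C X) ^^ length C) C" "\<lambda>X. gfp (g_hat ?G X)" "length C" "[]"] g1
      lfp_iterate[OF mono_g_hat(2) gfpC fin card] by simp
qed

lemma val_root_in_tm: "val (root_in_tm D \<phi> Z) \<longleftrightarrow> ({\<phi>}, deferrals {\<phi>}) \<in> node_of ` set (val Z)"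
proof -
  have "node_of ([\<phi>], val (deferrals_tm D [\<phi>])) = ({\<phi>}, deferrals {\<phi>})"
    using set_deferrals_tm[of "[\<phi>]"] FL_root[of \<phi>] by (simp add: node_of_def)
  then show ?thesis by (simp add: root_in_tm_def val_mem_fnode del: val_mem_tm)
qed

definition unexpanded :: "('p, 'a, 'v) fm list list \<Rightarrow> ('p, 'a, 'v) fm list list \<Rightarrow> ('p, 'a, 'v) fm list \<Rightarrow> ('p, 'a, 'v) fm list list" where
  "unexpanded G U t = val (union_tm eq_node_tm
     (filter (\<lambda>\<Gamma>. set \<Gamma> \<notin> set ` set (t # G)) (map fst (concat (val (concl_tm t)))))
     (filter (\<lambda>\<Gamma>. set t \<noteq> set \<Gamma>) U))"

lemma val_gc_iteration_tm:
  assumes "i < length U" "node_list (U ! i)" "\<forall>\<Gamma> \<in> set G. node_list \<Gamma>"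
  shows "val (gc_iteration_tm D \<phi> i e a G U) =
    (let t = U ! i; Gs = insert (set t) (set ` set G); r = ({\<phi>}, deferrals {\<phi>}) in
     if e \<and> r \<in> E_set Gs then Answer True
     else if a \<and> r \<in> A_set Gs then Answer False
     else if unexpanded G U t = [] then Answer (r \<in> E_set Gs)
     else Running (t # G) (unexpanded G U t))"
proof -
  have n: "\<forall>\<Gamma> \<in> set (U ! i # G). node_list \<Gamma>" using assms by simp
  have E: "val (root_in_tm D \<phi> (E_tm D (U ! i # G))) \<longleftrightarrow> ({\<phi>}, deferrals {\<phi>}) \<in> E_set (insert (set (U ! i)) (set ` set G))"
    using val_root_in_tm val_E_tm[OF n] by simp
  have A: "val (root_in_tm D \<phi> (A_tm D (U ! i # G))) \<longleftrightarrow> ({\<phi>}, deferrals {\<phi>}) \<in> A_set (insert (set (U ! i)) (set ` set G))"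
    using val_root_in_tm val_A_tm[OF n] by simp
  have mem: "val (mem_tm eq_node_tm \<Gamma> Z) \<longleftrightarrow> set \<Gamma> \<in> set ` set Z" for \<Gamma> :: "('p, 'a, 'v) fm list" and Z
    by (simp only: val_mem_tm val_eq_node_tm image_iff)
  have rem: "val (remove_tm eq_node_tm t Z) = filter (\<lambda>\<Gamma>. set t \<noteq> set \<Gamma>) Z" for t :: "('p, 'a, 'v) fm list" and Z
    by (simp only: val_remove_tm val_eq_node_tm)
  show ?thesis
    unfolding gc_iteration_tm_def Let_def unexpanded_def
    by (simp add: assms(1) E A mem rem del: val_mem_tm val_remove_tm val_seteq_tm list.set)
qed

lemma set_unexpanded:
  "set ` set (unexpanded G U t) = expand_unexpanded (set ` set G) (set ` set U) (set t)"
proof -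
  have "set ` set (unexpanded G U t) = set ` {\<Gamma> \<in> fst ` \<Union> (set ` set (val (concl_tm t))). set \<Gamma> \<notin> set ` set (t # G)} \<union>
      set ` {\<Gamma> \<in> set U. set t \<noteq> set \<Gamma>}"
    unfolding unexpanded_def image_union_tm[of eq_node_tm set, OF val_eq_node_tm] by simp
  also have "set ` {\<Gamma> \<in> set U. set t \<noteq> set \<Gamma>} = set ` set U - {set t}" by auto
  also have "set ` {\<Gamma> \<in> fst ` \<Union> (set ` set (val (concl_tm t))). set \<Gamma> \<notin> set ` set (t # G)} =
      fst ` \<Union> (concl (set t)) - insert (set t) (set ` set G)"
  proof -
    have "fst ` \<Union> (concl (set t)) = set ` fst ` \<Union> (set ` set (val (concl_tm t)))"
      unfolding rules_of_concl[symmetric] by (simp add: image_Union image_image concl_of_def)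
    moreover have "set ` {\<Gamma> \<in> A. set \<Gamma> \<notin> B} = set ` A - B" for A and B :: "('p, 'a, 'v) fm set set" by auto
    ultimately show ?thesis by (simp only: list.set image_insert)
  qed
  finally show ?thesis unfolding expand_unexpanded_def by (simp only: Un_commute)
qed

text \<open>No two lists may denote the same node; this bounds the lengths of \<open>G\<close> and
  \<open>U\<close> by the number of nodes.\<close>

definition gc_rep :: "('p, 'a, 'v) fm list list \<Rightarrow> bool" where
  "gc_rep U \<longleftrightarrow> (\<forall>\<Gamma> \<in> set U. node_list \<Gamma>) \<and> distinct (map set U)"

lemma gc_rep_unexpanded:
  assumes "gc_rep U" "node_list t"
  shows "gc_rep (unexpanded G U t)"
  unfolding gc_rep_def
proof
  have "distinct (map set (filter (\<lambda>\<Gamma>. set t \<noteq> set \<Gamma>) U))"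
    using assms(1) by (simp add: gc_rep_def distinct_map_filter)
  then show "distinct (map set (unexpanded G U t))"
    unfolding unexpanded_def by (rule distinct_union_tm[of eq_node_tm set, OF val_eq_node_tm])
  show "\<forall>\<Gamma> \<in> set (unexpanded G U t). node_list \<Gamma>"
  proof
    fix \<Gamma> assume "\<Gamma> \<in> set (unexpanded G U t)"
    then have "\<Gamma> \<in> fst ` \<Union> (set ` set (val (concl_tm t))) \<or> \<Gamma> \<in> set U"
      unfolding unexpanded_def using union_tm_subset by fastforce
    then show "node_list \<Gamma>" using concl_tm_node_list(1)[OF assms(2)] assms(1) by (auto simp: gc_rep_def)
  qed
qed

section \<open>Executions of the program against runs of the abstract algorithm\<close>

lemma gc_exec_inv:
  "gc_exec \<phi> r n \<Longrightarrow> (gc_step \<phi>)\<^sup>*\<^sup>* (gc_init \<phi>) (abs_conf r) \<and>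
    (\<forall>G U. r = Running G U \<longrightarrow> gc_rep G \<and> gc_rep U)"
proof (induction rule: gc_exec.induct)
  case init
  show ?case by (auto simp: abs_conf_def gc_init_def gc_rep_def node_list_def FL_root)
next
  case (iteration G U n i r e a)
  let ?t = "U ! i"
  let ?Gs = "set ` set G" and ?Us = "set ` set U"
  have rep: "gc_rep G" "gc_rep U" using iteration.IH by auto
  have t: "?t \<in> set U" "node_list ?t" using iteration.hyps(2) rep(2) by (auto simp: gc_rep_def)
  have reach: "(gc_step \<phi>)\<^sup>*\<^sup>* (gc_init \<phi>) (Running ?Gs ?Us)" using iteration.IH by (simp add: abs_conf_def)
  have inv: "gc_inv ?Gs ?Us" using gc_reachable[OF infinite_UNIV_nat reach] by simp
  have tU: "set ?t \<in> ?Us" using t by blast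
  have v: "val r = (let t = ?t; Gs = insert (set t) ?Gs; rt = ({\<phi>}, deferrals {\<phi>}) in
     if e \<and> rt \<in> E_set Gs then Answer True
     else if a \<and> rt \<in> A_set Gs then Answer False
     else if unexpanded G U t = [] then Answer (rt \<in> E_set Gs)
     else Running (t # G) (unexpanded G U t))"
    unfolding iteration.hyps(3)
    by (rule val_gc_iteration_tm[OF iteration.hyps(2) t(2)]) (use rep in \<open>auto simp: gc_rep_def\<close>)
  have ex: "set ` set (unexpanded G U ?t) = expand_unexpanded ?Gs ?Us (set ?t)" by (rule set_unexpanded)
  have "gc_step \<phi> (Running ?Gs ?Us) (abs_conf (val r)) \<and>
      (\<forall>G' U'. val r = Running G' U' \<longrightarrow> gc_rep G' \<and> gc_rep U')"
  proof -
    consider (yes) "({\<phi>}, deferrals {\<phi>}) \<in> E_set (insert (set ?t) ?Gs)" "val r = Answer True"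
      | (no) "({\<phi>}, deferrals {\<phi>}) \<in> A_set (insert (set ?t) ?Gs)" "val r = Answer False"
      | (fin) "unexpanded G U ?t = []" "val r = Answer (({\<phi>}, deferrals {\<phi>}) \<in> E_set (insert (set ?t) ?Gs))"
      | (cont) "unexpanded G U ?t \<noteq> []" "val r = Running (?t # G) (unexpanded G U ?t)"
      using v unfolding Let_def by (metis (full_types))
    then show ?thesis
    proof cases
      case yes
      then show ?thesis using gc_step.early_yes[OF tU] by (simp add: abs_conf_def)
    next
      case no
      then show ?thesis using gc_step.early_no[OF tU] by (simp add: abs_conf_def)
    next
      case fin
      then show ?thesis using gc_step.final[OF tU] ex by (simp add: abs_conf_def)
    next
      case cont
      have "expand_unexpanded ?Gs ?Us (set ?t) \<noteq> {}" using cont(1) ex by (metis set_empty image_is_empty)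
      from gc_step.continue[OF tU this, of \<phi>] have "gc_step \<phi> (Running ?Gs ?Us) (abs_conf (val r))"
        using cont(2) ex by (simp add: abs_conf_def)
      moreover have "gc_rep (?t # G)"
      proof -
        have "set ?t \<notin> ?Gs" using inv tU unfolding gc_inv_def by blast
        then show ?thesis using rep(1) t(2) by (auto simp: gc_rep_def)
      qed
      ultimately show ?thesis using cont(2) gc_rep_unexpanded[OF rep(2) t(2)] by auto
    qed
  qed
  then show ?case using reach by (auto intro: rtranclp.rtrancl_into_rtrancl)
qed

lemma gc_exec_complete:
  "(gc_step \<phi>)\<^sup>*\<^sup>* (gc_init \<phi>) r \<Longrightarrow> \<exists>r' n. gc_exec \<phi> r' n \<and> abs_conf r' = r"
proof (induction rule: rtranclp_induct)
  case base
  have "abs_conf (Running [] [[\<phi>]]) = gc_init \<phi>" by (simp add: abs_conf_def gc_init_def)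
  then show ?case using gc_exec.init by blast
next
  case (step r r2)
  then obtain r' n where r': "gc_exec \<phi> r' n" "abs_conf r' = r" by blast
  obtain Gs Us where r: "r = Running Gs Us" using step(2) by (auto elim: gc_step.cases)
  then obtain G U where GU: "r' = Running G U" "Gs = set ` set G" "Us = set ` set U"
    using r'(2) by (cases r') (auto simp: abs_conf_def)
  have rep: "gc_rep G" "gc_rep U" using gc_exec_inv[OF r'(1)] GU(1) by auto
  \<comment> \<open>The flags are chosen to match the abstract step: both off for
    \<open>continue\<close> and \<open>final\<close>, and only the relevant one on for an early
    answer.\<close>
  have "\<exists>i e a. i < length U \<and> abs_conf (val (gc_iteration_tm D \<phi> i e a G U)) = r2"
  proof -
    have key: "abs_conf (val (gc_iteration_tm D \<phi> i e a G U)) =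
      (let t = set (U ! i); rt = ({\<phi>}, deferrals {\<phi>}) in
       if e \<and> rt \<in> E_set (insert t Gs) then Answer True
       else if a \<and> rt \<in> A_set (insert t Gs) then Answer False
       else if expand_unexpanded Gs Us t = {} then Answer (rt \<in> E_set (insert t Gs))
       else Running (insert t Gs) (expand_unexpanded Gs Us t))" if "i < length U" for i e a
    proof -
      have "node_list (U ! i)" using that rep(2) by (auto simp: gc_rep_def)
      then have "val (gc_iteration_tm D \<phi> i e a G U) = (let t = U ! i; Gs = insert (set t) (set ` set G); r = ({\<phi>}, deferrals {\<phi>}) in
         if e \<and> r \<in> E_set Gs then Answer True
         else if a \<and> r \<in> A_set Gs then Answer False
         else if unexpanded G U t = [] then Answer (r \<in> E_set Gs)
         else Running (t # G) (unexpanded G U t))"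
        by (intro val_gc_iteration_tm[OF that]) (use rep in \<open>auto simp: gc_rep_def\<close>)
      moreover have "expand_unexpanded Gs Us (set (U ! i)) = {} \<longleftrightarrow> unexpanded G U (U ! i) = []"
        using set_unexpanded[of G U "U ! i"] GU by (metis set_empty image_is_empty)
      ultimately show ?thesis
        using set_unexpanded[of G U "U ! i"] GU(2,3) by (simp add: Let_def abs_conf_def)
    qed
    have idx: "\<exists>i < length U. t = set (U ! i)" if tU: "t \<in> Us" for t
    proof -
      obtain \<Gamma> where "\<Gamma> \<in> set U" "t = set \<Gamma>" using tU GU(3) by blast
      then show ?thesis by (metis in_set_conv_nth)
    qed
    from step(2)[unfolded r] show ?thesis
    proof cases
      case (continue t)
      then obtain i where "i < length U" "t = set (U ! i)" using idx by blast
      then show ?thesis using key[of i False False] continue by (intro exI[of _ i] exI[of _ False]) (simp add: Let_def)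
    next
      case (early_yes t)
      then obtain i where "i < length U" "t = set (U ! i)" using idx by blast
      then show ?thesis using key[of i True False] early_yes by (intro exI[of _ i] exI[of _ True] exI[of _ False]) (simp add: Let_def)
    next
      case (early_no t)
      then obtain i where "i < length U" "t = set (U ! i)" using idx by blast
      then show ?thesis using key[of i False True] early_no by (intro exI[of _ i] exI[of _ False] exI[of _ True]) (simp add: Let_def)
    next
      case (final t)
      then obtain i where "i < length U" "t = set (U ! i)" using idx by blast
      then show ?thesis using key[of i False False] final by (intro exI[of _ i] exI[of _ False]) (simp add: Let_def)
    qed
  qed
  then obtain i e a where "i < length U" "abs_conf (val (gc_iteration_tm D \<phi> i e a G U)) = r2" by blast
  then show ?case using gc_exec.iteration[OF r'(1)[unfolded GU(1)] _ refl, of i e a] by blast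
qed

lemma gc_step_iff_gc_exec:
  "(gc_step \<phi>)\<^sup>*\<^sup>* (gc_init \<phi>) r \<longleftrightarrow> (\<exists>r' n. gc_exec \<phi> r' n \<and> abs_conf r' = r)"
  using gc_exec_complete gc_exec_inv by blast

end

section \<open>Sizes\<close>

text \<open>\<open>wsize W \<alpha>\<close> is the size of an instance of \<open>\<alpha>\<close> in which \<open>X\<close> is replaced by a formula of size \<open>W X\<close>.\<close>

primrec wsize :: "('v \<Rightarrow> nat) \<Rightarrow> ('p, 'a, 'v) fm \<Rightarrow> nat" where
  "wsize W Bot = 1"
| "wsize W Top = 1"
| "wsize W (Prop p) = 1"
| "wsize W (NProp p) = 1"
| "wsize W (Var X) = W X"
| "wsize W (And \<psi> \<phi>) = 1 + wsize W \<psi> + wsize W \<phi>"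
| "wsize W (Or \<psi> \<phi>) = 1 + wsize W \<psi> + wsize W \<phi>"
| "wsize W (Dia a \<psi>) = 1 + wsize W \<psi>"
| "wsize W (Box a \<psi>) = 1 + wsize W \<psi>"
| "wsize W (Fix \<eta> X \<psi>) = 1 + wsize (W(X := 1)) \<psi>"

primrec nocc :: "'v \<Rightarrow> ('p, 'a, 'v) fm \<Rightarrow> nat" where
  "nocc X Bot = 0"
| "nocc X Top = 0"
| "nocc X (Prop p) = 0"
| "nocc X (NProp p) = 0"
| "nocc X (Var Y) = (if Y = X then 1 else 0)"
| "nocc X (And \<psi> \<phi>) = nocc X \<psi> + nocc X \<phi>"
| "nocc X (Or \<psi> \<phi>) = nocc X \<psi> + nocc X \<phi>"
| "nocc X (Dia a \<psi>) = nocc X \<psi>"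
| "nocc X (Box a \<psi>) = nocc X \<psi>"
| "nocc X (Fix \<eta> Y \<psi>) = (if Y = X then 0 else nocc X \<psi>)"

text \<open>With \<open>V\<close> empty this counts the occurrences of bound variables. Each of them
  is charged to its binder when sizes in the closure are bounded.\<close>

primrec nbound :: "'v set \<Rightarrow> ('p, 'a, 'v) fm \<Rightarrow> nat" where
  "nbound V Bot = 0"
| "nbound V Top = 0"
| "nbound V (Prop p) = 0"
| "nbound V (NProp p) = 0"
| "nbound V (Var Y) = (if Y \<in> V then 1 else 0)"
| "nbound V (And \<psi> \<phi>) = nbound V \<psi> + nbound V \<phi>"
| "nbound V (Or \<psi> \<phi>) = nbound V \<psi> + nbound V \<phi>"
| "nbound V (Dia a \<psi>) = nbound V \<psi>"
| "nbound V (Box a \<psi>) = nbound V \<psi>"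
| "nbound V (Fix \<eta> Y \<psi>) = nbound (insert Y V) \<psi>"

lemma nbound_le_fm_size: "nbound V \<alpha> \<le> fm_size \<alpha>"
  by (induction \<alpha> arbitrary: V) (simp_all add: add_mono le_SucI)

lemma nocc_nbound: "X \<notin> V \<Longrightarrow> nocc X \<alpha> + nbound V \<alpha> \<le> nbound (insert X V) \<alpha>"
proof (induction \<alpha> arbitrary: V)
  case (And \<alpha>1 \<alpha>2)
  show ?case using And.IH(1)[OF And.prems] And.IH(2)[OF And.prems] by simp
next
  case (Or \<alpha>1 \<alpha>2)
  show ?case using Or.IH(1)[OF Or.prems] Or.IH(2)[OF Or.prems] by simp
next
  case (Fix \<eta> Y \<psi>)
  show ?case
  proof (cases "Y = X")
    case False
    then show ?thesis using Fix.IH[of "insert Y V"] Fix.prems by (simp add: insert_commute)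
  qed simp
qed auto

lemma wsize_mono: "W \<le> W' \<Longrightarrow> wsize W \<alpha> \<le> wsize W' \<alpha>"
proof (induction \<alpha> arbitrary: W W')
  case (Fix \<eta> X \<psi>)
  have "wsize (W(X := 1)) \<psi> \<le> wsize (W'(X := 1)) \<psi>" by (rule Fix.IH) (use Fix.prems in \<open>simp add: le_fun_def\<close>)
  then show ?case by simp
qed (simp_all add: le_fun_def add_mono)

text \<open>The size is affine in the weight of \<open>X\<close>, with slope
  \<open>nocc X \<alpha>\<close>; weight 1 is the size of the bare variable.\<close>

lemma wsize_upd: "wsize (W(X := s)) \<alpha> \<le> wsize (W(X := 1)) \<alpha> + nocc X \<alpha> * s"
proof (induction \<alpha> arbitrary: W)
  case (Fix \<eta> Y \<psi>)
  show ?case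
  proof (cases "Y = X")
    case False
    then have "W(X := u, Y := 1) = W(Y := 1, X := u)" for u by (intro fun_upd_twist) simp
    then show ?thesis using Fix.IH[of "W(Y := 1)"] False by (simp del: fun_upd_apply)
  qed (simp del: fun_upd_apply)
next
  case (And \<alpha> \<beta>)
  show ?case using And.IH(1)[of W] And.IH(2)[of W] by (simp add: algebra_simps del: fun_upd_apply)
next
  case (Or \<alpha> \<beta>)
  show ?case using Or.IH(1)[of W] Or.IH(2)[of W] by (simp add: algebra_simps del: fun_upd_apply)
qed simp_all

lemma fm_size_psubst: "fm_size (psubst \<rho> \<alpha>) = wsize (\<lambda>X. fm_size (\<rho> X)) \<alpha>"
proof (induction \<alpha> arbitrary: \<rho>)
  case (Fix \<eta> X \<psi>)
  have "(\<lambda>Y. fm_size ((\<rho>(X := Var X)) Y)) = (\<lambda>Y. fm_size (\<rho> Y))(X := 1)" by auto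
  then show ?case using Fix.IH[of "\<rho>(X := Var X)"] by (simp del: fun_upd_apply)
qed simp_all

lemma le_mult_two_power: "(x::nat) \<le> x * 2 ^ k"
  using mult_le_mono2[of 1 "2 ^ k" x] by simp

text \<open>Unfolding a variable that occurs \<open>m\<close> times multiplies the size by at most \<open>1 + m \<le> 2 ^ m\<close>, and the
  exponents add up to the number of bound occurrences. Bounding each factor by the size of the whole
  formula would only yield \<open>2 ^ O(n log n)\<close>.\<close>

lemma fm_size_FL_list:
  "x \<in> set (FL_list \<alpha> \<sigma>) \<Longrightarrow> fm_size x \<le> wsize (\<lambda>X. fm_size (env \<sigma> X)) \<alpha> * 2 ^ nbound {} \<alpha>"
proof (induction \<alpha> arbitrary: \<sigma>)
  case (And \<alpha> \<beta>)
  let ?w = "wsize (\<lambda>X. fm_size (env \<sigma> X))"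
  have p: "(2::nat) ^ nbound {} \<alpha> \<le> 2 ^ nbound {} (And \<alpha> \<beta>)" "(2::nat) ^ nbound {} \<beta> \<le> 2 ^ nbound {} (And \<alpha> \<beta>)" by simp_all
  consider "x = psubst (env \<sigma>) (And \<alpha> \<beta>)" | "x \<in> set (FL_list \<alpha> \<sigma>)" | "x \<in> set (FL_list \<beta> \<sigma>)"
    using And.prems by auto
  then show ?case
  proof cases
    case 1
    then have "fm_size x = ?w (And \<alpha> \<beta>)" using fm_size_psubst by metis
    then show ?thesis by (simp only: le_mult_two_power)
  next
    case 2
    have "?w \<alpha> * 2 ^ nbound {} \<alpha> \<le> ?w (And \<alpha> \<beta>) * 2 ^ nbound {} (And \<alpha> \<beta>)" by (rule mult_le_mono) (use p in simp_all)
    then show ?thesis using And.IH(1)[OF 2] by linarith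
  next
    case 3
    have "?w \<beta> * 2 ^ nbound {} \<beta> \<le> ?w (And \<alpha> \<beta>) * 2 ^ nbound {} (And \<alpha> \<beta>)" by (rule mult_le_mono) (use p in simp_all)
    then show ?thesis using And.IH(2)[OF 3] by linarith
  qed
next
  case (Or \<alpha> \<beta>)
  let ?w = "wsize (\<lambda>X. fm_size (env \<sigma> X))"
  have p: "(2::nat) ^ nbound {} \<alpha> \<le> 2 ^ nbound {} (Or \<alpha> \<beta>)" "(2::nat) ^ nbound {} \<beta> \<le> 2 ^ nbound {} (Or \<alpha> \<beta>)" by simp_all
  consider "x = psubst (env \<sigma>) (Or \<alpha> \<beta>)" | "x \<in> set (FL_list \<alpha> \<sigma>)" | "x \<in> set (FL_list \<beta> \<sigma>)"
    using Or.prems by auto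
  then show ?case
  proof cases
    case 1
    then have "fm_size x = ?w (Or \<alpha> \<beta>)" using fm_size_psubst by metis
    then show ?thesis by (simp only: le_mult_two_power)
  next
    case 2
    have "?w \<alpha> * 2 ^ nbound {} \<alpha> \<le> ?w (Or \<alpha> \<beta>) * 2 ^ nbound {} (Or \<alpha> \<beta>)" by (rule mult_le_mono) (use p in simp_all)
    then show ?thesis using Or.IH(1)[OF 2] by linarith
  next
    case 3
    have "?w \<beta> * 2 ^ nbound {} \<beta> \<le> ?w (Or \<alpha> \<beta>) * 2 ^ nbound {} (Or \<alpha> \<beta>)" by (rule mult_le_mono) (use p in simp_all)
    then show ?thesis using Or.IH(2)[OF 3] by linarith
  qed
next
  case (Dia a \<alpha>)
  let ?w = "wsize (\<lambda>X. fm_size (env \<sigma> X))"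
  consider "x = psubst (env \<sigma>) (Dia a \<alpha>)" | "x \<in> set (FL_list \<alpha> \<sigma>)" using Dia.prems by auto
  then show ?case
  proof cases
    case 1
    then have "fm_size x = ?w (Dia a \<alpha>)" using fm_size_psubst by metis
    then show ?thesis by (simp only: le_mult_two_power)
  next
    case 2
    then show ?thesis using Dia.IH[of \<sigma>] by simp
  qed
next
  case (Box a \<alpha>)
  let ?w = "wsize (\<lambda>X. fm_size (env \<sigma> X))"
  consider "x = psubst (env \<sigma>) (Box a \<alpha>)" | "x \<in> set (FL_list \<alpha> \<sigma>)" using Box.prems by auto
  then show ?case
  proof cases
    case 1
    then have "fm_size x = ?w (Box a \<alpha>)" using fm_size_psubst by metis
    then show ?thesis by (simp only: le_mult_two_power)
  next
    case 2
    then show ?thesis using Box.IH[of \<sigma>] by simp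
  qed
next
  case (Fix \<eta> X \<psi>)
  let ?\<chi> = "Fix \<eta> X \<psi>"
  let ?W = "\<lambda>Y. fm_size (env \<sigma> Y)"
  define s where "s = wsize ?W ?\<chi>"
  have s: "s = fm_size (psubst (env \<sigma>) ?\<chi>)" by (simp only: s_def fm_size_psubst)
  define \<sigma>' where "\<sigma>' = (if closed_fm ?\<chi> then [?\<chi>] else ?\<chi> # \<sigma>)"
  consider "x = psubst (env \<sigma>) ?\<chi>" | "x \<in> set (FL_list \<psi> \<sigma>')"
    using Fix.prems by (auto simp: \<sigma>'_def simp del: psubst.simps)
  then show ?case
  proof cases
    case 1
    then have "fm_size x = s" using s by simp
    then show ?thesis unfolding s_def by (simp only: le_mult_two_power)
  next
    case 2
    \<comment> \<open>For a closed literal the rest of the chain is dropped, so the other variables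
      stand for themselves and have size 1, which is at most their former weight.\<close>
    have le: "fm_size (env \<sigma>' Y) \<le> (?W(X := s)) Y" for Y
    proof (cases "closed_fm ?\<chi>")
      case True
      then show ?thesis
        using s psubst_closed[OF True, of "env \<sigma>"] fm_size_pos[of "env \<sigma> Y"]
        by (auto simp: \<sigma>'_def simp del: psubst.simps)
    next
      case False
      then show ?thesis using s by (auto simp: \<sigma>'_def simp del: psubst.simps)
    qed
    have "wsize (\<lambda>Y. fm_size (env \<sigma>' Y)) \<psi> \<le> wsize (?W(X := s)) \<psi>"
      by (rule wsize_mono, rule le_funI, rule le)
    also have "\<dots> \<le> wsize (?W(X := 1)) \<psi> + nocc X \<psi> * s" by (rule wsize_upd)
    also have "\<dots> \<le> (1 + nocc X \<psi>) * s" by (simp add: s_def)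
    also have "\<dots> \<le> 2 ^ nocc X \<psi> * s"
      unfolding plus_1_eq_Suc by (intro mult_le_mono1 Suc_leI less_exp)
    finally have "fm_size x \<le> 2 ^ nocc X \<psi> * s * 2 ^ nbound {} \<psi>"
      using Fix.IH[OF 2] by (meson le_trans mult_le_mono1)
    also have "\<dots> = s * 2 ^ (nocc X \<psi> + nbound {} \<psi>)" by (simp add: power_add)
    also have "\<dots> \<le> s * 2 ^ nbound {} ?\<chi>"
      using nocc_nbound[of X "{}" \<psi>] by (intro mult_le_mono2 power_increasing) simp_all
    finally show ?thesis by (simp only: s_def)
  qed
qed simp_all

lemma fm_size_FL: "x \<in> FL \<phi> \<Longrightarrow> fm_size x \<le> 4 ^ fm_size \<phi>"
proof -
  assume "x \<in> FL \<phi>"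
  then have "x \<in> set (FL_list \<phi> [])" using FL_subset_FL_list by blast
  from fm_size_FL_list[OF this] have "fm_size x \<le> fm_size \<phi> * 2 ^ nbound {} \<phi>"
    using fm_size_psubst[of Var \<phi>] by simp
  also have "fm_size \<phi> * 2 ^ nbound {} \<phi> \<le> 2 ^ fm_size \<phi> * 2 ^ fm_size \<phi>"
    using less_exp[of "fm_size \<phi>"] nbound_le_fm_size by (intro mult_le_mono power_increasing) simp_all
  also have "\<dots> = 4 ^ fm_size \<phi>" by (simp flip: power_mult_distrib)
  finally show ?thesis .
qed

section \<open>Running time\<close>

lemma time_map_tm: "(\<And>x. x \<in> set xs \<Longrightarrow> time (f x) \<le> T) \<Longrightarrow> time (map_tm f xs) \<le> 1 + length xs * (T + 1)"
proof (induction xs)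
  case (Cons x xs)
  have "time (map_tm f xs) \<le> 1 + length xs * (T + 1)" "time (f x) \<le> T" using Cons by auto
  then show ?case by simp
qed simp

lemma time_filter_tm: "(\<And>x. x \<in> set xs \<Longrightarrow> time (f x) \<le> T) \<Longrightarrow> time (filter_tm f xs) \<le> 1 + length xs * (T + 1)"
proof (induction xs)
  case (Cons x xs)
  have "time (filter_tm f xs) \<le> 1 + length xs * (T + 1)" "time (f x) \<le> T" using Cons by auto
  then show ?case by simp
qed simp

lemma time_all_tm: "(\<And>x. x \<in> set xs \<Longrightarrow> time (f x) \<le> T) \<Longrightarrow> time (all_tm f xs) \<le> 1 + length xs * (T + 1)"
proof (induction xs)
  case (Cons x xs)
  have "time (all_tm f xs) \<le> 1 + length xs * (T + 1)" "time (f x) \<le> T" using Cons by auto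
  then show ?case by simp
qed simp

lemma time_ex_tm: "(\<And>x. x \<in> set xs \<Longrightarrow> time (f x) \<le> T) \<Longrightarrow> time (ex_tm f xs) \<le> 1 + length xs * (T + 1)"
proof (induction xs)
  case (Cons x xs)
  have "time (ex_tm f xs) \<le> 1 + length xs * (T + 1)" "time (f x) \<le> T" using Cons by auto
  then show ?case by simp
qed simp

lemma time_append_tm [simp]: "time (append_tm xs ys) = length xs + 1"
  by (induction xs) simp_all

lemma time_concat_tm: "(\<And>xs. xs \<in> set xss \<Longrightarrow> length xs + 1 \<le> T) \<Longrightarrow> time (concat_tm xss) \<le> 1 + length xss * (T + 1)"
proof (induction xss)
  case (Cons xs xss)
  have "time (concat_tm xss) \<le> 1 + length xss * (T + 1)" "length xs + 1 \<le> T" using Cons by auto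
  then show ?case by simp
qed simp

lemma time_nth_tm: "time (nth_tm xs i) \<le> 1 + length xs"
  by (induction xs arbitrary: i) (simp_all split: nat.splits)

lemma time_sublists_tm: "time (sublists_tm xs) \<le> 1 + 3 * length xs + 3 * 2 ^ length xs"
proof (induction xs)
  case (Cons x xs)
  have "time (map_tm (\<lambda>ys. tick (ret (x # ys))) (val (sublists_tm xs))) \<le> 1 + 2 ^ length xs * 2"
    using time_map_tm[of "val (sublists_tm xs)" "\<lambda>ys. tick (ret (x # ys))" 1] by (simp add: sublists_tm_props(3))
  then show ?case using Cons.IH by (simp add: sublists_tm_props(3))
qed simp

lemma time_iterate_tm:
  assumes "\<And>s. P s \<Longrightarrow> P (val (F s)) \<and> time (F s) \<le> T"
  shows "P s \<Longrightarrow> time (iterate_tm F cs s) \<le> 1 + length cs * (T + 1)"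
proof (induction cs arbitrary: s)
  case (Cons c cs)
  have "time (F s) \<le> T" "time (iterate_tm F cs (val (F s))) \<le> 1 + length cs * (T + 1)"
    using assms[OF Cons.prems] Cons.IH by blast+
  then show ?case by simp
qed simp

lemma time_eq_fm_tm: "time (eq_fm_tm \<psi> \<chi>) \<le> 3 * fm_size \<psi>"
proof (induction \<psi> arbitrary: \<chi>)
  case (And \<psi>1 \<psi>2)
  show ?case
  proof (cases \<chi>)
    case (And a b)
    then show ?thesis using And.IH(1)[of a] And.IH(2)[of b] by (auto simp: eq_fm_tm.simps)
  qed (simp_all add: eq_fm_tm.simps)
next
  case (Or \<psi>1 \<psi>2)
  show ?case
  proof (cases \<chi>)
    case (Or a b)
    then show ?thesis using Or.IH(1)[of a] Or.IH(2)[of b] by (auto simp: eq_fm_tm.simps)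
  qed (simp_all add: eq_fm_tm.simps)
next
  case (Dia c \<psi>)
  show ?case
  proof (cases \<chi>)
    case (Dia a b)
    then show ?thesis using Dia.IH[of b] by (simp add: eq_fm_tm.simps eq_atom_tm_def)
  qed (simp_all add: eq_fm_tm.simps)
next
  case (Box c \<psi>)
  show ?case
  proof (cases \<chi>)
    case (Box a b)
    then show ?thesis using Box.IH[of b] by (simp add: eq_fm_tm.simps eq_atom_tm_def)
  qed (simp_all add: eq_fm_tm.simps)
next
  case (Fix \<eta> X \<psi>)
  show ?case
  proof (cases \<chi>)
    case (Fix \<eta>' X' b)
    then show ?thesis using Fix.IH[of b] by (simp add: eq_fm_tm.simps eq_atom_tm_def)
  qed (simp_all add: eq_fm_tm.simps)
next
  case Bot
  show ?case by (cases \<chi>) (simp_all add: eq_fm_tm.simps)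
next
  case Top
  show ?case by (cases \<chi>) (simp_all add: eq_fm_tm.simps)
next
  case (Prop p)
  show ?case by (cases \<chi>) (simp_all add: eq_fm_tm.simps eq_atom_tm_def)
next
  case (NProp p)
  show ?case by (cases \<chi>) (simp_all add: eq_fm_tm.simps eq_atom_tm_def)
next
  case (Var X)
  show ?case by (cases \<chi>) (simp_all add: eq_fm_tm.simps eq_atom_tm_def)
qed

lemma time_subst_tm: "time (subst_tm X \<chi> \<psi>) \<le> 3 * fm_size \<psi>"
  by (induction \<psi>) (simp_all add: eq_atom_tm_def)

lemma fm_size_subst: "fm_size \<alpha> \<le> fm_size (subst X \<chi> \<alpha>)"
proof (induction \<alpha>)
  case (Var Y)
  then show ?case using fm_size_pos[of \<chi>] by simp
qed simp_all

text \<open>Substitution never shrinks a formula, so the size of the result bounds all intermediate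
  formulas. In its use the result lies in the closure.\<close>

lemma time_apply_unfolding_tm:
  "\<forall>\<chi> \<in> set \<sigma>. is_fix \<chi> \<Longrightarrow> fm_size (apply_unfolding \<sigma> \<alpha>) \<le> S \<Longrightarrow>
   fm_size \<alpha> \<le> S \<and> time (apply_unfolding_tm (map lit \<sigma>) \<alpha>) \<le> 1 + length \<sigma> * (3 * S + 1)"
proof (induction \<sigma> arbitrary: \<alpha>)
  case (Cons \<chi> \<sigma>)
  then obtain \<eta> X \<psi> where \<chi>: "\<chi> = Fix \<eta> X \<psi>" by (auto simp: is_fix_def)
  have IH: "fm_size (subst X \<chi> \<alpha>) \<le> S" "time (apply_unfolding_tm (map lit \<sigma>) (subst X \<chi> \<alpha>)) \<le> 1 + length \<sigma> * (3 * S + 1)"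
    using Cons.IH[of "subst X \<chi> \<alpha>"] Cons.prems \<chi> by auto
  then have "fm_size \<alpha> \<le> S" using fm_size_subst[of \<alpha> X \<chi>] by simp
  moreover have "time (subst_tm X \<chi> \<alpha>) \<le> 3 * S" using time_subst_tm[of X \<chi> \<alpha>] calculation by simp
  ultimately show ?case using IH \<chi> by simp
qed simp

lemma length_fv_tm: "length (val (fv_tm \<alpha>)) \<le> fm_size \<alpha>"
proof (induction \<alpha>)
  case (Fix \<eta> X \<psi>)
  have "length (val (fv_tm (Fix \<eta> X \<psi>))) \<le> length (val (fv_tm \<psi>))" by simp
  also have "\<dots> \<le> fm_size \<psi>" by (rule Fix.IH)
  finally show ?case by (simp only: fm_size.simps)
qed simp_all

lemma time_fv_tm: "fm_size \<alpha> \<le> N \<Longrightarrow> time (fv_tm \<alpha>) \<le> fm_size \<alpha> * (3 * N + 3)"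
proof (induction \<alpha>)
  case (And \<alpha>1 \<alpha>2)
  then show ?case using length_fv_tm[of \<alpha>1] by (simp add: algebra_simps)
next
  case (Or \<alpha>1 \<alpha>2)
  then show ?case using length_fv_tm[of \<alpha>1] by (simp add: algebra_simps)
next
  case (Fix \<eta> X \<psi>)
  let ?xs = "val (fv_tm \<psi>)"
  have "time (remove_tm eq_atom_tm X ?xs) \<le> 2 + length ?xs * 3"
    using time_filter_tm[of ?xs "\<lambda>y. tick (bind_tm (eq_atom_tm X y) (\<lambda>b. ret (\<not> b)))" 2]
    by (simp add: remove_tm_def eq_atom_tm_def)
  then show ?case using Fix length_fv_tm[of \<psi>] by (simp add: algebra_simps)
qed (simp_all add: algebra_simps)

section \<open>Bounds by powers of a sufficiently large base\<close>

lemma upower: "x \<le> M ^ a \<Longrightarrow> a \<le> c \<Longrightarrow> (16::nat) \<le> M \<Longrightarrow> x \<le> M ^ c"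
  by (meson le_trans power_increasing one_le_numeral)

text \<open>The scheme of all time bounds: a sum of at most sixteen terms \<open>M ^ a\<close> is at
  most \<open>M ^ (a + 1)\<close>, and by \<open>loop_bound\<close> the exponent of a loop is that
  of its length plus that of its body plus one. Thus the exponents depend on the program only and
  not on the input.\<close>

lemma upower16: "x \<le> 16 * M ^ a \<Longrightarrow> a < c \<Longrightarrow> (16::nat) \<le> M \<Longrightarrow> x \<le> M ^ c"
proof -
  assume a: "x \<le> 16 * M ^ a" "a < c" "16 \<le> M"
  have "16 * M ^ a \<le> M ^ Suc a" unfolding power_Suc using a(3) by (rule mult_le_mono1)
  then have "x \<le> M ^ Suc a" using a(1) by linarith
  then show ?thesis by (rule upower) (use a in simp_all)
qed

lemma loop_bound:
  assumes "len \<le> M ^ a" "T \<le> M ^ b" "a + b + 1 \<le> c" "(16::nat) \<le> M"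
  shows "1 + len * (T + 1) \<le> M ^ c"
proof -
  have one: "1 \<le> M ^ b" "1 \<le> M ^ (a + b)" using assms(4) by simp_all
  have "len * (T + 1) \<le> M ^ a * (2 * M ^ b)" using assms(2) one(1) by (intro mult_le_mono assms(1)) linarith
  also have "\<dots> = 2 * M ^ (a + b)" by (simp add: power_add)
  finally have "1 + len * (T + 1) \<le> 16 * M ^ (a + b)" using one(2) by linarith
  then show ?thesis by (rule upower16) (use assms in simp_all)
qed

lemma time_mem_tm:
  assumes "length xs \<le> M ^ a" "\<And>y. y \<in> set xs \<Longrightarrow> time (eq x y) \<le> M ^ b" "a + b + 2 \<le> c" "16 \<le> M"
  shows "time (mem_tm eq x xs) \<le> M ^ c"
proof -
  have "time (ex_tm (eq x) xs) \<le> 1 + length xs * (M ^ b + 1)" by (rule time_ex_tm) (rule assms(2))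
  also have "\<dots> \<le> M ^ (a + b + 1)" by (rule loop_bound[OF assms(1) order_refl _ assms(4)]) simp
  finally have "time (ex_tm (eq x) xs) \<le> M ^ (a + b + 1)" .
  moreover have "1 \<le> M ^ (a + b + 1)" using assms(4) by (intro one_le_power) simp
  moreover have "time (mem_tm eq x xs) = Suc (time (ex_tm (eq x) xs))" by (simp add: mem_tm_def)
  ultimately have "time (mem_tm eq x xs) \<le> 16 * M ^ (a + b + 1)" by linarith
  then show ?thesis by (rule upower16) (use assms in simp_all)
qed

lemma time_remove_tm:
  assumes "length xs \<le> M ^ a" "\<And>y. y \<in> set xs \<Longrightarrow> time (eq x y) \<le> M ^ b" "a + b + 3 \<le> c" "16 \<le> M"
  shows "time (remove_tm eq x xs) \<le> M ^ c"
proof -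
  have 1: "1 \<le> M ^ b" using assms(4) by simp
  have "time (tick (bind_tm (eq x y) (\<lambda>b. ret (\<not> b)))) \<le> M ^ (b + 1)" if "y \<in> set xs" for y
  proof (rule upower16[of _ M b])
    have "time (tick (bind_tm (eq x y) (\<lambda>b. ret (\<not> b)))) = Suc (time (eq x y))" by simp
    then show "time (tick (bind_tm (eq x y) (\<lambda>b. ret (\<not> b)))) \<le> 16 * M ^ b"
      using assms(2)[OF that] 1 by linarith
  qed (use assms(4) in simp_all)
  then have "time (filter_tm (\<lambda>y. tick (bind_tm (eq x y) (\<lambda>b. ret (\<not> b)))) xs) \<le> 1 + length xs * (M ^ (b + 1) + 1)"
    by (rule time_filter_tm)
  also have "\<dots> \<le> M ^ (a + b + 2)" by (rule loop_bound[OF assms(1) order_refl _ assms(4)]) simp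
  finally have "time (filter_tm (\<lambda>y. tick (bind_tm (eq x y) (\<lambda>b. ret (\<not> b)))) xs) \<le> M ^ (a + b + 2)" .
  moreover have "1 \<le> M ^ (a + b + 2)" using assms(4) by (intro one_le_power) simp
  moreover have "time (remove_tm eq x xs) = Suc (time (filter_tm (\<lambda>y. tick (bind_tm (eq x y) (\<lambda>b. ret (\<not> b)))) xs))"
    by (simp add: remove_tm_def)
  ultimately have "time (remove_tm eq x xs) \<le> 16 * M ^ (a + b + 2)" by linarith
  then show ?thesis by (rule upower16) (use assms in simp_all)
qed

lemma time_union_tm:
  assumes "length xs \<le> M ^ a" "length ys \<le> M ^ a"
    "\<And>x y. x \<in> set xs \<Longrightarrow> y \<in> set xs \<union> set ys \<Longrightarrow> time (eq x y) \<le> M ^ b" "2 * a + b + 4 \<le> c" "16 \<le> M"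
  shows "time (union_tm eq xs ys) \<le> M ^ c"
proof -
  have "set xs' \<subseteq> set xs \<Longrightarrow> length xs' \<le> length xs \<Longrightarrow>
      time (union_tm eq xs' ys) \<le> 1 + length xs' * (M ^ (a + b + 3) + 1)" for xs'
  proof (induction xs')
    case (Cons x xs')
    let ?zs = "val (union_tm eq xs' ys)"
    \<comment> \<open>The accumulated list can be as long as both arguments together, hence the
      exponent \<open>a + 1\<close>.\<close>
    have "length ?zs \<le> 16 * M ^ a" using length_union_tm[of eq xs' ys] assms(1,2) Cons.prems by simp
    then have l: "length ?zs \<le> M ^ (a + 1)" by (rule upower16) (use assms(5) in simp_all)
    have "time (mem_tm eq x ?zs) \<le> M ^ (a + b + 3)"
    proof (rule time_mem_tm[OF l _ _ assms(5)])
      show "time (eq x y) \<le> M ^ b" if "y \<in> set ?zs" for y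
        using that union_tm_subset[of eq xs' ys] Cons.prems by (intro assms(3)) auto
    qed simp
    moreover have "time (union_tm eq xs' ys) \<le> 1 + length xs' * (M ^ (a + b + 3) + 1)" using Cons by simp
    ultimately show ?case by simp
  qed simp
  then have "time (union_tm eq xs ys) \<le> 1 + length xs * (M ^ (a + b + 3) + 1)" by blast
  also have "\<dots> \<le> M ^ c" by (rule loop_bound[OF assms(1) order_refl _ assms(5)]) (use assms(4) in simp)
  finally show ?thesis .
qed

lemma time_seteq_tm:
  assumes "length xs \<le> M ^ a" "length ys \<le> M ^ a"
    "\<And>x y. x \<in> set xs \<union> set ys \<Longrightarrow> y \<in> set xs \<union> set ys \<Longrightarrow> time (eq x y) \<le> M ^ b" "2 * a + b + 4 \<le> c" "16 \<le> M"
  shows "time (seteq_tm eq xs ys) \<le> M ^ c"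
proof -
  have *: "time (all_tm (\<lambda>x. mem_tm eq x ys') xs') \<le> M ^ (2 * a + b + 3)"
    if "length xs' \<le> M ^ a" "length ys' \<le> M ^ a" "set xs' \<union> set ys' \<subseteq> set xs \<union> set ys" for xs' ys'
  proof -
    have "time (all_tm (\<lambda>x. mem_tm eq x ys') xs') \<le> 1 + length xs' * (M ^ (a + b + 2) + 1)"
      by (intro time_all_tm time_mem_tm[OF that(2) assms(3) _ assms(5)]) (use that(3) in auto)
    also have "\<dots> \<le> M ^ (2 * a + b + 3)" by (rule loop_bound[OF that(1) order_refl _ assms(5)]) simp
    finally show ?thesis .
  qed
  have "time (all_tm (\<lambda>x. mem_tm eq x ys) xs) \<le> M ^ (2 * a + b + 3)"
    "time (all_tm (\<lambda>x. mem_tm eq x xs) ys) \<le> M ^ (2 * a + b + 3)"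
    using *[of xs ys] *[of ys xs] assms(1,2) by auto
  moreover have "1 \<le> M ^ (2 * a + b + 3)" using assms(5) by (intro one_le_power) simp
  moreover have "time (seteq_tm eq xs ys) \<le>
      Suc (time (all_tm (\<lambda>x. mem_tm eq x ys) xs) + time (all_tm (\<lambda>x. mem_tm eq x xs) ys))"
    by (simp add: seteq_tm_def)
  ultimately have "time (seteq_tm eq xs ys) \<le> 16 * M ^ (2 * a + b + 3)" by linarith
  then show ?thesis by (rule upower16) (use assms in simp_all)
qed

context admissible
begin

abbreviation n :: nat where "n \<equiv> fm_size \<phi>"

text \<open>The base of all time bounds. It bounds the size \<open>4 ^ n\<close> of formulas in the
  closure and the number \<open>2 ^ (2 * n + 1)\<close> of represented focused nodes, and it is at
  least 16, so that one more power absorbs the constants.\<close>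

definition M :: nat where "M = 2 ^ (4 * n)"

lemma n_pos: "1 \<le> n"
  using fm_size_pos[of \<phi>] by simp

lemma M16: "16 \<le> M"
proof -
  have "(2::nat) ^ 4 \<le> 2 ^ (4 * n)" using n_pos by (intro power_increasing) simp_all
  then show ?thesis by (simp add: M_def)
qed

lemma one_le_M: "1 \<le> M ^ k"
  using M16 by (intro one_le_power) simp

lemma two_power_le_M: "k \<le> 4 * n \<Longrightarrow> 2 ^ k \<le> M"
  unfolding M_def by (rule power_increasing) simp_all

lemma n_le_M: "n \<le> M"
  by (rule le_trans[OF less_imp_le[OF less_exp] two_power_le_M]) simp

lemma FL_le_M: "x \<in> FL \<phi> \<Longrightarrow> fm_size x \<le> M"
proof -
  assume "x \<in> FL \<phi>"
  then have "fm_size x \<le> 4 ^ n" by (rule fm_size_FL)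
  also have "(4::nat) ^ n = 2 ^ (2 * n)" by (simp add: power_mult)
  also have "\<dots> \<le> M" by (rule two_power_le_M) simp
  finally show ?thesis .
qed

lemma up: "x \<le> M ^ a \<Longrightarrow> a \<le> c \<Longrightarrow> x \<le> M ^ c"
  using upower[OF _ _ M16] .

lemma up16: "x \<le> 16 * M ^ a \<Longrightarrow> a < c \<Longrightarrow> x \<le> M ^ c"
  using upower16[OF _ _ M16] .

lemma loop: "len \<le> M ^ a \<Longrightarrow> T \<le> M ^ b \<Longrightarrow> a + b + 1 \<le> c \<Longrightarrow> 1 + len * (T + 1) \<le> M ^ c"
  using loop_bound[OF _ _ _ M16] .

lemma length_node: "node_list \<Gamma> \<Longrightarrow> length \<Gamma> \<le> M ^ 1"
  using length_node_list[of \<Gamma>] n_le_M by simp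

lemma time_eq_FL: "x \<in> FL \<phi> \<Longrightarrow> time (eq_fm_tm x y) \<le> M ^ 2"
  by (rule up16[of _ 1]) (use time_eq_fm_tm[of x y] FL_le_M[of x] in simp_all)

lemma node_FL: "node_list \<Gamma> \<Longrightarrow> x \<in> set \<Gamma> \<Longrightarrow> x \<in> FL \<phi>"
  by (auto simp: node_list_def)

subsection \<open>Computing the deferrals\<close>

lemma occ_length: "occ \<phi> \<sigma> \<alpha> \<Longrightarrow> length \<sigma> + fm_size \<alpha> \<le> n"
proof (induction rule: occ.induct)
  case (fix_closed \<sigma> \<eta> X \<alpha>)
  then show ?case by simp
qed simp_all

lemma occ_size: "occ \<phi> \<sigma> \<alpha> \<Longrightarrow> fm_size \<alpha> \<le> M \<and> length \<sigma> \<le> M"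
  using occ_length[of \<sigma> \<alpha>] n_le_M by linarith

lemma time_fv_occ: "occ \<phi> \<sigma> \<alpha> \<Longrightarrow> time (fv_tm \<alpha>) \<le> M ^ 3"
proof -
  assume "occ \<phi> \<sigma> \<alpha>"
  then have s: "fm_size \<alpha> \<le> M" using occ_size by blast
  have "time (fv_tm \<alpha>) \<le> fm_size \<alpha> * (3 * M + 3)" using time_fv_tm[OF s] .
  also have "\<dots> \<le> M * (M * M)"
  proof (rule mult_le_mono[OF s])
    have "3 * M + 3 \<le> 16 * M" using M16 by simp
    also have "\<dots> \<le> M * M" using M16 by (rule mult_le_mono1)
    finally show "3 * M + 3 \<le> M * M" .
  qed
  finally show ?thesis by (simp add: power3_eq_cube)
qed

lemma time_open_instance:
  assumes "occ \<phi> \<sigma> \<alpha>"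
  shows "time (open_instance_tm (map lit \<sigma>) \<alpha>) \<le> M ^ 4"
proof -
  have fx: "\<forall>\<chi> \<in> set \<sigma>. is_fix \<chi>" using occ_subfms[OF assms] by blast
  have "psubst (env \<sigma>) \<alpha> \<in> FL \<phi>" unfolding FL_def using assms by blast
  then have "fm_size (apply_unfolding \<sigma> \<alpha>) \<le> M" using FL_le_M occ_apply_unfolding[OF assms clean] by metis
  from time_apply_unfolding_tm[OF fx this]
  have "time (apply_unfolding_tm (map lit \<sigma>) \<alpha>) \<le> 1 + length \<sigma> * (3 * M + 1)" by blast
  also have "\<dots> \<le> M ^ 3"
  proof -
    have "1 + length \<sigma> * (3 * M + 1) \<le> 1 + M * (3 * M + 1)"
      using occ_size[OF assms] by (intro add_mono mult_le_mono) simp_all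
    also have "\<dots> = 1 + 3 * (M * M) + M" by (simp add: algebra_simps)
    also have "\<dots> \<le> 16 * (M * M)"
    proof -
      have "M \<le> M * M" using M16 by simp
      then show ?thesis using M16 by linarith
    qed
    also have "\<dots> \<le> M * (M * M)" using M16 by (rule mult_le_mono1)
    finally show ?thesis by (simp add: power3_eq_cube)
  qed
  finally have "time (apply_unfolding_tm (map lit \<sigma>) \<alpha>) \<le> M ^ 3" .
  moreover have "time (open_instance_tm (map lit \<sigma>) \<alpha>) \<le>
      Suc (time (fv_tm \<alpha>) + time (apply_unfolding_tm (map lit \<sigma>) \<alpha>))"
    by (simp add: open_instance_tm_def)
  ultimately have "time (open_instance_tm (map lit \<sigma>) \<alpha>) \<le> 16 * M ^ 3"
    using time_fv_occ[OF assms] one_le_M[of 3] by linarith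
  then show ?thesis by (rule up16) simp
qed

lemma length_open_instance: "length (val (open_instance_tm \<sigma> \<alpha>)) \<le> 1"
  by (simp add: open_instance_tm_def)

lemma length_collect_deferrals: "length (val (collect_deferrals_tm \<alpha> \<sigma>)) \<le> fm_size \<alpha>"
proof (induction \<alpha> arbitrary: \<sigma>)
  case (And \<alpha> \<beta>)
  show ?case using And.IH(1)[of \<sigma>] And.IH(2)[of \<sigma>] length_open_instance[of \<sigma> "And \<alpha> \<beta>"] by simp
next
  case (Or \<alpha> \<beta>)
  show ?case using Or.IH(1)[of \<sigma>] Or.IH(2)[of \<sigma>] length_open_instance[of \<sigma> "Or \<alpha> \<beta>"] by simp
next
  case (Dia a \<alpha>)
  show ?case using Dia.IH[of \<sigma>] length_open_instance[of \<sigma> "Dia a \<alpha>"] by simp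
next
  case (Box a \<alpha>)
  show ?case using Box.IH[of \<sigma>] length_open_instance[of \<sigma> "Box a \<alpha>"] by simp
next
  case (Fix \<eta> X \<psi>)
  show ?case using Fix.IH[of "(X, Fix \<eta> X \<psi>) # \<sigma>"] length_open_instance[of \<sigma> "Fix \<eta> X \<psi>"] by simp
next
  case (Var X)
  show ?case using length_open_instance[of \<sigma> "Var X"] by simp
qed simp_all

text \<open>Linear in the size of \<open>\<alpha>\<close>: each subformula pays \<open>M ^ 5\<close>
  for its own instance, so the recursion does not raise the exponent.\<close>

lemma time_collect_deferrals: "occ \<phi> \<sigma> \<alpha> \<Longrightarrow> time (collect_deferrals_tm \<alpha> (map lit \<sigma>)) \<le> fm_size \<alpha> * M ^ 5"
proof (induction \<alpha> arbitrary: \<sigma>)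
  case (Var X)
  have "time (collect_deferrals_tm (Var X) (map lit \<sigma>)) \<le> 16 * M ^ 4"
    using time_open_instance[OF Var] one_le_M[of 4] by simp
  then have "time (collect_deferrals_tm (Var X) (map lit \<sigma>)) \<le> M ^ 5" by (rule up16) simp
  then show ?case by simp
next
  case (And \<alpha> \<beta>)
  let ?xs = "val (open_instance_tm (map lit \<sigma>) (And \<alpha> \<beta>))" and ?ys = "val (collect_deferrals_tm \<alpha> (map lit \<sigma>))"
    and ?zs = "val (collect_deferrals_tm \<beta> (map lit \<sigma>))"
  have l: "length ?xs \<le> 1" "length ?ys \<le> M ^ 4" "length ?zs \<le> M ^ 4"
    using length_open_instance length_collect_deferrals[of \<alpha>] length_collect_deferrals[of \<beta>] occ_size[OF And.prems]
      up[of M 1 4] by (force intro: le_trans)+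
  have "time (collect_deferrals_tm (And \<alpha> \<beta>) (map lit \<sigma>)) =
      time (open_instance_tm (map lit \<sigma>) (And \<alpha> \<beta>)) + time (collect_deferrals_tm \<alpha> (map lit \<sigma>)) +
      time (collect_deferrals_tm \<beta> (map lit \<sigma>)) + length ?xs + length ?ys + length ?zs + 8" by simp
  moreover have "time (open_instance_tm (map lit \<sigma>) (And \<alpha> \<beta>)) + length ?xs + length ?ys + length ?zs + 8 \<le> M ^ 5"
    by (rule up16[of _ 4]) (use time_open_instance[OF And.prems] l one_le_M[of 4] in linarith, simp)
  ultimately show ?case using And.IH(1)[OF occ.and1[OF And.prems]] And.IH(2)[OF occ.and2[OF And.prems]]
    by (simp add: algebra_simps)
next
  case (Or \<alpha> \<beta>)
  let ?xs = "val (open_instance_tm (map lit \<sigma>) (Or \<alpha> \<beta>))" and ?ys = "val (collect_deferrals_tm \<alpha> (map lit \<sigma>))"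
    and ?zs = "val (collect_deferrals_tm \<beta> (map lit \<sigma>))"
  have l: "length ?xs \<le> 1" "length ?ys \<le> M ^ 4" "length ?zs \<le> M ^ 4"
    using length_open_instance length_collect_deferrals[of \<alpha>] length_collect_deferrals[of \<beta>] occ_size[OF Or.prems]
      up[of M 1 4] by (force intro: le_trans)+
  have "time (collect_deferrals_tm (Or \<alpha> \<beta>) (map lit \<sigma>)) =
      time (open_instance_tm (map lit \<sigma>) (Or \<alpha> \<beta>)) + time (collect_deferrals_tm \<alpha> (map lit \<sigma>)) +
      time (collect_deferrals_tm \<beta> (map lit \<sigma>)) + length ?xs + length ?ys + length ?zs + 8" by simp
  moreover have "time (open_instance_tm (map lit \<sigma>) (Or \<alpha> \<beta>)) + length ?xs + length ?ys + length ?zs + 8 \<le> M ^ 5"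
    by (rule up16[of _ 4]) (use time_open_instance[OF Or.prems] l one_le_M[of 4] in linarith, simp)
  ultimately show ?case using Or.IH(1)[OF occ.or1[OF Or.prems]] Or.IH(2)[OF occ.or2[OF Or.prems]]
    by (simp add: algebra_simps)
next
  case (Dia a \<alpha>)
  have "time (open_instance_tm (map lit \<sigma>) (Dia a \<alpha>)) + length (val (open_instance_tm (map lit \<sigma>) (Dia a \<alpha>))) + 2 \<le> M ^ 5"
    by (rule up16[of _ 4])
      (use time_open_instance[OF Dia.prems] length_open_instance[of "map lit \<sigma>" "Dia a \<alpha>"] one_le_M[of 4] in linarith, simp)
  then show ?case using Dia.IH[OF occ.dia[OF Dia.prems]] by (simp add: algebra_simps)
next
  case (Box a \<alpha>)
  have "time (open_instance_tm (map lit \<sigma>) (Box a \<alpha>)) + length (val (open_instance_tm (map lit \<sigma>) (Box a \<alpha>))) + 2 \<le> M ^ 5"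
    by (rule up16[of _ 4])
      (use time_open_instance[OF Box.prems] length_open_instance[of "map lit \<sigma>" "Box a \<alpha>"] one_le_M[of 4] in linarith, simp)
  then show ?case using Box.IH[OF occ.box[OF Box.prems]] by (simp add: algebra_simps)
next
  case (Fix \<eta> X \<psi>)
  have fx: "\<forall>\<chi> \<in> set \<sigma>. is_fix \<chi>" using occ_subfms[OF Fix.prems] by blast
  let ?o = "open_instance_tm (map lit \<sigma>) (Fix \<eta> X \<psi>)"
  have o: "time ?o + length (val ?o) + 2 \<le> M ^ 5"
    by (rule up16[of _ 4])
      (use time_open_instance[OF Fix.prems] length_open_instance[of "map lit \<sigma>" "Fix \<eta> X \<psi>"] one_le_M[of 4] in linarith, simp)
  show ?case
  proof (cases "closed_fm (Fix \<eta> X \<psi>)")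
    case True
    then show ?thesis using o val_open_instance_tm[OF fx, of "Fix \<eta> X \<psi>"] by (simp add: algebra_simps)
  next
    case False
    have "time (collect_deferrals_tm \<psi> (map lit (Fix \<eta> X \<psi> # \<sigma>))) \<le> fm_size \<psi> * M ^ 5"
      by (rule Fix.IH[OF occ.fix_open[OF Fix.prems False]])
    then show ?thesis using o by (simp add: algebra_simps)
  qed
qed (use one_le_M[of 5] in simp_all)

lemma length_all_deferrals: "fm_size \<alpha> \<le> k \<Longrightarrow> length (val (all_deferrals_tm \<alpha>)) \<le> fm_size \<alpha> * k"
proof (induction \<alpha>)
  case (Fix \<eta> X \<psi>)
  show ?case using Fix length_collect_deferrals[of \<psi> "[(X, Fix Mu X \<psi>)]"] by (simp add: algebra_simps)
qed (simp_all add: algebra_simps)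

lemma length_D: "length D \<le> M ^ 1"
proof -
  have "length D \<le> n * n" by (rule length_all_deferrals) simp
  also have "\<dots> \<le> 2 ^ n * 2 ^ n" using less_exp[of n] by (intro mult_le_mono) simp_all
  also have "\<dots> = 2 ^ (2 * n)" by (simp add: power_add mult_2)
  also have "\<dots> \<le> M" by (rule two_power_le_M) simp
  finally show ?thesis by simp
qed

lemma time_all_deferrals_occ: "occ \<phi> \<sigma> \<alpha> \<Longrightarrow> time (all_deferrals_tm \<alpha>) \<le> fm_size \<alpha> * M ^ 7"
proof (induction \<alpha> arbitrary: \<sigma>)
  case (And \<alpha> \<beta>)
  have "length (val (all_deferrals_tm \<alpha>)) \<le> M ^ 2"
  proof -
    have s: "fm_size \<alpha> \<le> M" using occ_size[OF And.prems] by simp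
    have "length (val (all_deferrals_tm \<alpha>)) \<le> fm_size \<alpha> * M" using length_all_deferrals[OF s] .
    also have "\<dots> \<le> M * M" using s by (rule mult_le_mono1)
    finally show ?thesis by (simp add: power2_eq_square)
  qed
  then have "length (val (all_deferrals_tm \<alpha>)) + 2 \<le> M ^ 7"
    by (intro up16[of _ 2]) (use one_le_M[of 2] in linarith, simp)
  then show ?case using And.IH(1)[OF occ.and1[OF And.prems]] And.IH(2)[OF occ.and2[OF And.prems]] by (simp add: algebra_simps)
next
  case (Or \<alpha> \<beta>)
  have "length (val (all_deferrals_tm \<alpha>)) \<le> M ^ 2"
  proof -
    have s: "fm_size \<alpha> \<le> M" using occ_size[OF Or.prems] by simp
    have "length (val (all_deferrals_tm \<alpha>)) \<le> fm_size \<alpha> * M" using length_all_deferrals[OF s] .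
    also have "\<dots> \<le> M * M" using s by (rule mult_le_mono1)
    finally show ?thesis by (simp add: power2_eq_square)
  qed
  then have "length (val (all_deferrals_tm \<alpha>)) + 2 \<le> M ^ 7"
    by (intro up16[of _ 2]) (use one_le_M[of 2] in linarith, simp)
  then show ?case using Or.IH(1)[OF occ.or1[OF Or.prems]] Or.IH(2)[OF occ.or2[OF Or.prems]] by (simp add: algebra_simps)
next
  case (Dia a \<alpha>)
  then show ?case using Dia.IH[OF occ.dia[OF Dia.prems]] one_le_M[of 7] by simp
next
  case (Box a \<alpha>)
  then show ?case using Box.IH[OF occ.box[OF Box.prems]] one_le_M[of 7] by simp
next
  case (Fix \<eta> X \<psi>)
  let ?\<chi> = "Fix \<eta> X \<psi>"
  let ?c = "collect_deferrals_tm \<psi> [(X, ?\<chi>)]"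
  obtain \<sigma>' where "occ \<phi> \<sigma>' \<psi>" using occ_unfold[OF closed Fix.prems] by blast
  then have IH: "time (all_deferrals_tm \<psi>) \<le> fm_size \<psi> * M ^ 7" by (rule Fix.IH)
  have sz: "fm_size \<psi> \<le> M" using occ_size[OF Fix.prems] by simp
  have fv: "time (fv_tm ?\<chi>) \<le> M ^ 6" by (rule up[OF time_fv_occ[OF Fix.prems]]) simp
  have c: "time ?c \<le> M ^ 6" "length (val ?c) \<le> M ^ 6" if "closed_fm ?\<chi>"
  proof -
    have "time ?c \<le> fm_size \<psi> * M ^ 5"
      using time_collect_deferrals[OF occ.fix_closed[OF Fix.prems that]] by simp
    also have "\<dots> \<le> M * M ^ 5" using sz by (rule mult_le_mono1)
    finally show "time ?c \<le> M ^ 6" by (simp add: eval_nat_numeral)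
    show "length (val ?c) \<le> M ^ 6"
      by (rule up[of _ 1]) (use le_trans[OF length_collect_deferrals[of \<psi> "[(X, ?\<chi>)]"] sz] in simp_all)
  qed
  have "time (all_deferrals_tm ?\<chi>) \<le> time (all_deferrals_tm \<psi>) + (time (fv_tm ?\<chi>) +
      (if closed_fm ?\<chi> then time ?c + length (val ?c) + 1 else 0) + 1)"
    using fv_tm_Nil[of ?\<chi>] by (simp del: fv_tm.simps fv_tm_Nil)
  also have "time (fv_tm ?\<chi>) + (if closed_fm ?\<chi> then time ?c + length (val ?c) + 1 else 0) + 1 \<le> M ^ 7"
  proof (rule up16[of _ 6])
    show "time (fv_tm ?\<chi>) + (if closed_fm ?\<chi> then time ?c + length (val ?c) + 1 else 0) + 1 \<le> 16 * M ^ 6"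
    proof (cases "closed_fm ?\<chi>")
      case True
      then have "(if closed_fm ?\<chi> then time ?c + length (val ?c) + 1 else 0) = time ?c + length (val ?c) + 1" by simp
      then show ?thesis using fv c[OF True] one_le_M[of 6] by linarith
    next
      case False
      then have "(if closed_fm ?\<chi> then time ?c + length (val ?c) + 1 else 0) = 0" by simp
      then show ?thesis using fv one_le_M[of 6] by linarith
    qed
  qed simp
  finally show ?case using IH by (simp add: algebra_simps)
qed (use one_le_M[of 7] in simp_all)

lemma time_all_deferrals: "time (all_deferrals_tm \<phi>) \<le> M ^ 8"
proof -
  have "time (all_deferrals_tm \<phi>) \<le> n * M ^ 7" by (rule time_all_deferrals_occ[OF occ.root])
  also have "\<dots> \<le> M * M ^ 7" using n_le_M by (rule mult_le_mono1)
  finally show ?thesis by (simp add: eval_nat_numeral)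
qed

end

lemma concl_Domain:
  assumes "\<Sigma> \<in> concl \<Delta>" "c \<in> \<Sigma>" shows "Domain (snd c) \<subseteq> \<Delta>"
  using assms by (auto simp: concl_def split: if_splits elim!: modal_rules.cases nonmodal_rules.cases)
    (auto simp: replace_def)

lemma length_concat_le:
  "(\<And>xs. xs \<in> set xss \<Longrightarrow> length xs \<le> k) \<Longrightarrow> length (concat xss) \<le> length xss * k"
  by (induction xss) (simp_all add: add_mono)

lemma time_boxes_tm: "time (boxes_tm a \<Delta>) \<le> 1 + 2 * length \<Delta>"
proof (induction \<Delta>)
  case (Cons \<chi> \<Delta>)
  then show ?case by (cases \<chi>) (simp_all add: eq_atom_tm_def)
qed simp

lemma length_boxes_tm: "length (val (boxes_tm a \<Delta>)) \<le> length \<Delta>"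
proof (induction \<Delta>)
  case (Cons \<psi> \<Delta>)
  then show ?case by (cases \<psi>) auto
qed simp

context admissible
begin

subsection \<open>Tableau rules\<close>

lemma M_ge: "2 \<le> M ^ 1"
  using M16 by simp

lemma time_mem_fm: "x \<in> FL \<phi> \<Longrightarrow> length xs \<le> M ^ a \<Longrightarrow> a + 4 \<le> c \<Longrightarrow> time (mem_tm eq_fm_tm x xs) \<le> M ^ c"
  by (rule time_mem_tm[where a = a and b = 2]) (use time_eq_FL M16 in auto)

lemma time_deferrals_tm:
  assumes "set \<Gamma> \<subseteq> FL \<phi>" "length \<Gamma> \<le> M ^ a" "a + 7 \<le> c"
  shows "time (deferrals_tm D \<Gamma>) \<le> M ^ c"
proof -
  have "time (filter_tm (\<lambda>\<delta>. mem_tm eq_fm_tm \<delta> D) \<Gamma>) \<le> 1 + length \<Gamma> * (M ^ 5 + 1)"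
    by (rule time_filter_tm, rule time_mem_fm[OF _ length_D]) (use assms in auto)
  also have "\<dots> \<le> M ^ (a + 6)" by (rule loop[OF assms(2) order_refl]) simp
  finally have "time (filter_tm (\<lambda>\<delta>. mem_tm eq_fm_tm \<delta> D) \<Gamma>) \<le> M ^ (a + 6)" .
  moreover have "time (deferrals_tm D \<Gamma>) = Suc (time (filter_tm (\<lambda>\<delta>. mem_tm eq_fm_tm \<delta> D) \<Gamma>))"
    by (simp add: deferrals_tm_def)
  ultimately have "time (deferrals_tm D \<Gamma>) \<le> 16 * M ^ (a + 6)" using one_le_M[of "a + 6"] by linarith
  then show ?thesis by (rule up16) (use assms(3) in simp)
qed

lemma time_eq_node:
  assumes "node_list \<Gamma>" "node_list \<Gamma>'"
  shows "time (eq_node_tm \<Gamma> \<Gamma>') \<le> M ^ 8"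
proof (rule time_seteq_tm[where a = 1 and b = 2])
  show "time (eq_fm_tm x y) \<le> M ^ 2" if "x \<in> set \<Gamma> \<union> set \<Gamma>'" for x y
    using that assms node_FL by (intro time_eq_FL) auto
qed (use assms length_node M16 in auto)

lemma time_eq_fnode:
  assumes "fnode_list v" "fnode_list w"
  shows "time (eq_fnode_tm v w) \<le> M ^ 9"
proof -
  have "time (eq_node_tm (fst v) (fst w)) \<le> M ^ 8" "time (eq_node_tm (snd v) (snd w)) \<le> M ^ 8"
    using assms time_eq_node by (auto simp: fnode_list_def)
  moreover have "time (eq_fnode_tm v w) \<le> Suc (time (eq_node_tm (fst v) (fst w)) + time (eq_node_tm (snd v) (snd w)))"
    by (simp add: eq_fnode_tm_def case_prod_unfold)
  ultimately have "time (eq_fnode_tm v w) \<le> 16 * M ^ 8" using one_le_M[of 8] by linarith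
  then show ?thesis by (rule up16) simp
qed

lemma time_map_ret: "length xs \<le> M ^ a \<Longrightarrow> a + 1 \<le> c \<Longrightarrow> (\<And>x. x \<in> set xs \<Longrightarrow> time (f x) \<le> 1) \<Longrightarrow> time (map_tm f xs) \<le> M ^ c"
proof -
  assume a: "length xs \<le> M ^ a" "a + 1 \<le> c" "\<And>x. x \<in> set xs \<Longrightarrow> time (f x) \<le> 1"
  have "time (map_tm f xs) \<le> 1 + length xs * (1 + 1)" by (rule time_map_tm) (rule a(3))
  also have "\<dots> \<le> M ^ c" by (rule loop[OF a(1), of 1 0]) (use a(2) in simp_all)
  finally show ?thesis .
qed

lemma time_replace_tm:
  assumes "node_list \<Delta>" "\<chi> \<in> FL \<phi>" "set \<Theta> \<subseteq> FL \<phi>" "length \<Theta> \<le> 2"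
  shows "time (replace_tm \<Delta> \<chi> \<Theta>) \<le> M ^ 9"
proof -
  define \<Delta>' where "\<Delta>' = filter (\<lambda>y. \<not> \<chi> = y) \<Delta>"
  have l: "length \<Delta> \<le> M ^ 1" using length_node assms(1) by blast
  have l': "length \<Delta>' \<le> M ^ 1" using le_trans[OF length_filter_le l] by (simp only: \<Delta>'_def)
  have lT: "length \<Theta> \<le> M ^ 1" using assms(4) M_ge by linarith
  have t1: "time (remove_tm eq_fm_tm \<chi> \<Delta>) \<le> M ^ 8"
    by (rule time_remove_tm[OF l, where b = 2]) (use time_eq_FL[OF assms(2)] M16 in simp_all)
  have t2: "time (union_tm eq_fm_tm \<Theta> \<Delta>') \<le> M ^ 8"
    by (rule time_union_tm[OF lT l', where b = 2]) (use time_eq_FL assms(3) M16 in auto)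
  have t3: "time (map_tm (\<lambda>\<psi>. tick (ret (\<psi>, \<psi>))) \<Delta>') \<le> M ^ 8" by (rule time_map_ret[OF l']) simp_all
  have t4: "time (map_tm (\<lambda>\<theta>. tick (ret (\<chi>, \<theta>))) \<Theta>) \<le> M ^ 8" by (rule time_map_ret[OF lT]) simp_all
  have t5: "length \<Delta>' \<le> M ^ 8" by (rule up[OF l']) simp
  have "time (replace_tm \<Delta> \<chi> \<Theta>) = time (remove_tm eq_fm_tm \<chi> \<Delta>) + time (union_tm eq_fm_tm \<Theta> \<Delta>') +
      time (map_tm (\<lambda>\<psi>. tick (ret (\<psi>, \<psi>))) \<Delta>') + time (map_tm (\<lambda>\<theta>. tick (ret (\<chi>, \<theta>))) \<Theta>) + length \<Delta>' + 2"
    by (simp add: replace_tm_def \<Delta>'_def)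
  then have "time (replace_tm \<Delta> \<chi> \<Theta>) \<le> 16 * M ^ 8" using t1 t2 t3 t4 t5 one_le_M[of 8] by linarith
  then show ?thesis by (rule up16) simp
qed

lemma time_nonmodal_rules_tm:
  assumes "node_list \<Delta>" "\<chi> \<in> set \<Delta>"
  shows "time (nonmodal_rules_tm \<Delta> \<chi>) \<le> M ^ 11"
proof -
  have \<chi>: "\<chi> \<in> FL \<phi>" using assms node_FL by blast
  have l: "length \<Delta> \<le> M ^ 1" using length_node assms(1) by blast
  note rep = time_replace_tm[OF assms(1) \<chi>]
  have "time (nonmodal_rules_tm \<Delta> \<chi>) \<le> 16 * M ^ 9"
  proof (cases \<chi>)
    case (Prop p)
    have "time (mem_tm eq_fm_tm (NProp p) \<Delta>) \<le> M ^ 9"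
    proof (rule time_mem_tm[OF l, where b = 2])
      show "time (eq_fm_tm (NProp p) y) \<le> M ^ 2" for y :: "('p, 'a, 'v) fm"
        by (rule up16[of _ 1]) (use time_eq_fm_tm[of "NProp p" y] M16 in simp_all)
    qed (use M16 in simp_all)
    moreover have "time (nonmodal_rules_tm \<Delta> \<chi>) = Suc (time (mem_tm eq_fm_tm (NProp p) \<Delta>))"
      by (simp add: nonmodal_rules_tm_def Prop)
    ultimately show ?thesis using one_le_M[of 9] by linarith
  next
    case (And \<psi> \<psi>')
    have "\<psi> \<in> FL \<phi>" "\<psi>' \<in> FL \<phi>" using FL_And[OF closed] \<chi> And by blast+
    then have "time (replace_tm \<Delta> \<chi> [\<psi>, \<psi>']) \<le> M ^ 9" by (intro rep) simp_all
    moreover have "time (nonmodal_rules_tm \<Delta> \<chi>) = Suc (time (replace_tm \<Delta> \<chi> [\<psi>, \<psi>']))"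
      by (simp add: nonmodal_rules_tm_def And)
    ultimately show ?thesis using one_le_M[of 9] by linarith
  next
    case (Or \<psi> \<psi>')
    have "\<psi> \<in> FL \<phi>" "\<psi>' \<in> FL \<phi>" using FL_Or[OF closed] \<chi> Or by blast+
    then have "time (replace_tm \<Delta> \<chi> [\<psi>]) \<le> M ^ 9" "time (replace_tm \<Delta> \<chi> [\<psi>']) \<le> M ^ 9" by (intro rep; simp)+
    moreover have "time (nonmodal_rules_tm \<Delta> \<chi>) = Suc (time (replace_tm \<Delta> \<chi> [\<psi>]) + time (replace_tm \<Delta> \<chi> [\<psi>']))"
      by (simp add: nonmodal_rules_tm_def Or)
    ultimately show ?thesis using one_le_M[of 9] by linarith
  next
    case (Fix \<eta> X \<psi>)
    let ?u = "subst X \<chi> \<psi>"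
    have "?u \<in> FL \<phi>" using FL_Fix[OF closed] \<chi> Fix by blast
    then have "time (replace_tm \<Delta> \<chi> [?u]) \<le> M ^ 9" by (intro rep) simp_all
    moreover have "time (subst_tm X \<chi> \<psi>) \<le> 3 * M" using time_subst_tm[of X \<chi> \<psi>] FL_le_M[OF \<chi>] Fix by simp
    moreover have "M \<le> M ^ 9" by (rule up[of _ 1]) simp_all
    moreover have "time (nonmodal_rules_tm \<Delta> \<chi>) = Suc (time (subst_tm X \<chi> \<psi>) + time (replace_tm \<Delta> \<chi> [?u]))"
      by (simp add: nonmodal_rules_tm_def Fix)
    ultimately show ?thesis using one_le_M[of 9] by linarith
  qed (use one_le_M[of 9] in \<open>simp_all add: nonmodal_rules_tm_def\<close>)
  then show ?thesis by (rule up16) simp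
qed

lemma time_modal_rules_tm:
  assumes "node_list \<Delta>" "\<chi> \<in> set \<Delta>"
  shows "time (modal_rules_tm \<Delta> \<chi>) \<le> M ^ 11"
proof -
  have l: "length \<Delta> \<le> M ^ 1" using length_node assms(1) by blast
  have "time (modal_rules_tm \<Delta> \<chi>) \<le> 16 * M ^ 10"
  proof (cases \<chi>)
    case (Dia a \<psi>)
    define \<rho> where "\<rho> = (\<chi>, \<psi>) # val (boxes_tm a \<Delta>)"
    have \<psi>: "\<psi> \<in> FL \<phi>" using FL_Dia[OF closed] assms node_FL Dia by blast
    have bx: "\<psi>' \<in> FL \<phi>" if "Box a \<psi>' \<in> set \<Delta>" for \<psi>' using FL_Box[OF closed] assms(1) node_FL that by blast
    have l\<rho>: "length \<rho> \<le> M ^ 2"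
      by (rule up16[of _ 1]) (use l length_boxes_tm[of a \<Delta>] M_ge in \<open>simp_all add: \<rho>_def\<close>)
    have s: "set (map snd \<rho>) \<subseteq> FL \<phi>" using \<psi> bx by (auto simp: \<rho>_def set_boxes_tm)
    have t1: "time (boxes_tm a \<Delta>) \<le> 3 * M ^ 10"
      using time_boxes_tm[of a \<Delta>] up[OF l, of 10] one_le_M[of 10] by linarith
    have t2: "time (map_tm (\<lambda>(_, \<psi>). tick (ret \<psi>)) \<rho>) \<le> M ^ 10"
      by (rule time_map_ret[OF l\<rho>]) auto
    have t3: "time (union_tm eq_fm_tm (map snd \<rho>) []) \<le> M ^ 10"
      by (rule time_union_tm[where a = 2 and b = 2]) (use l\<rho> s time_eq_FL M16 in auto)
    have "time (modal_rules_tm \<Delta> \<chi>) = Suc (time (boxes_tm a \<Delta>) + time (map_tm (\<lambda>(_, \<psi>). tick (ret \<psi>)) \<rho>) +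
        time (union_tm eq_fm_tm (map snd \<rho>) []))"
      by (simp add: modal_rules_tm_def Dia \<rho>_def)
    then show ?thesis using t1 t2 t3 one_le_M[of 10] by linarith
  qed (use one_le_M[of 10] in \<open>simp_all add: modal_rules_tm_def\<close>)
  then show ?thesis by (rule up16) simp
qed

lemma time_concl_tm:
  assumes "node_list \<Delta>"
  shows "time (concl_tm \<Delta>) \<le> M ^ 14" "length (val (concl_tm \<Delta>)) \<le> M ^ 1"
proof -
  have l: "length \<Delta> \<le> M ^ 1" using length_node assms(1) by blast
  have d: "distinct \<Delta>" using assms by (simp add: node_list_def)
  let ?h = "\<lambda>\<chi> :: ('p, 'a, 'v) fm. tick (case \<chi> of Top \<Rightarrow> ret True
     | Prop p \<Rightarrow> bind_tm (mem_tm eq_fm_tm (NProp p) \<Delta>) (\<lambda>b. ret (\<not> b))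
     | NProp p \<Rightarrow> ret True | Dia a \<psi> \<Rightarrow> ret True | Box a \<psi> \<Rightarrow> ret True | _ \<Rightarrow> ret False)"
  have h: "time (?h \<chi>) \<le> M ^ 6" for \<chi>
  proof (rule up16[of _ 5])
    show "time (?h \<chi>) \<le> 16 * M ^ 5"
    proof (cases \<chi>)
      case (Prop p)
      have "time (mem_tm eq_fm_tm (NProp p) \<Delta>) \<le> M ^ 5"
      proof (rule time_mem_tm[OF l, where b = 2])
        show "time (eq_fm_tm (NProp p) y) \<le> M ^ 2" for y :: "('p, 'a, 'v) fm"
          by (rule up16[of _ 1]) (use time_eq_fm_tm[of "NProp p" y] M16 in simp_all)
      qed (use M16 in simp_all)
      moreover have "time (?h \<chi>) = Suc (time (mem_tm eq_fm_tm (NProp p) \<Delta>))" by (simp add: Prop)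
      ultimately show ?thesis using one_le_M[of 5] by linarith
    qed (use one_le_M[of 5] in simp_all)
  qed simp
  have "time (all_tm ?h \<Delta>) \<le> 1 + length \<Delta> * (M ^ 6 + 1)" by (rule time_all_tm) (rule h)
  also have "\<dots> \<le> M ^ 8" by (rule loop[OF l order_refl]) simp
  finally have "time (all_tm ?h \<Delta>) \<le> M ^ 8" .
  moreover have "time (state_node_tm \<Delta>) = Suc (time (all_tm ?h \<Delta>))" by (simp add: state_node_tm_def)
  moreover have "M ^ 8 \<le> M ^ 13" by (rule up[OF order_refl]) simp
  ultimately have t1: "time (state_node_tm \<Delta>) \<le> 2 * M ^ 13" using one_le_M[of 13] by linarith
  have "time (rules_tm \<Delta> \<chi>) \<le> M ^ 11" if "\<chi> \<in> set \<Delta>" for \<chi>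
    using time_modal_rules_tm[OF assms that] time_nonmodal_rules_tm[OF assms that] by (simp add: rules_tm_def)
  then have "time (map_tm (rules_tm \<Delta>) \<Delta>) \<le> 1 + length \<Delta> * (M ^ 11 + 1)" by (rule time_map_tm)
  also have "\<dots> \<le> M ^ 13" by (rule loop[OF l order_refl]) simp
  finally have t2: "time (map_tm (rules_tm \<Delta>) \<Delta>) \<le> M ^ 13" .
  let ?R = "map (\<lambda>\<chi>. val (rules_tm \<Delta> \<chi>)) \<Delta>"
  have R: "length xs \<le> 1" if "xs \<in> set ?R" for xs using that rules_tm_shape[OF d] by auto
  have "time (concat_tm ?R) \<le> 1 + length ?R * (2 + 1)"
    by (rule time_concat_tm) (use R in fastforce)
  also have "\<dots> \<le> M ^ 13" by (rule loop[where a = 1 and b = 1]) (use l M_ge in simp_all)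
  finally have t3: "time (concat_tm ?R) \<le> M ^ 13" .
  have "time (concl_tm \<Delta>) = Suc (time (state_node_tm \<Delta>) + time (map_tm (rules_tm \<Delta>) \<Delta>) + time (concat_tm ?R))"
    by (simp add: concl_tm_def val_state_node_tm rules_tm_def)
  then have "time (concl_tm \<Delta>) \<le> 16 * M ^ 13" using t1 t2 t3 one_le_M[of 13] by linarith
  then show "time (concl_tm \<Delta>) \<le> M ^ 14" by (rule up16) simp
  have "length (val (concl_tm \<Delta>)) \<le> length ?R * 1" unfolding val_concl_tm by (rule length_concat_le) (rule R)
  then show "length (val (concl_tm \<Delta>)) \<le> M ^ 1" using l by simp
qed

lemma time_track_tm:
  assumes \<Delta>: "node_list \<Delta>" "\<Sigma> \<in> set (val (concl_tm \<Delta>))" "c \<in> set \<Sigma>" and d: "node_list d"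
  shows "time (track_tm D d c) \<le> M ^ 11" "fnode_list (fst c, val (track_tm D d c))"
proof -
  note c = concl_tm_node_list[OF \<Delta>]
  obtain \<Gamma> \<rho> where cc: "c = (\<Gamma>, \<rho>)" by (cases c)
  have S: "concl_of c \<in> concl_of ` set \<Sigma>" using \<Delta>(3) by blast
  have dom: "\<delta> \<in> FL \<phi>" if "(\<delta>, \<delta>') \<in> set \<rho>" for \<delta> \<delta>'
    using concl_Domain[OF c(5) S] that \<Delta>(1) by (auto simp: concl_of_def cc node_list_def)
  have rng: "\<delta>' \<in> FL \<phi>" if "(\<delta>, \<delta>') \<in> set \<rho>" for \<delta> \<delta>'
    using c(2)[of UNIV] c(1) that by (auto simp: cc node_list_def)
  have l: "length \<Gamma> \<le> M ^ 1" using length_node[OF c(1)] by (simp add: cc)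
  have l\<rho>: "length \<rho> \<le> M ^ 2"
    by (rule up16[of _ 1]) (use c(3) length_node[OF \<Delta>(1)] M_ge in \<open>simp_all add: cc\<close>)
  have ld: "length d \<le> M ^ 1" using length_node[OF d] .
  show "time (track_tm D d c) \<le> M ^ 11"
  proof (cases "d = []")
    case True
    have "time (deferrals_tm D \<Gamma>) \<le> M ^ 10"
      by (rule time_deferrals_tm[OF _ l]) (use c(1) in \<open>simp_all add: cc node_list_def\<close>)
    then have "time (track_tm D d c) \<le> 16 * M ^ 10" using True one_le_M[of 10] by (simp add: track_tm_def cc)
    then show ?thesis by (rule up16) simp
  next
    case False
    let ?p = "\<lambda>(\<delta> :: ('p, 'a, 'v) fm, _ :: ('p, 'a, 'v) fm). tick (mem_tm eq_fm_tm \<delta> d)"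
    define \<rho>' where "\<rho>' = filter (\<lambda>x. val (?p x)) \<rho>"
    have l': "length \<rho>' \<le> M ^ 2" using le_trans[OF length_filter_le l\<rho>] by (simp only: \<rho>'_def)
    have s': "set (map snd \<rho>') \<subseteq> FL \<phi>" using rng by (auto simp: \<rho>'_def)
    have "time (?p x) \<le> M ^ 6" if "x \<in> set \<rho>" for x
    proof (rule up16[of _ 5])
      have "time (mem_tm eq_fm_tm (fst x) d) \<le> M ^ 5"
        by (rule time_mem_fm[OF _ ld]) (use that dom[of "fst x" "snd x"] in simp_all)
      moreover have "time (?p x) = Suc (time (mem_tm eq_fm_tm (fst x) d))" by (simp add: case_prod_unfold)
      ultimately show "time (?p x) \<le> 16 * M ^ 5" using one_le_M[of 5] by linarith
    qed simp
    then have "time (filter_tm ?p \<rho>) \<le> 1 + length \<rho> * (M ^ 6 + 1)" by (rule time_filter_tm)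
    also have "\<dots> \<le> M ^ 10" by (rule loop[OF l\<rho> order_refl]) simp
    finally have t1: "time (filter_tm ?p \<rho>) \<le> M ^ 10" .
    have t2: "time (map_tm (\<lambda>(_, \<delta>'). tick (ret \<delta>')) \<rho>') \<le> M ^ 10" by (rule time_map_ret[OF l']) auto
    have t3: "time (union_tm eq_fm_tm (map snd \<rho>') []) \<le> M ^ 10"
      by (rule time_union_tm[where a = 2 and b = 2]) (use l' s' time_eq_FL M16 in auto)
    have t4: "time (deferrals_tm D (val (union_tm eq_fm_tm (map snd \<rho>') []))) \<le> M ^ 10"
      by (rule time_deferrals_tm[where a = 2])
        (use s' le_trans[OF length_union_tm[of eq_fm_tm "map snd \<rho>'" "[]"]] l' in auto)
    have "time (track_tm D d c) = Suc (time (filter_tm ?p \<rho>) + time (map_tm (\<lambda>(_, \<delta>'). tick (ret \<delta>')) \<rho>') +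
        time (union_tm eq_fm_tm (map snd \<rho>') []) + time (deferrals_tm D (val (union_tm eq_fm_tm (map snd \<rho>') []))))"
      using False by (simp add: track_tm_def cc \<rho>'_def)
    then have "time (track_tm D d c) \<le> 16 * M ^ 10" using t1 t2 t3 t4 one_le_M[of 10] by linarith
    then show ?thesis by (rule up16) simp
  qed
  have "set (val (track_tm D d c)) = track (set d) (concl_of c)"
    by (rule track_tm_props(1)) (use c(1,2) in \<open>simp_all add: node_list_def\<close>)
  also have "\<dots> \<subseteq> FL \<phi>"
    using track_subset_deferrals[OF c(5) S, of "set d"] c(1) by (auto simp: deferrals_def concl_of_def node_list_def)
  finally show "fnode_list (fst c, val (track_tm D d c))"
    using track_tm_props(2)[of c d] c(1,2) by (simp add: fnode_list_def node_list_def)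
qed

subsection \<open>Propagation\<close>

definition fnodes :: "('p, 'a, 'v) fnode_rep list \<Rightarrow> bool" where
  "fnodes Z \<longleftrightarrow> (\<forall>v \<in> set Z. fnode_list v) \<and> length Z \<le> M ^ 1"

lemma time_mem_fnode: "fnodes Z \<Longrightarrow> fnode_list v \<Longrightarrow> time (mem_tm eq_fnode_tm v Z) \<le> M ^ 12"
  by (rule time_mem_tm[where a = 1 and b = 9]) (use time_eq_fnode M16 in \<open>auto simp: fnodes_def\<close>)

lemma time_successor_in_tm:
  assumes \<Delta>: "node_list \<Delta>" "\<Sigma> \<in> set (val (concl_tm \<Delta>))" "c \<in> set \<Sigma>" and d: "node_list d" and Z: "fnodes Z"
  shows "time (successor_in_tm D Z d c) \<le> M ^ 13"
proof -
  note t = time_track_tm[OF \<Delta> d]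
  have "time (successor_in_tm D Z d c) = Suc (time (track_tm D d c) + time (mem_tm eq_fnode_tm (fst c, val (track_tm D d c)) Z))"
    by (simp add: successor_in_tm_def case_prod_unfold)
  moreover have "time (track_tm D d c) \<le> M ^ 12" by (rule up[OF t(1)]) simp
  ultimately have "time (successor_in_tm D Z d c) \<le> 16 * M ^ 12"
    using time_mem_fnode[OF Z t(2)] one_le_M[of 12] by linarith
  then show ?thesis by (rule up16) simp
qed

lemma
  assumes v: "fnode_list v" and Z: "fnodes Z"
  shows time_f_tm: "time (f_tm D Z v) \<le> M ^ 19" and time_g_tm: "time (g_tm D Z v) \<le> M ^ 19"
proof -
  obtain \<Delta> d where vd: "v = (\<Delta>, d)" by (cases v)
  have n: "node_list \<Delta>" "node_list d" using v by (simp_all add: vd fnode_list_def)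
  note C = time_concl_tm[OF n(1)]
  have l: "length \<Sigma> \<le> M ^ 1" if "\<Sigma> \<in> set (val (concl_tm \<Delta>))" for \<Sigma>
  proof (cases \<Sigma>)
    case (Cons c \<Sigma>')
    then show ?thesis using concl_tm_node_list(4)[OF n(1) that, of c] M_ge by simp
  qed simp
  have inner: "time (tick (q (successor_in_tm D Z d) \<Sigma>)) \<le> M ^ 16"
    if \<Sigma>: "\<Sigma> \<in> set (val (concl_tm \<Delta>))" and q: "q = ex_tm \<or> q = all_tm" for \<Sigma> q
  proof (rule up16[of _ 15])
    have "time (q (successor_in_tm D Z d) \<Sigma>) \<le> 1 + length \<Sigma> * (M ^ 13 + 1)"
      using q time_ex_tm[of \<Sigma> "successor_in_tm D Z d" "M ^ 13"] time_all_tm[of \<Sigma> "successor_in_tm D Z d" "M ^ 13"]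
        time_successor_in_tm[OF n(1) \<Sigma> _ n(2) Z] by blast
    also have "\<dots> \<le> M ^ 15" by (rule loop[OF l[OF \<Sigma>] order_refl]) simp
    finally have "time (q (successor_in_tm D Z d) \<Sigma>) \<le> M ^ 15" .
    moreover have "time (tick (q (successor_in_tm D Z d) \<Sigma>)) = Suc (time (q (successor_in_tm D Z d) \<Sigma>))" by simp
    ultimately show "time (tick (q (successor_in_tm D Z d) \<Sigma>)) \<le> 16 * M ^ 15" using one_le_M[of 15] by linarith
  qed simp
  have c14: "time (concl_tm \<Delta>) \<le> M ^ 18" by (rule up[OF C(1)]) simp
  have "time (all_tm (\<lambda>\<Sigma>. tick (ex_tm (successor_in_tm D Z d) \<Sigma>)) (val (concl_tm \<Delta>))) \<le>
      1 + length (val (concl_tm \<Delta>)) * (M ^ 16 + 1)" by (rule time_all_tm) (use inner in blast)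
  also have "\<dots> \<le> M ^ 18" by (rule loop[OF C(2) order_refl]) simp
  finally have "time (all_tm (\<lambda>\<Sigma>. tick (ex_tm (successor_in_tm D Z d) \<Sigma>)) (val (concl_tm \<Delta>))) \<le> M ^ 18" .
  moreover have "time (f_tm D Z v) = Suc (time (concl_tm \<Delta>) +
      time (all_tm (\<lambda>\<Sigma>. tick (ex_tm (successor_in_tm D Z d) \<Sigma>)) (val (concl_tm \<Delta>))))" by (simp add: f_tm_def vd)
  ultimately have "time (f_tm D Z v) \<le> 16 * M ^ 18" using c14 one_le_M[of 18] by linarith
  then show "time (f_tm D Z v) \<le> M ^ 19" by (rule up16) simp
  have "time (ex_tm (\<lambda>\<Sigma>. tick (all_tm (successor_in_tm D Z d) \<Sigma>)) (val (concl_tm \<Delta>))) \<le>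
      1 + length (val (concl_tm \<Delta>)) * (M ^ 16 + 1)" by (rule time_ex_tm) (use inner in blast)
  also have "\<dots> \<le> M ^ 18" by (rule loop[OF C(2) order_refl]) simp
  finally have "time (ex_tm (\<lambda>\<Sigma>. tick (all_tm (successor_in_tm D Z d) \<Sigma>)) (val (concl_tm \<Delta>))) \<le> M ^ 18" .
  moreover have "time (g_tm D Z v) = Suc (time (concl_tm \<Delta>) +
      time (ex_tm (\<lambda>\<Sigma>. tick (all_tm (successor_in_tm D Z d) \<Sigma>)) (val (concl_tm \<Delta>))))" by (simp add: g_tm_def vd)
  ultimately have "time (g_tm D Z v) \<le> 16 * M ^ 18" using c14 one_le_M[of 18] by linarith
  then show "time (g_tm D Z v) \<le> M ^ 19" by (rule up16) simp
qed

lemma fnodes_hat_tm: "fnodes C \<Longrightarrow> fnodes (val (hat_tm h C X Y))"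
  unfolding fnodes_def val_hat_tm by (auto intro: le_trans[OF length_filter_le])

lemma time_hat_tm:
  assumes h: "\<And>Z v. fnodes Z \<Longrightarrow> fnode_list v \<Longrightarrow> time (h Z v) \<le> M ^ 19"
    and C: "fnodes C" "fnodes X" "fnodes Y"
  shows "time (hat_tm h C X Y) \<le> M ^ 23"
proof -
  let ?p = "\<lambda>v. tick (case v of (\<Delta>, d) \<Rightarrow> h (if d = [] then X else Y) v)"
  have "time (?p v) \<le> M ^ 20" if "v \<in> set C" for v
  proof (rule up16[of _ 19])
    have "time (h (if snd v = [] then X else Y) v) \<le> M ^ 19"
      by (rule h) (use C that in \<open>auto simp: fnodes_def\<close>)
    moreover have "time (?p v) = Suc (time (h (if snd v = [] then X else Y) v))" by (simp add: case_prod_unfold)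
    ultimately show "time (?p v) \<le> 16 * M ^ 19" using one_le_M[of 19] by linarith
  qed simp
  then have "time (filter_tm ?p C) \<le> 1 + length C * (M ^ 20 + 1)" by (rule time_filter_tm)
  also have "\<dots> \<le> M ^ 22" by (rule loop[where a = 1 and b = 20]) (use C(1) in \<open>simp_all add: fnodes_def\<close>)
  finally have "time (filter_tm ?p C) \<le> M ^ 22" .
  moreover have "time (hat_tm h C X Y) = Suc (time (filter_tm ?p C))" by (simp add: hat_tm_def)
  ultimately have "time (hat_tm h C X Y) \<le> 16 * M ^ 22" using one_le_M[of 22] by linarith
  then show ?thesis by (rule up16) simp
qed

lemma fnodes_funpow: "(\<And>Y. fnodes Y \<Longrightarrow> fnodes (F Y)) \<Longrightarrow> fnodes Y \<Longrightarrow> fnodes (((F :: ('p, 'a, 'v) fnode_rep list \<Rightarrow> _) ^^ k) Y)"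
  by (induction k) simp_all

text \<open>The operator \<open>h\<close> and both starting points are parameters, so that one bound
  covers \<open>E_tm\<close> and \<open>A_tm\<close>. Both loops run over \<open>C\<close>, and
  every intermediate set is a starting point or a filtered \<open>C\<close>, hence no longer than
  \<open>M\<close>.\<close>

lemma time_fixpoints:
  assumes h: "\<And>Z v. fnodes Z \<Longrightarrow> fnode_list v \<Longrightarrow> time (h Z v) \<le> M ^ 19"
    and C: "fnodes C" "fnodes Y0" "fnodes X0"
  defines "F \<equiv> \<lambda>X. tick (iterate_tm (\<lambda>Y. hat_tm h C X Y) C Y0)"
  shows "time (iterate_tm F C X0) \<le> M ^ 28" "fnodes (val (iterate_tm F C X0))"
proof -
  have lC: "length C \<le> M ^ 1" using C(1) by (simp add: fnodes_def)
  have F: "fnodes (val (F X)) \<and> time (F X) \<le> M ^ 26" if X: "fnodes X" for X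
  proof
    show "fnodes (val (F X))"
      unfolding F_def using fnodes_funpow[of "\<lambda>Y. val (hat_tm h C X Y)" Y0 "length C"] fnodes_hat_tm[OF C(1)] C(2) by simp
    have "time (iterate_tm (\<lambda>Y. hat_tm h C X Y) C Y0) \<le> 1 + length C * (M ^ 23 + 1)"
      by (rule time_iterate_tm[where P = fnodes]) (use fnodes_hat_tm time_hat_tm[OF h] C X in auto)
    also have "\<dots> \<le> M ^ 25" by (rule loop[OF lC order_refl]) simp
    finally have "time (iterate_tm (\<lambda>Y. hat_tm h C X Y) C Y0) \<le> M ^ 25" .
    moreover have "time (F X) = Suc (time (iterate_tm (\<lambda>Y. hat_tm h C X Y) C Y0))" by (simp add: F_def)
    ultimately have "time (F X) \<le> 16 * M ^ 25" using one_le_M[of 25] by linarith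
    then show "time (F X) \<le> M ^ 26" by (rule up16) simp
  qed
  have "time (iterate_tm F C X0) \<le> 1 + length C * (M ^ 26 + 1)"
    by (rule time_iterate_tm[where P = fnodes]) (use F C(3) in blast)+
  also have "\<dots> \<le> M ^ 28" by (rule loop[OF lC order_refl]) simp
  finally show "time (iterate_tm F C X0) \<le> M ^ 28" .
  show "fnodes (val (iterate_tm F C X0))"
    using fnodes_funpow[of "\<lambda>X. val (F X)" X0 "length C"] F C(3) by simp
qed

text \<open>Propagation runs on \<open>t # G\<close>, one node more than
  \<open>length_gc_rep\<close> grants; \<open>2 ^ (n + 1)\<close> leaves room for it.\<close>

lemma
  assumes G: "\<forall>\<Gamma> \<in> set G. node_list \<Gamma>" "length G \<le> 2 ^ (n + 1)"
  shows time_focused_nodes_tm: "time (focused_nodes_tm D G) \<le> M ^ 12"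
    and fnodes_focused_nodes_tm: "fnodes (val (focused_nodes_tm D G))"
proof -
  let ?s = "\<lambda>\<Gamma>. val (sublists_tm (val (deferrals_tm D \<Gamma>)))"
  let ?h = "\<lambda>\<Gamma>. tick (bind_tm (deferrals_tm D \<Gamma>) (\<lambda>\<delta>s. bind_tm (sublists_tm \<delta>s) (map_tm (\<lambda>d. tick (ret (\<Gamma>, d))))))"
  have lG: "length G \<le> M ^ 1" using le_trans[OF G(2) two_power_le_M[of "n + 1"]] n_pos by simp
  have ld: "length (val (deferrals_tm D \<Gamma>)) \<le> n" if "\<Gamma> \<in> set G" for \<Gamma>
    unfolding val_deferrals_tm using le_trans[OF length_filter_le length_node_list] G(1) that by blast
  have ls: "length (?s \<Gamma>) \<le> 2 ^ n" if "\<Gamma> \<in> set G" for \<Gamma>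
    unfolding sublists_tm_props(3) using ld[OF that] by (rule power_increasing) simp
  have lsM: "length (?s \<Gamma>) + 1 \<le> M ^ 1" if "\<Gamma> \<in> set G" for \<Gamma>
  proof -
    have "length (?s \<Gamma>) + 1 \<le> 2 ^ n + 2 ^ n" using ls[OF that] one_le_power[of 2 n] by (intro add_mono) simp_all
    also have "\<dots> = 2 ^ (n + 1)" by simp
    also have "\<dots> \<le> M" by (rule two_power_le_M) (use n_pos in simp)
    finally show ?thesis by simp
  qed
  have "time (?h \<Gamma>) \<le> M ^ 9" if \<Gamma>: "\<Gamma> \<in> set G" for \<Gamma>
  proof (rule up16[of _ 8])
    let ?ds = "val (deferrals_tm D \<Gamma>)"
    have t1: "time (deferrals_tm D \<Gamma>) \<le> M ^ 8"
      by (rule time_deferrals_tm[where a = 1]) (use G(1) \<Gamma> length_node in \<open>auto simp: node_list_def\<close>)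
    have "time (sublists_tm ?ds) \<le> 1 + 3 * length ?ds + 3 * length (?s \<Gamma>)"
      using time_sublists_tm[of ?ds] by (simp add: sublists_tm_props(3))
    moreover have "length ?ds \<le> M ^ 8" by (rule up[of _ 1]) (use ld[OF \<Gamma>] n_le_M in simp_all)
    moreover have "length (?s \<Gamma>) \<le> M ^ 8" by (rule up[of _ 1]) (use lsM[OF \<Gamma>] in simp_all)
    moreover have "time (map_tm (\<lambda>d. tick (ret (\<Gamma>, d))) (?s \<Gamma>)) \<le> M ^ 8"
      by (rule time_map_ret[where a = 1]) (use lsM[OF \<Gamma>] in simp_all)
    moreover have "time (?h \<Gamma>) = Suc (time (deferrals_tm D \<Gamma>) + time (sublists_tm ?ds) +
        time (map_tm (\<lambda>d. tick (ret (\<Gamma>, d))) (?s \<Gamma>)))" by simp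
    ultimately show "time (?h \<Gamma>) \<le> 16 * M ^ 8" using t1 one_le_M[of 8] by linarith
  qed simp
  then have "time (map_tm ?h G) \<le> 1 + length G * (M ^ 9 + 1)" by (rule time_map_tm)
  also have "\<dots> \<le> M ^ 11" by (rule loop[OF lG order_refl]) simp
  finally have t1: "time (map_tm ?h G) \<le> M ^ 11" .
  let ?vss = "map (\<lambda>\<Gamma>. map (Pair \<Gamma>) (?s \<Gamma>)) G"
  have "time (concat_tm ?vss) \<le> 1 + length ?vss * (M ^ 1 + 1)"
    by (rule time_concat_tm) (use lsM in auto)
  also have "\<dots> \<le> M ^ 11" by (rule loop[OF _ order_refl, of _ 1]) (use lG in simp_all)
  finally have t2: "time (concat_tm ?vss) \<le> M ^ 11" .
  have "time (focused_nodes_tm D G) = Suc (time (map_tm ?h G) + time (concat_tm ?vss))"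
    by (simp add: focused_nodes_tm_def)
  then have "time (focused_nodes_tm D G) \<le> 16 * M ^ 11" using t1 t2 one_le_M[of 11] by linarith
  then show "time (focused_nodes_tm D G) \<le> M ^ 12" by (rule up16) simp
  have "length (val (focused_nodes_tm D G)) \<le> length ?vss * 2 ^ n"
    unfolding val_focused_nodes_tm by (rule length_concat_le) (use ls in auto)
  also have "\<dots> \<le> 2 ^ (n + 1) * 2 ^ n" using G(2) by (intro mult_le_mono1) simp
  also have "\<dots> = 2 ^ (n + 1 + n)" by (rule power_add[symmetric])
  also have "\<dots> \<le> M" by (rule two_power_le_M) (use n_pos in simp)
  finally show "fnodes (val (focused_nodes_tm D G))"
    using focused_nodes_tm_props(2)[OF G(1)] by (simp add: fnodes_def)
qed

lemma
  assumes G: "\<forall>\<Gamma> \<in> set G. node_list \<Gamma>" "length G \<le> 2 ^ (n + 1)"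
  shows time_E_tm: "time (E_tm D G) \<le> M ^ 29" "fnodes (val (E_tm D G))"
    and time_A_tm: "time (A_tm D G) \<le> M ^ 29" "fnodes (val (A_tm D G))"
proof -
  let ?C = "val (focused_nodes_tm D G)"
  have C: "fnodes ?C" "fnodes []" using fnodes_focused_nodes_tm[OF G] by (simp_all add: fnodes_def)
  have t: "time (focused_nodes_tm D G) \<le> M ^ 28" by (rule up[OF time_focused_nodes_tm[OF G]]) simp
  have h: "time (f_tm D Z v) \<le> M ^ 19" "time (g_tm D Z v) \<le> M ^ 19" if "fnodes Z" "fnode_list v" for Z v
    using time_f_tm[OF that(2,1)] time_g_tm[OF that(2,1)] by blast+
  note fE = time_fixpoints[where h = "f_tm D", OF h(1) C(1,2,1)]
    and fA = time_fixpoints[where h = "g_tm D", OF h(2) C(1,1,2)]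
  have "time (E_tm D G) = Suc (time (focused_nodes_tm D G) +
      time (iterate_tm (\<lambda>X. tick (iterate_tm (\<lambda>Y. hat_tm (f_tm D) ?C X Y) ?C [])) ?C ?C))" by (simp add: E_tm_def)
  then have "time (E_tm D G) \<le> 16 * M ^ 28" using t fE(1) one_le_M[of 28] by linarith
  then show "time (E_tm D G) \<le> M ^ 29" by (rule up16) simp
  show "fnodes (val (E_tm D G))" using fE(2) by (simp add: E_tm_def)
  have "time (A_tm D G) = Suc (time (focused_nodes_tm D G) +
      time (iterate_tm (\<lambda>X. tick (iterate_tm (\<lambda>Y. hat_tm (g_tm D) ?C X Y) ?C ?C)) ?C []))" by (simp add: A_tm_def)
  then have "time (A_tm D G) \<le> 16 * M ^ 28" using t fA(1) one_le_M[of 28] by linarith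
  then show "time (A_tm D G) \<le> M ^ 29" by (rule up16) simp
  show "fnodes (val (A_tm D G))" using fA(2) by (simp add: A_tm_def)
qed

lemma time_root_in_tm:
  assumes "time Z \<le> M ^ 29" "fnodes (val Z)"
  shows "time (root_in_tm D \<phi> Z) \<le> M ^ 30"
proof -
  have "time (deferrals_tm D [\<phi>]) \<le> M ^ 29" by (rule time_deferrals_tm[where a = 0]) (use FL_root[of \<phi>] in simp_all)
  moreover have "fnode_list ([\<phi>], val (deferrals_tm D [\<phi>]))"
    using FL_root[of \<phi>] by (simp add: fnode_list_def node_list_def val_deferrals_tm)
  then have "time (mem_tm eq_fnode_tm ([\<phi>], val (deferrals_tm D [\<phi>])) (val Z)) \<le> M ^ 29"
    using up[OF time_mem_fnode[OF assms(2)], of _ 29] by simp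
  moreover have "time (root_in_tm D \<phi> Z) = Suc (time Z + time (deferrals_tm D [\<phi>]) +
      time (mem_tm eq_fnode_tm ([\<phi>], val (deferrals_tm D [\<phi>])) (val Z)))" by (simp add: root_in_tm_def)
  ultimately have "time (root_in_tm D \<phi> Z) \<le> 16 * M ^ 29" using assms(1) one_le_M[of 29] by linarith
  then show ?thesis by (rule up16) simp
qed

subsection \<open>The main loop\<close>

lemma length_gc_rep: "gc_rep U \<Longrightarrow> length U \<le> 2 ^ n"
proof -
  assume U: "gc_rep U"
  have "length U = card (set (map set U))" using U distinct_card[of "map set U"] by (simp add: gc_rep_def)
  also have "\<dots> \<le> card (Pow (FL \<phi>))" using U finite_FL by (intro card_mono) (auto simp: gc_rep_def node_list_def)
  also have "\<dots> = 2 ^ card (FL \<phi>)" using finite_FL by (rule card_Pow)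
  also have "\<dots> \<le> 2 ^ n" using card_FL by (rule power_increasing) simp
  finally show ?thesis .
qed

lemma time_gc_iteration_tm:
  assumes G: "gc_rep G" and U: "gc_rep U" and i: "i < length U"
  shows "time (gc_iteration_tm D \<phi> i e a G U) \<le> M ^ 31"
proof -
  define t where "t = U ! i"
  have t: "node_list t" using U i by (auto simp: t_def gc_rep_def)
  have nG: "\<forall>\<Gamma> \<in> set (t # G). node_list \<Gamma>" using G t by (simp add: gc_rep_def)
  have nU: "\<forall>\<Gamma> \<in> set U. node_list \<Gamma>" using U by (simp add: gc_rep_def)
  have lG: "length (t # G) \<le> 2 ^ (n + 1)"
  proof -
    have "(1::nat) \<le> 2 ^ n" by simp
    then have "length (t # G) \<le> 2 * 2 ^ n" using length_gc_rep[OF G] unfolding length_Cons by linarith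
    then show ?thesis by simp
  qed
  have lGM: "length (t # G) \<le> M ^ 1" using le_trans[OF lG two_power_le_M[of "n + 1"]] n_pos by simp
  have lU: "length U \<le> M ^ 1" using le_trans[OF length_gc_rep[OF U] two_power_le_M[of n]] by simp
  let ?cs = "concat (val (concl_tm t))"
  define \<Gamma>s where "\<Gamma>s = map fst ?cs"
  let ?p = "\<lambda>\<Gamma>. tick (bind_tm (mem_tm eq_node_tm \<Gamma> (t # G)) (\<lambda>b. ret (\<not> b)))"
  define U1 where "U1 = val (remove_tm eq_node_tm t U)"
  define new where "new = filter (\<lambda>\<Gamma>. val (?p \<Gamma>)) \<Gamma>s"
  note C = time_concl_tm[OF t]
  have l2: "length \<Sigma> \<le> 2" if "\<Sigma> \<in> set (val (concl_tm t))" for \<Sigma>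
  proof (cases \<Sigma>)
    case (Cons c \<Sigma>')
    then show ?thesis using concl_tm_node_list(4)[OF t that, of c] by simp
  qed simp
  have lcs: "length ?cs \<le> M ^ 2"
  proof (rule up16[of _ 1])
    have "length ?cs \<le> length (val (concl_tm t)) * 2" by (rule length_concat_le) (rule l2)
    then show "length ?cs \<le> 16 * M ^ 1" using C(2) by linarith
  qed simp
  have l\<Gamma>s: "length \<Gamma>s \<le> M ^ 2" using lcs by (simp add: \<Gamma>s_def)
  have n\<Gamma>s: "node_list \<Gamma>" if "\<Gamma> \<in> set \<Gamma>s" for \<Gamma>
    using that concl_tm_node_list(1)[OF t] by (auto simp: \<Gamma>s_def)
  have lnew: "length new \<le> M ^ 2" using le_trans[OF length_filter_le l\<Gamma>s] by (simp only: new_def)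
  have lU1: "length U1 \<le> M ^ 1" unfolding U1_def val_remove_tm by (rule le_trans[OF length_filter_le lU])
  have nnew: "\<forall>\<Gamma> \<in> set new \<union> set U1. node_list \<Gamma>" using n\<Gamma>s nU by (auto simp: new_def U1_def)
  have t1: "time (nth_tm U i) \<le> 2 * M ^ 30"
    using time_nth_tm[of U i] up[OF lU, of 30] one_le_M[of 30] by linarith
  have t2: "time (remove_tm eq_node_tm t U) \<le> M ^ 30"
    by (rule time_remove_tm[OF lU, where b = 8]) (use time_eq_node[OF t] nU M16 in auto)
  have t3: "time (concl_tm t) \<le> M ^ 30" by (rule up[OF C(1)]) simp
  have "time (concat_tm (val (concl_tm t))) \<le> 1 + length (val (concl_tm t)) * (3 + 1)"
    by (rule time_concat_tm) (use l2 in fastforce)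
  also have "\<dots> \<le> M ^ 30" by (rule loop[OF C(2), of _ 1]) (use M16 in simp_all)
  finally have t4: "time (concat_tm (val (concl_tm t))) \<le> M ^ 30" .
  have t5: "time (map_tm (\<lambda>(\<Gamma>, _). tick (ret \<Gamma>)) ?cs) \<le> M ^ 30" by (rule time_map_ret[OF lcs]) auto
  have "time (?p \<Gamma>) \<le> M ^ 12" if "\<Gamma> \<in> set \<Gamma>s" for \<Gamma>
  proof (rule up16[of _ 11])
    have "time (mem_tm eq_node_tm \<Gamma> (t # G)) \<le> M ^ 11"
      by (rule time_mem_tm[OF lGM, where b = 8]) (use time_eq_node[OF n\<Gamma>s[OF that]] nG M16 in auto)
    moreover have "time (?p \<Gamma>) = Suc (time (mem_tm eq_node_tm \<Gamma> (t # G)))" by simp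
    ultimately show "time (?p \<Gamma>) \<le> 16 * M ^ 11" using one_le_M[of 11] by linarith
  qed simp
  then have "time (filter_tm ?p \<Gamma>s) \<le> 1 + length \<Gamma>s * (M ^ 12 + 1)" by (rule time_filter_tm)
  also have "\<dots> \<le> M ^ 30" by (rule loop[OF l\<Gamma>s order_refl]) simp
  finally have t6: "time (filter_tm ?p \<Gamma>s) \<le> M ^ 30" .
  have t7: "time (union_tm eq_node_tm new U1) \<le> M ^ 30"
    by (rule time_union_tm[OF lnew, where b = 8])
      (use up[OF lU1, of 2] time_eq_node nnew M16 in auto)
  have t8: "time (root_in_tm D \<phi> (E_tm D (t # G))) \<le> M ^ 30" by (rule time_root_in_tm) (rule time_E_tm[OF nG lG])+
  have t9: "time (root_in_tm D \<phi> (A_tm D (t # G))) \<le> M ^ 30" by (rule time_root_in_tm) (rule time_A_tm[OF nG lG])+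
  \<comment> \<open>All three propagations are charged whatever the flags: the two optional ones and
    the final one.\<close>
  have "time (gc_iteration_tm D \<phi> i e a G U) \<le> Suc (time (nth_tm U i) + time (remove_tm eq_node_tm t U) + time (concl_tm t) +
      time (concat_tm (val (concl_tm t))) + time (map_tm (\<lambda>(\<Gamma>, _). tick (ret \<Gamma>)) ?cs) + time (filter_tm ?p \<Gamma>s) +
      time (union_tm eq_node_tm new U1) + time (root_in_tm D \<phi> (E_tm D (t # G))) +
      time (root_in_tm D \<phi> (A_tm D (t # G))) + time (root_in_tm D \<phi> (E_tm D (t # G))))"
    using i by (simp add: gc_iteration_tm_def t_def[symmetric] \<Gamma>s_def new_def U1_def)
  then have "time (gc_iteration_tm D \<phi> i e a G U) \<le> 16 * M ^ 30"
    using t1 t2 t3 t4 t5 t6 t7 t8 t9 one_le_M[of 30] by linarith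
  then show ?thesis by (rule up16) simp
qed

text \<open>The length of \<open>G\<close> counts the iterations so far, each costing at most
  \<open>M ^ 31\<close>. After an answer \<open>G\<close> is no longer visible, and
  \<open>2 * M\<close> bounds the number of iterations including the last one. \<open>M ^ 8\<close>
  pays for the list of deferrals.\<close>

lemma gc_exec_time:
  "gc_exec \<phi> r k \<Longrightarrow> k \<le> M ^ 8 + (case r of Running G U \<Rightarrow> length G | Answer b \<Rightarrow> 2 * M) * M ^ 31"
proof (induction rule: gc_exec.induct)
  case init
  show ?case using time_all_deferrals by simp
next
  case (iteration G U k i r e a)
  have rep: "gc_rep G" "gc_rep U" using gc_exec_inv[OF iteration.hyps(1)] by auto
  have lG: "length G \<le> M" using le_trans[OF length_gc_rep[OF rep(1)] two_power_le_M[of n]] by simp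
  have r: "time r \<le> M ^ 31" unfolding iteration.hyps(3) by (rule time_gc_iteration_tm[OF rep iteration.hyps(2)])
  have k: "k \<le> M ^ 8 + length G * M ^ 31" using iteration.IH by simp
  have kr: "k + time r \<le> M ^ 8 + Suc (length G) * M ^ 31" using k r by simp
  show ?case
  proof (cases "val r")
    case (Running G' U')
    have t: "node_list (U ! i)" using rep(2) iteration.hyps(2) by (auto simp: gc_rep_def)
    have "length G' = Suc (length G)"
      using Running val_gc_iteration_tm[OF iteration.hyps(2) t, of G e a] rep(1)
      unfolding iteration.hyps(3) by (auto simp: Let_def gc_rep_def split: if_splits)
    then show ?thesis using kr Running by simp
  next
    case (Answer b)
    have "Suc (length G) * M ^ 31 \<le> 2 * M * M ^ 31" using lG M16 by (intro mult_le_mono1) simp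
    then show ?thesis using kr Answer by simp
  qed
qed

text \<open>The total is at most \<open>16 * M ^ 32\<close>, hence at most \<open>M ^ 33\<close>; as
  \<open>M\<close> is \<open>2 ^ (4 * n)\<close>, this gives the factor 132 in the exponent.\<close>

lemma gc_exec_exponential: "gc_exec \<phi> r k \<Longrightarrow> k \<le> 2 ^ (132 * n)"
proof -
  assume e: "gc_exec \<phi> r k"
  have "(case r of Running G U \<Rightarrow> length G | Answer b \<Rightarrow> 2 * M) \<le> 2 * M"
  proof (cases r)
    case (Running G U)
    then have "gc_rep G" using gc_exec_inv[OF e] by blast
    from le_trans[OF length_gc_rep[OF this] two_power_le_M[of n]] show ?thesis using Running by simp
  qed simp
  then have "k \<le> M ^ 8 + 2 * M * M ^ 31" using gc_exec_time[OF e] mult_le_mono1 add_left_mono le_trans by meson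
  moreover have "M ^ 8 \<le> M ^ 32" by (rule up[OF order_refl]) simp
  moreover have "2 * M * M ^ 31 = 2 * M ^ 32" using power_Suc[of M 31] by simp
  ultimately have "k \<le> 16 * M ^ 32" by linarith
  then have "k \<le> M ^ 33" by (rule up16) simp
  then show ?thesis by (simp add: M_def flip: power_mult)
qed

end

theorem theorem30:
  assumes "infinite (UNIV :: 'w set)"
  shows "\<exists>c. \<forall>\<phi>\<^sub>0 :: ('p, 'a, 'v) fm.
    closed_fm \<phi>\<^sub>0 \<and> guarded \<phi>\<^sub>0 \<and> clean \<phi>\<^sub>0 \<and> irredundant \<phi>\<^sub>0 \<and> alternation_free \<phi>\<^sub>0 \<longrightarrow>
      (\<nexists>s. s 0 = gc_init \<phi>\<^sub>0 \<and> (\<forall>i::nat. gc_step \<phi>\<^sub>0 (s i) (s (Suc i)))) \<and>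
      (\<forall>G U. (gc_step \<phi>\<^sub>0)\<^sup>*\<^sup>* (gc_init \<phi>\<^sub>0) (Running G U) \<longrightarrow> (\<exists>r. gc_step \<phi>\<^sub>0 (Running G U) r)) \<and>
      (\<forall>b. (gc_step \<phi>\<^sub>0)\<^sup>*\<^sup>* (gc_init \<phi>\<^sub>0) (Answer b) \<longrightarrow> (b \<longleftrightarrow> satisfiable TYPE('w) \<phi>\<^sub>0)) \<and>
      (\<forall>r. (gc_step \<phi>\<^sub>0)\<^sup>*\<^sup>* (gc_init \<phi>\<^sub>0) r \<longleftrightarrow> (\<exists>r' n. gc_exec \<phi>\<^sub>0 r' n \<and> abs_conf r' = r)) \<and>
      (\<forall>r' n. gc_exec \<phi>\<^sub>0 r' n \<longrightarrow> n \<le> 2 ^ (c * fm_size \<phi>\<^sub>0))"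
proof (intro exI[of _ 132] allI impI)
  fix \<phi> :: "('p, 'a, 'v) fm"
  assume "closed_fm \<phi> \<and> guarded \<phi> \<and> clean \<phi> \<and> irredundant \<phi> \<and> alternation_free \<phi>"
  then interpret admissible \<phi> by unfold_locales auto
  note reach = gc_reachable[OF assms]
  show "(\<nexists>s. s 0 = gc_init \<phi> \<and> (\<forall>i::nat. gc_step \<phi> (s i) (s (Suc i)))) \<and>
      (\<forall>G U. (gc_step \<phi>)\<^sup>*\<^sup>* (gc_init \<phi>) (Running G U) \<longrightarrow> (\<exists>r. gc_step \<phi> (Running G U) r)) \<and>
      (\<forall>b. (gc_step \<phi>)\<^sup>*\<^sup>* (gc_init \<phi>) (Answer b) \<longrightarrow> (b \<longleftrightarrow> satisfiable TYPE('w) \<phi>)) \<and>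
      (\<forall>r. (gc_step \<phi>)\<^sup>*\<^sup>* (gc_init \<phi>) r \<longleftrightarrow> (\<exists>r' n. gc_exec \<phi> r' n \<and> abs_conf r' = r)) \<and>
      (\<forall>r' n. gc_exec \<phi> r' n \<longrightarrow> n \<le> 2 ^ (132 * fm_size \<phi>))"
  proof (intro conjI allI impI)
    show "\<nexists>s. s 0 = gc_init \<phi> \<and> (\<forall>i::nat. gc_step \<phi> (s i) (s (Suc i)))" by (rule gc_terminates)
    show "\<exists>r. gc_step \<phi> (Running G U) r" if "(gc_step \<phi>)\<^sup>*\<^sup>* (gc_init \<phi>) (Running G U)" for G U
      using reach[OF that] by (intro gc_progress) simp
    show "b \<longleftrightarrow> satisfiable TYPE('w) \<phi>" if "(gc_step \<phi>)\<^sup>*\<^sup>* (gc_init \<phi>) (Answer b)" for b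
      using reach[OF that] by simp
    show "(gc_step \<phi>)\<^sup>*\<^sup>* (gc_init \<phi>) r \<longleftrightarrow> (\<exists>r' n. gc_exec \<phi> r' n \<and> abs_conf r' = r)" for r
      by (rule gc_step_iff_gc_exec)
    show "k \<le> 2 ^ (132 * fm_size \<phi>)" if "gc_exec \<phi> r' k" for r' k
      using gc_exec_exponential[OF that] .
  qed
qed

end
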